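(* Let $X$ be a trawl process with trawl function $a$ and homogeneous Lévy basis $L$ on $\mathbb{R}^2$ with characteristic triplet $(\gamma,b,\nu)$ and Lévy seed $L'$, observed at times $0,\Delta_n,\ldots,(n-1)\Delta_n$. Assume: (i) as $n\uparrow\infty$, $\Delta_n\downarrow0$, $n\Delta_n\to+\infty$, and $n\Delta_n^3\to\mu\in[0,\infty)$; (ii) $a(s)=\int_s^\infty\phi(y)\,dy$ for $s\ge 0$, where $\phi$ is a strictly positive function that is continuous on $[0,\infty)$ and satisfies $\phi(s)=\mathrm{O}(s^{-\alpha-1})$ as $s\to+\infty$ for some $\alpha>1$; (iii) $\mathrm{Var}(L')=1$ and $\mathbb{E}(|L'|^{p_0})<\infty$ for some $p_0>4$. Let $c_4(L')=\int x^4\nu(dx)$ and $Q_n=\frac{1}{2\Delta_n n}\sum_{k=0}^{n-2}(\delta_kX)^4$. If $c_4(L')>0$, then $$\sqrt{\frac{n\Delta_n}{Q_n}}\,(\hat a(0)-a(0))\overset{d}{\to}N(0,1)+\frac{a'(0)}{2}\sqrt{\frac{\mu}{c_4(L')a(0)}},\qquad n\to\infty.$$ If $L$ is purely Gaussian (i.e. $\nu=0$), assume in addition that $n\Delta_n^2\to\mu_0\in[0,\infty]$. Then, as $n\to\infty$: 1. When $0\le\mu_0<\infty$, $$\sqrt{\frac{n\Delta_n}{Q_n}}\,(\hat a(0)-a(0))\overset{d}{\to}N(0,1/3)+\frac{a'(0)}{2}\sqrt{\frac{\mu_0}{6a(0)^2}}.$$ 2. When $\mu_0=\infty$, $$\frac1{\Delta_n}(\hat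 a(0)-a(0))\overset{\mathbb{P}}{\to}\frac12a'(0).$$
   Context: A homogeneous Lévy basis $L$ on $\mathbb{R}^2$ with characteristic triplet $(\gamma,b,\nu)$ is a family of real random variables $L(B)$, indexed by Borel sets $B\subset\mathbb{R}^2$ with $\mathrm{Leb}(B)<\infty$, that is almost surely $\sigma$-additive, has $L(B)$ and $L(C)$ independent for disjoint $B,C$ (independently scattered), each $L(B)$ infinitely divisible, and $\log \mathbb{E}(e^{izL(B)})=\mathrm{Leb}(B)\psi(z)$, where $\psi(z)=i\gamma z-\frac12 b^2z^2+\int_{\mathbb{R}\setminus\{0\}}(e^{izx}-1-izx\mathbf 1_{|x|\le1})\nu(\mathrm{d}x)$, with $\gamma\in\mathbb R$, $b\ge 0$ and $\nu$ a Lévy measure. The Lévy seed $L'$ is an infinitely divisible random variable with $\log\mathbb{E}(e^{izL'})=\psi(z)$. A trawl process: let $a:[0,\infty)\to[0,\infty)$ (the trawl function) be continuous, non-increasing and integrable, let $A=\{(r,y): r\le 0,\ 0\le y\le a(-r)\}$ (the trawl set), $A_t=A+(t,0)$, and $X_t=L(A_t)$, $t\in\mathbb{R}$. Estimator at $0$: $\hat a(0)=\frac{1}{2\Delta_n n}\sum_{k=0}^{n-2}(\delta_kX)^2$, where $\delta_kX=X_{(k+1)\Delta_n}-X_{k\Delta_n}$. Here $a'(0)$ is the right derivative of $a$ at $0$, and "$N(0,\sigma^2)+$ constant" denotes the law of a centred normal variable of variance $\sigma^2$ plus the constant. *)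

theory Defs
  imports "HOL-Probability.Probability" "HOL-Library.Landau_Symbols"
begin

section \<open>Infinitely divisible laws and Levy-Khintchine triplets\<close>

definition convolution_power :: "real measure \<Rightarrow> nat \<Rightarrow> real measure" where
  "convolution_power N n = (convolution N ^^ n) (return borel 0)"

definition infinitely_divisible :: "real measure \<Rightarrow> bool" where
  "infinitely_divisible \<mu> \<longleftrightarrow> real_distribution \<mu> \<and>
     (\<forall>n\<ge>1. \<exists>N. real_distribution N \<and> \<mu> = convolution_power N n)"

definition levy_measure :: "real measure \<Rightarrow> bool" where
  "levy_measure \<nu> \<longleftrightarrow> sets \<nu> = sets borel \<and> emeasure \<nu> {0} = 0 \<and>
     integrable \<nu> (\<lambda>x. min 1 (x\<^sup>2))"

definition levy_triplet :: "real \<Rightarrow> real \<Rightarrow> real measure \<Rightarrow> bool" where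
  "levy_triplet \<gamma> b \<nu> \<longleftrightarrow> 0 \<le> b \<and> levy_measure \<nu>"

definition levy_exponent :: "real \<Rightarrow> real \<Rightarrow> real measure \<Rightarrow> real \<Rightarrow> complex" where
  "levy_exponent \<gamma> b \<nu> z =
     \<i> * complex_of_real (\<gamma> * z) - complex_of_real (b\<^sup>2 * z\<^sup>2 / 2)
     + (CLINT x:-{0}|\<nu>. iexp (z * x) - 1 - \<i> * complex_of_real (z * x * indicator {-1..1} x))"

text \<open>
  An equation of the form $\log \mathbb{E}(e^{izY}) = \kappa(z)$ involves the distinguished
  logarithm (continuous, zero at the origin). As the exponents used here are continuous and
  vanish at the origin, it amounts to the exponentiated equation, which is how it is stated below.
\<close>

locale levy_seed = prob_space S for S :: "'s measure" +
  fixes \<gamma> b :: real and \<nu> :: "real measure" and L' :: "'s \<Rightarrow> real"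
  assumes triplet: "levy_triplet \<gamma> b \<nu>"
    and random_variable: "L' \<in> borel_measurable S"
    and infinitely_divisible: "infinitely_divisible (distr S borel L')"
    and char_eq: "char (distr S borel L') z = exp (levy_exponent \<gamma> b \<nu> z)"


section \<open>Homogeneous Levy bases on the plane\<close>

definition finite_borel_sets :: "(real \<times> real) set set" where
  "finite_borel_sets = {B \<in> sets borel. emeasure lborel B < \<infinity>}"

text \<open>
  Independent scattering is taken in its usual sense for random measures: the values on pairwise
  disjoint sets form a (mutually) independent family. This is more than independence of the
  values on each pair of disjoint sets.
\<close>

locale homogeneous_levy_basis = prob_space M for M :: "'w measure" +
  fixes \<gamma> b :: real and \<nu> :: "real measure" and L :: "(real \<times> real) set \<Rightarrow> 'w \<Rightarrow> real"
  assumes triplet: "levy_triplet \<gamma> b \<nu>"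
    and random_variable: "B \<in> finite_borel_sets \<Longrightarrow> L B \<in> borel_measurable M"
    and sigma_additive:
      "\<lbrakk>\<And>i. Bs i \<in> finite_borel_sets; disjoint_family Bs; (\<Union>i. Bs i) \<in> finite_borel_sets\<rbrakk>
        \<Longrightarrow> AE \<omega> in M. (\<lambda>i::nat. L (Bs i) \<omega>) sums L (\<Union>i. Bs i) \<omega>"
    and independently_scattered:
      "\<lbrakk>\<And>i. Bs i \<in> finite_borel_sets; disjoint_family Bs\<rbrakk>
        \<Longrightarrow> indep_vars (\<lambda>_. borel) (\<lambda>i::nat. L (Bs i)) UNIV"
    and infinitely_divisible:
      "B \<in> finite_borel_sets \<Longrightarrow> infinitely_divisible (distr M borel (L B))"
    and char_eq:
      "B \<in> finite_borel_sets \<Longrightarrow>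
        char (distr M borel (L B)) z
          = exp (complex_of_real (measure lborel B) * levy_exponent \<gamma> b \<nu> z)"


section \<open>Trawl processes\<close>

definition trawl_function :: "(real \<Rightarrow> real) \<Rightarrow> bool" where
  "trawl_function a \<longleftrightarrow> (\<forall>s\<ge>0. 0 \<le> a s) \<and> continuous_on {0..} a \<and>
     antimono_on {0..} a \<and> set_integrable lborel {0..} a"

definition trawl_set :: "(real \<Rightarrow> real) \<Rightarrow> real \<Rightarrow> (real \<times> real) set" where
  "trawl_set a t = (\<lambda>p. p + (t, 0)) ` {(r, y). r \<le> 0 \<and> 0 \<le> y \<and> y \<le> a (- r)}"

definition trawl_process ::
    "((real \<times> real) set \<Rightarrow> 'w \<Rightarrow> real) \<Rightarrow> (real \<Rightarrow> real) \<Rightarrow> real \<Rightarrow> 'w \<Rightarrow> real" where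
  "trawl_process L a t = L (trawl_set a t)"


section \<open>Statistics of a discretely observed process\<close>

definition increment :: "(real \<Rightarrow> 'w \<Rightarrow> real) \<Rightarrow> real \<Rightarrow> nat \<Rightarrow> 'w \<Rightarrow> real" where
  "increment X h k \<omega> = X (real (k + 1) * h) \<omega> - X (real k * h) \<omega>"

text \<open>
  The index range \<open>{..<n - 1}\<close> is $0, \ldots, n-2$; unlike \<open>{0..n - 2}\<close>, with its truncated
  subtraction, it is also empty for \<open>n = 1\<close>, when there is no increment.
\<close>

definition normalized_power_variation ::
    "nat \<Rightarrow> (real \<Rightarrow> 'w \<Rightarrow> real) \<Rightarrow> nat \<Rightarrow> real \<Rightarrow> 'w \<Rightarrow> real" where
  "normalized_power_variation p X n h \<omega> =
     1 / (2 * h * real n) * (\<Sum>k<n - 1. increment X h k \<omega> ^ p)"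

definition a_hat_0 :: "(real \<Rightarrow> 'w \<Rightarrow> real) \<Rightarrow> nat \<Rightarrow> real \<Rightarrow> 'w \<Rightarrow> real" where
  "a_hat_0 X n h = normalized_power_variation 2 X n h"

definition Q_stat :: "(real \<Rightarrow> 'w \<Rightarrow> real) \<Rightarrow> nat \<Rightarrow> real \<Rightarrow> 'w \<Rightarrow> real" where
  "Q_stat X n h = normalized_power_variation 4 X n h"

definition c4 :: "real measure \<Rightarrow> real" where
  "c4 \<nu> = (LINT x|\<nu>. x ^ 4)"


section \<open>Modes of convergence\<close>

definition converges_in_distribution ::
    "'w measure \<Rightarrow> (nat \<Rightarrow> 'w \<Rightarrow> real) \<Rightarrow> real measure \<Rightarrow> bool" where
  "converges_in_distribution M Y \<mu> \<longleftrightarrow> weak_conv_m (\<lambda>n. distr M borel (Y n)) \<mu>"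

definition converges_in_probability ::
    "'w measure \<Rightarrow> (nat \<Rightarrow> 'w \<Rightarrow> real) \<Rightarrow> ('w \<Rightarrow> real) \<Rightarrow> bool" where
  "converges_in_probability M Y Z \<longleftrightarrow>
     (\<forall>\<epsilon>>0. (\<lambda>n. measure M {\<omega> \<in> space M. \<bar>Y n \<omega> - Z \<omega>\<bar> > \<epsilon>}) \<longlonglongrightarrow> 0)"

text \<open>
  The first argument is the variance, whereas \<^const>\<open>normal_density\<close> expects the standard deviation.
\<close>

definition normal_plus_const :: "real \<Rightarrow> real \<Rightarrow> real measure" where
  "normal_plus_const v c =
     distr (density lborel (\<lambda>x. ennreal (normal_density 0 (sqrt v) x))) borel (\<lambda>x. x + c)"

end

theory Submission
  imports Defs "HOL-Real_Asymp.Real_Asymp"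
begin

text \<open>
  An increment over one mesh interval is \<open>E k - F k\<close>, where \<open>E k\<close> and \<open>F k\<close> are the centred values of
  the basis on the entering and on the leaving set; both sets have the same area \<open>A\<close>, and each of the two
  families is independent. Since almost every point that enters also leaves within the observation
  period, the sum of the \<open>(E k)\<^sup>2 - (F k)\<^sup>2\<close> is negligible.

  When there are jumps, the products \<open>E k * F k\<close> are negligible too, and the sum of the squared
  increments behaves like twice the sum of the \<open>(E k)\<^sup>2\<close>, a triangular array of independent
  variables. Its central limit theorem needs a fourth moment of order \<open>c4 \<nu> * A\<close> and moments of order
  \<open>p > 4\<close> that are \<open>O(A)\<close>; the latter come from the superadditivity of moments of independent
  symmetric variables.

  In the Gaussian case the products \<open>E k * F k\<close> contribute to the variance. There the sum of the squared
  increments has the law of a quadratic form in independent standard normal variables, which is, up to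
  a negligible remainder, a multiple of the sum of their squares.

  The bias comes from \<open>A / h - a 0\<close> being asymptotic to \<open>- \<phi> 0 * h / 2\<close> for mesh \<open>h\<close>, and a Slutsky
  argument inserts the random normalization.
\<close>

section \<open>Convergence in probability and in distribution\<close>

text \<open>Two obstacles shape the argument. First, the basis is given by characteristic functions
  of single sets, while the limit theorems need moments of sets of vanishing area. Variances follow
  from additivity in the area alone, but the fourth moment has to be tied to \<nu>; this is done
  with a bounded trigonometric kernel in place of the fourth power, the error being controlled by
  the \<open>p\<close>-th moments. Their order \<open>O(A)\<close> is also what yields a Lyapunov
  condition: the total of the normalized moments behaves like the horizon
  \<open>n * \<Delta>\<close> to the power \<open>1 - p/4\<close>. Second, without jumps the squares
  have variance \<open>2 * A^2\<close> instead of about \<open>c4 \<nu> * A\<close>, the same order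
  as the variance \<open>A^2\<close> of the products \<open>E k * F k\<close>, so independence
  within one family no longer suffices. The law of the sum is then transferred to another
  probability space, which is why convergence is handled through characteristic functions. The limit
  variances are ratios: with jumps, numerator and limit of \<open>Q_stat\<close> are both
  \<open>c4 \<nu> * a 0\<close>; in the Gaussian case they are \<open>2 * (a 0)^2\<close> and, for
  \<open>Q_stat / \<Delta>\<close>, \<open>6 * (a 0)^2\<close>.\<close>

context prob_space
begin

text \<open>Markov's inequality for the dominating variable. Domination is asked for only eventually
  and almost surely, because the splitting of an increment into entering and leaving part holds off
  a null set and once \<open>area h \<le> 1\<close>.\<close>

lemma converges_in_probability_L1:
  fixes R U :: "nat \<Rightarrow> 'a \<Rightarrow> real"
  assumes [measurable]: "\<And>n. random_variable borel (R n)"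
    and ev: "\<forall>\<^sub>F n in sequentially. integrable M (U n) \<and> (AE \<omega> in M. \<bar>R n \<omega> - c\<bar> \<le> U n \<omega>)"
    and lim: "(\<lambda>n. expectation (U n)) \<longlonglongrightarrow> 0"
  shows "converges_in_probability M R (\<lambda>_. c)"
  unfolding converges_in_probability_def
proof safe
  fix e :: real assume e: "0 < e"
  have "\<forall>\<^sub>F n in sequentially. norm (prob {\<omega> \<in> space M. e < \<bar>R n \<omega> - c\<bar>}) \<le> (1/e) * expectation (U n)"
    using ev
  proof eventually_elim
    case (elim n)
    have *: "AE \<omega> in M. \<bar>R n \<omega> - c\<bar> \<le> U n \<omega>" using elim by auto
    have "AE \<omega> in M. 0 \<le> U n \<omega>" using * by eventually_elim linarith
    have [measurable]: "U n \<in> borel_measurable M" using elim by auto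
    have "prob {\<omega> \<in> space M. e < \<bar>R n \<omega> - c\<bar>} \<le> prob {\<omega> \<in> space M. e \<le> U n \<omega>}"
      by (rule finite_measure_mono_AE) (use * in \<open>auto elim!: eventually_mono\<close>)
    also have "\<dots> \<le> (1/e) * expectation (U n)"
      using elim \<open>AE \<omega> in M. 0 \<le> U n \<omega>\<close> e
      by (intro integral_Markov_inequality_measure[where A="{}", THEN order_trans]) auto
    finally show ?case by simp
  qed
  moreover have "(\<lambda>n. (1/e) * expectation (U n)) \<longlonglongrightarrow> 0"
    using tendsto_mult_right_zero[OF lim, of "1/e"] by simp
  ultimately show "(\<lambda>n. prob {\<omega> \<in> space M. e < \<bar>R n \<omega> - c\<bar>}) \<longlonglongrightarrow> 0"
    by (rule Lim_null_comparison)
qed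

lemma converges_in_probability_L2:
  fixes R :: "nat \<Rightarrow> 'a \<Rightarrow> real"
  assumes [measurable]: "\<And>n. random_variable borel (R n)"
    and ev: "\<forall>\<^sub>F n in sequentially. integrable M (\<lambda>\<omega>. (R n \<omega>)\<^sup>2) \<and> expectation (\<lambda>\<omega>. (R n \<omega>)\<^sup>2) \<le> v n"
    and lim: "v \<longlonglongrightarrow> 0"
  shows "converges_in_probability M R (\<lambda>_. 0)"
  unfolding converges_in_probability_def
proof safe
  fix e :: real assume e: "0 < e"
  have "\<forall>\<^sub>F n in sequentially. norm (prob {\<omega> \<in> space M. e < \<bar>R n \<omega> - 0\<bar>}) \<le> (1/e\<^sup>2) * v n"
    using ev
  proof eventually_elim
    case (elim n)
    have "prob {\<omega> \<in> space M. e < \<bar>R n \<omega> - 0\<bar>} \<le> prob {\<omega> \<in> space M. e\<^sup>2 \<le> (R n \<omega>)\<^sup>2}"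
      by (rule finite_measure_mono) (use e in \<open>auto intro: abs_le_square_iff[THEN iffD1]\<close>)
    also have "\<dots> \<le> (1/e\<^sup>2) * expectation (\<lambda>\<omega>. (R n \<omega>)\<^sup>2)"
      using elim e by (intro integral_Markov_inequality_measure[where A="{}", THEN order_trans]) auto
    also have "\<dots> \<le> (1/e\<^sup>2) * v n" using elim e by (intro mult_left_mono) auto
    finally show ?case by simp
  qed
  moreover have "(\<lambda>n. (1/e\<^sup>2) * v n) \<longlonglongrightarrow> 0"
    using tendsto_mult_right_zero[OF lim, of "1/e\<^sup>2"] by simp
  ultimately show "(\<lambda>n. prob {\<omega> \<in> space M. e < \<bar>R n \<omega> - 0\<bar>}) \<longlonglongrightarrow> 0"
    by (rule Lim_null_comparison)
qed

text \<open>A union bound: if \<open>R\<close> is off by more than \<open>e\<close>, then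
  \<open>R1\<close> or \<open>R2\<close> is off by more than \<open>d\<close>. The rules for almost
  sure modifications, sums, multiples and continuous images are instances; those with a single input
  use it twice.\<close>

lemma converges_in_probability_dominated:
  fixes R R1 R2 :: "nat \<Rightarrow> 'a \<Rightarrow> real"
  assumes [measurable]: "\<And>n. random_variable borel (R n)" "\<And>n. random_variable borel (R1 n)"
      "\<And>n. random_variable borel (R2 n)"
    and R1: "converges_in_probability M R1 (\<lambda>_. c1)"
    and R2: "converges_in_probability M R2 (\<lambda>_. c2)"
    and dom: "\<And>e. 0 < e \<Longrightarrow> \<exists>d>0. \<forall>\<^sub>F n in sequentially. AE \<omega> in M.
      \<bar>R1 n \<omega> - c1\<bar> \<le> d \<longrightarrow> \<bar>R2 n \<omega> - c2\<bar> \<le> d \<longrightarrow> \<bar>R n \<omega> - c\<bar> \<le> e"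
  shows "converges_in_probability M R (\<lambda>_. c)"
  unfolding converges_in_probability_def
proof safe
  fix e :: real assume e: "0 < e"
  then obtain d where d: "d > 0" and ev: "\<forall>\<^sub>F n in sequentially. AE \<omega> in M.
      \<bar>R1 n \<omega> - c1\<bar> \<le> d \<longrightarrow> \<bar>R2 n \<omega> - c2\<bar> \<le> d \<longrightarrow> \<bar>R n \<omega> - c\<bar> \<le> e" using dom by blast
  have "\<forall>\<^sub>F n in sequentially. norm (prob {\<omega> \<in> space M. e < \<bar>R n \<omega> - c\<bar>}) \<le>
     prob {\<omega> \<in> space M. d < \<bar>R1 n \<omega> - c1\<bar>} + prob {\<omega> \<in> space M. d < \<bar>R2 n \<omega> - c2\<bar>}"
    using ev
  proof eventually_elim
    case (elim n)
    have "prob {\<omega> \<in> space M. e < \<bar>R n \<omega> - c\<bar>} \<le>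
      prob ({\<omega> \<in> space M. d < \<bar>R1 n \<omega> - c1\<bar>} \<union> {\<omega> \<in> space M. d < \<bar>R2 n \<omega> - c2\<bar>})"
    proof (rule finite_measure_mono_AE)
      show "AE x in M. x \<in> {\<omega> \<in> space M. e < \<bar>R n \<omega> - c\<bar>} \<longrightarrow>
        x \<in> {\<omega> \<in> space M. d < \<bar>R1 n \<omega> - c1\<bar>} \<union> {\<omega> \<in> space M. d < \<bar>R2 n \<omega> - c2\<bar>}"
        using elim by eventually_elim (auto simp: not_less)
    qed measurable
    also have "\<dots> \<le> prob {\<omega> \<in> space M. d < \<bar>R1 n \<omega> - c1\<bar>} + prob {\<omega> \<in> space M. d < \<bar>R2 n \<omega> - c2\<bar>}"
      by (rule measure_Un_le) auto
    finally show ?case by simp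
  qed
  moreover have "(\<lambda>n. prob {\<omega> \<in> space M. d < \<bar>R1 n \<omega> - c1\<bar>} + prob {\<omega> \<in> space M. d < \<bar>R2 n \<omega> - c2\<bar>}) \<longlonglongrightarrow> 0 + 0"
    using R1 R2 d unfolding converges_in_probability_def by (intro tendsto_add) auto
  ultimately show "(\<lambda>n. prob {\<omega> \<in> space M. e < \<bar>R n \<omega> - c\<bar>}) \<longlonglongrightarrow> 0"
    by (auto intro: Lim_null_comparison[rotated])
qed

lemma converges_in_probability_AE_cong:
  fixes R R1 :: "nat \<Rightarrow> 'a \<Rightarrow> real"
  assumes [measurable]: "\<And>n. random_variable borel (R n)" "\<And>n. random_variable borel (R1 n)"
    and R1: "converges_in_probability M R1 (\<lambda>_. c)"
    and eq: "\<forall>\<^sub>F n in sequentially. AE \<omega> in M. R n \<omega> = R1 n \<omega>"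
  shows "converges_in_probability M R (\<lambda>_. c)"
proof (rule converges_in_probability_dominated[OF _ _ _ R1 R1])
  fix e :: real assume "0 < e"
  show "\<exists>d>0. \<forall>\<^sub>F n in sequentially. AE \<omega> in M.
      \<bar>R1 n \<omega> - c\<bar> \<le> d \<longrightarrow> \<bar>R1 n \<omega> - c\<bar> \<le> d \<longrightarrow> \<bar>R n \<omega> - c\<bar> \<le> e"
    by (intro exI[of _ e] conjI \<open>0 < e\<close> eventually_mono[OF eq]) (auto elim!: eventually_mono)
qed measurable

lemma converges_in_probability_add:
  fixes R1 R2 :: "nat \<Rightarrow> 'a \<Rightarrow> real"
  assumes [measurable]: "\<And>n. random_variable borel (R1 n)" "\<And>n. random_variable borel (R2 n)"
    and R1: "converges_in_probability M R1 (\<lambda>_. c1)"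
    and R2: "converges_in_probability M R2 (\<lambda>_. c2)"
  shows "converges_in_probability M (\<lambda>n \<omega>. R1 n \<omega> + R2 n \<omega>) (\<lambda>_. c1 + c2)"
proof (rule converges_in_probability_dominated[OF _ _ _ R1 R2])
  fix e :: real assume "0 < e"
  then show "\<exists>d>0. \<forall>\<^sub>F n in sequentially. AE \<omega> in M.
      \<bar>R1 n \<omega> - c1\<bar> \<le> d \<longrightarrow> \<bar>R2 n \<omega> - c2\<bar> \<le> d \<longrightarrow> \<bar>R1 n \<omega> + R2 n \<omega> - (c1 + c2)\<bar> \<le> e"
    by (intro exI[of _ "e/2"] conjI always_eventually allI AE_I2 impI; linarith)
qed measurable

lemma converges_in_probability_const:
  assumes "b \<longlonglongrightarrow> (c::real)"
  shows "converges_in_probability M (\<lambda>n _. b n) (\<lambda>_. c)"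
proof (rule converges_in_probability_L1[where U="\<lambda>n _. \<bar>b n - c\<bar>"])
  show "(\<lambda>n. expectation (\<lambda>_. \<bar>b n - c\<bar>)) \<longlonglongrightarrow> 0"
    using assms LIM_zero tendsto_rabs_zero by (force simp: prob_space)
qed auto

lemma converges_in_probability_cmult:
  fixes R1 :: "nat \<Rightarrow> 'a \<Rightarrow> real"
  assumes [measurable]: "\<And>n. random_variable borel (R1 n)"
    and R1: "converges_in_probability M R1 (\<lambda>_. c1)"
  shows "converges_in_probability M (\<lambda>n \<omega>. b * R1 n \<omega>) (\<lambda>_. b * c1)"
proof (rule converges_in_probability_dominated[OF _ _ _ R1 R1])
  fix e :: real assume e: "0 < e"
  have *: "\<bar>b * x - b * c1\<bar> \<le> e" if "\<bar>x - c1\<bar> \<le> e / (\<bar>b\<bar> + 1)" for x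
  proof -
    have "\<bar>b * x - b * c1\<bar> = \<bar>b\<bar> * \<bar>x - c1\<bar>" by (simp flip: abs_mult right_diff_distrib)
    also have "\<dots> \<le> (\<bar>b\<bar> + 1) * (e / (\<bar>b\<bar> + 1))" using that e by (intro mult_mono) auto
    finally show ?thesis using e by simp
  qed
  show "\<exists>d>0. \<forall>\<^sub>F n in sequentially. AE \<omega> in M.
      \<bar>R1 n \<omega> - c1\<bar> \<le> d \<longrightarrow> \<bar>R1 n \<omega> - c1\<bar> \<le> d \<longrightarrow> \<bar>b * R1 n \<omega> - b * c1\<bar> \<le> e"
    by (intro exI[of _ "e/(\<bar>b\<bar>+1)"]) (use e * in \<open>auto intro!: always_eventually AE_I2 divide_pos_pos\<close>)
qed measurable

lemma converges_in_probability_compose: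
  fixes R1 :: "nat \<Rightarrow> 'a \<Rightarrow> real"
  assumes [measurable]: "\<And>n. random_variable borel (R1 n)" "f \<in> borel_measurable borel"
    and R1: "converges_in_probability M R1 (\<lambda>_. c1)"
    and f: "isCont f (c1::real)"
  shows "converges_in_probability M (\<lambda>n \<omega>. f (R1 n \<omega>) :: real) (\<lambda>_. f c1)"
proof (rule converges_in_probability_dominated[OF _ _ _ R1 R1])
  fix e :: real assume e: "0 < e"
  from f obtain d where d: "d > 0" "\<And>x. dist x c1 < d \<Longrightarrow> dist (f x) (f c1) < e"
    using e unfolding continuous_at_eps_delta by blast
  show "\<exists>d>0. \<forall>\<^sub>F n in sequentially. AE \<omega> in M.
      \<bar>R1 n \<omega> - c1\<bar> \<le> d \<longrightarrow> \<bar>R1 n \<omega> - c1\<bar> \<le> d \<longrightarrow> \<bar>f (R1 n \<omega>) - f c1\<bar> \<le> e"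
  proof (intro exI[of _ "d/2"] conjI always_eventually allI AE_I2 impI)
    fix n \<omega> assume "\<bar>R1 n \<omega> - c1\<bar> \<le> d / 2"
    then show "\<bar>f (R1 n \<omega>) - f c1\<bar> \<le> e" using d(2)[of "R1 n \<omega>"] d(1) by (auto simp: dist_real_def)
  qed (use d in auto)
qed measurable

text \<open>Weak convergence in the form in which Levy's continuity theorem takes it. Only the laws
  of the variables enter, so a sequence may be exchanged for one on another probability
  space.\<close>

definition converges_in_char :: "(nat \<Rightarrow> 'a \<Rightarrow> real) \<Rightarrow> real measure \<Rightarrow> bool" where
  "converges_in_char X \<mu> \<longleftrightarrow> (\<forall>t. (\<lambda>n. char (distr M borel (X n)) t) \<longlonglongrightarrow> char \<mu> t)"

lemma converges_in_char_tight:
  fixes X :: "nat \<Rightarrow> 'a \<Rightarrow> real"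
  assumes [measurable]: "\<And>n. random_variable borel (X n)"
    and \<mu>: "real_distribution \<mu>" and X: "converges_in_char X \<mu>" and e: "0 < e"
  obtains K where "0 < K" "\<forall>\<^sub>F n in sequentially. prob {\<omega> \<in> space M. K < \<bar>X n \<omega>\<bar>} < e"
proof -
  interpret \<mu>: real_distribution \<mu> by fact
  have wc: "weak_conv_m (\<lambda>n. distr M borel (X n)) \<mu>"
    using X unfolding converges_in_char_def by (intro levy_continuity \<mu>) auto
  \<comment> \<open>A continuous majorant of the indicator of
    \<open>\<bar>x\<bar> > real (Suc k)\<close>, bounded by 1 and tending to 0 pointwise: its
    integral under \<mu> is below \<open>e\<close> for some \<open>k\<close>, and weak convergence
    carries this over to the laws of \<open>X n\<close>.\<close>
  define g where "g k x = min 1 (\<bar>x\<bar> / real (Suc k))" for k and x :: real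
  have g01: "norm (g k x) \<le> 1" "0 \<le> g k x" for k x by (auto simp: g_def)
  have gcont: "isCont (g k) x" for k x unfolding g_def by (intro continuous_intros) auto
  have [measurable]: "g k \<in> borel_measurable borel" for k unfolding g_def by measurable
  have "(\<lambda>k. integral\<^sup>L \<mu> (g k)) \<longlonglongrightarrow> integral\<^sup>L \<mu> (\<lambda>_. 0)"
  proof (rule integral_dominated_convergence[where w="\<lambda>_. 1"])
    show "AE x in \<mu>. (\<lambda>k. g k x) \<longlonglongrightarrow> 0"
    proof (rule AE_I2)
      fix x
      have "(\<lambda>k. \<bar>x\<bar> / real (Suc k)) \<longlonglongrightarrow> 0" by real_asymp
      from tendsto_min[OF tendsto_const[of 1] this] show "(\<lambda>k. g k x) \<longlonglongrightarrow> 0"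
        by (simp add: g_def)
    qed
  qed (use g01 in auto)
  then have "(\<lambda>k. integral\<^sup>L \<mu> (g k)) \<longlonglongrightarrow> 0" by simp
  then have "\<forall>\<^sub>F k in sequentially. integral\<^sup>L \<mu> (g k) < e"
    using e by (rule order_tendstoD)
  then obtain k where k: "integral\<^sup>L \<mu> (g k) < e" by (auto dest: eventually_happens)
  have "(\<lambda>n. integral\<^sup>L (distr M borel (X n)) (g k)) \<longlonglongrightarrow> integral\<^sup>L \<mu> (g k)"
    by (rule weak_conv_imp_integral_bdd_continuous_conv[OF _ \<mu> wc gcont g01(1)]) auto
  then have "\<forall>\<^sub>F n in sequentially. integral\<^sup>L (distr M borel (X n)) (g k) < e"
    using k by (rule order_tendstoD)
  then have "\<forall>\<^sub>F n in sequentially. prob {\<omega> \<in> space M. real (Suc k) < \<bar>X n \<omega>\<bar>} < e"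
  proof eventually_elim
    case (elim n)
    have int: "integrable M (\<lambda>\<omega>. g k (X n \<omega>))"
      by (rule integrable_const_bound[where B=1]) (use g01 in auto)
    have "prob {\<omega> \<in> space M. real (Suc k) < \<bar>X n \<omega>\<bar>} = expectation (indicator {\<omega> \<in> space M. real (Suc k) < \<bar>X n \<omega>\<bar>})"
      by simp
    also have "\<dots> \<le> expectation (\<lambda>\<omega>. g k (X n \<omega>))"
      by (rule integral_mono[OF integrable_real_indicator int])
        (auto simp: g_def indicator_def field_simps simp flip: less_top)
    also have "\<dots> = integral\<^sup>L (distr M borel (X n)) (g k)"
      by (simp add: integral_distr)
    finally show ?case using elim by simp
  qed
  then show ?thesis by (intro that[of "real (Suc k)"]) auto
qed

text \<open>Slutsky's theorem for sums, directly on characteristic functions: adding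
  \<open>R n\<close> changes the integrand by at most
  \<open>min 2 (\<bar>t\<bar> * \<bar>R n \<omega>\<bar>)\<close>, whose mean tends to 0.\<close>

lemma converges_in_char_add:
  fixes X R :: "nat \<Rightarrow> 'a \<Rightarrow> real"
  assumes [measurable]: "\<And>n. random_variable borel (X n)" "\<And>n. random_variable borel (R n)"
    and X: "converges_in_char X \<mu>" and R: "converges_in_probability M R (\<lambda>_. 0)"
  shows "converges_in_char (\<lambda>n \<omega>. X n \<omega> + R n \<omega>) \<mu>"
  unfolding converges_in_char_def
proof
  fix t
  let ?c = "\<lambda>X n. char (distr M borel (X n :: 'a \<Rightarrow> real)) t"
  have bd: "norm (?c (\<lambda>n \<omega>. X n \<omega> + R n \<omega>) n - ?c X n) \<le> expectation (\<lambda>\<omega>. min 2 (\<bar>t\<bar> * \<bar>R n \<omega>\<bar>))" for n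
  proof -
    have "?c (\<lambda>n \<omega>. X n \<omega> + R n \<omega>) n - ?c X n = (CLINT \<omega>|M. iexp (t * (X n \<omega> + R n \<omega>)) - iexp (t * X n \<omega>))"
      by (subst Bochner_Integration.integral_diff)
         (auto simp: char_def integral_distr intro!: integrable_const_bound[where B=1])
    also have "norm \<dots> \<le> (LINT \<omega>|M. norm (iexp (t * (X n \<omega> + R n \<omega>)) - iexp (t * X n \<omega>)))"
      by (rule integral_norm_bound)
    also have "\<dots> \<le> expectation (\<lambda>\<omega>. min 2 (\<bar>t\<bar> * \<bar>R n \<omega>\<bar>))"
    proof (rule integral_mono)
      fix \<omega>
      have "iexp (t * (X n \<omega> + R n \<omega>)) - iexp (t * X n \<omega>) = iexp (t * X n \<omega>) * (iexp (t * R n \<omega>) - 1)"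
        by (simp add: exp_add[symmetric] ring_distribs)
      then have "norm (iexp (t * (X n \<omega> + R n \<omega>)) - iexp (t * X n \<omega>)) = norm (iexp (t * R n \<omega>) - 1)"
        by (simp add: norm_mult)
      moreover have "norm (iexp (t * R n \<omega>) - 1) \<le> 2"
        using norm_triangle_ineq4[of "iexp (t * R n \<omega>)" 1] by simp
      moreover have "norm (iexp (t * R n \<omega>) - 1) \<le> \<bar>t\<bar> * \<bar>R n \<omega>\<bar>"
        using iexp_approx1[of "t * R n \<omega>" 0] by (simp add: abs_mult)
      ultimately show "norm (iexp (t * (X n \<omega> + R n \<omega>)) - iexp (t * X n \<omega>)) \<le> min 2 (\<bar>t\<bar> * \<bar>R n \<omega>\<bar>)"
        by simp
    next
      show "integrable M (\<lambda>\<omega>. cmod (iexp (t * (X n \<omega> + R n \<omega>)) - iexp (t * X n \<omega>)))"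
        by (intro integrable_norm Bochner_Integration.integrable_diff integrable_const_bound[where B=1]) auto
    qed (auto intro!: integrable_const_bound[where B=2])
    finally show ?thesis .
  qed
  have "(\<lambda>n. expectation (\<lambda>\<omega>. min 2 (\<bar>t\<bar> * \<bar>R n \<omega>\<bar>))) \<longlonglongrightarrow> 0"
  proof (rule LIMSEQ_I)
    fix r :: real assume r: "0 < r"
    \<comment> \<open>On the event \<open>\<bar>R n \<omega>\<bar> \<le> d\<close> the integrand is
      at most \<open>r / 2\<close>; elsewhere it is at most 2, with probability below
      \<open>r / 4\<close>.\<close>
    define d where "d = r / (2 * (\<bar>t\<bar> + 1))"
    have d: "d > 0" using r by (auto simp: d_def)
    have "(\<lambda>n. prob {\<omega> \<in> space M. d < \<bar>R n \<omega> - 0\<bar>}) \<longlonglongrightarrow> 0"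
      using R d unfolding converges_in_probability_def by blast
    then have "\<forall>\<^sub>F n in sequentially. prob {\<omega> \<in> space M. d < \<bar>R n \<omega>\<bar>} < r / 4"
      using r by (intro order_tendstoD) auto
    then obtain n0 where n0: "\<And>n. n \<ge> n0 \<Longrightarrow> prob {\<omega> \<in> space M. d < \<bar>R n \<omega>\<bar>} < r / 4"
      by (auto simp: eventually_sequentially)
    have "norm (expectation (\<lambda>\<omega>. min 2 (\<bar>t\<bar> * \<bar>R n \<omega>\<bar>)) - 0) < r" if "n \<ge> n0" for n
    proof -
      have "expectation (\<lambda>\<omega>. min 2 (\<bar>t\<bar> * \<bar>R n \<omega>\<bar>)) \<le>
          expectation (\<lambda>\<omega>. r / 2 + 2 * indicator {\<omega> \<in> space M. d < \<bar>R n \<omega>\<bar>} \<omega>)"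
      proof (rule integral_mono)
        fix \<omega> assume w: "\<omega> \<in> space M"
        show "min 2 (\<bar>t\<bar> * \<bar>R n \<omega>\<bar>) \<le> r / 2 + 2 * indicator {\<omega> \<in> space M. d < \<bar>R n \<omega>\<bar>} \<omega>"
        proof (cases "d < \<bar>R n \<omega>\<bar>")
          case False
          then have "\<bar>t\<bar> * \<bar>R n \<omega>\<bar> \<le> (\<bar>t\<bar> + 1) * d" by (intro mult_mono) auto
          also have "\<dots> = r / 2" by (simp add: d_def field_simps)
          finally show ?thesis using False by simp
        qed (use w r in auto)
      next
        show "integrable M (\<lambda>\<omega>. min 2 (\<bar>t\<bar> * \<bar>R n \<omega>\<bar>))"
          by (rule integrable_const_bound[where B=2]) auto
        show "integrable M (\<lambda>\<omega>. r / 2 + 2 * indicat_real {\<omega> \<in> space M. d < \<bar>R n \<omega>\<bar>} \<omega>)"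
          by (rule integrable_const_bound[where B="r / 2 + 2"]) (use r in \<open>auto simp: indicator_def\<close>)
      qed
      also have "\<dots> = r / 2 + 2 * prob {\<omega> \<in> space M. d < \<bar>R n \<omega>\<bar>}"
        by (subst Bochner_Integration.integral_add)
          (auto simp: prob_space intro!: integrable_real_indicator simp flip: less_top)
      also have "\<dots> < r" using n0[OF that] by simp
      finally show ?thesis by (simp add: integral_nonneg)
    qed
    then show "\<exists>no. \<forall>n\<ge>no. norm (expectation (\<lambda>\<omega>. min 2 (\<bar>t\<bar> * \<bar>R n \<omega>\<bar>)) - 0) < r" by blast
  qed
  then have "(\<lambda>n. ?c (\<lambda>n \<omega>. X n \<omega> + R n \<omega>) n - ?c X n) \<longlonglongrightarrow> 0"
    by (rule Lim_null_comparison[rotated]) (use bd in auto)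
  moreover have "(\<lambda>n. ?c X n) \<longlonglongrightarrow> char \<mu> t" using X unfolding converges_in_char_def by blast
  ultimately show "(\<lambda>n. ?c (\<lambda>n \<omega>. X n \<omega> + R n \<omega>) n) \<longlonglongrightarrow> char \<mu> t"
    using tendsto_add[of "\<lambda>n. ?c (\<lambda>n \<omega>. X n \<omega> + R n \<omega>) n - ?c X n" 0 sequentially "\<lambda>n. ?c X n"] by simp
qed

text \<open>Convergence in law gives tightness: up to small probability \<open>X n\<close> is
  bounded by some \<open>K\<close>, and then the product exceeds \<open>e\<close> only if
  \<open>R n\<close> exceeds \<open>e / K\<close>.\<close>

lemma converges_in_probability_tight_mult:
  fixes X R :: "nat \<Rightarrow> 'a \<Rightarrow> real"
  assumes [measurable]: "\<And>n. random_variable borel (X n)" "\<And>n. random_variable borel (R n)"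
    and \<mu>: "real_distribution \<mu>"
    and X: "converges_in_char X \<mu>" and R: "converges_in_probability M R (\<lambda>_. 0)"
  shows "converges_in_probability M (\<lambda>n \<omega>. X n \<omega> * R n \<omega>) (\<lambda>_. 0)"
  unfolding converges_in_probability_def
proof safe
  fix e :: real assume e: "0 < e"
  show "(\<lambda>n. prob {\<omega> \<in> space M. e < \<bar>X n \<omega> * R n \<omega> - 0\<bar>}) \<longlonglongrightarrow> 0"
  proof (rule LIMSEQ_I)
    fix r :: real assume r: "0 < r"
    obtain K where K: "0 < K" "\<forall>\<^sub>F n in sequentially. prob {\<omega> \<in> space M. K < \<bar>X n \<omega>\<bar>} < r / 2"
      using converges_in_char_tight[OF _ \<mu> X, of "r/2"] r by auto
    have "(\<lambda>n. prob {\<omega> \<in> space M. e / K < \<bar>R n \<omega> - 0\<bar>}) \<longlonglongrightarrow> 0"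
      using R e K unfolding converges_in_probability_def by simp
    then have "\<forall>\<^sub>F n in sequentially. prob {\<omega> \<in> space M. e / K < \<bar>R n \<omega> - 0\<bar>} < r / 2"
      using r by (intro order_tendstoD) auto
    then have "\<forall>\<^sub>F n in sequentially. norm (prob {\<omega> \<in> space M. e < \<bar>X n \<omega> * R n \<omega> - 0\<bar>} - 0) < r"
      using K(2)
    proof eventually_elim
      case (elim n)
      have "e / K < \<bar>R n \<omega>\<bar>" if "e < \<bar>X n \<omega> * R n \<omega>\<bar>" "\<bar>X n \<omega>\<bar> \<le> K" for \<omega>
      proof -
        have "e < K * \<bar>R n \<omega>\<bar>"
          using that(1) mult_right_mono[OF that(2), of "\<bar>R n \<omega>\<bar>"] by (simp add: abs_mult)
        then show ?thesis using K by (simp add: field_simps)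
      qed
      then have *: "K < \<bar>X n \<omega>\<bar> \<or> e / K < \<bar>R n \<omega>\<bar>" if "e < \<bar>X n \<omega> * R n \<omega>\<bar>" for \<omega>
        using that by (meson not_le)
      have "prob {\<omega> \<in> space M. e < \<bar>X n \<omega> * R n \<omega> - 0\<bar>} \<le>
        prob ({\<omega> \<in> space M. K < \<bar>X n \<omega>\<bar>} \<union> {\<omega> \<in> space M. e / K < \<bar>R n \<omega> - 0\<bar>})"
        by (intro finite_measure_mono) (auto dest: *)
      also have "\<dots> \<le> prob {\<omega> \<in> space M. K < \<bar>X n \<omega>\<bar>} + prob {\<omega> \<in> space M. e / K < \<bar>R n \<omega> - 0\<bar>}"
        by (rule measure_Un_le) auto
      finally show ?case using elim by simp
    qed
    then show "\<exists>no. \<forall>n\<ge>no. norm (prob {\<omega> \<in> space M. e < \<bar>X n \<omega> * R n \<omega> - 0\<bar>} - 0) < r"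
      by (simp add: eventually_sequentially)
  qed
qed

lemma converges_in_char_cmult:
  fixes X :: "nat \<Rightarrow> 'a \<Rightarrow> real"
  assumes [measurable]: "\<And>n. random_variable borel (X n)" 
    and \<mu>: "real_distribution \<mu>" and X: "converges_in_char X \<mu>"
  shows "converges_in_char (\<lambda>n \<omega>. a * X n \<omega> + c) (distr \<mu> borel (\<lambda>x. a * x + c))"
proof -
  interpret \<mu>: real_distribution \<mu> by fact
  have "char (distr N borel (\<lambda>x. a * Y x + c)) t = iexp (t * c) * char (distr N borel Y) (a * t)"
    if [measurable]: "Y \<in> borel_measurable N" for N :: "'z measure" and Y :: "'z \<Rightarrow> real" and t
    by (simp add: char_def integral_distr exp_add ring_distribs mult_ac)
  note 1 = this[of "X _" M] this[of "\<lambda>x. x" \<mu>]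
  have "distr \<mu> borel (\<lambda>x. x) = \<mu>" by (rule distr_id2) simp
  then show ?thesis
    using X tendsto_mult[OF tendsto_const] unfolding converges_in_char_def by (simp add: 1)
qed

end

text \<open>The upper half passes through \<open>1 / (1 + u)\<close>, using
  \<open>(1 - u + u^2) * (1 + u) = 1 + u^3\<close>.\<close>

lemma exp_minus_linear_bound:
  fixes u :: real assumes "0 \<le> u" shows "\<bar>exp (- u) - (1 - u)\<bar> \<le> u\<^sup>2"
proof -
  have "1 - u \<le> exp (- u)" using exp_ge_add_one_self[of "-u"] by simp
  moreover have "exp (- u) \<le> 1 - u + u\<^sup>2"
  proof -
    have "exp (- u) \<le> inverse (1 + u)"
      unfolding exp_minus using assms exp_ge_add_one_self[of u] by (intro le_imp_inverse_le) auto
    also have "\<dots> \<le> 1 - u + u\<^sup>2"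
    proof -
      have "1 \<le> (1 - u + u\<^sup>2) * (1 + u)"
        using assms by (simp add: algebra_simps power2_eq_square)
      then show ?thesis using assms by (simp add: field_simps)
    qed
    finally show ?thesis .
  qed
  ultimately show ?thesis by simp
qed

lemma (in prob_space) powr_dominates:
  fixes X :: "'a \<Rightarrow> real"
  assumes [measurable]: "random_variable borel X" and int: "integrable M (\<lambda>\<omega>. \<bar>X \<omega>\<bar> powr q)" and q: "real k \<le> q" "0 < k"
  shows "integrable M (\<lambda>\<omega>. X \<omega> ^ k)"
proof (rule Bochner_Integration.integrable_bound[of _ "\<lambda>\<omega>. 1 + \<bar>X \<omega>\<bar> powr q"])
  show "AE \<omega> in M. norm (X \<omega> ^ k) \<le> norm (1 + \<bar>X \<omega>\<bar> powr q)"
  proof (rule AE_I2)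
    fix \<omega>
    show "norm (X \<omega> ^ k) \<le> norm (1 + \<bar>X \<omega>\<bar> powr q)"
    proof (cases "\<bar>X \<omega>\<bar> \<le> 1")
      case True
      then have "\<bar>X \<omega>\<bar> ^ k \<le> 1" by (intro power_le_one) auto
      then show ?thesis by (simp add: power_abs add_increasing add_increasing2)
    next
      case False
      then have "\<bar>X \<omega>\<bar> ^ k = \<bar>X \<omega>\<bar> powr k" by (subst powr_realpow) auto
      also have "\<dots> \<le> \<bar>X \<omega>\<bar> powr q" using False q by (intro powr_mono) auto
      finally show ?thesis by (simp add: power_abs add_increasing add_increasing2)
    qed
  qed
qed (use int in auto)

lemma expectation_square_sum:
  fixes X :: "'i \<Rightarrow> 'a \<Rightarrow> real"
  assumes "\<And>i j. i \<in> I \<Longrightarrow> j \<in> I \<Longrightarrow> integrable M (\<lambda>\<omega>. X i \<omega> * X j \<omega>)"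
  shows "integrable M (\<lambda>\<omega>. (\<Sum>i\<in>I. X i \<omega>)\<^sup>2)"
    and "(LINT \<omega>|M. (\<Sum>i\<in>I. X i \<omega>)\<^sup>2) = (\<Sum>i\<in>I. \<Sum>j\<in>I. LINT \<omega>|M. X i \<omega> * X j \<omega>)"
  using assms by (auto simp: power2_eq_square sum_product Bochner_Integration.integral_sum)

lemma expectation_square_sum_orthogonal:
  fixes X :: "'i \<Rightarrow> 'a \<Rightarrow> real"
  assumes "finite I"
    and "\<And>i j. i \<in> I \<Longrightarrow> j \<in> I \<Longrightarrow> integrable M (\<lambda>\<omega>. X i \<omega> * X j \<omega>)"
    and "\<And>i j. i \<in> I \<Longrightarrow> j \<in> I \<Longrightarrow> i \<noteq> j \<Longrightarrow> (LINT \<omega>|M. X i \<omega> * X j \<omega>) = 0"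
  shows "(LINT \<omega>|M. (\<Sum>i\<in>I. X i \<omega>)\<^sup>2) = (\<Sum>i\<in>I. LINT \<omega>|M. (X i \<omega>)\<^sup>2)"
proof -
  have "(\<Sum>j\<in>I. LINT \<omega>|M. X i \<omega> * X j \<omega>) = (LINT \<omega>|M. (X i \<omega>)\<^sup>2)" if "i \<in> I" for i
    using assms(1,3) that by (subst sum.remove[of _ i]) (auto simp: power2_eq_square intro!: sum.neutral)
  then show ?thesis by (subst expectation_square_sum(2)) (use assms(2) in auto)
qed

lemma (in prob_space) indep_vars_expectation_mult:
  fixes X :: "'i \<Rightarrow> 'a \<Rightarrow> real"
  assumes ind: "indep_vars (\<lambda>_. borel) X I" and ij: "i \<in> I" "j \<in> I" "i \<noteq> j"
    and int: "integrable M (X i)" "integrable M (X j)"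
  shows "integrable M (\<lambda>\<omega>. X i \<omega> * X j \<omega>)"
    and "expectation (\<lambda>\<omega>. X i \<omega> * X j \<omega>) = expectation (X i) * expectation (X j)"
proof -
  have ind: "indep_vars (\<lambda>_. borel) X {i, j}" by (rule indep_vars_subset[OF ind]) (use ij in auto)
  show "integrable M (\<lambda>\<omega>. X i \<omega> * X j \<omega>)"
    using indep_vars_integrable[OF _ ind] int ij by auto
  show "expectation (\<lambda>\<omega>. X i \<omega> * X j \<omega>) = expectation (X i) * expectation (X j)"
    using indep_vars_lebesgue_integral[OF _ ind] int ij by auto
qed

section \<open>Limit theorems for row-wise independent arrays\<close>

text \<open>A quantitative Lyapunov theorem. Each factor of the characteristic function is compared
  with that of a normal variable of variance \<open>s\<close>; since all factors have modulus at
  most 1, the products differ by at most the sum of the differences. The first error term is the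
  Lyapunov one, the second comes from replacing \<open>1 - t^2 * s / 2\<close> by an exponential. A
  limit theorem results when \<open>N * s\<close> converges while \<open>N * r\<close> and
  \<open>N * s^2\<close> vanish.\<close>

lemma (in prob_space) char_sum_normal_approx:
  fixes X :: "nat \<Rightarrow> 'a \<Rightarrow> real"
  assumes ind: "indep_vars (\<lambda>_. borel) X {..<N}"
    and int: "\<And>k. k < N \<Longrightarrow> integrable M (\<lambda>\<omega>. \<bar>X k \<omega>\<bar> powr q)" and q: "2 < q" "q \<le> 3"
    and m0: "\<And>k. k < N \<Longrightarrow> expectation (X k) = 0"
    and v: "\<And>k. k < N \<Longrightarrow> expectation (\<lambda>\<omega>. (X k \<omega>)\<^sup>2) = s"
    and r: "\<And>k. k < N \<Longrightarrow> expectation (\<lambda>\<omega>. \<bar>X k \<omega>\<bar> powr q) \<le> r"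
  shows "norm (char (distr M borel (\<lambda>\<omega>. \<Sum>k<N. X k \<omega>)) t - complex_of_real (exp (- (real N * s * t\<^sup>2 / 2))))
     \<le> t\<^sup>2 * (1 + \<bar>t\<bar>) * (real N * r) + t ^ 4 * (real N * s\<^sup>2)"
proof -
  have [measurable]: "random_variable borel (X k)" if "k < N" for k
    using ind that unfolding indep_vars_def2 by auto
  define w where "w = complex_of_real (exp (- (t\<^sup>2 * s / 2)))"
  have s0: "0 \<le> s" if "k < N" for k unfolding v[OF that, symmetric] by simp
  have bd: "norm (char (distr M borel (X k)) t - w) \<le> t\<^sup>2 * (1 + \<bar>t\<bar>) * r + t ^ 4 * s\<^sup>2" if k: "k < N" for k
  proof -
    note [measurable] = \<open>k < N \<Longrightarrow> random_variable borel (X k)\<close>[OF k]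
    have i2: "integrable M (\<lambda>\<omega>. (X k \<omega>)\<^sup>2)" by (rule powr_dominates[OF _ int[OF k]]) (use q in auto)
    have i1: "integrable M (X k)" by (rule square_integrable_imp_integrable[OF _ i2]) simp
    have "norm (char (distr M borel (X k)) t - complex_of_real (1 - t\<^sup>2 * s / 2)) \<le>
      (t\<^sup>2 / 6) * expectation (\<lambda>\<omega>. min (6 * (X k \<omega>)\<^sup>2) (\<bar>t\<bar> * \<bar>X k \<omega>\<bar>^3))"
      by (rule char_approx3'[OF _ i1 i2 m0[OF k] _ refl]) (use m0[OF k] v[OF k] in auto)
    also have "\<dots> \<le> (t\<^sup>2 / 6) * expectation (\<lambda>\<omega>. 6 * (1 + \<bar>t\<bar>) * \<bar>X k \<omega>\<bar> powr q)"
    proof (intro mult_left_mono integral_mono)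
      fix \<omega>
      \<comment> \<open>The minimum interpolates: for
        \<open>\<bar>X k \<omega>\<bar> \<le> 1\<close> the cubic term lies below the power
        \<open>q \<le> 3\<close>, otherwise the quadratic term does, as
        \<open>q > 2\<close>.\<close>
      show "min (6 * (X k \<omega>)\<^sup>2) (\<bar>t\<bar> * \<bar>X k \<omega>\<bar>^3) \<le> 6 * (1 + \<bar>t\<bar>) * \<bar>X k \<omega>\<bar> powr q"
      proof (cases "X k \<omega> = 0")
        case False
        show ?thesis
        proof (cases "\<bar>X k \<omega>\<bar> \<le> 1")
          case True
          have "\<bar>X k \<omega>\<bar> ^ 3 = \<bar>X k \<omega>\<bar> powr 3" using False by (subst powr_realpow[symmetric]) auto
          also have "\<dots> \<le> \<bar>X k \<omega>\<bar> powr q" using True q by (intro powr_mono') auto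
          finally have "\<bar>t\<bar> * \<bar>X k \<omega>\<bar> ^ 3 \<le> (6 * (1 + \<bar>t\<bar>)) * \<bar>X k \<omega>\<bar> powr q" by (intro mult_mono) auto
          then show ?thesis by simp
        next
          case f: False
          have "(X k \<omega>)\<^sup>2 = \<bar>X k \<omega>\<bar> powr 2" using False by (simp add: powr_numeral)
          also have "\<dots> \<le> \<bar>X k \<omega>\<bar> powr q" using f q by (intro powr_mono) auto
          finally have "6 * (X k \<omega>)\<^sup>2 \<le> (6 * (1 + \<bar>t\<bar>)) * \<bar>X k \<omega>\<bar> powr q" by (intro mult_mono) auto
          then show ?thesis by simp
        qed
      qed auto
    next
      show "integrable M (\<lambda>\<omega>. min (6 * (X k \<omega>)\<^sup>2) (\<bar>t\<bar> * \<bar>X k \<omega>\<bar>^3))"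
        by (rule Bochner_Integration.integrable_bound[where f="\<lambda>\<omega>. 6 * (X k \<omega>)\<^sup>2"]) (use i2 in auto)
    qed (use int k in auto)
    also have "\<dots> = t\<^sup>2 * (1 + \<bar>t\<bar>) * expectation (\<lambda>\<omega>. \<bar>X k \<omega>\<bar> powr q)" by simp
    also have "\<dots> \<le> t\<^sup>2 * (1 + \<bar>t\<bar>) * r" using r[OF k] by (intro mult_left_mono) auto
    finally have 1: "norm (char (distr M borel (X k)) t - complex_of_real (1 - t\<^sup>2 * s / 2)) \<le> t\<^sup>2 * (1 + \<bar>t\<bar>) * r" .
    have "\<bar>exp (- (t\<^sup>2 * s / 2)) - (1 - t\<^sup>2 * s / 2)\<bar> \<le> (t\<^sup>2 * s / 2)\<^sup>2"
      by (rule exp_minus_linear_bound) (use s0[OF k] in auto)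
    also have "\<dots> = (t ^ 4 * s\<^sup>2) / 4" by (simp add: power_mult_distrib power_divide)
    also have "\<dots> \<le> t ^ 4 * s\<^sup>2" by (simp add: zero_le_even_power)
    finally have "norm (complex_of_real ((1 - t\<^sup>2 * s / 2) - exp (- (t\<^sup>2 * s / 2)))) \<le> t ^ 4 * s\<^sup>2"
      by (simp only: norm_of_real abs_minus_commute)
    then have 2: "norm (complex_of_real (1 - t\<^sup>2 * s / 2) - w) \<le> t ^ 4 * s\<^sup>2"
      by (simp only: w_def of_real_diff)
    show ?thesis using norm_triangle_mono[OF 1 2] by simp
  qed
  have "char (distr M borel (\<lambda>\<omega>. \<Sum>k<N. X k \<omega>)) t = (\<Prod>k<N. char (distr M borel (X k)) t)"
    by (rule char_distr_sum[OF ind])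
  moreover have "complex_of_real (exp (- (real N * s * t\<^sup>2 / 2))) = (\<Prod>k<N. w)"
  proof -
    have "exp (- (real N * s * t\<^sup>2 / 2)) = exp (- (t\<^sup>2 * s / 2)) ^ N"
      unfolding exp_of_nat_mult[symmetric] by (simp add: mult_ac)
    then show ?thesis by (simp add: w_def)
  qed
  moreover have "norm ((\<Prod>k<N. char (distr M borel (X k)) t) - (\<Prod>k<N. w)) \<le>
      (\<Sum>k<N. norm (char (distr M borel (X k)) t - w))"
  proof (rule norm_prod_diff)
    fix k assume "k \<in> {..<N}"
    then show "norm w \<le> 1" using s0[of k] unfolding w_def norm_of_real by simp
    show "norm (char (distr M borel (X k)) t) \<le> 1"
      using \<open>k \<in> {..<N}\<close> by (intro real_distribution.cmod_char_le_1) auto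
  qed
  moreover have "\<dots> \<le> (\<Sum>k<N. t\<^sup>2 * (1 + \<bar>t\<bar>) * r + t ^ 4 * s\<^sup>2)"
    by (intro sum_mono bd) auto
  ultimately show ?thesis by (simp add: algebra_simps)
qed

text \<open>Meant for fourth powers of values of the basis, which have moments of an order above 1
  but perhaps no variance. Truncation at level 1 splits \<open>Y\<close> into \<open>Z\<close>,
  whose variance is at most \<open>r\<close> because \<open>q \<le> 2\<close>, and \<open>W\<close>,
  whose mean is at most \<open>r\<close> because \<open>q > 1\<close>; these produce the square root
  and the linear term of the bound.\<close>

lemma (in prob_space) L1_weak_law:
  fixes Y :: "nat \<Rightarrow> 'a \<Rightarrow> real"
  assumes ind: "indep_vars (\<lambda>_. borel) Y {..<N}"
    and pos: "\<And>k \<omega>. 0 \<le> Y k \<omega>"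
    and int: "\<And>k. k < N \<Longrightarrow> integrable M (\<lambda>\<omega>. Y k \<omega> powr q)" and q: "1 < q" "q \<le> 2"
    and r: "\<And>k. k < N \<Longrightarrow> expectation (\<lambda>\<omega>. Y k \<omega> powr q) \<le> r"
  shows "\<And>k. k < N \<Longrightarrow> integrable M (Y k)"
   and "expectation (\<lambda>\<omega>. \<bar>(\<Sum>k<N. Y k \<omega>) - (\<Sum>k<N. expectation (Y k))\<bar>) \<le> 2 * (real N * r) + sqrt (real N * r)"
proof -
  have [measurable]: "random_variable borel (Y k)" if "k < N" for k
    using ind that unfolding indep_vars_def2 by auto
  show intY: "integrable M (Y k)" if k: "k < N" for k
    using powr_dominates[of "Y k" q 1] int[OF k] pos[of k] that q by (simp add: abs_of_nonneg)
  define Z where "Z k \<omega> = (if Y k \<omega> \<le> 1 then Y k \<omega> else 0)" for k \<omega>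
  define W where "W k \<omega> = (if Y k \<omega> \<le> 1 then 0 else Y k \<omega>)" for k \<omega>
  have [measurable]: "random_variable borel (Z k)" "random_variable borel (W k)" if "k < N" for k
    using that unfolding Z_def W_def by measurable
  have YZW: "Y k \<omega> = Z k \<omega> + W k \<omega>" for k \<omega> by (auto simp: Z_def W_def)
  have W0: "0 \<le> W k \<omega>" "W k \<omega> \<le> Y k \<omega> powr q" for k \<omega>
    using powr_mono[of 1 q "Y k \<omega>"] pos[of k \<omega>] q by (auto simp: W_def)
  have Z0: "0 \<le> Z k \<omega>" "Z k \<omega> \<le> 1" "(Z k \<omega>)\<^sup>2 \<le> Y k \<omega> powr q" for k \<omega>
  proof -
    show "0 \<le> Z k \<omega>" "Z k \<omega> \<le> 1" using pos by (auto simp: Z_def)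
    show "(Z k \<omega>)\<^sup>2 \<le> Y k \<omega> powr q"
    proof (cases "Y k \<omega> \<le> 1 \<and> Y k \<omega> \<noteq> 0")
      case True
      then have p: "0 < Y k \<omega>" using pos[of k \<omega>] by auto
      have "Y k \<omega> powr 2 \<le> Y k \<omega> powr q" using True p q by (intro powr_mono') auto
      then show ?thesis using True p by (simp add: Z_def powr_numeral)
    qed (auto simp: Z_def)
  qed
  have iW: "integrable M (W k)" "expectation (W k) \<le> r" if k: "k < N" for k
  proof -
    show i: "integrable M (W k)"
      by (rule Bochner_Integration.integrable_bound[OF int[OF k]]) (use W0 k in auto)
    show "expectation (W k) \<le> r"
      using integral_mono[OF i int[OF k] W0(2)] r[OF k] by linarith
  qed
  have iZ: "integrable M (Z k)" "integrable M (\<lambda>\<omega>. (Z k \<omega>)\<^sup>2)" if k: "k < N" for k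
    using k Z0[of k] by (auto intro!: integrable_const_bound[where B=1] AE_I2 power_le_one)
  have indZ: "indep_vars (\<lambda>_. borel) Z {..<N}"
    unfolding Z_def by (rule indep_vars_compose2[OF ind]) auto
  have var: "variance (Z k) \<le> r" if k: "k < N" for k
  proof -
    have "variance (Z k) \<le> expectation (\<lambda>\<omega>. (Z k \<omega>)\<^sup>2)"
      by (subst variance_eq[OF iZ[OF k]]) simp
    also have "\<dots> \<le> expectation (\<lambda>\<omega>. Y k \<omega> powr q)"
      by (rule integral_mono[OF iZ(2)[OF k] int[OF k] Z0(3)])
    also have "\<dots> \<le> r" by (rule r[OF k])
    finally show ?thesis .
  qed
  let ?S = "\<lambda>\<omega>. \<Sum>k<N. Z k \<omega>"
  have vs: "variance ?S = (\<Sum>k<N. variance (Z k))"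
  proof -
    define m where "m k = expectation (Z k)" for k
    have iZm: "integrable M (\<lambda>\<omega>. Z k \<omega> - m k)" if "k < N" for k using iZ that by simp
    have indZm: "indep_vars (\<lambda>_. borel) (\<lambda>k \<omega>. Z k \<omega> - m k) {..<N}"
      by (rule indep_vars_compose2[OF indZ]) auto
    have eqm: "?S \<omega> - expectation ?S = (\<Sum>k<N. Z k \<omega> - m k)" for \<omega>
      using iZ by (simp add: m_def sum_subtractf Bochner_Integration.integral_sum)
    have "integrable M (\<lambda>\<omega>. (Z i \<omega> - m i) * (Z j \<omega> - m j))" if "i < N" "j < N" for i j
    proof (cases "i = j")
      case True
      have "integrable M (\<lambda>\<omega>. (Z i \<omega>)\<^sup>2 - 2 * m i * Z i \<omega> + (m i)\<^sup>2)" using iZ that by auto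
      then show ?thesis using True by (simp add: power2_eq_square algebra_simps)
    qed (use that in \<open>auto intro!: indep_vars_expectation_mult(1)[OF indZm] iZm\<close>)
    then show ?thesis
      unfolding eqm by (subst expectation_square_sum_orthogonal)
        (use indep_vars_expectation_mult(2)[OF indZm] iZm iZ in \<open>auto simp: m_def prob_space\<close>)
  qed
  have "expectation (\<lambda>\<omega>. \<bar>?S \<omega> - expectation ?S\<bar>) \<le> sqrt (variance ?S)"
  proof -
    have iS: "integrable M ?S" using iZ by auto
    have bS: "\<bar>?S \<omega>\<bar> \<le> real N" for \<omega>
      using sum_mono[of "{..<N}" "\<lambda>k. Z k \<omega>" "\<lambda>_. 1"] sum_nonneg[of "{..<N}" "\<lambda>k. Z k \<omega>"] Z0 by simp
    have i2: "integrable M (\<lambda>\<omega>. \<bar>?S \<omega> - expectation ?S\<bar>\<^sup>2)"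
    proof (rule integrable_const_bound[where B="(real N + \<bar>expectation ?S\<bar>)\<^sup>2"])
      show "AE \<omega> in M. norm (\<bar>?S \<omega> - expectation ?S\<bar>\<^sup>2) \<le> (real N + \<bar>expectation ?S\<bar>)\<^sup>2"
      proof (rule AE_I2)
        fix \<omega>
        have *: "\<bar>?S \<omega> - expectation ?S\<bar> \<le> real N + \<bar>expectation ?S\<bar>" using bS[of \<omega>] by linarith
        show "norm (\<bar>?S \<omega> - expectation ?S\<bar>\<^sup>2) \<le> (real N + \<bar>expectation ?S\<bar>)\<^sup>2"
          using power_mono[OF * abs_ge_zero, of 2] by simp
      qed
    qed auto
    have i1: "integrable M (\<lambda>\<omega>. \<bar>?S \<omega> - expectation ?S\<bar>)" using iS by auto
    \<comment> \<open>Jensen's inequality, in the form that the variance of the absolute deviation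
      is nonnegative.\<close>
    have "(expectation (\<lambda>\<omega>. \<bar>?S \<omega> - expectation ?S\<bar>))\<^sup>2 \<le> expectation (\<lambda>\<omega>. \<bar>?S \<omega> - expectation ?S\<bar>\<^sup>2)"
      using variance_positive[of "\<lambda>\<omega>. \<bar>?S \<omega> - expectation ?S\<bar>"] variance_eq[OF i1 i2] by linarith
    then show ?thesis by (intro real_le_rsqrt) simp
  qed
  also have "\<dots> \<le> sqrt (real N * r)"
    unfolding vs using sum_mono[of "{..<N}" "\<lambda>k. variance (Z k)" "\<lambda>_. r"] var by simp
  finally have 1: "expectation (\<lambda>\<omega>. \<bar>?S \<omega> - expectation ?S\<bar>) \<le> sqrt (real N * r)" .
  have 2: "expectation (\<lambda>\<omega>. \<Sum>k<N. W k \<omega>) \<le> real N * r"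
    using sum_mono[of "{..<N}" "\<lambda>k. expectation (W k)" "\<lambda>_. r"] iW by (simp add: Bochner_Integration.integral_sum)
  have eq: "(\<Sum>k<N. expectation (Y k)) = expectation ?S + expectation (\<lambda>\<omega>. \<Sum>k<N. W k \<omega>)"
    unfolding YZW using iZ iW by (simp add: Bochner_Integration.integral_sum sum.distrib)
  have EW: "0 \<le> expectation (\<lambda>\<omega>. \<Sum>k<N. W k \<omega>)" using W0 by (intro integral_nonneg_AE AE_I2 sum_nonneg) auto
  have "expectation (\<lambda>\<omega>. \<bar>(\<Sum>k<N. Y k \<omega>) - (\<Sum>k<N. expectation (Y k))\<bar>) \<le>
    expectation (\<lambda>\<omega>. \<bar>?S \<omega> - expectation ?S\<bar> + ((\<Sum>k<N. W k \<omega>) + expectation (\<lambda>\<omega>. \<Sum>k<N. W k \<omega>)))"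
  proof (rule integral_mono)
    fix \<omega>
    have "0 \<le> (\<Sum>k<N. W k \<omega>)" using W0 by (intro sum_nonneg) auto
    moreover have "(\<Sum>k<N. Y k \<omega>) = ?S \<omega> + (\<Sum>k<N. W k \<omega>)" by (simp add: YZW sum.distrib)
    ultimately show "\<bar>(\<Sum>k<N. Y k \<omega>) - (\<Sum>k<N. expectation (Y k))\<bar> \<le> \<bar>?S \<omega> - expectation ?S\<bar> + ((\<Sum>k<N. W k \<omega>) + expectation (\<lambda>\<omega>. \<Sum>k<N. W k \<omega>))"
      using EW unfolding eq by linarith
  qed (use iZ iW intY in \<open>auto intro!: integrable_abs Bochner_Integration.integrable_diff
      Bochner_Integration.integrable_add Bochner_Integration.integrable_sum\<close>)
  also have "\<dots> = expectation (\<lambda>\<omega>. \<bar>?S \<omega> - expectation ?S\<bar>) + 2 * expectation (\<lambda>\<omega>. \<Sum>k<N. W k \<omega>)"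
  proof -
    have "integrable M (\<lambda>\<omega>. \<bar>?S \<omega> - expectation ?S\<bar>)" "integrable M (\<lambda>\<omega>. \<Sum>k<N. W k \<omega>)"
      using iZ iW by (auto intro!: integrable_abs Bochner_Integration.integrable_diff
        Bochner_Integration.integrable_sum)
    then show ?thesis by (subst Bochner_Integration.integral_add, simp, simp,
        subst Bochner_Integration.integral_add) (simp_all add: prob_space)
  qed
  finally show "expectation (\<lambda>\<omega>. \<bar>(\<Sum>k<N. Y k \<omega>) - (\<Sum>k<N. expectation (Y k))\<bar>) \<le> 2 * (real N * r) + sqrt (real N * r)"
    using 1 2 by linarith
qed

section \<open>Laws determined by their Laplace transforms\<close>

text \<open>The integer points of the Laplace transform are the moments of \<open>exp (- V)\<close>.
  This variable lies in [0, 1], so its characteristic function is the sum of its moment series and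
  its law is determined; minus the logarithm returns to \<open>V\<close>.\<close>

lemma distr_eq_if_Laplace_eq:
  fixes V W
  assumes "prob_space M" "prob_space P"
    and [measurable]: "V \<in> borel_measurable M" "W \<in> borel_measurable P"
    and pos: "\<And>x. 0 \<le> (V x :: real)" "\<And>x. 0 \<le> (W x :: real)"
    and eq: "\<And>m::nat. (LINT x|M. exp (- (real m * V x))) = (LINT x|P. exp (- (real m * W x)))"
  shows "distr M borel V = distr P borel W"
proof -
  interpret M: prob_space M by fact
  interpret P: prob_space P by fact
  define U where "U x = exp (- V x)" for x
  define U' where "U' x = exp (- W x)" for x
  have [measurable]: "U \<in> borel_measurable M" "U' \<in> borel_measurable P"
    unfolding U_def U'_def by measurable
  have U01: "0 \<le> U x" "U x \<le> 1" "0 \<le> U' y" "U' y \<le> 1" for x y using pos by (auto simp: U_def U'_def)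
  have mom: "(LINT x|M. U x ^ k) = (LINT x|P. U' x ^ k)" for k
    using eq[of k] by (simp add: U_def U'_def exp_of_nat_mult[symmetric])
  have "char (distr M borel U) t = char (distr P borel U') t" for t
  proof -
    \<comment> \<open>Both characteristic functions are close to one and the same Taylor polynomial
      \<open>?S\<close>, whose coefficients are the common moments.\<close>
    have bd: "norm (char (distr M borel U) t - char (distr P borel U') t) \<le> 4 * (\<bar>t\<bar> ^ n / fact n)" for n
    proof -
      let ?S = "\<Sum>k \<le> n. ((\<i> * t)^k / fact k) * (LINT x|M. U x ^ k)"
      have "norm (char (distr M borel U) t - ?S) \<le> (2 * \<bar>t\<bar>^n / fact n) * M.expectation (\<lambda>x. \<bar>U x\<bar>^n)"
        by (rule M.char_approx1'[OF _ _ refl])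
          (use U01 in \<open>auto intro!: M.integrable_const_bound[where B=1] AE_I2 power_le_one\<close>)
      also have "\<dots> \<le> (2 * \<bar>t\<bar>^n / fact n) * M.expectation (\<lambda>x. 1)"
        by (intro mult_left_mono integral_mono)
          (use U01 in \<open>auto intro!: M.integrable_const_bound[where B=1] AE_I2 power_le_one\<close>)
      finally have 1: "norm (char (distr M borel U) t - ?S) \<le> 2 * \<bar>t\<bar>^n / fact n" by (simp add: M.prob_space)
      have "norm (char (distr P borel U') t - ?S) \<le> (2 * \<bar>t\<bar>^n / fact n) * P.expectation (\<lambda>x. \<bar>U' x\<bar>^n)"
        unfolding mom by (rule P.char_approx1'[OF _ _ refl])
          (use U01 in \<open>auto intro!: P.integrable_const_bound[where B=1] AE_I2 power_le_one\<close>)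
      also have "\<dots> \<le> (2 * \<bar>t\<bar>^n / fact n) * P.expectation (\<lambda>x. 1)"
        by (intro mult_left_mono integral_mono)
          (use U01 in \<open>auto intro!: P.integrable_const_bound[where B=1] AE_I2 power_le_one\<close>)
      finally have 2: "norm (char (distr P borel U') t - ?S) \<le> 2 * \<bar>t\<bar>^n / fact n" by (simp add: P.prob_space)
      show ?thesis
        using norm_triangle_ineq4[of "char (distr M borel U) t - ?S" "char (distr P borel U') t - ?S"] 1 2 by simp
    qed
    have "(\<lambda>n. 4 * (\<bar>t\<bar> ^ n / fact n)) \<longlonglongrightarrow> 4 * 0"
      using summable_LIMSEQ_zero[OF summable_exp[of "\<bar>t\<bar>"]] by (intro tendsto_mult) (auto simp: field_simps)
    then have "norm (char (distr M borel U) t - char (distr P borel U') t) \<le> 4 * 0"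
      by (rule tendsto_lowerbound) (use bd in auto)
    then show ?thesis by simp
  qed
  then have "distr M borel U = distr P borel U'"
    by (intro Levy_uniqueness) auto
  then have "distr (distr M borel U) borel (\<lambda>x. - ln x) = distr (distr P borel U') borel (\<lambda>x. - ln x)" by simp
  then show ?thesis by (simp add: distr_distr comp_def U_def U'_def)
qed

section \<open>Moments of sums of independent variables\<close>

text \<open>After division by the total both shares lie in [0, 1], where a power with exponent at
  least 1 lies below the identity.\<close>

lemma powr_add_superadditive:
  fixes u v q :: real assumes "0 \<le> u" "0 \<le> v" "1 \<le> q"
  shows "u powr q + v powr q \<le> (u + v) powr q"
proof (cases "u + v = 0")
  case False
  define s where "s = u + v"
  have s: "0 < s" using False assms by (auto simp: s_def)
  have *: "w powr q \<le> s powr q * (w / s)" if "0 \<le> w" "w \<le> s" for w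
  proof -
    have "w powr q = s powr q * (w / s) powr q"
      using s that by (simp add: powr_divide)
    also have "(w / s) powr q \<le> (w / s) powr 1"
      using s that assms by (intro powr_mono') auto
    finally show ?thesis using s that by (simp add: mult_left_mono)
  qed
  have "u powr q + v powr q \<le> s powr q * (u / s) + s powr q * (v / s)"
    using *[of u] *[of v] assms by (auto simp: s_def)
  also have "\<dots> = s powr q" using s by (simp add: s_def flip: distrib_left add_divide_distrib)
  finally show ?thesis by (simp add: s_def)
next
  case True
  then show ?thesis using assms by (simp add: add_nonneg_eq_0_iff)
qed

text \<open>For positive arguments this is convexity of the power; zero arguments are treated
  separately, through \<open>w powr q \<le> w\<close> on [0, 1].\<close>

lemma powr_convex_nonneg:
  fixes x y u q :: real assumes q: "1 \<le> q" and "0 \<le> x" "0 \<le> y" "0 \<le> u" "u \<le> 1"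
  shows "((1 - u) * x + u * y) powr q \<le> (1 - u) * x powr q + u * y powr q"
proof -
  have *: "(w * z) powr q \<le> w * z powr q" if "0 \<le> w" "w \<le> 1" "0 \<le> z" for w z
  proof -
    have "w powr q \<le> w powr 1" using that q by (intro powr_mono') auto
    then show ?thesis using that by (simp add: powr_mult mult_right_mono)
  qed
  consider "x = 0" | "y = 0" | "0 < x" "0 < y" using assms by linarith
  then show ?thesis
  proof cases
    case 3
    then show ?thesis using convex_onD[OF powr_convex[OF q], of u x y] assms by simp
  qed (use *[of u y] *[of "1 - u" x] assms in auto)
qed

lemma convex_on_abs_powr:
  fixes q :: real assumes "1 \<le> q" shows "convex_on UNIV (\<lambda>x::real. \<bar>x\<bar> powr q)"
proof (rule convex_onI)
  fix t x y :: real assume t: "0 < t" "t < 1"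
  have "\<bar>(1 - t) *\<^sub>R x + t *\<^sub>R y\<bar> \<le> (1 - t) * \<bar>x\<bar> + t * \<bar>y\<bar>"
    using abs_triangle_ineq[of "(1 - t) * x" "t * y"] t by (simp add: abs_mult)
  then have "\<bar>(1 - t) *\<^sub>R x + t *\<^sub>R y\<bar> powr q \<le> ((1 - t) * \<bar>x\<bar> + t * \<bar>y\<bar>) powr q"
    using assms by (intro powr_mono2) auto
  also have "\<dots> \<le> (1 - t) * \<bar>x\<bar> powr q + t * \<bar>y\<bar> powr q"
    using t assms by (intro powr_convex_nonneg) auto
  finally show "\<bar>(1 - t) *\<^sub>R x + t *\<^sub>R y\<bar> powr q \<le> (1 - t) * \<bar>x\<bar> powr q + t * \<bar>y\<bar> powr q" .
qed simp

text \<open>With \<open>q = p / 2\<close>, superadditivity bounds the sum of the two powers by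
  \<open>(x^2 + y^2) powr q\<close>; the parallelogram identity writes \<open>x^2 + y^2\<close> as
  the mean of \<open>(x + y)^2\<close> and \<open>(x - y)^2\<close>, and convexity finishes.\<close>

lemma Clarkson_powr:
  fixes x y p :: real assumes p: "2 \<le> p"
  shows "2 * (\<bar>x\<bar> powr p + \<bar>y\<bar> powr p) \<le> \<bar>x + y\<bar> powr p + \<bar>x - y\<bar> powr p"
proof -
  define q where "q = p / 2"
  have q: "1 \<le> q" "p = 2 * q" using p by (auto simp: q_def)
  have sq: "\<bar>z\<bar> powr p = (z\<^sup>2) powr q" for z :: real
  proof (cases "z = 0")
    case False
    then have "\<bar>z\<bar> powr 2 = z\<^sup>2" by (simp add: powr_numeral)
    then show ?thesis by (simp add: q(2) flip: powr_powr)
  qed simp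
  have "(x\<^sup>2) powr q + (y\<^sup>2) powr q \<le> (x\<^sup>2 + y\<^sup>2) powr q"
    by (rule powr_add_superadditive) (use q in auto)
  also have "x\<^sup>2 + y\<^sup>2 = (1 - 1/2) * (x + y)\<^sup>2 + 1/2 * (x - y)\<^sup>2"
    by (simp add: power2_eq_square algebra_simps)
  also have "\<dots> powr q \<le> (1 - 1/2) * ((x + y)\<^sup>2) powr q + 1/2 * ((x - y)\<^sup>2) powr q"
    by (rule powr_convex_nonneg) (use q in auto)
  finally show ?thesis by (simp add: sq)
qed

lemma abs_add_powr_le:
  fixes x y p :: real assumes p: "0 \<le> p"
  shows "\<bar>x + y\<bar> powr p \<le> 2 powr p * (\<bar>x\<bar> powr p + \<bar>y\<bar> powr p)"
proof -
  have "\<bar>x + y\<bar> powr p \<le> (2 * max \<bar>x\<bar> \<bar>y\<bar>) powr p" using p by (intro powr_mono2) auto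
  also have "\<dots> = 2 powr p * (max \<bar>x\<bar> \<bar>y\<bar>) powr p" by (simp add: powr_mult)
  also have "\<dots> \<le> 2 powr p * (\<bar>x\<bar> powr p + \<bar>y\<bar> powr p)"
    by (intro mult_left_mono) (auto simp: max_def)
  finally show ?thesis .
qed

context prob_space
begin

lemma integrable_abs_powr_add:
  fixes X Y :: "'a \<Rightarrow> real"
  assumes [measurable]: "random_variable borel X" "random_variable borel Y" and p: "0 \<le> p"
    and "integrable M (\<lambda>\<omega>. \<bar>X \<omega>\<bar> powr p)" "integrable M (\<lambda>\<omega>. \<bar>Y \<omega>\<bar> powr p)"
  shows "integrable M (\<lambda>\<omega>. \<bar>X \<omega> + Y \<omega>\<bar> powr p)"
  by (rule Bochner_Integration.integrable_bound[where f="\<lambda>\<omega>. 2 powr p * (\<bar>X \<omega>\<bar> powr p + \<bar>Y \<omega>\<bar> powr p)"])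
    (use assms abs_add_powr_le[OF p] in auto)

lemma indep_var_distr_pair:
  assumes "indep_var S X T Y"
  shows "distr M (S \<Otimes>\<^sub>M T) (\<lambda>\<omega>. (X \<omega>, Y \<omega>)) = distr M S X \<Otimes>\<^sub>M distr M T Y"
  using assms unfolding indep_var_distribution_eq by simp

lemma indep_vars_imp_indep_var:
  assumes ind: "indep_vars (\<lambda>_. N) X I" and ij: "i \<in> I" "j \<in> I" "i \<noteq> j"
  shows "indep_var N (X i) N (X j)"
proof -
  have "indep_var (PiM {i} (\<lambda>_. N)) (\<lambda>\<omega>. restrict (\<lambda>i. X i \<omega>) {i}) (PiM {j} (\<lambda>_. N)) (\<lambda>\<omega>. restrict (\<lambda>i. X i \<omega>) {j})"
    by (rule indep_var_restrict[OF ind]) (use ij in auto)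
  from indep_var_compose[OF this, of "\<lambda>f. f i" N "\<lambda>f. f j" N] show ?thesis
    by (auto simp: comp_def)
qed

text \<open>By Fubini, \<open>\<bar>x + Y \<omega>\<bar> powr p\<close> is integrable for some fixed
  number \<open>x\<close>, and a constant shift does not affect integrability.\<close>

lemma integrable_powr_summand:
  fixes X Y :: "'a \<Rightarrow> real"
  assumes ind: "indep_var borel X borel Y" and p: "0 \<le> p"
    and int: "integrable M (\<lambda>\<omega>. \<bar>X \<omega> + Y \<omega>\<bar> powr p)"
  shows "integrable M (\<lambda>\<omega>. \<bar>Y \<omega>\<bar> powr p)"
proof -
  have [measurable]: "random_variable borel X" "random_variable borel Y"
    using ind by (auto dest: indep_var_rv1 indep_var_rv2)
  interpret X: prob_space "distr M borel X" by (rule prob_space_distr) simp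
  interpret Y: prob_space "distr M borel Y" by (rule prob_space_distr) simp
  interpret XY: pair_prob_space "distr M borel X" "distr M borel Y" ..
  have "integrable (distr M (borel \<Otimes>\<^sub>M borel) (\<lambda>\<omega>. (X \<omega>, Y \<omega>))) (\<lambda>z. \<bar>fst z + snd z\<bar> powr p)"
    using int by (subst integrable_distr_eq) auto
  then have "integrable (distr M borel X \<Otimes>\<^sub>M distr M borel Y) (\<lambda>z. \<bar>fst z + snd z\<bar> powr p)"
    by (simp add: indep_var_distr_pair[OF ind])
  from XY.AE_integrable_fst'[OF this] have AE: "AE x in distr M borel X. integrable (distr M borel Y) (\<lambda>y. \<bar>x + y\<bar> powr p)"
    by simp
  have "\<exists>x. integrable (distr M borel Y) (\<lambda>y. \<bar>x + y\<bar> powr p)"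
  proof (rule ccontr)
    assume "\<nexists>x. integrable (distr M borel Y) (\<lambda>y. \<bar>x + y\<bar> powr p)"
    with AE have "AE x in distr M borel X. False" by simp
    then show False by simp
  qed
  then obtain x where "integrable (distr M borel Y) (\<lambda>y. \<bar>x + y\<bar> powr p)" by blast
  then have "integrable M (\<lambda>\<omega>. \<bar>x + Y \<omega>\<bar> powr p)" by (subst (asm) integrable_distr_eq) auto
  then show ?thesis
    using integrable_abs_powr_add[of "\<lambda>\<omega>. x + Y \<omega>" "\<lambda>_. - x" p] p by simp
qed

text \<open>Independence and symmetry give \<open>X - Y\<close> the law of \<open>X + Y\<close>, so
  the two terms on the right of Clarkson's inequality have the same mean.\<close>

lemma expectation_powr_superadditive:
  fixes X Y :: "'a \<Rightarrow> real"
  assumes ind: "indep_var borel X borel Y" and p: "2 \<le> p"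
    and sym: "distr M borel (\<lambda>\<omega>. - Y \<omega>) = distr M borel Y"
    and int: "integrable M (\<lambda>\<omega>. \<bar>X \<omega>\<bar> powr p)" "integrable M (\<lambda>\<omega>. \<bar>Y \<omega>\<bar> powr p)"
  shows "expectation (\<lambda>\<omega>. \<bar>X \<omega>\<bar> powr p) + expectation (\<lambda>\<omega>. \<bar>Y \<omega>\<bar> powr p)
    \<le> expectation (\<lambda>\<omega>. \<bar>X \<omega> + Y \<omega>\<bar> powr p)"
proof -
  have [measurable]: "random_variable borel X" "random_variable borel Y"
    using ind by (auto dest: indep_var_rv1 indep_var_rv2)
  have ind': "indep_var borel X borel (\<lambda>\<omega>. - Y \<omega>)"
    using indep_var_compose[OF ind, of "\<lambda>x. x" borel "\<lambda>x. - x" borel] by (simp add: comp_def)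
  have "expectation (\<lambda>\<omega>. \<bar>X \<omega> - Y \<omega>\<bar> powr p) =
      (LINT z|distr M (borel \<Otimes>\<^sub>M borel) (\<lambda>\<omega>. (X \<omega>, - Y \<omega>)). \<bar>fst z + snd z\<bar> powr p)"
    by (subst integral_distr) auto
  also have "\<dots> = (LINT z|distr M (borel \<Otimes>\<^sub>M borel) (\<lambda>\<omega>. (X \<omega>, Y \<omega>)). \<bar>fst z + snd z\<bar> powr p)"
    by (simp add: indep_var_distr_pair[OF ind'] indep_var_distr_pair[OF ind] sym)
  also have "\<dots> = expectation (\<lambda>\<omega>. \<bar>X \<omega> + Y \<omega>\<bar> powr p)"
    by (subst integral_distr) auto
  finally have eq: "expectation (\<lambda>\<omega>. \<bar>X \<omega> - Y \<omega>\<bar> powr p) = expectation (\<lambda>\<omega>. \<bar>X \<omega> + Y \<omega>\<bar> powr p)" .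
  have i1: "integrable M (\<lambda>\<omega>. \<bar>X \<omega> + Y \<omega>\<bar> powr p)"
    using integrable_abs_powr_add[OF _ _ _ int] p by simp
  have i2: "integrable M (\<lambda>\<omega>. \<bar>X \<omega> - Y \<omega>\<bar> powr p)"
    using integrable_abs_powr_add[of X "\<lambda>\<omega>. - Y \<omega>" p] int p by simp
  have "expectation (\<lambda>\<omega>. 2 * (\<bar>X \<omega>\<bar> powr p + \<bar>Y \<omega>\<bar> powr p)) \<le>
     expectation (\<lambda>\<omega>. \<bar>X \<omega> + Y \<omega>\<bar> powr p + \<bar>X \<omega> - Y \<omega>\<bar> powr p)"
    by (rule integral_mono) (use int i1 i2 Clarkson_powr[OF p] in auto)
  then show ?thesis using int i1 i2 eq by simp
qed

text \<open>Jensen's inequality in the variable \<open>Y\<close> with the value of \<open>X\<close>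
  held fixed: subtracting a mean is averaging over an independent variable with that mean. This is
  the way back from the symmetrized basis to the centred one.\<close>

lemma expectation_powr_centred_le:
  fixes X Y :: "'a \<Rightarrow> real"
  assumes ind: "indep_var borel X borel Y" and p: "1 \<le> p"
    and int: "integrable M (\<lambda>\<omega>. \<bar>X \<omega> - Y \<omega>\<bar> powr p)" and intY: "integrable M Y"
  shows "integrable M (\<lambda>\<omega>. \<bar>X \<omega> - expectation Y\<bar> powr p)"
    and "expectation (\<lambda>\<omega>. \<bar>X \<omega> - expectation Y\<bar> powr p) \<le> expectation (\<lambda>\<omega>. \<bar>X \<omega> - Y \<omega>\<bar> powr p)"
proof -
  have [measurable]: "random_variable borel X" "random_variable borel Y"
    using ind by (auto dest: indep_var_rv1 indep_var_rv2)
  define m where "m = expectation Y"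
  let ?X = "distr M borel X" and ?Y = "distr M borel Y"
  interpret X: prob_space ?X by (rule prob_space_distr) simp
  interpret Y: prob_space ?Y by (rule prob_space_distr) simp
  interpret XY: pair_prob_space ?X ?Y ..
  have i: "integrable (?X \<Otimes>\<^sub>M ?Y) (\<lambda>z. \<bar>fst z - snd z\<bar> powr p)"
    unfolding indep_var_distr_pair[OF ind, symmetric] using int by (subst integrable_distr_eq) auto
  have AE: "AE x in ?X. integrable ?Y (\<lambda>y. \<bar>x - y\<bar> powr p)"
    using XY.AE_integrable_fst'[OF i] by simp
  have i': "integrable ?X (\<lambda>x. LINT y|?Y. \<bar>x - y\<bar> powr p)"
    using XY.integrable_fst'[OF i] by simp
  have iY: "integrable ?Y (\<lambda>y. x - y)" for x using intY by (subst integrable_distr_eq) auto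
  have EY: "(LINT y|?Y. x - y) = x - m" for x
    by (subst integral_distr) (use intY in \<open>auto simp: m_def prob_space\<close>)
  have J: "AE x in ?X. \<bar>x - m\<bar> powr p \<le> (LINT y|?Y. \<bar>x - y\<bar> powr p)"
    using AE
  proof eventually_elim
    case (elim x)
    show ?case
      using Y.jensens_inequality[of "\<lambda>y. x - y" UNIV, OF iY _ _ elim convex_on_abs_powr[OF p]] EY by simp
  qed
  have i3: "integrable ?X (\<lambda>x. \<bar>x - m\<bar> powr p)"
    by (rule Bochner_Integration.integrable_bound[OF i']) (use J in \<open>auto elim!: eventually_mono\<close>)
  then show "integrable M (\<lambda>\<omega>. \<bar>X \<omega> - expectation Y\<bar> powr p)"
    by (subst (asm) integrable_distr_eq) (auto simp: m_def)
  have "expectation (\<lambda>\<omega>. \<bar>X \<omega> - expectation Y\<bar> powr p) = (LINT x|?X. \<bar>x - m\<bar> powr p)"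
    by (subst integral_distr) (auto simp: m_def)
  also have "\<dots> \<le> (LINT x|?X. LINT y|?Y. \<bar>x - y\<bar> powr p)"
    by (rule integral_mono_AE[OF i3 i' J])
  also have "\<dots> = (LINT z|(?X \<Otimes>\<^sub>M ?Y). \<bar>fst z - snd z\<bar> powr p)"
    using XY.integral_fst'[OF i] by simp
  also have "\<dots> = expectation (\<lambda>\<omega>. \<bar>X \<omega> - Y \<omega>\<bar> powr p)"
    unfolding indep_var_distr_pair[OF ind, symmetric] by (subst integral_distr) auto
  finally show "expectation (\<lambda>\<omega>. \<bar>X \<omega> - expectation Y\<bar> powr p) \<le> expectation (\<lambda>\<omega>. \<bar>X \<omega> - Y \<omega>\<bar> powr p)" .
qed

end

text \<open>Cauchy's functional equation on an interval. Nonnegativity makes \<open>f\<close>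
  monotone, and the values at the grid points \<open>k / N\<close>, which additivity determines,
  enclose \<open>f x\<close> up to \<open>f 1 / N\<close>.\<close>

lemma nonneg_additive_imp_linear:
  fixes f :: "real \<Rightarrow> real"
  assumes add: "\<And>x y. 0 \<le> x \<Longrightarrow> 0 \<le> y \<Longrightarrow> x + y \<le> 1 \<Longrightarrow> f (x + y) = f x + f y"
    and nn: "\<And>x. 0 \<le> x \<Longrightarrow> x \<le> 1 \<Longrightarrow> 0 \<le> f x" and x: "0 \<le> x" "x \<le> 1"
  shows "f x = x * f 1"
proof -
  have mult: "f (real k * y) = real k * f y" if "0 \<le> y" "real k * y \<le> 1" for k y
    using that
  proof (induction k)
    case 0
    then show ?case using add[of 0 0] by simp
  next
    case (Suc k)
    then have "f (real k * y + y) = f (real k * y) + f y" by (intro add) (auto simp: algebra_simps)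
    then show ?case using Suc by (simp add: algebra_simps)
  qed
  have mono: "f y \<le> f z" if "0 \<le> y" "y \<le> z" "z \<le> 1" for y z
    using add[of y "z - y"] nn[of "z - y"] that by simp
  have bd: "\<bar>f x - x * f 1\<bar> \<le> f 1 * inverse (real (Suc n))" for n
  proof -
    define N where "N = Suc n"
    have N: "0 < real N" by (simp add: N_def)
    define k where "k = nat \<lfloor>real N * x\<rfloor>"
    have k: "real k \<le> real N * x" "real N * x < real k + 1" using x by (auto simp: k_def)
    have fN: "f (1 / real N) = f 1 / real N" using mult[of "1 / real N" N] N by (simp add: field_simps)
    have fk: "f (real j / real N) = real j * f 1 / real N" if "j \<le> N" for j
      using mult[of "1 / real N" j] fN that N by simp
    have f1: "0 \<le> f 1" using nn by simp
    have kN: "real k / real N \<le> x" using k N by (simp add: field_simps)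
    have "real k \<le> real N" using k(1) x N by (meson mult_left_le of_nat_0_le_iff order_trans)
    then have kN': "k \<le> N" by simp
    have lo: "real k * f 1 / real N \<le> f x" using mono[of "real k / real N" x] kN x fk[OF kN'] by simp
    \<comment> \<open>For \<open>k = N\<close> the next grid point would leave [0, 1]; in that case
      \<open>x = 1\<close>.\<close>
    have up: "f x \<le> (real k + 1) * f 1 / real N"
    proof (cases "k = N")
      case True
      then have "x = 1" using k x N by (simp add: field_simps)
      then show ?thesis using True N f1 by (simp add: field_simps)
    next
      case False
      then have "Suc k \<le> N" using kN' by simp
      moreover have "x \<le> real (Suc k) / real N" using k N by (simp add: field_simps)
      ultimately show ?thesis using mono[of x "real (Suc k) / real N"] x fk[of "Suc k"] N by (simp add: add.commute)
    qed
    have "real k * f 1 / real N \<le> x * f 1" "x * f 1 \<le> (real k + 1) * f 1 / real N"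
      using mult_right_mono[OF kN f1] k N mult_right_mono[of x "(real k + 1) / real N" "f 1"] f1
      by (auto simp: field_simps)
    moreover have "(real k + 1) * f 1 / real N = real k * f 1 / real N + f 1 * inverse (real N)"
      by (simp add: divide_inverse algebra_simps)
    ultimately show ?thesis using lo up unfolding N_def by linarith
  qed
  have "(\<lambda>n. f 1 * inverse (real (Suc n))) \<longlonglongrightarrow> f 1 * 0"
    by (intro tendsto_mult LIMSEQ_inverse_real_of_nat tendsto_const)
  then have "\<bar>f x - x * f 1\<bar> \<le> f 1 * 0" by (rule tendsto_lowerbound) (use bd in auto)
  then show ?thesis by simp
qed

section \<open>Levy bases: additivity, independence and moments\<close>

lemma finite_borel_sets_Un [intro, simp]:
  "B \<in> finite_borel_sets \<Longrightarrow> C \<in> finite_borel_sets \<Longrightarrow> B \<union> C \<in> finite_borel_sets"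
proof -
  assume a: "B \<in> finite_borel_sets" "C \<in> finite_borel_sets"
  then have "emeasure lborel (B \<union> C) \<le> emeasure lborel B + emeasure lborel C"
    by (intro emeasure_subadditive) (auto simp: finite_borel_sets_def)
  also have "\<dots> < \<infinity>" using a by (auto simp: finite_borel_sets_def)
  finally show ?thesis using a by (auto simp: finite_borel_sets_def)
qed

lemma finite_borel_sets_subset:
  "C \<in> finite_borel_sets \<Longrightarrow> B \<subseteq> C \<Longrightarrow> B \<in> sets borel \<Longrightarrow> B \<in> finite_borel_sets"
  using emeasure_mono[of B C lborel] by (auto simp: finite_borel_sets_def)

lemma finite_borel_sets_Diff [intro, simp]:
  "B \<in> finite_borel_sets \<Longrightarrow> C \<in> finite_borel_sets \<Longrightarrow> B - C \<in> finite_borel_sets"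
  by (rule finite_borel_sets_subset[of B]) (auto simp: finite_borel_sets_def)

lemma finite_borel_sets_Int [intro, simp]:
  "B \<in> finite_borel_sets \<Longrightarrow> C \<in> finite_borel_sets \<Longrightarrow> B \<inter> C \<in> finite_borel_sets"
  by (rule finite_borel_sets_subset[of B]) (auto simp: finite_borel_sets_def)

lemma finite_borel_sets_empty [intro, simp]: "{} \<in> finite_borel_sets"
  by (simp add: finite_borel_sets_def)

lemma finite_borel_sets_UN:
  "finite I \<Longrightarrow> (\<And>i. i \<in> I \<Longrightarrow> A i \<in> finite_borel_sets) \<Longrightarrow> (\<Union>i\<in>I. A i) \<in> finite_borel_sets"
  by (induction I rule: finite_induct) auto

lemma measure_Un_finite_borel:
  assumes "B \<in> finite_borel_sets" "C \<in> finite_borel_sets" "B \<inter> C = {}"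
  shows "measure lborel (B \<union> C) = measure lborel B + measure lborel C"
  using assms by (intro measure_Union) (auto simp: finite_borel_sets_def)

lemma measure_UN_finite_borel:
  assumes "finite I" "\<And>i. i \<in> I \<Longrightarrow> A i \<in> finite_borel_sets" "disjoint_family_on A I"
  shows "measure lborel (\<Union>i\<in>I. A i) = (\<Sum>i\<in>I. measure lborel (A i))"
  using assms by (intro measure_finite_Union) (auto simp: finite_borel_sets_def image_subset_iff top.not_eq_extremum)

lemma measure_mono_finite_borel:
  assumes "B \<subseteq> C" "B \<in> finite_borel_sets" "C \<in> finite_borel_sets"
  shows "measure lborel B \<le> measure lborel C"
  using assms by (intro measure_mono_fmeasurable) (auto simp: finite_borel_sets_def fmeasurable_def)

text \<open>Model sets: the law of \<open>L B\<close> depends only on the area of \<open>B\<close>,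
  so statements about a set of area \<open>A\<close> are proved for a rectangle of height 1 and
  width \<open>A\<close>, which can be cut at will. The levels \<open>c = 0\<close> and
  \<open>c = 2\<close> supply two disjoint, hence independent, copies.\<close>

definition rect :: "real \<Rightarrow> real \<Rightarrow> real \<Rightarrow> (real \<times> real) set" where
  "rect c s t = {s<..t} \<times> {c<..c + 1}"

lemma rect_finite_borel [simp, intro]: "rect c s t \<in> finite_borel_sets"
  and measure_rect: "s \<le> t \<Longrightarrow> measure lborel (rect c s t) = t - s"
proof -
  have e: "emeasure lborel (rect c s t) = emeasure lborel {s<..t} * emeasure lborel {c<..c + 1}"
    unfolding rect_def lborel_prod[symmetric] by (rule lborel.emeasure_pair_measure_Times) auto
  have "rect c s t \<in> sets borel" unfolding rect_def by (auto simp flip: borel_prod)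
  then show "rect c s t \<in> finite_borel_sets"
    using e by (cases "s \<le> t") (auto simp: finite_borel_sets_def)
  assume "s \<le> t"
  then show "measure lborel (rect c s t) = t - s" using e by (simp add: measure_def)
qed

context homogeneous_levy_basis
begin

declare random_variable [measurable]

text \<open>Additivity along the constant sequence of empty sets makes a constant series converge,
  which forces its term to be 0.\<close>

lemma L_empty: "AE \<omega> in M. L {} \<omega> = 0"
proof -
  have "AE \<omega> in M. (\<lambda>i::nat. L {} \<omega>) sums L (\<Union>i::nat. {}) \<omega>"
    by (rule sigma_additive) (auto simp: disjoint_family_on_def)
  then show ?thesis
  proof eventually_elim
    case (elim \<omega>)
    then show ?case using sums_summable[OF elim] by (simp add: summable_const_iff)
  qed
qed

lemma L_Un:
  assumes "B \<in> finite_borel_sets" "C \<in> finite_borel_sets" "B \<inter> C = {}"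
  shows "AE \<omega> in M. L (B \<union> C) \<omega> = L B \<omega> + L C \<omega>"
proof -
  define Bs where "Bs i = (if i = 0 then B else if i = Suc 0 then C else {})" for i
  have U: "(\<Union>i. Bs i) = B \<union> C" by (auto simp: Bs_def split: if_splits)
  have "AE \<omega> in M. (\<lambda>i. L (Bs i) \<omega>) sums L (\<Union>i. Bs i) \<omega>"
    by (rule sigma_additive) (use assms U in \<open>auto simp: Bs_def disjoint_family_on_def\<close>)
  with L_empty show ?thesis
  proof eventually_elim
    case (elim \<omega>)
    have "(\<lambda>i. L (Bs i) \<omega>) sums (\<Sum>i\<in>{0, Suc 0}. L (Bs i) \<omega>)"
      by (rule sums_finite) (use elim in \<open>auto simp: Bs_def\<close>)
    from sums_unique2[OF elim(2) this] show ?case by (simp add: U Bs_def Un_commute)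
  qed
qed

lemma L_UN:
  assumes "finite I" "\<And>i. i \<in> I \<Longrightarrow> A i \<in> finite_borel_sets" "disjoint_family_on A I"
  shows "AE \<omega> in M. L (\<Union>i\<in>I. A i) \<omega> = (\<Sum>i\<in>I. L (A i) \<omega>)"
  using assms
proof (induction I rule: finite_induct)
  case empty
  then show ?case using L_empty by simp
next
  case (insert i I)
  have "AE \<omega> in M. L (\<Union>i\<in>I. A i) \<omega> = (\<Sum>i\<in>I. L (A i) \<omega>)"
    using insert by (intro insert.IH) (auto simp: disjoint_family_on_def)
  moreover have "AE \<omega> in M. L (A i \<union> (\<Union>i\<in>I. A i)) \<omega> = L (A i) \<omega> + L (\<Union>i\<in>I. A i) \<omega>"
    using insert by (intro L_Un finite_borel_sets_UN) (auto simp: disjoint_family_on_def)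
  ultimately show ?case
    by eventually_elim (use insert in simp)
qed

lemma L_indep_vars:
  assumes A: "\<And>i. i < n \<Longrightarrow> A i \<in> finite_borel_sets" "disjoint_family_on A {..<n}"
  shows "indep_vars (\<lambda>_. borel) (\<lambda>i::nat. L (A i)) {..<n}"
proof -
  define Bs where "Bs i = (if i < n then A i else {})" for i
  have "indep_vars (\<lambda>_. borel) (\<lambda>i::nat. L (Bs i)) UNIV"
    by (rule independently_scattered) (use A in \<open>auto simp: Bs_def disjoint_family_on_def\<close>)
  then have "indep_vars (\<lambda>_. borel) (\<lambda>i::nat. L (Bs i)) {..<n}"
    by (rule indep_vars_subset) simp
  then show ?thesis by (rule indep_vars_cong[THEN iffD1, rotated 3]) (auto simp: Bs_def)
qed

lemma L_indep_var:
  assumes "B \<in> finite_borel_sets" "C \<in> finite_borel_sets" "B \<inter> C = {}"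
  shows "indep_var borel (L B) borel (L C)"
proof -
  have "indep_vars (\<lambda>_. borel) (\<lambda>i::nat. L ((\<lambda>i. if i = 0 then B else C) i)) {..<2}"
    by (rule L_indep_vars) (use assms in \<open>auto simp: disjoint_family_on_def\<close>)
  from indep_vars_imp_indep_var[OF this, of 0 1] show ?thesis by simp
qed

lemma L_distr_eq:
  assumes "B \<in> finite_borel_sets" "C \<in> finite_borel_sets" "measure lborel B = measure lborel C"
  shows "distr M borel (L B) = distr M borel (L C)"
  using assms by (intro Levy_uniqueness) (auto simp: char_eq fun_eq_iff)

lemma L_expectation_eq:
  fixes f :: "real \<Rightarrow> real"
  assumes "B \<in> finite_borel_sets" "C \<in> finite_borel_sets" "measure lborel B = measure lborel C"
    and f [measurable]: "f \<in> borel_measurable borel"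
  shows "expectation (\<lambda>\<omega>. f (L B \<omega>)) = expectation (\<lambda>\<omega>. f (L C \<omega>))"
    and "integrable M (\<lambda>\<omega>. f (L B \<omega>)) \<longleftrightarrow> integrable M (\<lambda>\<omega>. f (L C \<omega>))"
proof -
  have [measurable]: "random_variable borel (L B)" "random_variable borel (L C)" using assms by auto
  have "(LINT x|distr M borel (L B). f x) = (LINT x|distr M borel (L C). f x)"
    using L_distr_eq[OF assms(1-3)] by simp
  then show "expectation (\<lambda>\<omega>. f (L B \<omega>)) = expectation (\<lambda>\<omega>. f (L C \<omega>))"
    by (subst (asm) (1 2) integral_distr) auto
  have "integrable (distr M borel (L B)) f \<longleftrightarrow> integrable (distr M borel (L C)) f"
    using L_distr_eq[OF assms(1-3)] by simp
  then show "integrable M (\<lambda>\<omega>. f (L B \<omega>)) \<longleftrightarrow> integrable M (\<lambda>\<omega>. f (L C \<omega>))"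
    by (subst (asm) (1 2) integrable_distr_eq) auto
qed

end

text \<open>The cap on \<open>p\<close> costs nothing, as a higher moment can be lowered, and it
  puts the derived exponents into the ranges of the tools: \<open>p / 2\<close> into (2, 3] for the
  normal approximation, \<open>p / 4\<close> into (1, 2] for the weak law, \<open>p - 4\<close> into
  (0, 2] for comparing the sine with its argument.\<close>

locale levy_basis_moments = homogeneous_levy_basis M \<gamma> b \<nu> L
  for M :: "'w measure" and \<gamma> b \<nu> L +
  fixes p :: real
  assumes p: "4 < p" "p \<le> 6"
    and unit_moment: "\<And>B. B \<in> finite_borel_sets \<Longrightarrow> measure lborel B = 1 \<Longrightarrow>
      integrable M (\<lambda>\<omega>. \<bar>L B \<omega>\<bar> powr p)"
    and unit_variance: "\<And>B. B \<in> finite_borel_sets \<Longrightarrow> measure lborel B = 1 \<Longrightarrow> variance (L B) = 1"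
begin

lemma rect_split:
  assumes "s \<le> t" "t \<le> u"
  shows "rect c s u = rect c s t \<union> rect c t u" "rect c s t \<inter> rect c t u = {}"
  using assms by (auto simp: rect_def)

lemma L_rect_split:
  assumes "s \<le> t" "t \<le> u"
  shows "AE \<omega> in M. L (rect c s u) \<omega> = L (rect c s t) \<omega> + L (rect c t u) \<omega>"
  using L_Un[of "rect c s t" "rect c t u"] rect_split[OF assms, of c] by simp

text \<open>Area at most 1 allows the law of \<open>L B\<close> to be realized on a part of a set of
  unit area; moments are given for unit areas only.\<close>

definition small :: "(real \<times> real) set \<Rightarrow> bool" where
  "small B \<longleftrightarrow> B \<in> finite_borel_sets \<and> measure lborel B \<le> 1"

lemma small_finite_borel [simp]: "small B \<Longrightarrow> B \<in> finite_borel_sets"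
  by (simp add: small_def)

text \<open>A unit rectangle is cut into a piece with the area of \<open>B\<close> and an
  independent rest; integrability of the power of a sum of independent variables passes to each
  summand.\<close>

lemma integrable_L_powr:
  assumes "small B" shows "integrable M (\<lambda>\<omega>. \<bar>L B \<omega>\<bar> powr p)"
proof -
  define A where "A = measure lborel B"
  have A: "0 \<le> A" "A \<le> 1" using assms by (auto simp: A_def small_def)
  have "integrable M (\<lambda>\<omega>. \<bar>L (rect 0 0 1) \<omega>\<bar> powr p)"
    by (rule unit_moment) (auto simp: measure_rect)
  moreover have "AE \<omega> in M. \<bar>L (rect 0 0 1) \<omega>\<bar> powr p = \<bar>L (rect 0 A 1) \<omega> + L (rect 0 0 A) \<omega>\<bar> powr p"
    using L_rect_split[of 0 A 1 0] A by (auto elim!: eventually_mono simp: add.commute)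
  ultimately have "integrable M (\<lambda>\<omega>. \<bar>L (rect 0 A 1) \<omega> + L (rect 0 0 A) \<omega>\<bar> powr p)"
    by (subst (asm) integrable_cong_AE) auto
  from integrable_powr_summand[OF _ _ this]
  have "integrable M (\<lambda>\<omega>. \<bar>L (rect 0 0 A) \<omega>\<bar> powr p)"
    using p rect_split[of 0 A 1 0] A by (auto intro!: L_indep_var)
  then show ?thesis
    by (subst L_expectation_eq(2)[of B "rect 0 0 A"]) (use assms A in \<open>auto simp: measure_rect A_def small_def\<close>)
qed

lemma integrable_L_power:
  assumes "small B" "0 < k" "k \<le> 4" shows "integrable M (\<lambda>\<omega>. L B \<omega> ^ k)"
  by (rule powr_dominates[OF _ integrable_L_powr]) (use assms p in auto)

lemma integrable_L [simp, intro]: "small B \<Longrightarrow> integrable M (L B)"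
  using integrable_L_power[of B 1] by simp

definition Lc :: "(real \<times> real) set \<Rightarrow> 'w \<Rightarrow> real" where
  "Lc B \<omega> = L B \<omega> - expectation (L B)"

lemma Lc_measurable [measurable]: "B \<in> finite_borel_sets \<Longrightarrow> Lc B \<in> borel_measurable M"
  unfolding Lc_def by measurable

lemma integrable_Lc_powr:
  assumes "small B" shows "integrable M (\<lambda>\<omega>. \<bar>Lc B \<omega>\<bar> powr p)"
  using integrable_abs_powr_add[of "L B" "\<lambda>_. - expectation (L B)" p] integrable_L_powr[OF assms] p assms
  by (simp add: Lc_def)

lemma integrable_Lc_power:
  assumes "small B" "k \<le> 4" shows "integrable M (\<lambda>\<omega>. Lc B \<omega> ^ k)"
proof (cases "k = 0")
  case False
  show ?thesis by (rule powr_dominates[OF _ integrable_Lc_powr]) (use assms p False in auto)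
qed simp

lemma integrable_Lc [simp, intro]: "small B \<Longrightarrow> integrable M (Lc B)"
  using integrable_Lc_power[of B 1] by simp

lemma expectation_Lc [simp]: "small B \<Longrightarrow> expectation (Lc B) = 0"
  by (simp add: Lc_def[abs_def] prob_space)

lemma Lc_indep_vars:
  assumes A: "\<And>i. i < n \<Longrightarrow> A i \<in> finite_borel_sets" "disjoint_family_on A {..<n}"
  shows "indep_vars (\<lambda>_. borel) (\<lambda>i::nat. Lc (A i)) {..<n}"
  unfolding Lc_def by (rule indep_vars_compose2[OF L_indep_vars[OF A]]) auto

lemma Lc_indep_var:
  assumes "B \<in> finite_borel_sets" "C \<in> finite_borel_sets" "B \<inter> C = {}"
  shows "indep_var borel (Lc B) borel (Lc C)"
  using indep_var_compose[OF L_indep_var[OF assms], of "\<lambda>x. x - expectation (L B)" borel "\<lambda>x. x - expectation (L C)" borel]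
  by (simp add: comp_def Lc_def[abs_def])

lemma Lc_expectation_eq:
  fixes f :: "real \<Rightarrow> real"
  assumes "B \<in> finite_borel_sets" "C \<in> finite_borel_sets" "measure lborel B = measure lborel C"
    and f [measurable]: "f \<in> borel_measurable borel"
  shows "expectation (\<lambda>\<omega>. f (Lc B \<omega>)) = expectation (\<lambda>\<omega>. f (Lc C \<omega>))"
  using L_expectation_eq(1)[OF assms(1-3), of "\<lambda>x. f (x - expectation (L C))"]
    L_expectation_eq(1)[OF assms(1-3), of "\<lambda>x. x"] by (simp add: Lc_def)

lemma small_mono: "small C \<Longrightarrow> B \<subseteq> C \<Longrightarrow> B \<in> sets borel \<Longrightarrow> small B"
  unfolding small_def using finite_borel_sets_subset[of C B] measure_mono_finite_borel[of B C] by auto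

lemma small_rect: "s \<le> t \<Longrightarrow> t - s \<le> 1 \<Longrightarrow> small (rect c s t)"
  by (simp add: small_def measure_rect)

lemma Lc_Un:
  assumes "B \<in> finite_borel_sets" "C \<in> finite_borel_sets" "small (B \<union> C)" "B \<inter> C = {}"
  shows "AE \<omega> in M. Lc (B \<union> C) \<omega> = Lc B \<omega> + Lc C \<omega>"
proof -
  have s: "small B" "small C"
    using assms small_mono[OF assms(3), of B] small_mono[OF assms(3), of C] by (auto simp: finite_borel_sets_def)
  note L = L_Un[OF assms(1,2,4)]
  have "expectation (L (B \<union> C)) = expectation (\<lambda>\<omega>. L B \<omega> + L C \<omega>)"
    by (rule integral_cong_AE) (use L assms in auto)
  then have "expectation (L (B \<union> C)) = expectation (L B) + expectation (L C)" using s by simp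
  with L show ?thesis by (auto simp: Lc_def elim!: eventually_mono)
qed

text \<open>The variance is additive over disjoint sets, hence an additive nonnegative function of
  the area on [0, 1], hence linear; \<open>unit_variance\<close> fixes the slope.\<close>

lemma variance_Lc:
  assumes "small B" shows "expectation (\<lambda>\<omega>. (Lc B \<omega>)\<^sup>2) = measure lborel B"
proof -
  define V where "V A = expectation (\<lambda>\<omega>. (Lc (rect 0 0 A) \<omega>)\<^sup>2)" for A
  have VB: "expectation (\<lambda>\<omega>. (Lc B \<omega>)\<^sup>2) = V (measure lborel B)" if "small B" for B
    unfolding V_def by (rule Lc_expectation_eq[of _ _ "\<lambda>x. x\<^sup>2"]) (use that in \<open>auto simp: measure_rect\<close>)
  have "V A = A * V 1" if "0 \<le> A" "A \<le> 1" for A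
  proof (rule nonneg_additive_imp_linear[OF _ _ that])
    fix x y :: real assume xy: "0 \<le> x" "0 \<le> y" "x + y \<le> 1"
    let ?B = "rect 0 0 x" and ?C = "rect 0 x (x + y)"
    have U: "rect 0 0 (x + y) = ?B \<union> ?C" "?B \<inter> ?C = {}" using rect_split[of 0 x "x + y" 0] xy by auto
    have s: "small (rect 0 0 (x + y))" "small ?B" "small ?C" using xy by (auto intro!: small_rect)
    note ind = Lc_indep_var[OF _ _ U(2)]
    have "V (x + y) = expectation (\<lambda>\<omega>. (Lc ?B \<omega> + Lc ?C \<omega>)\<^sup>2)"
      unfolding V_def U(1) using Lc_Un[OF _ _ _ U(2)] s U(1)
      by (intro integral_cong_AE) (auto elim!: eventually_mono)
    also have "\<dots> = expectation (\<lambda>\<omega>. (Lc ?B \<omega>)\<^sup>2 + (Lc ?C \<omega>)\<^sup>2 + 2 * (Lc ?B \<omega> * Lc ?C \<omega>))"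
      by (intro Bochner_Integration.integral_cong) (auto simp: power2_eq_square algebra_simps)
    also have "\<dots> = expectation (\<lambda>\<omega>. (Lc ?B \<omega>)\<^sup>2) + expectation (\<lambda>\<omega>. (Lc ?C \<omega>)\<^sup>2)"
      using s integrable_Lc_power[of ?B 2] integrable_Lc_power[of ?C 2]
        indep_var_integrable[OF ind] indep_var_lebesgue_integral[OF ind] by simp
    finally show "V (x + y) = V x + V y" using VB[of ?B] VB[of ?C] s xy by (simp add: measure_rect)
  qed (simp add: V_def)
  moreover have "V 1 = 1"
    using unit_variance[of "rect 0 0 1"] by (simp add: V_def Lc_def measure_rect)
  ultimately show ?thesis using VB[OF assms] assms by (simp add: small_def)
qed

end

lemma (in prob_space) indep_var_groups:
  assumes ind: "indep_vars (\<lambda>_. borel) X I" and AB: "A \<inter> B = {}" "A \<subseteq> I" "B \<subseteq> I"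
    and f: "f \<in> measurable (PiM A (\<lambda>_. borel)) S" and g: "g \<in> measurable (PiM B (\<lambda>_. borel)) T"
  shows "indep_var S (\<lambda>\<omega>. f (restrict (\<lambda>i. X i \<omega>) A)) T (\<lambda>\<omega>. g (restrict (\<lambda>i. X i \<omega>) B))"
  using indep_var_compose[OF indep_var_restrict[OF ind AB] f g] by (simp add: comp_def)

text \<open>In the expansion, the terms containing a first power vanish because both variables are
  centred; what remains is the product of the variances with binomial coefficient 6.\<close>

lemma (in prob_space) fourth_moment_add:
  fixes X Y :: "'a \<Rightarrow> real"
  assumes ind: "indep_var borel X borel Y" and EX: "expectation X = 0" and EY: "expectation Y = 0"
    and iX: "\<And>k. k \<le> 4 \<Longrightarrow> integrable M (\<lambda>\<omega>. X \<omega> ^ k)" and iY: "\<And>k. k \<le> 4 \<Longrightarrow> integrable M (\<lambda>\<omega>. Y \<omega> ^ k)"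
  shows "expectation (\<lambda>\<omega>. (X \<omega> + Y \<omega>) ^ 4) = expectation (\<lambda>\<omega>. X \<omega> ^ 4)
     + 6 * (expectation (\<lambda>\<omega>. (X \<omega>)\<^sup>2) * expectation (\<lambda>\<omega>. (Y \<omega>)\<^sup>2)) + expectation (\<lambda>\<omega>. Y \<omega> ^ 4)"
proof -
  have ind': "indep_var borel (\<lambda>\<omega>. X \<omega> ^ j) borel (\<lambda>\<omega>. Y \<omega> ^ k)" for j k
    using indep_var_compose[OF ind, of "\<lambda>x. x ^ j" borel "\<lambda>x. x ^ k" borel] by (simp add: comp_def)
  have i: "integrable M (\<lambda>\<omega>. X \<omega> ^ j * Y \<omega> ^ k)"
    and e: "expectation (\<lambda>\<omega>. X \<omega> ^ j * Y \<omega> ^ k) = expectation (\<lambda>\<omega>. X \<omega> ^ j) * expectation (\<lambda>\<omega>. Y \<omega> ^ k)"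
    if "j \<le> 4" "k \<le> 4" for j k
    using that by (auto intro!: indep_var_integrable[OF ind'] indep_var_lebesgue_integral[OF ind'] iX iY)
  have "(\<lambda>\<omega>. (X \<omega> + Y \<omega>) ^ 4) = (\<lambda>\<omega>. X \<omega> ^ 4 + 4 * (X \<omega> ^ 3 * Y \<omega> ^ 1) + 6 * (X \<omega> ^ 2 * Y \<omega> ^ 2) + 4 * (X \<omega> ^ 1 * Y \<omega> ^ 3) + Y \<omega> ^ 4)"
    by (rule ext) (simp add: algebra_simps power4_eq_xxxx power3_eq_cube power2_eq_square)
  moreover have "expectation \<dots> = expectation (\<lambda>\<omega>. X \<omega> ^ 4) + 4 * expectation (\<lambda>\<omega>. X \<omega> ^ 3 * Y \<omega> ^ 1)
     + 6 * expectation (\<lambda>\<omega>. X \<omega> ^ 2 * Y \<omega> ^ 2) + 4 * expectation (\<lambda>\<omega>. X \<omega> ^ 1 * Y \<omega> ^ 3) + expectation (\<lambda>\<omega>. Y \<omega> ^ 4)"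
    using i[of 3 1] i[of 2 2] i[of 1 3] iX[of 4] iY[of 4] by simp
  ultimately show ?thesis using e[of 3 1] e[of 2 2] e[of 1 3] EX EY by simp
qed

section \<open>A trigonometric substitute for the fourth power\<close>

lemma abs_sin_minus_self_le: "\<bar>sin y - y\<bar> \<le> \<bar>y\<bar> ^ 3 / 6" for y :: real
proof -
  have "\<bar>Im (iexp y - (\<Sum>k\<le>2. (\<i> * y) ^ k / fact k))\<bar> \<le> \<bar>y\<bar> ^ Suc 2 / fact (Suc 2)"
    using order_trans[OF abs_Im_le_cmod iexp_approx1[of y 2]] .
  moreover have "Im (iexp y - (\<Sum>k\<le>2. (\<i> * y) ^ k / fact k)) = sin y - y"
    by (simp add: numeral_2_eq_2 Im_exp power2_eq_square)
  ultimately show ?thesis by (simp add: numeral_2_eq_2 power3_eq_cube fact_numeral)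
qed

text \<open>With \<open>r\<close> the quotient of \<open>\<bar>sin y\<bar>\<close> and
  \<open>\<bar>y\<bar>\<close>, the claim comes down to a bound for \<open>1 - r ^ 4\<close>. The
  error has order \<open>p\<close> in \<open>x\<close>, where moments are linear in the area, and it
  carries a factor that vanishes with \<open>t\<close>.\<close>

lemma sin_fourth_power_approx:
  fixes x t p :: real assumes t: "0 < t" and p: "4 < p" "p \<le> 6"
  shows "\<bar>x ^ 4 - 16 * sin (t * x / 2) ^ 4 / t ^ 4\<bar> \<le> t powr (p - 4) * \<bar>x\<bar> powr p"
    and "16 * sin (t * x / 2) ^ 4 / t ^ 4 \<le> x ^ 4"
proof -
  define y where "y = t * x / 2"
  define r where "r = \<bar>sin y\<bar> / \<bar>y\<bar>"
  show "16 * sin (t * x / 2) ^ 4 / t ^ 4 \<le> x ^ 4"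
  proof -
    have "\<bar>sin y\<bar> ^ 4 \<le> \<bar>y\<bar> ^ 4" by (intro power_mono abs_sin_x_le_abs_x) simp
    then have "sin y ^ 4 \<le> y ^ 4" by (simp add: power_even_abs)
    then show ?thesis using t by (simp add: y_def power_mult_distrib power_divide field_simps)
  qed
  show "\<bar>x ^ 4 - 16 * sin (t * x / 2) ^ 4 / t ^ 4\<bar> \<le> t powr (p - 4) * \<bar>x\<bar> powr p"
  proof (cases "x = 0")
    case False
    then have y: "y \<noteq> 0" using t by (simp add: y_def)
    have r: "0 \<le> r" "r \<le> 1" using y abs_sin_x_le_abs_x[of y] by (auto simp: r_def)
    have r4: "0 \<le> r ^ 4" "r ^ 4 \<le> 1" using r by (auto simp: power_le_one)
    \<comment> \<open>For small \<open>y\<close>, the estimate \<open>r \<ge> 1 - y^2 / 6\<close>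
      and Bernoulli's inequality bound the left side by \<open>y^2\<close>, and
      \<open>p - 4 \<le> 2\<close>; for large \<open>y\<close> the right side is at least 1.\<close>
    have "1 - r ^ 4 \<le> \<bar>y\<bar> powr (p - 4)"
    proof (cases "\<bar>y\<bar> \<le> 1")
      case True
      have "\<bar>y\<bar> - \<bar>y\<bar> ^ 3 / 6 \<le> \<bar>sin y\<bar>" using abs_sin_minus_self_le[of y] by linarith
      then have "(\<bar>y\<bar> - \<bar>y\<bar> ^ 3 / 6) / \<bar>y\<bar> \<le> r" unfolding r_def using y by (intro divide_right_mono) auto
      then have r1: "1 + - (y\<^sup>2 / 6) \<le> r" using y by (simp add: diff_divide_distrib power3_eq_cube power2_eq_square)
      have y1: "y\<^sup>2 \<le> 1" using True by (simp add: abs_square_le_1)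
      have "1 + real 4 * (- (y\<^sup>2 / 6)) \<le> (1 + - (y\<^sup>2 / 6)) ^ 4"
        by (rule Bernoulli_inequality) (use y1 in auto)
      also have "\<dots> \<le> r ^ 4" using r1 y1 by (intro power_mono) auto
      finally have "1 - r ^ 4 \<le> y\<^sup>2" using zero_le_power2[of y] by linarith
      also have "y\<^sup>2 = \<bar>y\<bar> powr 2" using y by (simp add: powr_numeral)
      also have "\<dots> \<le> \<bar>y\<bar> powr (p - 4)" using True p by (intro powr_mono') auto
      finally show ?thesis .
    next
      case False
      then have "1 \<le> \<bar>y\<bar> powr (p - 4)" using p by (intro ge_one_powr_ge_zero) auto
      then show ?thesis using r4 by linarith
    qed
    also have "\<dots> \<le> (t * \<bar>x\<bar>) powr (p - 4)"
      using t p by (intro powr_mono2) (auto simp: y_def abs_mult)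
    finally have *: "1 - r ^ 4 \<le> (t * \<bar>x\<bar>) powr (p - 4)" .
    have "sin y ^ 4 = r ^ 4 * y ^ 4" using y by (simp add: r_def power_divide power_even_abs)
    then have "16 * sin (t * x / 2) ^ 4 / t ^ 4 = r ^ 4 * x ^ 4"
      using t by (simp add: y_def power_mult_distrib power_divide field_simps)
    then have "\<bar>x ^ 4 - 16 * sin (t * x / 2) ^ 4 / t ^ 4\<bar> = \<bar>(1 - r ^ 4) * x ^ 4\<bar>" by (simp add: algebra_simps)
    also have "\<dots> = (1 - r ^ 4) * \<bar>x\<bar> powr 4" using r4 False by (simp add: abs_mult power_even_abs powr_numeral)
    also have "\<dots> \<le> (t * \<bar>x\<bar>) powr (p - 4) * \<bar>x\<bar> powr 4" by (intro mult_right_mono *) simp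
    also have "\<dots> = t powr (p - 4) * \<bar>x\<bar> powr p"
    proof -
      have "\<bar>x\<bar> powr p = \<bar>x\<bar> powr (p - 4) * \<bar>x\<bar> powr 4" by (subst powr_add[symmetric]) simp
      then show ?thesis using t by (simp add: powr_mult)
    qed
    finally show ?thesis .
  qed simp
qed

text \<open>The coefficients 2, -8 and 6 add up to 0, so the kernel is also a combination of
  \<open>cos (2 * t) - 1\<close> and \<open>cos t - 1\<close>, the form in which cosines occur in
  the real part of the Levy exponent.\<close>

lemma sin_fourth_power_cos: "16 * sin (t / 2) ^ 4 = 2 * cos (2 * t) - 8 * cos t + 6" for t :: real
proof -
  have c: "cos t = 1 - 2 * (sin (t / 2))\<^sup>2" using cos_double_sin[of "t / 2"] by simp
  have "cos (2 * t) = 2 * (cos t)\<^sup>2 - 1" by (rule cos_double_cos)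
  then show ?thesis unfolding c by (simp add: power2_eq_square power4_eq_xxxx algebra_simps)
qed

lemma levy_kernel_bound:
  fixes z x :: real
  shows "norm (iexp (z * x) - 1 - \<i> * complex_of_real (z * x * indicator {-1..1} x)) \<le> (2 + z\<^sup>2) * min 1 (x\<^sup>2)"
proof (cases "\<bar>x\<bar> \<le> 1")
  case True
  then have x2: "x\<^sup>2 \<le> 1" by (simp add: abs_square_le_1)
  have "norm (iexp (z * x) - (\<Sum>k\<le>1. (\<i> * (z * x)) ^ k / fact k)) \<le> \<bar>z * x\<bar> ^ Suc 1 / fact (Suc 1)"
    by (rule iexp_approx1)
  also have "(\<Sum>k\<le>1. (\<i> * (z * x)) ^ k / fact k) = 1 + \<i> * complex_of_real (z * x)" by simp
  also have "\<bar>z * x\<bar> ^ Suc 1 / fact (Suc 1) = z\<^sup>2 / 2 * x\<^sup>2" by (simp add: power2_eq_square abs_mult_self_eq abs_mult algebra_simps)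
  also have "\<dots> \<le> (2 + z\<^sup>2) * x\<^sup>2" by (intro mult_right_mono) auto
  finally show ?thesis using True x2 by (auto simp: indicator_def algebra_simps min_def)
next
  case False
  then have x2: "1 \<le> x\<^sup>2" using abs_square_le_1[of x] by linarith
  have "norm (iexp (z * x) - 1) \<le> 2"
    using norm_triangle_ineq4[of "iexp (z * x)" 1] by simp
  then show ?thesis using False x2 by (auto simp: indicator_def min_def intro: order_trans)
qed

text \<open>Real parts remove the drift and the compensator. Since \<open>cos (z * x) - 1\<close>
  vanishes at the origin, the restriction of the domain of integration disappears as well.\<close>

lemma Re_levy_exponent:
  assumes "levy_measure \<nu>"
  shows "integrable \<nu> (\<lambda>x. cos (z * x) - 1)"
    and "Re (levy_exponent \<gamma> b \<nu> z) = - (b\<^sup>2 * z\<^sup>2 / 2) + (LINT x|\<nu>. cos (z * x) - 1)"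
proof -
  have [measurable_cong]: "sets \<nu> = sets borel" and i: "integrable \<nu> (\<lambda>x. min 1 (x\<^sup>2))"
    using assms by (auto simp: levy_measure_def)
  let ?K = "\<lambda>x. indicator (-{0}) x *\<^sub>R (iexp (z * x) - 1 - \<i> * complex_of_real (z * x * indicator {-1..1} x))"
  have iK: "integrable \<nu> ?K"
  proof (rule Bochner_Integration.integrable_bound[OF integrable_mult_right[OF i, of "2 + z\<^sup>2"]])
    have "norm (?K x) \<le> norm (iexp (z * x) - 1 - \<i> * complex_of_real (z * x * indicator {-1..1} x))" for x
      by (simp only: norm_scaleR) (intro mult_left_le_one_le; simp add: indicator_def)
    also have "norm (iexp (z * x) - 1 - \<i> * complex_of_real (z * x * indicator {-1..1} x)) \<le> norm ((2 + z\<^sup>2) * min 1 (x\<^sup>2))" for x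
      using levy_kernel_bound[of z x] by (metis abs_ge_self order_trans real_norm_def)
    finally show "AE x in \<nu>. norm (?K x) \<le> norm ((2 + z\<^sup>2) * min 1 (x\<^sup>2))" by simp
  qed measurable
  have Re: "Re (?K x) = cos (z * x) - 1" for x
    by (auto simp: indicator_def Re_exp)
  have "integrable \<nu> (\<lambda>x. Re (?K x))" using iK by (rule integrable_Re)
  then show "integrable \<nu> (\<lambda>x. cos (z * x) - 1)" by (simp only: Re)
  have "Re (integral\<^sup>L \<nu> ?K) = (LINT x|\<nu>. cos (z * x) - 1)"
    using integral_Re[OF iK] by (simp only: Re)
  then show "Re (levy_exponent \<gamma> b \<nu> z) = - (b\<^sup>2 * z\<^sup>2 / 2) + (LINT x|\<nu>. cos (z * x) - 1)"
    unfolding levy_exponent_def set_lebesgue_integral_def by simp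
qed

section \<open>The symmetrized basis: moments of order p and the fourth cumulant\<close>

context levy_basis_moments
begin

text \<open>
  Only the symmetrized basis is used for moment bounds: for independent symmetric summands Clarkson's
  inequality makes the \<open>p\<close>-th absolute moment superadditive in the area, hence linearly bounded.
\<close>

definition Z :: "real \<Rightarrow> real \<Rightarrow> 'w \<Rightarrow> real" where
  "Z s t \<omega> = L (rect 0 s t) \<omega> - L (rect 2 s t) \<omega>"

lemma Z_measurable [measurable]: "Z s t \<in> borel_measurable M"
  unfolding Z_def by measurable

lemma rect_disjoint: "rect 0 s t \<inter> rect 2 u v = {}"
  by (auto simp: rect_def)

lemma char_Z:
  assumes "s \<le> t"
  shows "char (distr M borel (Z s t)) z =
    exp (complex_of_real (t - s) * (levy_exponent \<gamma> b \<nu> z + levy_exponent \<gamma> b \<nu> (- z)))"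
proof -
  have "indep_var borel (L (rect 0 s t)) borel (\<lambda>\<omega>. - L (rect 2 s t) \<omega>)"
    using indep_var_compose[OF L_indep_var[OF _ _ rect_disjoint[of s t s t]], of "\<lambda>x. x" borel "\<lambda>x. - x" borel]
    by (simp add: comp_def)
  from char_distr_add[OF this]
  have "char (distr M borel (Z s t)) z = char (distr M borel (L (rect 0 s t))) z *
      char (distr M borel (\<lambda>\<omega>. - L (rect 2 s t) \<omega>)) z"
    by (simp add: Z_def[abs_def])
  also have "char (distr M borel (\<lambda>\<omega>. - L (rect 2 s t) \<omega>)) z = char (distr M borel (L (rect 2 s t))) (- z)"
    by (simp add: char_def integral_distr)
  finally show ?thesis
    using assms by (simp add: char_eq measure_rect algebra_simps flip: exp_add)
qed

lemma Z_distr_eq: "s \<le> t \<Longrightarrow> u \<le> v \<Longrightarrow> t - s = v - u \<Longrightarrow> distr M borel (Z s t) = distr M borel (Z u v)"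
  by (rule Levy_uniqueness) (auto simp: char_Z fun_eq_iff)

lemma Z_symmetric:
  assumes "s \<le> t" shows "distr M borel (\<lambda>\<omega>. - Z s t \<omega>) = distr M borel (Z s t)"
proof (rule Levy_uniqueness)
  have "char (distr M borel (\<lambda>\<omega>. - Z s t \<omega>)) z = char (distr M borel (Z s t)) (- z)" for z
    by (simp add: char_def integral_distr)
  then show "char (distr M borel (\<lambda>\<omega>. - Z s t \<omega>)) = char (distr M borel (Z s t))"
    using assms by (auto simp: char_Z add.commute fun_eq_iff)
qed auto

lemma Z_split:
  assumes "s \<le> t" "t \<le> u" shows "AE \<omega> in M. Z s u \<omega> = Z s t \<omega> + Z t u \<omega>"
  using L_rect_split[OF assms, of 0] L_rect_split[OF assms, of 2]
  by eventually_elim (simp add: Z_def)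

lemma Z_indep:
  assumes "s \<le> t" "t \<le> u" shows "indep_var borel (Z s t) borel (Z t u)"
proof -
  define A where "A i = [rect 0 s t, rect 2 s t, rect 0 t u, rect 2 t u] ! i" for i
  have ind: "indep_vars (\<lambda>_. borel) (\<lambda>i. L (A i)) {..<4}"
  proof (rule L_indep_vars)
    show "disjoint_family_on A {..<4}"
      unfolding disjoint_family_on_def A_def
      by (auto simp: less_Suc_eq numeral_eq_Suc rect_def)
  qed (auto simp: A_def less_Suc_eq numeral_eq_Suc)
  have "indep_var borel (\<lambda>\<omega>. (\<lambda>f. f 0 - f 1) (restrict (\<lambda>i. L (A i) \<omega>) {0, 1}))
      borel (\<lambda>\<omega>. (\<lambda>f. f 2 - f 3) (restrict (\<lambda>i. L (A i) \<omega>) {2, 3}))"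
    by (rule indep_var_groups[OF ind]) (auto intro!: borel_measurable_diff measurable_component_singleton)
  then show ?thesis by (simp add: A_def Z_def[abs_def])
qed

lemma Z_expectation_eq:
  fixes f :: "real \<Rightarrow> real"
  assumes "s \<le> t" "u \<le> v" "t - s = v - u" and [measurable]: "f \<in> borel_measurable borel"
  shows "expectation (\<lambda>\<omega>. f (Z s t \<omega>)) = expectation (\<lambda>\<omega>. f (Z u v \<omega>))"
proof -
  have "(LINT x|distr M borel (Z s t). f x) = (LINT x|distr M borel (Z u v). f x)"
    using Z_distr_eq[OF assms(1-3)] by simp
  then show ?thesis by (subst (asm) (1 2) integral_distr) auto
qed

lemma integrable_Z_powr:
  assumes "s \<le> t" "t - s \<le> 1" shows "integrable M (\<lambda>\<omega>. \<bar>Z s t \<omega>\<bar> powr p)"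
  using integrable_abs_powr_add[of "L (rect 0 s t)" "\<lambda>\<omega>. - L (rect 2 s t) \<omega>" p] p
    integrable_L_powr[OF small_rect[OF assms]] by (simp add: Z_def)

definition Zp :: "real \<Rightarrow> real" where
  "Zp A = expectation (\<lambda>\<omega>. \<bar>Z 0 A \<omega>\<bar> powr p)"

lemma Zp_nonneg [simp]: "0 \<le> Zp A" by (simp add: Zp_def)

lemma Zp_superadditive:
  assumes "0 \<le> x" "0 \<le> y" "x + y \<le> 1" shows "Zp x + Zp y \<le> Zp (x + y)"
proof -
  have "Zp x + expectation (\<lambda>\<omega>. \<bar>Z x (x + y) \<omega>\<bar> powr p) \<le> expectation (\<lambda>\<omega>. \<bar>Z 0 x \<omega> + Z x (x + y) \<omega>\<bar> powr p)"
    unfolding Zp_def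
    by (rule expectation_powr_superadditive) (use assms p in \<open>auto intro!: Z_indep Z_symmetric integrable_Z_powr\<close>)
  also have "\<dots> = Zp (x + y)"
    unfolding Zp_def using Z_split[of 0 x "x + y"] assms
    by (intro integral_cong_AE) (auto elim!: eventually_mono)
  also have "expectation (\<lambda>\<omega>. \<bar>Z x (x + y) \<omega>\<bar> powr p) = Zp y"
    unfolding Zp_def by (rule Z_expectation_eq[where f="\<lambda>x. \<bar>x\<bar> powr p"]) (use assms in auto)
  finally show ?thesis .
qed

text \<open>As many disjoint copies of area \<open>A\<close> as fit into area 1, namely
  \<open>N = \<lfloor>1 / A\<rfloor>\<close>, give \<open>N * Zp A \<le> Zp 1\<close> by
  superadditivity; the factor 2 absorbs the rounding.\<close>

lemma Zp_linear_bound: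
  assumes A: "0 \<le> A" "A \<le> 1" shows "Zp A \<le> 2 * A * Zp 1"
proof (cases "A = 0")
  case True
  then show ?thesis using Zp_superadditive[of 0 0] by simp
next
  case False
  have mult: "real k * Zp A \<le> Zp (real k * A)" if "real k * A \<le> 1" for k
    using that
  proof (induction k)
    case (Suc k)
    then have "real k * Zp A + Zp A \<le> Zp (real k * A + A)"
      using Zp_superadditive[of "real k * A" A] A by (auto simp: algebra_simps)
    then show ?case by (simp add: algebra_simps)
  qed simp
  define N where "N = nat \<lfloor>1 / A\<rfloor>"
  have A0: "0 < A" using A False by simp
  have "1 \<le> 1 / A" using A A0 by simp
  then have N: "real N \<le> 1 / A" "1 / A < real N + 1" "1 \<le> real N"
  proof -
    assume "1 \<le> 1 / A"
    then have "1 \<le> \<lfloor>1 / A\<rfloor>" by (simp add: le_floor_iff)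
    then have "real N = of_int \<lfloor>1 / A\<rfloor>" "1 \<le> (of_int \<lfloor>1 / A\<rfloor> :: real)"
      unfolding N_def by (intro of_nat_nat, linarith, simp only: of_int_1_le_iff)
    then show "real N \<le> 1 / A" "1 / A < real N + 1" "1 \<le> real N" by linarith+
  qed
  \<comment> \<open>Together with \<open>N \<ge> 1\<close> this yields
    \<open>1 < A * N + A \<le> 2 * A * N\<close>.\<close>
  have "1 < A * real N + A" using N(2) A0 by (simp add: field_simps)
  moreover have "A \<le> A * real N" using mult_left_mono[OF N(3), of A] A by simp
  ultimately have NA: "real N * A \<le> 1" "1 \<le> 2 * A * real N"
    using N(1) A0 by (simp add: field_simps, linarith)
  have "Zp (real N * A) \<le> Zp 1" using Zp_superadditive[of "real N * A" "1 - real N * A"] NA A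
    by (smt (verit) Zp_nonneg mult_nonneg_nonneg of_nat_0_le_iff)
  then have *: "real N * Zp A \<le> Zp 1" using mult[of N] NA by simp
  have "Zp A \<le> (2 * A * real N) * Zp A" using mult_right_mono[OF NA(2), of "Zp A"] by simp
  also have "\<dots> = 2 * A * (real N * Zp A)" by simp
  also have "\<dots> \<le> 2 * A * Zp 1" using A by (intro mult_left_mono *) auto
  finally show ?thesis .
qed

text \<open>The mean of \<open>L B\<close> is also the mean of an independent copy, and subtracting
  the mean costs no more than subtracting the copy, which produces \<open>Z\<close>.\<close>

lemma expectation_Lc_powr_le:
  assumes B: "small B" shows "expectation (\<lambda>\<omega>. \<bar>Lc B \<omega>\<bar> powr p) \<le> 2 * Zp 1 * measure lborel B"
proof -
  define A where "A = measure lborel B"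
  have A: "0 \<le> A" "A \<le> 1" using B by (auto simp: A_def small_def)
  have s: "small (rect 0 0 A)" "small (rect 2 0 A)" using A by (auto intro!: small_rect)
  have m: "expectation (L (rect 0 0 A)) = expectation (L (rect 2 0 A))"
    by (rule L_expectation_eq(1)[where f="\<lambda>x. x"]) (use A in \<open>auto simp: measure_rect\<close>)
  have "expectation (\<lambda>\<omega>. \<bar>Lc B \<omega>\<bar> powr p) = expectation (\<lambda>\<omega>. \<bar>Lc (rect 0 0 A) \<omega>\<bar> powr p)"
    by (rule Lc_expectation_eq[where f="\<lambda>x. \<bar>x\<bar> powr p"]) (use A B in \<open>auto simp: measure_rect A_def\<close>)
  also have "\<dots> \<le> Zp A"
    unfolding Lc_def m Zp_def Z_def
    by (rule expectation_powr_centred_le(2))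
      (use s p A integrable_Z_powr[of 0 A] in \<open>auto intro!: L_indep_var rect_disjoint simp: Z_def\<close>)
  also have "\<dots> \<le> 2 * A * Zp 1" by (rule Zp_linear_bound[OF A])
  finally show ?thesis by (simp add: A_def mult_ac)
qed

lemma Z_Lc:
  assumes "s \<le> t" "t - s \<le> 1" shows "Z s t = (\<lambda>\<omega>. Lc (rect 0 s t) \<omega> + - Lc (rect 2 s t) \<omega>)"
proof -
  have "expectation (L (rect 0 s t)) = expectation (L (rect 2 s t))"
    by (rule L_expectation_eq(1)[where f="\<lambda>x. x"]) (use assms in \<open>auto simp: measure_rect\<close>)
  then show ?thesis by (simp add: Z_def Lc_def fun_eq_iff)
qed

lemma fourth_moment_Lc_Un:
  assumes "B \<in> finite_borel_sets" "C \<in> finite_borel_sets" "small (B \<union> C)" "B \<inter> C = {}"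
  shows "expectation (\<lambda>\<omega>. Lc (B \<union> C) \<omega> ^ 4) = expectation (\<lambda>\<omega>. Lc B \<omega> ^ 4)
     + 6 * (measure lborel B * measure lborel C) + expectation (\<lambda>\<omega>. Lc C \<omega> ^ 4)"
proof -
  have s: "small B" "small C"
    using assms small_mono[OF assms(3), of B] small_mono[OF assms(3), of C] by (auto simp: finite_borel_sets_def)
  have "expectation (\<lambda>\<omega>. Lc (B \<union> C) \<omega> ^ 4) = expectation (\<lambda>\<omega>. (Lc B \<omega> + Lc C \<omega>) ^ 4)"
    using Lc_Un[OF assms] assms by (intro integral_cong_AE) (auto elim!: eventually_mono)
  also have "\<dots> = expectation (\<lambda>\<omega>. Lc B \<omega> ^ 4)
     + 6 * (measure lborel B * measure lborel C) + expectation (\<lambda>\<omega>. Lc C \<omega> ^ 4)"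
    using fourth_moment_add[OF Lc_indep_var[OF assms(1,2,4)]] s
    by (simp add: integrable_Lc_power variance_Lc)
  finally show ?thesis .
qed

lemma fourth_moment_Z:
  assumes "s \<le> t" "t - s \<le> 1"
  shows "expectation (\<lambda>\<omega>. Z s t \<omega> ^ 4) = 2 * expectation (\<lambda>\<omega>. Lc (rect 0 s t) \<omega> ^ 4) + 6 * (t - s)\<^sup>2"
proof -
  have s: "small (rect 0 s t)" "small (rect 2 s t)" using assms by (auto intro!: small_rect)
  have "indep_var borel (Lc (rect 0 s t)) borel (\<lambda>\<omega>. - Lc (rect 2 s t) \<omega>)"
    using indep_var_compose[OF Lc_indep_var[OF _ _ rect_disjoint[of s t s t]], of "\<lambda>x. x" borel "\<lambda>x. - x" borel]
    by (simp add: comp_def)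
  moreover have "integrable M (\<lambda>\<omega>. (- Lc (rect 2 s t) \<omega>) ^ k)" if "k \<le> 4" for k
    using integrable_Lc_power[OF s(2) that] by (simp add: power_minus[of "Lc _ _"])
  ultimately have "expectation (\<lambda>\<omega>. Z s t \<omega> ^ 4) = expectation (\<lambda>\<omega>. Lc (rect 0 s t) \<omega> ^ 4) + 6 * (t - s)\<^sup>2 +
     expectation (\<lambda>\<omega>. Lc (rect 2 s t) \<omega> ^ 4)"
    using s assms fourth_moment_add[of "Lc (rect 0 s t)" "\<lambda>\<omega>. - Lc (rect 2 s t) \<omega>"]
    by (simp add: Z_Lc integrable_Lc_power variance_Lc measure_rect) (simp add: power2_eq_square)
  also have "expectation (\<lambda>\<omega>. Lc (rect 2 s t) \<omega> ^ 4) = expectation (\<lambda>\<omega>. Lc (rect 0 s t) \<omega> ^ 4)"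
    by (rule Lc_expectation_eq[where f="\<lambda>x. x ^ 4"]) (use assms in \<open>auto simp: measure_rect\<close>)
  finally show ?thesis by simp
qed

text \<open>
  The function \<open>16 * sin (t * x / 2) ^ 4 / t ^ 4\<close> is a bounded substitute for \<open>x ^ 4\<close> and a
  trigonometric polynomial, so that its mean can be read off the characteristic function.
\<close>

lemma sin_fourth_moment_limit:
  assumes A: "0 < A" "A \<le> 1"
  shows "(\<lambda>n. real (Suc n) * expectation (\<lambda>\<omega>. 16 * sin (t * Z 0 (A / Suc n) \<omega> / 2) ^ 4)) \<longlonglongrightarrow>
    2 * A * (LINT x|\<nu>. 16 * sin (t * x / 2) ^ 4)"
proof -
  let ?\<psi> = "levy_exponent \<gamma> b \<nu>"
  define w where "w z = ?\<psi> z + ?\<psi> (- z)" for z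
  have lv: "levy_measure \<nu>" using triplet by (simp add: levy_triplet_def)
  have [measurable_cong]: "sets \<nu> = sets borel" using lv by (simp add: levy_measure_def)
  note Re\<psi> = Re_levy_exponent[OF lv]
  have Rew: "Re (w z) = - (b\<^sup>2 * z\<^sup>2) + 2 * (LINT x|\<nu>. cos (z * x) - 1)" for z
    by (simp add: w_def Re\<psi>(2))
  have cosE: "expectation (\<lambda>\<omega>. cos (z * Z 0 B \<omega>)) = Re (exp (complex_of_real B * w z))" if "0 \<le> B" for B z
  proof -
    have "Re (char (distr M borel (Z 0 B)) z) = (LINT x|distr M borel (Z 0 B). Re (iexp (z * x)))"
      unfolding char_def by (rule integral_Re[symmetric])
        (auto intro!: finite_measure.integrable_const_bound[where B=1] finite_measure_distr)
    also have "\<dots> = expectation (\<lambda>\<omega>. cos (z * Z 0 B \<omega>))"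
      by (subst integral_distr) (auto simp: Re_exp)
    finally show ?thesis using that by (simp add: char_Z w_def)
  qed
  have E: "expectation (\<lambda>\<omega>. 16 * sin (t * Z 0 B \<omega> / 2) ^ 4) =
      2 * (Re (exp (complex_of_real B * w (2 * t))) - 1) - 8 * (Re (exp (complex_of_real B * w t)) - 1)" if "0 \<le> B" for B
  proof -
    have i: "integrable M (\<lambda>\<omega>. cos (z * Z 0 B \<omega>))" for z
      by (rule integrable_const_bound[where B=1]) auto
    have "expectation (\<lambda>\<omega>. 16 * sin (t * Z 0 B \<omega> / 2) ^ 4) =
      expectation (\<lambda>\<omega>. 2 * cos ((2 * t) * Z 0 B \<omega>) - 8 * cos (t * Z 0 B \<omega>) + 6)"
      by (simp add: sin_fourth_power_cos mult.assoc)
    also have "\<dots> = 2 * expectation (\<lambda>\<omega>. cos ((2 * t) * Z 0 B \<omega>)) - 8 * expectation (\<lambda>\<omega>. cos (t * Z 0 B \<omega>)) + 6"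
      using i[of "2 * t"] i[of t] by (simp add: prob_space)
    finally show ?thesis using that by (simp add: cosE)
  qed
  \<comment> \<open>The derivative at \<open>s = 0\<close> of the real part of
    \<open>exp (s * z)\<close>, taken along \<open>s = A / Suc n\<close>.\<close>
  have lim: "(\<lambda>n. real (Suc n) * (Re (exp (complex_of_real (A / Suc n) * z)) - 1)) \<longlonglongrightarrow> A * Re z" for z
  proof -
    have "((\<lambda>s::real. exp (s *\<^sub>R z)) has_vector_derivative exp (0 *\<^sub>R z) * z) (at 0)"
      by (rule exp_scaleR_has_vector_derivative_right)
    then have D: "((\<lambda>s::real. Re (exp (s *\<^sub>R z))) has_real_derivative Re z) (at 0)"
      using bounded_linear.has_vector_derivative[OF bounded_linear_Re]
      by (force simp: has_real_derivative_iff_has_vector_derivative)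
    have "((\<lambda>h. (Re (exp (h *\<^sub>R z)) - 1) / h) \<longlongrightarrow> Re z) (at 0)"
      using D unfolding DERIV_def by simp
    moreover have "filterlim (\<lambda>n. A / real (Suc n)) (at 0) sequentially"
    proof -
      have "(\<lambda>n. A / real (Suc n)) \<longlonglongrightarrow> 0" by real_asymp
      then show ?thesis using A by (auto simp: filterlim_at)
    qed
    ultimately have "(\<lambda>n. (Re (exp ((A / real (Suc n)) *\<^sub>R z)) - 1) / (A / real (Suc n))) \<longlonglongrightarrow> Re z"
      by (rule filterlim_compose)
    moreover have "A * (y / (A / real (Suc n))) = real (Suc n) * y" for y n
      using A by (simp add: field_simps del: of_nat_Suc)
    ultimately show ?thesis
      using tendsto_mult_left[of "\<lambda>n. (Re (exp ((A / real (Suc n)) *\<^sub>R z)) - 1) / (A / real (Suc n))" "Re z" sequentially A]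
      by (simp only: scaleR_conv_of_real)
  qed
  have "(\<lambda>n. 2 * (real (Suc n) * (Re (exp (complex_of_real (A / Suc n) * w (2 * t))) - 1))
        - 8 * (real (Suc n) * (Re (exp (complex_of_real (A / Suc n) * w t)) - 1)))
     \<longlonglongrightarrow> 2 * (A * Re (w (2 * t))) - 8 * (A * Re (w t))"
    by (intro tendsto_diff tendsto_mult_left lim)
  \<comment> \<open>The Gaussian part of the exponent drops out, because
    \<open>2 * (2 * t)^2 - 8 * t^2 = 0\<close>; only the Levy measure is seen by the kernel.\<close>
  moreover have "2 * (A * Re (w (2 * t))) - 8 * (A * Re (w t)) = 2 * A * (LINT x|\<nu>. 16 * sin (t * x / 2) ^ 4)"
  proof -
    have "(LINT x|\<nu>. 16 * sin (t * x / 2) ^ 4) = (LINT x|\<nu>. 2 * (cos ((2 * t) * x) - 1) - 8 * (cos (t * x) - 1))"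
      by (intro Bochner_Integration.integral_cong) (auto simp: sin_fourth_power_cos mult.assoc)
    also have "\<dots> = 2 * (LINT x|\<nu>. cos ((2 * t) * x) - 1) - 8 * (LINT x|\<nu>. cos (t * x) - 1)"
    proof -
      define c where "c z x = cos (z * x) - 1" for z x :: real
      have "integrable \<nu> (c z)" for z using Re\<psi>(1)[of z] by (simp add: c_def[abs_def])
      then have "(LINT x|\<nu>. 2 * c (2 * t) x - 8 * c t x) = 2 * integral\<^sup>L \<nu> (c (2 * t)) - 8 * integral\<^sup>L \<nu> (c t)"
        by simp
      then show ?thesis by (simp only: c_def[abs_def])
    qed
    finally have e: "(LINT x|\<nu>. 16 * sin (t * x / 2) ^ 4) =
      2 * (LINT x|\<nu>. cos ((2 * t) * x) - 1) - 8 * (LINT x|\<nu>. cos (t * x) - 1)" .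
    show ?thesis unfolding e Rew by (simp only: power_mult_distrib) (simp only: algebra_simps, simp)
  qed
  moreover have "real (Suc n) * expectation (\<lambda>\<omega>. 16 * sin (t * Z 0 (A / Suc n) \<omega> / 2) ^ 4) =
      2 * (real (Suc n) * (Re (exp (complex_of_real (A / Suc n) * w (2 * t))) - 1))
        - 8 * (real (Suc n) * (Re (exp (complex_of_real (A / Suc n) * w t)) - 1))" for n
    by (subst E, use A in simp) (simp only: right_diff_distrib mult.left_commute)
  ultimately show ?thesis by (simp only:)
qed

text \<open>The fourth cumulant is additive in the area, hence \<open>n\<close> times that of a set
  of area \<open>A / n\<close>. For such a set the fourth power is exchanged for the sine kernel at
  an error \<open>t powr (p - 4)\<close> times an \<open>O(A / n)\<close>; multiplied by
  \<open>n\<close>, this is uniform in \<open>n\<close>. So \<open>n\<close> may tend to infinity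
  first, which turns the mean of the kernel into its integral against \<nu>, and \<open>t\<close>
  may tend to 0 afterwards. No fourth derivative of the characteristic function is taken.\<close>

theorem fourth_moment_Lc:
  assumes c4: "integrable \<nu> (\<lambda>x. x ^ 4)" and B: "small B"
  shows "expectation (\<lambda>\<omega>. Lc B \<omega> ^ 4) = c4 \<nu> * measure lborel B + 3 * (measure lborel B)\<^sup>2"
proof (cases "measure lborel B = 0")
  case True
  have "expectation (\<lambda>\<omega>. Lc B \<omega> ^ 4) = expectation (\<lambda>\<omega>. Lc {} \<omega> ^ 4)"
    by (rule Lc_expectation_eq[where f="\<lambda>x. x ^ 4"]) (use True B in auto)
  moreover have "AE \<omega> in M. Lc {} \<omega> = 0"
  proof -
    have "expectation (L {}) = expectation (\<lambda>_. 0)" by (intro integral_cong_AE L_empty) auto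
    then show ?thesis using L_empty by (simp add: Lc_def)
  qed
  then have "expectation (\<lambda>\<omega>. Lc {} \<omega> ^ 4) = expectation (\<lambda>_. 0)"
    by (intro integral_cong_AE) (auto elim!: eventually_mono)
  ultimately show ?thesis using True by simp
next
  case False
  define A where "A = measure lborel B"
  have A: "0 < A" "A \<le> 1" using B False zero_less_measure_iff[of lborel B] by (auto simp: A_def small_def)
  have lv: "levy_measure \<nu>" using triplet by (simp add: levy_triplet_def)
  have [measurable_cong]: "sets \<nu> = sets borel" using lv by (simp add: levy_measure_def)
  \<comment> \<open>The fourth cumulant of \<open>Z 0 x\<close>: the variance of that variable is
    \<open>2 * x\<close>, hence the correction \<open>3 * (2 * x)^2\<close>.\<close>
  define g where "g x = expectation (\<lambda>\<omega>. Z 0 x \<omega> ^ 4) - 12 * x\<^sup>2" for x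
  have g_mult: "g (real k * x) = real k * g x" if "0 \<le> x" "real k * x \<le> 1" for k x
    using that
  proof (induction k)
    case 0
    have "expectation (\<lambda>\<omega>. Z 0 0 \<omega> ^ 4) = expectation (\<lambda>_. 0)"
    proof (intro integral_cong_AE)
      show "AE \<omega> in M. Z 0 0 \<omega> ^ 4 = 0"
        using L_empty by (auto simp: Z_def rect_def elim!: eventually_mono)
    qed auto
    then show ?case by (simp add: g_def)
  next
    case (Suc k)
    let ?y = "real k * x"
    let ?B = "rect 0 0 ?y" and ?C = "rect 0 ?y (?y + x)"
    have y: "0 \<le> ?y" "?y + x \<le> 1" using Suc by (auto simp: algebra_simps)
    have U: "rect 0 0 (?y + x) = ?B \<union> ?C" "?B \<inter> ?C = {}" using rect_split[of 0 ?y "?y + x" 0] y Suc by auto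
    have e: "expectation (\<lambda>\<omega>. Lc ?C \<omega> ^ 4) = expectation (\<lambda>\<omega>. Lc (rect 0 0 x) \<omega> ^ 4)"
      by (rule Lc_expectation_eq[where f="\<lambda>x. x ^ 4"]) (use Suc in \<open>auto simp: measure_rect\<close>)
    have sm: "small (rect 0 0 (?y + x))" using y Suc by (intro small_rect) auto
    have "expectation (\<lambda>\<omega>. Lc (rect 0 0 (?y + x)) \<omega> ^ 4) = expectation (\<lambda>\<omega>. Lc ?B \<omega> ^ 4) + 6 * (?y * x) + expectation (\<lambda>\<omega>. Lc (rect 0 0 x) \<omega> ^ 4)"
      using fourth_moment_Lc_Un[of ?B ?C] U sm y Suc(2) e by (simp add: measure_rect)
    then have "g (?y + x) = g ?y + g x"
      using fourth_moment_Z[of 0 "?y + x"] fourth_moment_Z[of 0 ?y] fourth_moment_Z[of 0 x] y Suc(2)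
      by (simp add: g_def power2_eq_square algebra_simps)
    then show ?case using Suc by (simp add: algebra_simps)
  qed
  have iZ4: "integrable M (\<lambda>\<omega>. Z 0 x \<omega> ^ 4)" if "0 \<le> x" "x \<le> 1" for x
    by (rule powr_dominates[OF _ integrable_Z_powr]) (use that p in auto)
  have bd: "\<bar>g A - 2 * A * (LINT x|\<nu>. 16 * sin (t * x / 2) ^ 4) / t ^ 4\<bar> \<le> t powr (p - 4) * (2 * A * Zp 1)"
    if t: "0 < t" for t
  proof -
    let ?S = "\<lambda>x. expectation (\<lambda>\<omega>. 16 * sin (t * Z 0 x \<omega> / 2) ^ 4)"
    have bn: "\<bar>g A + 12 * A\<^sup>2 / real (Suc n) - real (Suc n) * ?S (A / Suc n) / t ^ 4\<bar> \<le> t powr (p - 4) * (2 * A * Zp 1)" for n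
    proof -
      let ?x = "A / real (Suc n)"
      have x: "0 \<le> ?x" "?x \<le> 1" using A by (auto simp: field_simps)
      have "g A = real (Suc n) * g ?x" using g_mult[of ?x "Suc n"] x A by simp
      \<comment> \<open>The quadratic parts of \<open>Suc n\<close> pieces of area
        \<open>A / Suc n\<close> total \<open>12 * A^2 / Suc n\<close>, which disappears in the
        limit.\<close>
      then have gA: "g A + 12 * A\<^sup>2 / real (Suc n) = real (Suc n) * expectation (\<lambda>\<omega>. Z 0 ?x \<omega> ^ 4)"
      proof -
        have "real (Suc n) * (12 * ?x\<^sup>2) = 12 * A\<^sup>2 / real (Suc n)" by (simp add: power2_eq_square)
        then show ?thesis using \<open>g A = real (Suc n) * g ?x\<close> by (simp add: g_def right_diff_distrib)
      qed
      have i16: "integrable M (\<lambda>\<omega>. 16 * sin (t * Z 0 ?x \<omega> / 2) ^ 4 / t ^ 4)"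
      proof (rule integrable_const_bound[where B="16 / t ^ 4"])
        show "AE \<omega> in M. norm (16 * sin (t * Z 0 ?x \<omega> / 2) ^ 4 / t ^ 4) \<le> 16 / t ^ 4"
        proof (rule AE_I2)
          fix \<omega>
          have "\<bar>sin (t * Z 0 ?x \<omega> / 2)\<bar> ^ 4 \<le> 1" by (intro power_le_one) auto
          then show "norm (16 * sin (t * Z 0 ?x \<omega> / 2) ^ 4 / t ^ 4) \<le> 16 / t ^ 4"
            using t by (simp add: abs_mult power_even_abs divide_right_mono del: of_nat_Suc)
        qed
      qed simp
      have "\<bar>expectation (\<lambda>\<omega>. Z 0 ?x \<omega> ^ 4) - ?S ?x / t ^ 4\<bar> =
          \<bar>expectation (\<lambda>\<omega>. Z 0 ?x \<omega> ^ 4 - 16 * sin (t * Z 0 ?x \<omega> / 2) ^ 4 / t ^ 4)\<bar>"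
        using iZ4[OF x] i16 by simp
      also have "\<dots> \<le> expectation (\<lambda>\<omega>. t powr (p - 4) * \<bar>Z 0 ?x \<omega>\<bar> powr p)"
        by (rule order_trans[OF integral_abs_bound integral_mono])
          (use iZ4[OF x] i16 integrable_Z_powr[OF x(1)] x(2) sin_fourth_power_approx(1)[OF t p] in
            \<open>auto intro!: integrable_abs Bochner_Integration.integrable_diff\<close>)
      also have "\<dots> = t powr (p - 4) * Zp ?x" by (simp add: Zp_def)
      also have "\<dots> \<le> t powr (p - 4) * (2 * ?x * Zp 1)"
        by (intro mult_left_mono Zp_linear_bound x) simp
      finally have "real (Suc n) * \<bar>expectation (\<lambda>\<omega>. Z 0 ?x \<omega> ^ 4) - ?S ?x / t ^ 4\<bar> \<le> real (Suc n) * (t powr (p - 4) * (2 * ?x * Zp 1))"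
        by (intro mult_left_mono) auto
      moreover have "c * \<bar>u - v / d\<bar> = \<bar>c * u - c * v / d\<bar>" if "0 \<le> c" for c u v d :: real
        using that abs_mult[of c "u - v / d"] by (simp add: right_diff_distrib)
      from this[of "real (Suc n)"] have "real (Suc n) * \<bar>u - v / d\<bar> = \<bar>real (Suc n) * u - real (Suc n) * v / d\<bar>" for u v d
        by simp
      ultimately have "\<bar>real (Suc n) * expectation (\<lambda>\<omega>. Z 0 ?x \<omega> ^ 4) - real (Suc n) * ?S ?x / t ^ 4\<bar> \<le>
          real (Suc n) * (t powr (p - 4) * (2 * ?x * Zp 1))"
        by metis
      also have "\<dots> = t powr (p - 4) * (2 * A * Zp 1)" by simp
      finally show ?thesis unfolding gA .
    qed
    have "(\<lambda>n. \<bar>g A + 12 * A\<^sup>2 / real (Suc n) - real (Suc n) * ?S (A / Suc n) / t ^ 4\<bar>) \<longlonglongrightarrow>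
        \<bar>g A + 0 - 2 * A * (LINT x|\<nu>. 16 * sin (t * x / 2) ^ 4) / t ^ 4\<bar>"
    proof (intro tendsto_rabs tendsto_diff tendsto_add tendsto_const tendsto_divide sin_fourth_moment_limit[OF A])
      show "(\<lambda>n. 12 * A\<^sup>2 / real (Suc n)) \<longlonglongrightarrow> 0" by real_asymp
    qed (use t in auto)
    then show ?thesis using tendsto_upperbound[OF _ always_eventually] bn by fastforce
  qed
  \<comment> \<open>The second limit, along \<open>t = tm m\<close>: the kernel stays below
    \<open>x ^ 4\<close>, which is integrable under \<nu>, so dominated convergence applies.\<close>
  define tm where "tm m = 1 / real (Suc m)" for m
  have tm: "0 < tm m" for m by (simp add: tm_def)
  have tm0: "tm \<longlonglongrightarrow> 0" unfolding tm_def by real_asymp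
  have "(\<lambda>m. LINT x|\<nu>. 16 * sin (tm m * x / 2) ^ 4 / tm m ^ 4) \<longlonglongrightarrow> (LINT x|\<nu>. x ^ 4)"
  proof (rule integral_dominated_convergence[OF _ _ c4])
    show "AE x in \<nu>. (\<lambda>m. 16 * sin (tm m * x / 2) ^ 4 / tm m ^ 4) \<longlonglongrightarrow> x ^ 4"
    proof (rule AE_I2)
      fix x
      have "(\<lambda>m. tm m powr (p - 4) * \<bar>x\<bar> powr p) \<longlonglongrightarrow> 0 powr (p - 4) * \<bar>x\<bar> powr p"
        using p less_imp_le[OF tm] by (intro tendsto_mult tendsto_powr' tm0) auto
      then have "(\<lambda>m. tm m powr (p - 4) * \<bar>x\<bar> powr p) \<longlonglongrightarrow> 0" by simp
      then have "(\<lambda>m. x ^ 4 - 16 * sin (tm m * x / 2) ^ 4 / tm m ^ 4) \<longlonglongrightarrow> 0"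
        by (rule Lim_null_comparison[rotated]) (use sin_fourth_power_approx(1)[OF tm p] in auto)
      from tendsto_diff[OF tendsto_const[of "x ^ 4"] this]
      show "(\<lambda>m. 16 * sin (tm m * x / 2) ^ 4 / tm m ^ 4) \<longlonglongrightarrow> x ^ 4" by simp
    qed
    show "AE x in \<nu>. norm (16 * sin (tm m * x / 2) ^ 4 / tm m ^ 4) \<le> x ^ 4" for m
      using sin_fourth_power_approx(2)[OF tm p] by (intro AE_I2) simp
  qed auto
  then have S: "(\<lambda>m. \<bar>g A - 2 * A * (LINT x|\<nu>. 16 * sin (tm m * x / 2) ^ 4) / tm m ^ 4\<bar>) \<longlonglongrightarrow> \<bar>g A - 2 * A * c4 \<nu>\<bar>"
  proof -
    assume *: "(\<lambda>m. LINT x|\<nu>. 16 * sin (tm m * x / 2) ^ 4 / tm m ^ 4) \<longlonglongrightarrow> (LINT x|\<nu>. x ^ 4)"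
    have "2 * A * (LINT x|\<nu>. 16 * sin (tm m * x / 2) ^ 4 / tm m ^ 4) =
        2 * A * (LINT x|\<nu>. 16 * sin (tm m * x / 2) ^ 4) / tm m ^ 4" for m
      by simp
    with tendsto_mult_left[OF *, of "2 * A"] show ?thesis
      unfolding c4_def by (intro tendsto_rabs tendsto_diff tendsto_const) (simp only:)
  qed
  have "(\<lambda>m. tm m powr (p - 4) * (2 * A * Zp 1)) \<longlonglongrightarrow> 0 powr (p - 4) * (2 * A * Zp 1)"
    using p less_imp_le[OF tm] by (intro tendsto_mult tendsto_powr' tm0) auto
  then have "(\<lambda>m. tm m powr (p - 4) * (2 * A * Zp 1)) \<longlonglongrightarrow> 0" by simp
  from tendsto_le[OF _ this S] have "\<bar>g A - 2 * A * c4 \<nu>\<bar> \<le> 0" using bd[OF tm] by auto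
  then have "g A = 2 * A * c4 \<nu>" by simp
  then have "expectation (\<lambda>\<omega>. Lc (rect 0 0 A) \<omega> ^ 4) = c4 \<nu> * A + 3 * A\<^sup>2"
    using fourth_moment_Z[of 0 A] A by (simp add: g_def algebra_simps)
  moreover have "expectation (\<lambda>\<omega>. Lc B \<omega> ^ 4) = expectation (\<lambda>\<omega>. Lc (rect 0 0 A) \<omega> ^ 4)"
    by (rule Lc_expectation_eq[where f="\<lambda>x. x ^ 4"]) (use B A in \<open>auto simp: measure_rect A_def\<close>)
  ultimately show ?thesis by (simp add: A_def)
qed

end

section \<open>Mixed moments of overlapping sets\<close>

context levy_basis_moments
begin

text \<open>On the atoms \<open>B - C\<close>, \<open>B \<inter> C\<close> and \<open>C - B\<close>
  everything is a polynomial in three independent centred variables, of which only the monomials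
  without first powers survive. The constant \<open>c4 \<nu>\<close> enters through the fourth
  moment of the common atom.\<close>

lemma Lc_square_product:
  assumes c4: "integrable \<nu> (\<lambda>x. x ^ 4)" and B: "small B" and C: "small C"
  shows "integrable M (\<lambda>\<omega>. (Lc B \<omega>)\<^sup>2 * (Lc C \<omega>)\<^sup>2)"
    and "expectation (\<lambda>\<omega>. (Lc B \<omega>)\<^sup>2 * (Lc C \<omega>)\<^sup>2) = measure lborel B * measure lborel C
      + c4 \<nu> * measure lborel (B \<inter> C) + 2 * (measure lborel (B \<inter> C))\<^sup>2"
proof -
  define A where "A i = [B - C, B \<inter> C, C - B] ! i" for i
  define X where "X i = Lc (A i)" for i
  have [measurable]: "B \<in> sets borel" "C \<in> sets borel" using B C by (auto simp: small_def finite_borel_sets_def)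
  have [measurable]: "random_variable borel (Lc B)" "random_variable borel (Lc C)" using B C by auto
  have sA: "small (A i)" if "i < 3" for i
    using that by (auto simp: A_def less_Suc_eq numeral_eq_Suc intro: small_mono[OF B] small_mono[OF C])
  have s: "small (B - C)" "small (B \<inter> C)" "small (C - B)" using sA[of 0] sA[of 1] sA[of 2] by (auto simp: A_def)
  have [measurable]: "random_variable borel (X i)" if "i < 3" for i using sA[OF that] by (auto simp: X_def)
  have ind: "indep_vars (\<lambda>_. borel) X {..<3}"
    unfolding X_def by (rule Lc_indep_vars)
      (use sA in \<open>auto simp: A_def disjoint_family_on_def less_Suc_eq numeral_eq_Suc\<close>)
  define m where "m i j = expectation (\<lambda>\<omega>. X i \<omega> ^ j)" for i j
  have iX: "integrable M (\<lambda>\<omega>. X i \<omega> ^ j)" if "i < 3" "j \<le> 4" for i j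
    unfolding X_def by (rule integrable_Lc_power[OF sA[OF that(1)] that(2)])
  define pr where "pr i j k \<omega> = X 0 \<omega> ^ i * X 1 \<omega> ^ j * X 2 \<omega> ^ k" for i j k \<omega>
  have ind': "indep_vars (\<lambda>_. borel) (\<lambda>l \<omega>. X l \<omega> ^ ([i, j, k] ! l)) {..<3}" for i j k
    by (rule indep_vars_compose2[OF ind]) auto
  have pr: "integrable M (pr i j k)" "expectation (pr i j k) = m 0 i * m 1 j * m 2 k" if "i \<le> 4" "j \<le> 4" "k \<le> 4" for i j k
  proof -
    have eq: "pr i j k = (\<lambda>\<omega>. \<Prod>l<3. X l \<omega> ^ ([i, j, k] ! l))"
      by (auto simp: pr_def numeral_eq_Suc fun_eq_iff)
    have int: "integrable M (\<lambda>\<omega>. X l \<omega> ^ ([i, j, k] ! l))" if "l < 3" for l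
      using that \<open>i \<le> 4\<close> \<open>j \<le> 4\<close> \<open>k \<le> 4\<close> by (auto simp: less_Suc_eq numeral_eq_Suc intro!: iX[unfolded numeral_eq_Suc])
    show "integrable M (pr i j k)" unfolding eq
      by (rule indep_vars_integrable[OF _ ind']) (use int in auto)
    show "expectation (pr i j k) = m 0 i * m 1 j * m 2 k" unfolding eq m_def
      by (subst indep_vars_lebesgue_integral[OF _ ind']) (use int in \<open>auto simp: numeral_eq_Suc\<close>)
  qed
  have mA: "m i 1 = 0" "m i 0 = 1" "m i 2 = measure lborel (A i)" if "i < 3" for i
    using sA[OF that] expectation_Lc[of "A i"] by (auto simp: m_def X_def variance_Lc prob_space simp del: expectation_Lc)
  have m4: "m 1 4 = c4 \<nu> * measure lborel (B \<inter> C) + 3 * (measure lborel (B \<inter> C))\<^sup>2"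
    unfolding m_def X_def using fourth_moment_Lc[OF c4, of "A 1"] sA[of 1] by (simp add: A_def)
  have BC: "AE \<omega> in M. Lc B \<omega> = X 0 \<omega> + X 1 \<omega>" "AE \<omega> in M. Lc C \<omega> = X 1 \<omega> + X 2 \<omega>"
  proof -
    have "B = (B - C) \<union> (B \<inter> C)" "C = (B \<inter> C) \<union> (C - B)" by auto
    then show "AE \<omega> in M. Lc B \<omega> = X 0 \<omega> + X 1 \<omega>" "AE \<omega> in M. Lc C \<omega> = X 1 \<omega> + X 2 \<omega>"
      using Lc_Un[of "B - C" "B \<inter> C"] Lc_Un[of "B \<inter> C" "C - B"] s B C by (auto simp: X_def A_def)
  qed
  have mB: "measure lborel B = measure lborel (B - C) + measure lborel (B \<inter> C)"
    "measure lborel C = measure lborel (B \<inter> C) + measure lborel (C - B)"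
    using measure_Un_finite_borel[of "B - C" "B \<inter> C"] measure_Un_finite_borel[of "B \<inter> C" "C - B"] s
      Un_Diff_Int[of B C] Un_Diff_Int[of C B] by (auto simp: Int_commute Un_commute)
  define G where "G \<omega> = pr 2 2 0 \<omega> + 2 * pr 2 1 1 \<omega> + pr 2 0 2 \<omega> + 2 * pr 1 3 0 \<omega> + 4 * pr 1 2 1 \<omega> + 2 * pr 1 1 2 \<omega>
     + pr 0 4 0 \<omega> + 2 * pr 0 3 1 \<omega> + pr 0 2 2 \<omega>" for \<omega>
  have AE: "AE \<omega> in M. (Lc B \<omega>)\<^sup>2 * (Lc C \<omega>)\<^sup>2 = G \<omega>"
    using BC by eventually_elim (simp add: G_def pr_def power2_eq_square power3_eq_cube power4_eq_xxxx algebra_simps)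
  have iG: "integrable M G" unfolding G_def by (intro Bochner_Integration.integrable_add integrable_mult_right pr) auto
  have meas: "(\<lambda>\<omega>. (Lc B \<omega>)\<^sup>2 * (Lc C \<omega>)\<^sup>2) \<in> borel_measurable M" by measurable
  show "integrable M (\<lambda>\<omega>. (Lc B \<omega>)\<^sup>2 * (Lc C \<omega>)\<^sup>2)"
    using integrable_cong_AE[OF meas _ AE] iG by auto
  have "expectation (\<lambda>\<omega>. (Lc B \<omega>)\<^sup>2 * (Lc C \<omega>)\<^sup>2) = expectation G"
    using iG by (intro integral_cong_AE meas AE) auto
  also have "\<dots> = m 0 2 * m 1 2 + m 0 2 * m 2 2 + m 1 4 + m 1 2 * m 2 2"
    unfolding G_def by (simp add: pr mA mA(1)[unfolded One_nat_def])
  finally show "expectation (\<lambda>\<omega>. (Lc B \<omega>)\<^sup>2 * (Lc C \<omega>)\<^sup>2) = measure lborel B * measure lborel C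
      + c4 \<nu> * measure lborel (B \<inter> C) + 2 * (measure lborel (B \<inter> C))\<^sup>2"
    unfolding m4 by (simp add: mA mB A_def power2_eq_square algebra_simps)
qed

text \<open>Tailored to two steps \<open>k < l\<close>: \<open>En h k\<close> and
  \<open>Lv h l\<close> may share points, while \<open>Lv h k\<close> and \<open>En h l\<close> meet
  neither of them nor each other. The three atoms of the overlapping pair and the two other sets
  carry five independent variables.\<close>

lemma Lc_factorization:
  assumes B: "small B1" "small B2" and B34: "small B3" "small B4"
    and disj: "B3 \<inter> B1 = {}" "B3 \<inter> B2 = {}" "B4 \<inter> B1 = {}" "B4 \<inter> B2 = {}" "B4 \<inter> B3 = {}"
    and meas [measurable]: "f \<in> borel_measurable (borel \<Otimes>\<^sub>M borel)" "q \<in> borel_measurable borel" "r \<in> borel_measurable borel"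
    and int: "integrable M (\<lambda>\<omega>. f (Lc B1 \<omega>, Lc B2 \<omega>))" "integrable M (\<lambda>\<omega>. q (Lc B3 \<omega>))" "integrable M (\<lambda>\<omega>. r (Lc B4 \<omega>))"
  shows "integrable M (\<lambda>\<omega>. f (Lc B1 \<omega>, Lc B2 \<omega>) * q (Lc B3 \<omega>) * r (Lc B4 \<omega>) :: real)"
    and "expectation (\<lambda>\<omega>. f (Lc B1 \<omega>, Lc B2 \<omega>) * q (Lc B3 \<omega>) * r (Lc B4 \<omega>)) =
      expectation (\<lambda>\<omega>. f (Lc B1 \<omega>, Lc B2 \<omega>)) * expectation (\<lambda>\<omega>. q (Lc B3 \<omega>)) * expectation (\<lambda>\<omega>. r (Lc B4 \<omega>))"
proof -
  define A where "A i = [B1 - B2, B1 \<inter> B2, B2 - B1, B3, B4] ! i" for i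
  define X where "X i = Lc (A i)" for i
  have [measurable]: "B1 \<in> sets borel" "B2 \<in> sets borel" using B by (auto simp: small_def finite_borel_sets_def)
  have sA: "small (A i)" if "i < 5" for i
    using that B B34 by (auto simp: A_def less_Suc_eq numeral_eq_Suc intro: small_mono[OF B(1)] small_mono[OF B(2)])
  have s: "small (B1 - B2)" "small (B1 \<inter> B2)" "small (B2 - B1)" using sA[of 0] sA[of 1] sA[of 2] by (auto simp: A_def)
  have [measurable]: "random_variable borel (X i)" if "i < 5" for i using sA[OF that] by (auto simp: X_def)
  have ind: "indep_vars (\<lambda>_. borel) X {..<5}"
    unfolding X_def
  proof (rule Lc_indep_vars)
    show "disjoint_family_on A {..<5}"
      using disj by (auto simp: A_def disjoint_family_on_def less_Suc_eq numeral_eq_Suc disjoint_iff)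
  qed (use sA in auto)
  define F where "F x = f (x 0 + x 1, x 1 + x 2)" for x :: "nat \<Rightarrow> real"
  have BC: "AE \<omega> in M. Lc B1 \<omega> = X 0 \<omega> + X 1 \<omega>" "AE \<omega> in M. Lc B2 \<omega> = X 1 \<omega> + X 2 \<omega>"
  proof -
    have "B1 = (B1 - B2) \<union> (B1 \<inter> B2)" "B2 = (B1 \<inter> B2) \<union> (B2 - B1)" by auto
    then show "AE \<omega> in M. Lc B1 \<omega> = X 0 \<omega> + X 1 \<omega>" "AE \<omega> in M. Lc B2 \<omega> = X 1 \<omega> + X 2 \<omega>"
      using Lc_Un[of "B1 - B2" "B1 \<inter> B2"] Lc_Un[of "B1 \<inter> B2" "B2 - B1"] s B by (auto simp: X_def A_def)
  qed
  have F1 [measurable]: "(\<lambda>x. F x) \<in> borel_measurable (PiM {0, 1, 2} (\<lambda>_. borel))"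
    unfolding F_def by measurable
  have F2 [measurable]: "(\<lambda>x. F x * q (x 3)) \<in> borel_measurable (PiM {0, 1, 2, 3} (\<lambda>_. borel))"
    unfolding F_def by measurable
  have q1: "(\<lambda>x. q (x 3)) \<in> borel_measurable (PiM {3::nat} (\<lambda>_. borel))"
    and r1: "(\<lambda>x. r (x 4)) \<in> borel_measurable (PiM {4::nat} (\<lambda>_. borel))"
    by measurable
  have ind1: "indep_var borel (\<lambda>\<omega>. F (\<lambda>i. X i \<omega>)) borel (\<lambda>\<omega>. q (X 3 \<omega>))"
    using indep_var_groups[OF ind _ _ _ F1 q1] by (simp add: F_def)
  have ind2: "indep_var borel (\<lambda>\<omega>. F (\<lambda>i. X i \<omega>) * q (X 3 \<omega>)) borel (\<lambda>\<omega>. r (X 4 \<omega>))"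
    using indep_var_groups[OF ind _ _ _ F2 r1] by (simp add: F_def)
  have X34: "X 3 = Lc B3" "X 4 = Lc B4" by (auto simp: X_def A_def)
  have AE: "AE \<omega> in M. f (Lc B1 \<omega>, Lc B2 \<omega>) = F (\<lambda>i. X i \<omega>)"
    using BC by eventually_elim (simp add: F_def)
  have mf: "(\<lambda>\<omega>. f (Lc B1 \<omega>, Lc B2 \<omega>)) \<in> borel_measurable M" "(\<lambda>\<omega>. F (\<lambda>i. X i \<omega>)) \<in> borel_measurable M"
    using int(1) ind1 by (auto dest: indep_var_rv1)
  have iF: "integrable M (\<lambda>\<omega>. F (\<lambda>i. X i \<omega>))" using int(1) integrable_cong_AE[OF mf AE] by simp
  have EF: "expectation (\<lambda>\<omega>. F (\<lambda>i. X i \<omega>)) = expectation (\<lambda>\<omega>. f (Lc B1 \<omega>, Lc B2 \<omega>))"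
    using integral_cong_AE[OF mf AE] by simp
  note i1 = indep_var_integrable[OF ind1 iF] and e1 = indep_var_lebesgue_integral[OF ind1 iF]
  note i2 = indep_var_integrable[OF ind2 i1] and e2 = indep_var_lebesgue_integral[OF ind2 i1]
  have AE': "AE \<omega> in M. f (Lc B1 \<omega>, Lc B2 \<omega>) * q (Lc B3 \<omega>) * r (Lc B4 \<omega>) = F (\<lambda>i. X i \<omega>) * q (X 3 \<omega>) * r (X 4 \<omega>)"
    using AE by eventually_elim (simp add: X34)
  have m1: "(\<lambda>\<omega>. f (Lc B1 \<omega>, Lc B2 \<omega>) * q (Lc B3 \<omega>) * r (Lc B4 \<omega>)) \<in> borel_measurable M"
    using int by measurable
  have i2': "integrable M (\<lambda>\<omega>. F (\<lambda>i. X i \<omega>) * q (X 3 \<omega>) * r (X 4 \<omega>))"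
    using i2 int(2,3) by (simp add: X34)
  show "integrable M (\<lambda>\<omega>. f (Lc B1 \<omega>, Lc B2 \<omega>) * q (Lc B3 \<omega>) * r (Lc B4 \<omega>))"
    using integrable_cong_AE[OF m1 _ AE'] i2' by auto
  have "expectation (\<lambda>\<omega>. f (Lc B1 \<omega>, Lc B2 \<omega>) * q (Lc B3 \<omega>) * r (Lc B4 \<omega>)) = expectation (\<lambda>\<omega>. F (\<lambda>i. X i \<omega>) * q (X 3 \<omega>) * r (X 4 \<omega>))"
    by (rule integral_cong_AE[OF m1 _ AE']) (use i2' in auto)
  also have "\<dots> = expectation (\<lambda>\<omega>. F (\<lambda>i. X i \<omega>)) * expectation (\<lambda>\<omega>. q (X 3 \<omega>)) * expectation (\<lambda>\<omega>. r (X 4 \<omega>))"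
    using e1 e2 int(2,3) by (simp add: X34)
  finally show "expectation (\<lambda>\<omega>. f (Lc B1 \<omega>, Lc B2 \<omega>) * q (Lc B3 \<omega>) * r (Lc B4 \<omega>)) =
      expectation (\<lambda>\<omega>. f (Lc B1 \<omega>, Lc B2 \<omega>)) * expectation (\<lambda>\<omega>. q (Lc B3 \<omega>)) * expectation (\<lambda>\<omega>. r (Lc B4 \<omega>))"
    by (simp add: EF X34)
qed

end

section \<open>Geometry of trawl sets\<close>

lemma emeasure_lborel_sections:
  assumes "S \<in> sets (borel :: (real \<times> real) measure)"
  shows "emeasure lborel S = (\<integral>\<^sup>+r. emeasure lborel {y. (r, y) \<in> S} \<partial>lborel)"
proof -
  have "S \<in> sets (lborel \<Otimes>\<^sub>M lborel)" using assms by (simp only: lborel_prod sets_lborel)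
  from lborel.emeasure_pair_measure_alt[OF this] show ?thesis by (simp add: lborel_prod vimage_def)
qed

lemma measure_Diff_Int:
  assumes "B \<in> finite_borel_sets" "C \<in> finite_borel_sets"
  shows "measure lborel B = measure lborel (B - C) + measure lborel (B \<inter> C)"
proof -
  have "measure lborel ((B - C) \<union> (B \<inter> C)) = measure lborel (B - C) + measure lborel (B \<inter> C)"
    using assms by (intro measure_Un_finite_borel) auto
  then show ?thesis by (simp add: Un_Diff_Int)
qed

locale trawl_shape =
  fixes a \<phi> :: "real \<Rightarrow> real" and \<alpha> :: real
  assumes trawl: "trawl_function a"
    and a_eq: "\<And>s. 0 \<le> s \<Longrightarrow> a s = (LBINT y:{s..}. \<phi> y)"
    and phi_pos: "\<And>s. 0 \<le> s \<Longrightarrow> 0 < \<phi> s"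
    and phi_cont: "continuous_on {0..} \<phi>"
    and alpha: "1 < \<alpha>"
    and phi_decay: "\<phi> \<in> O[at_top](\<lambda>s. s powr (- \<alpha> - 1))"
begin

abbreviation T :: "real \<Rightarrow> (real \<times> real) set" where
  "T \<equiv> trawl_set a"

lemma a_nonneg: "0 \<le> s \<Longrightarrow> 0 \<le> a s"
  and a_antimono: "0 \<le> s \<Longrightarrow> s \<le> t \<Longrightarrow> a t \<le> a s"
  and a_cont: "continuous_on {0..} a"
  and a_integrable: "set_integrable lborel {0..} a"
  using trawl by (auto simp: trawl_function_def monotone_on_def)

text \<open>Constant continuation to the left of 0 gives a function continuous on the whole line, so
  that closedness of the trawl sets, measurability and two-sided differentiation need no special
  care at 0.\<close>

definition ae :: "real \<Rightarrow> real" where "ae s = a (max 0 s)"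

lemma ae_cont: "continuous_on S ae"
  unfolding ae_def by (rule continuous_on_compose2[OF a_cont]) (auto intro!: continuous_intros)

lemma ae_measurable [measurable]: "ae \<in> borel_measurable borel"
  by (rule borel_measurable_continuous_onI[OF ae_cont])

lemma ae_nonneg: "0 \<le> ae s" by (simp add: ae_def a_nonneg)

lemma mem_T: "(r, y) \<in> T t \<longleftrightarrow> r \<le> t \<and> 0 \<le> y \<and> y \<le> a (t - r)"
proof
  assume "r \<le> t \<and> 0 \<le> y \<and> y \<le> a (t - r)"
  then show "(r, y) \<in> T t"
    unfolding trawl_set_def by (intro image_eqI[of _ _ "(r - t, y)"]) auto
qed (auto simp: trawl_set_def)

lemma T_closed: "closed (T t)"
proof -
  have "T t = {p. fst p \<le> t \<and> 0 \<le> snd p \<and> snd p \<le> ae (t - fst p)}"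
    by (auto simp: mem_T ae_def)
  moreover have "closed {p :: real \<times> real. fst p \<le> t \<and> 0 \<le> snd p \<and> snd p \<le> ae (t - fst p)}"
    by (intro closed_Collect_conj closed_Collect_le continuous_intros continuous_on_compose2[OF ae_cont[of UNIV]]) auto
  ultimately show ?thesis by simp
qed

lemma T_borel [measurable]: "T t \<in> sets borel"
  using T_closed by (rule borel_closed)

lemma emeasure_T: "emeasure lborel (T t) = (\<integral>\<^sup>+s. ennreal (ae s) * indicator {0..} s \<partial>lborel)"
proof -
  have "emeasure lborel (T t) = (\<integral>\<^sup>+r. ennreal (ae (t - r)) * indicator {0..} (t - r) \<partial>lborel)"
    unfolding emeasure_lborel_sections[OF T_borel]
  proof (intro nn_integral_cong)
    fix r
    have "{y. (r, y) \<in> T t} = (if r \<le> t then {0..a (t - r)} else {})" by (auto simp: mem_T)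
    then show "emeasure lborel {y. (r, y) \<in> T t} = ennreal (ae (t - r)) * indicator {0..} (t - r)"
      using a_nonneg[of "t - r"] by (auto simp: ae_def indicator_def)
  qed
  also have "\<dots> = (\<integral>\<^sup>+s. ennreal (ae s) * indicator {0..} s \<partial>lborel)"
    by (subst (2) nn_integral_real_affine[of _ "-1" t]) auto
  finally show ?thesis .
qed

lemma T_finite_borel [simp, intro]: "T t \<in> finite_borel_sets"
proof -
  have "integrable lborel (\<lambda>s. indicator {0..} s * a s)"
    using a_integrable by (simp add: set_integrable_def)
  moreover have "ennreal (norm (indicator {0..} s * a s)) = ennreal (ae s) * indicator {0..} s" for s
    by (auto simp: indicator_def ae_def a_nonneg)
  ultimately have "emeasure lborel (T t) < \<infinity>"
    unfolding emeasure_T integrable_iff_bounded by simp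
  then show ?thesis by (simp add: finite_borel_sets_def)
qed

lemma measure_T: "measure lborel (T t) = measure lborel (T 0)"
  by (simp add: measure_def emeasure_T)

text \<open>A point \<open>(r, y)\<close> belongs to \<open>T t\<close> during an interval of times:
  from \<open>r\<close> on, until \<open>a (t - r)\<close> falls below \<open>y\<close>. Hence a
  point enters at most once and leaves at most once.\<close>

lemma T_convex: "p \<in> T s \<Longrightarrow> p \<in> T u \<Longrightarrow> s \<le> t \<Longrightarrow> t \<le> u \<Longrightarrow> p \<in> T t"
  using a_antimono[of "t - fst p" "u - fst p"] by (cases p) (auto simp: mem_T)

text \<open>For nonnegative \<open>h\<close> this is the integral of \<open>ae\<close> over [0, h].
  The base point -1 makes 0 an interior point, where \<open>area\<close> then has a two-sided
  derivative.\<close>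

definition area :: "real \<Rightarrow> real" where
  "area h = integral {-1..h} ae - integral {-1..0} ae"

lemma area_0 [simp]: "area 0 = 0" by (simp add: area_def)

lemma area_deriv: "-1 < h \<Longrightarrow> (area has_real_derivative ae h) (at h)"
proof -
  assume h: "-1 < h"
  have "((\<lambda>u. integral {-1..u} ae) has_real_derivative ae h) (at h within {-1..h+1})"
    by (rule integral_has_real_derivative) (use h ae_cont in auto)
  moreover have "at h within {-1..h+1} = at h" by (rule at_within_interior) (use h in auto)
  ultimately show ?thesis unfolding area_def by (auto intro!: derivative_eq_intros)
qed

text \<open>A column with abscissa in \<open>{t<..t + h}\<close> is new from bottom to top; columns
  further left can only shrink, as \<open>a\<close> is non-increasing, and contribute
  nothing.\<close>

lemma measure_enter:
  assumes h: "0 \<le> h"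
  shows "measure lborel (T (t + h) - T t) = area h"
    and "0 \<le> area h"
proof -
  have a0: "area 0 \<le> area h"
  proof (rule DERIV_nonneg_imp_nondecreasing[OF h])
    fix x :: real assume "0 \<le> x" "x \<le> h"
    then show "\<exists>y. (area has_real_derivative y) (at x) \<and> 0 \<le> y"
      using area_deriv[of x] ae_nonneg[of x] by auto
  qed
  then show "0 \<le> area h" by simp
  have "emeasure lborel (T (t + h) - T t) = (\<integral>\<^sup>+r. ennreal (ae (t + h - r)) * indicator {0..<h} (t + h - r) \<partial>lborel)"
    unfolding emeasure_lborel_sections[OF sets.Diff[OF T_borel T_borel]]
  proof (intro nn_integral_cong)
    fix r
    have "{y. (r, y) \<in> T (t + h) - T t} = (if t < r \<and> r \<le> t + h then {0..a (t + h - r)} else {})"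
      using a_antimono[of "t - r" "t + h - r"] h by (auto simp: mem_T)
    then show "emeasure lborel {y. (r, y) \<in> T (t + h) - T t} = ennreal (ae (t + h - r)) * indicator {0..<h} (t + h - r)"
      using a_nonneg[of "t + h - r"] by (auto simp: ae_def indicator_def)
  qed
  also have "\<dots> = (\<integral>\<^sup>+s. ennreal (ae s) * indicator {0..<h} s \<partial>lborel)"
    by (subst (2) nn_integral_real_affine[of _ "-1" "t + h"]) auto
  also have "\<dots> = (\<integral>\<^sup>+s. ennreal (ae s) * indicator {0..h} s \<partial>lborel)"
    by (rule nn_integral_cong_AE) (use AE_lborel_singleton[of h] in \<open>auto elim!: eventually_mono simp: indicator_def\<close>)
  also have "\<dots> = ennreal (area h - area 0)"
    by (rule nn_integral_FTC_Icc) (use h area_deriv ae_nonneg in \<open>auto intro: has_field_derivative_at_within\<close>)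
  finally show "measure lborel (T (t + h) - T t) = area h"
    using a0 by (simp add: measure_def)
qed

text \<open>\<open>T t\<close> and \<open>T (t + h)\<close> have the same finite area, so gain and
  loss balance.\<close>

lemma measure_leave:
  assumes h: "0 \<le> h"
  shows "measure lborel (T t - T (t + h)) = area h"
proof -
  show ?thesis
    using measure_enter(1)[OF h, of t] measure_T[of t] measure_T[of "t + h"]
      measure_Diff_Int[of "T t" "T (t + h)"] measure_Diff_Int[of "T (t + h)" "T t"]
    by (simp add: Int_commute)
qed

lemma phi_integrable: "set_integrable lborel {0..} \<phi>"
proof -
  obtain C where C: "\<forall>\<^sub>F s in at_top. norm (\<phi> s) \<le> C * norm (s powr (- \<alpha> - 1))" "0 < C"
    using landau_o.bigE[OF phi_decay] by metis
  then obtain s0 where s0: "\<And>s. s0 \<le> s \<Longrightarrow> norm (\<phi> s) \<le> C * s powr (- \<alpha> - 1)"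
    by (auto simp: eventually_at_top_linorder)
  define s1 where "s1 = max 1 s0"
  have s1: "1 \<le> s1" "\<And>s. s1 \<le> s \<Longrightarrow> norm (\<phi> s) \<le> C * s powr (- \<alpha> - 1)" using s0 by (auto simp: s1_def)
  have m: "set_borel_measurable borel {0..} \<phi>"
    using borel_measurable_continuous_on_indicator[OF _ phi_cont] by (auto simp: set_borel_measurable_def)
  have 1: "set_integrable lborel {0..s1} \<phi>"
    by (rule borel_integrable_atLeastAtMost') (rule continuous_on_subset[OF phi_cont], auto)
  have "(\<integral>\<^sup>+x. ennreal (x powr (- \<alpha> - 1)) * indicator {s1..} x \<partial>lborel) = ennreal (0 - (- (s1 powr (- \<alpha>) / \<alpha>)))"
  proof (rule nn_integral_FTC_atLeast)
    show "((\<lambda>x. - (x powr (- \<alpha>) / \<alpha>)) has_real_derivative x powr (- \<alpha> - 1)) (at x)" if "s1 \<le> x" for x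
      using that s1 alpha by (auto intro!: derivative_eq_intros simp: field_simps)
    show "((\<lambda>x. - (x powr (- \<alpha>) / \<alpha>)) \<longlongrightarrow> 0) at_top" using alpha by real_asymp
  qed auto
  then have "(\<integral>\<^sup>+x. ennreal (norm (indicator {s1..} x * x powr (- \<alpha> - 1))) \<partial>lborel) < \<infinity>"
    by (subst nn_integral_cong[where v="\<lambda>x. ennreal (x powr (- \<alpha> - 1)) * indicator {s1..} x"]) (auto simp: indicator_def)
  then have "integrable lborel (\<lambda>x. indicator {s1..} x * x powr (- \<alpha> - 1))"
    by (subst integrable_iff_bounded) auto
  then have "integrable lborel (\<lambda>x. C * (indicator {s1..} x * x powr (- \<alpha> - 1)))" by simp
  then have 2: "set_integrable lborel {s1..} \<phi>"
    unfolding set_integrable_def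
  proof (rule Bochner_Integration.integrable_bound)
    show "(\<lambda>x. indicator {s1..} x *\<^sub>R \<phi> x) \<in> borel_measurable lborel"
    proof -
      have "(\<lambda>x. indicator {s1..} x *\<^sub>R (indicator {0..} x *\<^sub>R \<phi> x)) \<in> borel_measurable borel"
        by (rule borel_measurable_scaleR) (use m in \<open>auto simp: set_borel_measurable_def\<close>)
      moreover have "(\<lambda>x. indicator {s1..} x *\<^sub>R (indicator {0..} x *\<^sub>R \<phi> x)) = (\<lambda>x. indicator {s1..} x *\<^sub>R \<phi> x)"
        using s1 by (auto simp: indicator_def fun_eq_iff)
      ultimately show ?thesis by simp
    qed
    show "AE x in lborel. norm (indicator {s1..} x *\<^sub>R \<phi> x) \<le> norm (C * (indicator {s1..} x * x powr (- \<alpha> - 1)))"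
      using s1 C(2) by (intro AE_I2) (auto simp: indicator_def abs_mult)
  qed
  have "{0..} = {0..s1} \<union> {s1..}" using s1 by auto
  then show ?thesis using set_integrable_Un[OF 1 2] by auto
qed

lemma phi_bounded: obtains C where "0 < C" "\<And>s. 0 \<le> s \<Longrightarrow> \<phi> s \<le> C"
proof -
  obtain C where C: "\<forall>\<^sub>F s in at_top. norm (\<phi> s) \<le> C * norm (s powr (- \<alpha> - 1))" "0 < C"
    using landau_o.bigE[OF phi_decay] by metis
  then obtain s0 where s0: "\<And>s. s0 \<le> s \<Longrightarrow> norm (\<phi> s) \<le> C * s powr (- \<alpha> - 1)"
    by (auto simp: eventually_at_top_linorder)
  define s1 where "s1 = max 1 s0"
  have "compact (\<phi> ` {0..s1})"
    by (intro compact_continuous_image continuous_on_subset[OF phi_cont]) auto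
  then obtain D where D: "\<And>s. s \<in> {0..s1} \<Longrightarrow> norm (\<phi> s) \<le> D"
    by (meson bounded_iff compact_imp_bounded image_eqI)
  have "\<phi> s \<le> max C D" if "0 \<le> s" for s
  proof (cases "s \<le> s1")
    case True
    then show ?thesis using D[of s] that by auto
  next
    case False
    then have "s powr (- \<alpha> - 1) \<le> s powr 0" using alpha by (intro powr_mono) (auto simp: s1_def)
    then have "s powr (- \<alpha> - 1) \<le> 1" using False by (auto simp: s1_def split: if_splits)
    then have "C * s powr (- \<alpha> - 1) \<le> C" using C by simp
    moreover have "\<phi> s \<le> C * s powr (- \<alpha> - 1)" using s0[of s] False abs_ge_self[of "\<phi> s"]
      by (simp add: s1_def, linarith)
    ultimately show ?thesis by linarith
  qed
  then show ?thesis using C by (intro that[of "max C D"]) auto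
qed

lemma a_has_derivative:
  assumes x: "0 \<le> x" "x \<le> u" "0 < u"
  shows "(a has_real_derivative - \<phi> x) (at x within {0..u})"
proof -
  have eq: "a s = a 0 - integral {0..s} \<phi>" if s: "0 \<le> s" for s
  proof -
    have i1: "set_integrable lborel {0..s} \<phi>" and i2: "set_integrable lborel {s<..} \<phi>"
      and i3: "set_integrable lborel {s..} \<phi>"
      using s by (auto intro: set_integrable_subset[OF phi_integrable])
    have "{0..} = {0..s} \<union> {s<..}" using s by auto
    then have "a 0 = (LBINT y:{0..s} \<union> {s<..}. \<phi> y)" using a_eq[of 0] by simp
    also have "\<dots> = (LBINT y:{0..s}. \<phi> y) + (LBINT y:{s<..}. \<phi> y)"
      by (rule set_integral_Un[OF _ i1 i2]) auto
    also have "(LBINT y:{s<..}. \<phi> y) = (LBINT y:{s..}. \<phi> y)"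
      using AE_lborel_singleton[of s] i2 i3
      by (intro set_integral_cong_set) (auto simp: set_integrable_def set_borel_measurable_def elim!: eventually_mono)
    also have "\<dots> = a s" using a_eq[OF s] by simp
    finally show ?thesis using set_borel_integral_eq_integral(2)[OF i1] by simp
  qed
  have "((\<lambda>s. integral {0..s} \<phi>) has_real_derivative \<phi> x) (at x within {0..u})"
    by (rule integral_has_real_derivative) (use x in \<open>auto intro: continuous_on_subset[OF phi_cont]\<close>)
  then have "((\<lambda>s. a 0 - integral {0..s} \<phi>) has_real_derivative - \<phi> x) (at x within {0..u})"
    by (auto intro!: derivative_eq_intros)
  then show ?thesis
    by (rule has_field_derivative_transform_within[where d=1]) (use x in \<open>auto simp: eq[symmetric]\<close>)
qed

lemma a_decrement:
  assumes "0 \<le> s" "s < t" obtains \<xi> where "s < \<xi>" "\<xi> < t" "a s - a t = \<phi> \<xi> * (t - s)"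
proof -
  have "\<exists>x\<in>{s<..<t}. a t - a s = (\<lambda>y. - \<phi> x * y) (t - s)"
  proof (rule mvt_simple[OF assms(2)])
    fix x assume "s \<le> x" "x \<le> t"
    then have "(a has_real_derivative - \<phi> x) (at x within {s..t})"
      using assms by (intro DERIV_subset[OF a_has_derivative[of x t]]) auto
    then show "(a has_derivative (\<lambda>y. - \<phi> x * y)) (at x within {s..t})"
      unfolding has_field_derivative_def .
  qed
  then show ?thesis using that by (auto simp: algebra_simps)
qed

lemma a0_pos: "0 < a 0"
proof -
  obtain \<xi> where "0 < \<xi>" "a 0 - a 1 = \<phi> \<xi> * (1 - 0)" using a_decrement[of 0 1] by auto
  then show ?thesis using phi_pos[of \<xi>] a_nonneg[of 1] by simp
qed

lemma a_right_derivative: "(a has_real_derivative - \<phi> 0) (at_right 0)"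
  using a_has_derivative[of 0 1] by (simp add: at_within_Icc_at_right)

lemma vector_derivative_a: "vector_derivative a (at_right 0) = - \<phi> 0"
  using vector_derivative_within[OF trivial_limit_at_right_real
    a_right_derivative[unfolded has_real_derivative_iff_has_vector_derivative]] .

text \<open>Such points lie in a strip of width \<open>h\<close>, and over the abscissa
  \<open>r\<close> their ordinates range between \<open>a (t - r + h)\<close> and
  \<open>a (t - r)\<close>, at a distance of at most \<open>C * h\<close> by the mean value theorem.
  This gains one power of \<open>h\<close> over the trivial bound \<open>area h\<close>.\<close>

lemma measure_enter_leave_le:
  assumes C: "\<And>s. 0 \<le> s \<Longrightarrow> \<phi> s \<le> C" and h: "0 < h" and st: "s + h \<le> t"
  shows "measure lborel ((T (s + h) - T s) \<inter> (T t - T (t + h))) \<le> C * h\<^sup>2"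
proof -
  have C0: "0 \<le> C" using C[of 0] phi_pos[of 0] by simp
  have "emeasure lborel ((T (s + h) - T s) \<inter> (T t - T (t + h))) \<le> (\<integral>\<^sup>+r. ennreal (C * h) * indicator {s<..s + h} r \<partial>lborel)"
    unfolding emeasure_lborel_sections[OF sets.Int[OF sets.Diff[OF T_borel T_borel] sets.Diff[OF T_borel T_borel]]]
  proof (intro nn_integral_mono)
    fix r
    let ?S = "{y. (r, y) \<in> (T (s + h) - T s) \<inter> (T t - T (t + h))}"
    show "emeasure lborel ?S \<le> ennreal (C * h) * indicator {s<..s + h} r"
    proof (cases "s < r \<and> r \<le> s + h")
      case True
      obtain \<xi> where xi: "t - r < \<xi>" "a (t - r) - a (t - r + h) = \<phi> \<xi> * h"
        using a_decrement[of "t - r" "t - r + h"] True st h by auto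
      have "?S \<subseteq> {a (t - r + h)..a (t - r)}"
        using True st h by (auto simp: mem_T algebra_simps)
      then have "emeasure lborel ?S \<le> emeasure lborel {a (t - r + h)..a (t - r)}"
        by (intro emeasure_mono) auto
      also have "\<dots> = ennreal (a (t - r) - a (t - r + h))"
        using a_antimono[of "t - r" "t - r + h"] True st h by simp
      also have "\<dots> \<le> ennreal (C * h)"
        unfolding xi using C[of \<xi>] xi True st h by (intro ennreal_leI mult_right_mono) auto
      finally show ?thesis using True by simp
    next
      case False
      have "?S = {}" using False a_antimono[of "s - r" "s + h - r"] h by (auto simp: mem_T)
      then show ?thesis by (metis emeasure_empty zero_le)
    qed
  qed
  also have "\<dots> = ennreal (C * h) * ennreal h" using h by (subst nn_integral_cmult_indicator) auto
  also have "\<dots> = ennreal (C * h\<^sup>2)" using h C0 by (simp add: ennreal_mult[symmetric] power2_eq_square mult.assoc)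
  finally show ?thesis
    unfolding measure_def using C0 by (intro enn2real_leI) auto
qed

text \<open>The second limit is l'Hopital's rule for \<open>area h - a 0 * h\<close> over
  \<open>h^2\<close>: the quotient of the derivatives is half the difference quotient of
  \<open>a\<close>, and this is the origin of the factor 1/2 in the bias. The first limit follows
  from the second.\<close>

lemma area_limit: "((\<lambda>h. area h / h) \<longlongrightarrow> a 0) (at_right 0)"
  and area_second_limit: "((\<lambda>h. (area h / h - a 0) / h) \<longlongrightarrow> - \<phi> 0 / 2) (at_right 0)"
proof -
  have "((\<lambda>h. (a h - a 0) / (h - 0)) \<longlongrightarrow> - \<phi> 0) (at_right 0)"
    using a_right_derivative unfolding has_field_derivative_iff by simp
  from tendsto_divide[OF this tendsto_const[of 2]]
  have L: "((\<lambda>h. (a h - a 0) / (2 * h)) \<longlongrightarrow> - \<phi> 0 / 2) (at_right 0)" by (simp add: mult.commute)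
  have pos: "\<forall>\<^sub>F h :: real in at_right 0. 0 < h" by (simp add: eventually_at_right_less)
  have "((\<lambda>h. (area h - a 0 * h) / h\<^sup>2) \<longlongrightarrow> - \<phi> 0 / 2) (at_right 0)"
  proof (rule lhopital_right_0[where f'="\<lambda>h. a h - a 0" and g'="\<lambda>h. 2 * h"])
    have "isCont area 0" using DERIV_isCont[OF area_deriv[of 0]] by simp
    then have "(area \<longlongrightarrow> 0) (at_right 0)"
      using tendsto_mono[OF at_le[of "{0<..}" UNIV 0], of area "area 0"] by (simp add: isCont_def)
    then show "((\<lambda>h. area h - a 0 * h) \<longlongrightarrow> 0) (at_right 0)" by (auto intro!: tendsto_eq_intros)
    show "((\<lambda>h::real. h\<^sup>2) \<longlongrightarrow> 0) (at_right 0)" by (auto intro!: tendsto_eq_intros)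
    show "\<forall>\<^sub>F h in at_right 0. ((\<lambda>h. area h - a 0 * h) has_real_derivative a h - a 0) (at h)"
      using pos
    proof eventually_elim
      case (elim h)
      then show ?case using area_deriv[of h] by (auto intro!: derivative_eq_intros simp: ae_def)
    qed
    show "\<forall>\<^sub>F h :: real in at_right 0. ((\<lambda>h. h\<^sup>2) has_real_derivative 2 * h) (at h)"
      by (auto intro!: always_eventually derivative_eq_intros)
  qed (use pos L in \<open>auto elim!: eventually_mono\<close>)
  then show S: "((\<lambda>h. (area h / h - a 0) / h) \<longlongrightarrow> - \<phi> 0 / 2) (at_right 0)"
    by (rule Lim_transform_eventually) (use pos in \<open>auto elim!: eventually_mono simp: power2_eq_square field_simps\<close>)
  have "((\<lambda>h. (area h / h - a 0) / h * h + a 0) \<longlongrightarrow> - \<phi> 0 / 2 * 0 + a 0) (at_right 0)"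
    by (intro tendsto_intros S)
  then have "((\<lambda>h. (area h / h - a 0) / h * h + a 0) \<longlongrightarrow> a 0) (at_right 0)" by simp
  then show "((\<lambda>h. area h / h) \<longlongrightarrow> a 0) (at_right 0)"
    by (rule Lim_transform_eventually) (rule eventually_mono[OF pos], simp)
qed

end

section \<open>Increments of the trawl process\<close>

locale trawl_array = levy_basis_moments M \<gamma> b \<nu> L p + trawl_shape a \<phi> \<alpha>
  for M :: "'w measure" and \<gamma> b \<nu> L p a \<phi> \<alpha> +
  assumes c4_integrable: "integrable \<nu> (\<lambda>x. x ^ 4)"
begin

definition En :: "real \<Rightarrow> nat \<Rightarrow> (real \<times> real) set" where
  "En h k = T (real (k + 1) * h) - T (real k * h)"

definition Lv :: "real \<Rightarrow> nat \<Rightarrow> (real \<times> real) set" where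
  "Lv h k = T (real k * h) - T (real (k + 1) * h)"

definition E :: "real \<Rightarrow> nat \<Rightarrow> 'w \<Rightarrow> real" where "E h k = Lc (En h k)"

definition F :: "real \<Rightarrow> nat \<Rightarrow> 'w \<Rightarrow> real" where "F h k = Lc (Lv h k)"

text \<open>The covariance of \<open>E h k\<close> and \<open>F h l\<close>, because variance equals
  area on the common part and disjoint parts are independent.\<close>

definition C :: "real \<Rightarrow> nat \<Rightarrow> nat \<Rightarrow> real" where
  "C h k l = measure lborel (En h k \<inter> Lv h l)"

lemma En_Lv_finite_borel [simp, intro]: "En h k \<in> finite_borel_sets" "Lv h k \<in> finite_borel_sets"
  by (auto simp: En_def Lv_def)

lemma E_F_measurable [measurable]: "E h k \<in> borel_measurable M" "F h k \<in> borel_measurable M"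
  by (auto simp: E_def F_def)

context
  fixes h :: real assumes h: "0 < h" and area_le: "area h \<le> 1"
begin

lemma measure_En: "measure lborel (En h k) = area h"
  and measure_Lv: "measure lborel (Lv h k) = area h"
  using measure_enter(1)[of h "real k * h"] measure_leave[of h "real k * h"] h
  by (auto simp: En_def Lv_def algebra_simps)

lemma area_nonneg: "0 \<le> area h" using measure_enter(2) h by simp

lemma small_En_Lv [simp]: "small (En h k)" "small (Lv h k)"
  using area_le by (auto simp: small_def measure_En measure_Lv)

lemma grid_mono: "j \<le> k \<Longrightarrow> real j * h \<le> real k * h"
  using h by simp

lemma T_grid_convex: "q \<in> T (real i * h) \<Longrightarrow> q \<in> T (real k * h) \<Longrightarrow> i \<le> j \<Longrightarrow> j \<le> k \<Longrightarrow> q \<in> T (real j * h)"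
  using T_convex[of q "real i * h" "real k * h" "real j * h"] grid_mono by blast

lemma En_disjoint: "k \<noteq> l \<Longrightarrow> En h k \<inter> En h l = {}"
proof -
  have "En h k \<inter> En h l = {}" if "k < l" for k l
    using T_grid_convex[of _ "k + 1" "l + 1" l] that by (auto simp: En_def)
  then show "k \<noteq> l \<Longrightarrow> En h k \<inter> En h l = {}" by (metis Int_commute linorder_neqE_nat)
qed

lemma Lv_disjoint: "k \<noteq> l \<Longrightarrow> Lv h k \<inter> Lv h l = {}"
proof -
  have "Lv h k \<inter> Lv h l = {}" if "k < l" for k l
    using T_grid_convex[of _ k l "k + 1"] that by (auto simp: Lv_def)
  then show "k \<noteq> l \<Longrightarrow> Lv h k \<inter> Lv h l = {}" by (metis Int_commute linorder_neqE_nat)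
qed

lemma En_Lv_disjoint: "l \<le> k \<Longrightarrow> En h k \<inter> Lv h l = {}"
  using T_grid_convex[of _ l "k + 1" k] by (auto simp: En_def Lv_def)

lemma C_zero: "l \<le> k \<Longrightarrow> C h k l = 0"
  using En_Lv_disjoint by (simp add: C_def)

lemma C_nonneg: "0 \<le> C h k l" by (simp add: C_def)

text \<open>The sets left in different steps are disjoint, so a row sum is the area of what enters
  in step \<open>k\<close> and has left by the end.\<close>

lemma sum_C: "(\<Sum>l<N. C h k l) = area h - measure lborel (En h k - (\<Union>l<N. Lv h l))"
proof -
  have U: "(\<Union>l<N. Lv h l) \<in> finite_borel_sets" by (intro finite_borel_sets_UN) auto
  have "(\<Sum>l<N. C h k l) = measure lborel (\<Union>l<N. En h k \<inter> Lv h l)"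
    unfolding C_def by (rule measure_UN_finite_borel[symmetric])
      (use Lv_disjoint in \<open>auto simp: disjoint_family_on_def\<close>)
  also have "(\<Union>l<N. En h k \<inter> Lv h l) = En h k \<inter> (\<Union>l<N. Lv h l)" by auto
  finally show ?thesis
    using measure_Diff_Int[OF En_Lv_finite_borel(1) U, of h k] by (simp add: measure_En)
qed

lemma sum_C_le: "(\<Sum>l<N. C h k l) \<le> area h"
  unfolding sum_C by simp

lemma C_le: "C h k l \<le> area h"
proof -
  have "C h k l \<le> (\<Sum>l<Suc l. C h k l)" by (intro member_le_sum) (auto simp: C_nonneg)
  then show ?thesis using sum_C_le[where k=k and N="Suc l"] by linarith
qed

text \<open>\<open>R k\<close> collects the points that enter in step \<open>k\<close> and do not
  leave any more. They all lie in the last trawl set, whose area does not depend on time, and the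
  sets \<open>R k\<close> are disjoint.\<close>

lemma total_C: "real N * area h - measure lborel (T 0) \<le> (\<Sum>k<N. \<Sum>l<N. C h k l)"
proof -
  define R where "R k = En h k - (\<Union>l<N. Lv h l)" for k
  have U: "(\<Union>l<N. Lv h l) \<in> finite_borel_sets" by (intro finite_borel_sets_UN) auto
  have "(\<Sum>k<N. measure lborel (R k)) = measure lborel (\<Union>k<N. R k)"
    using U En_disjoint by (intro measure_UN_finite_borel[symmetric]) (auto simp: R_def disjoint_family_on_def)
  also have "\<dots> \<le> measure lborel (T (real N * h))"
  proof (rule measure_mono_finite_borel)
    have "q \<in> T (real j * h)" if "q \<in> R k" "k < j" "j \<le> N" for q j k
      using that(2,3)
    proof (induction j)
      case (Suc j)
      then show ?case
      proof (cases "k < j")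
        case True
        then have "q \<in> T (real j * h)" "q \<notin> Lv h j" using Suc that(1) by (auto simp: R_def)
        then show ?thesis by (auto simp: Lv_def)
      next
        case False
        then have "j = k" using Suc by simp
        then show ?thesis using that(1) by (auto simp: R_def En_def)
      qed
    qed simp
    then show "(\<Union>k<N. R k) \<subseteq> T (real N * h)" by auto
    show "(\<Union>k<N. R k) \<in> finite_borel_sets" using U by (intro finite_borel_sets_UN) (auto simp: R_def)
  qed simp
  also have "\<dots> = measure lborel (T 0)" by (rule measure_T)
  finally have "(\<Sum>k<N. measure lborel (R k)) \<le> measure lborel (T 0)" .
  moreover have "(\<Sum>k<N. \<Sum>l<N. C h k l) = real N * area h - (\<Sum>k<N. measure lborel (R k))"
    by (simp add: sum_C R_def sum_subtractf)
  ultimately show ?thesis by linarith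
qed

text \<open>The value on the common part of the two trawl sets cancels, and so do the means, since
  the entering and the leaving set have equal area.\<close>

lemma increment_eq: "AE \<omega> in M. increment (trawl_process L a) h k \<omega> = E h k \<omega> - F h k \<omega>"
proof -
  let ?s = "real k * h" and ?t = "real (k + 1) * h"
  have "AE \<omega> in M. L ((T ?t - T ?s) \<union> (T ?t \<inter> T ?s)) \<omega> = L (T ?t - T ?s) \<omega> + L (T ?t \<inter> T ?s) \<omega>"
    by (rule L_Un) auto
  moreover have "AE \<omega> in M. L ((T ?s - T ?t) \<union> (T ?t \<inter> T ?s)) \<omega> = L (T ?s - T ?t) \<omega> + L (T ?t \<inter> T ?s) \<omega>"
    by (rule L_Un) auto
  moreover have "(T ?t - T ?s) \<union> (T ?t \<inter> T ?s) = T ?t" "(T ?s - T ?t) \<union> (T ?t \<inter> T ?s) = T ?s" by auto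
  moreover have "expectation (L (En h k)) = expectation (L (Lv h k))"
    by (rule L_expectation_eq(1)[where f="\<lambda>x. x"]) (auto simp: measure_En measure_Lv)
  ultimately show ?thesis
    by (auto simp: increment_def trawl_process_def E_def F_def Lc_def En_def Lv_def elim: eventually_elim2)
qed

lemma E_indep_vars: "indep_vars (\<lambda>_. borel) (E h) {..<N}"
  and F_indep_vars: "indep_vars (\<lambda>_. borel) (F h) {..<N}"
  unfolding E_def F_def using En_disjoint Lv_disjoint
  by (auto intro!: Lc_indep_vars simp: disjoint_family_on_def)

lemma E_F_indep_var: "indep_var borel (E h k) borel (F h k)"
  unfolding E_def F_def using En_Lv_disjoint[of k k] by (intro Lc_indep_var) auto

lemma E_F_power_integrable: "j \<le> 4 \<Longrightarrow> integrable M (\<lambda>\<omega>. E h k \<omega> ^ j)" "j \<le> 4 \<Longrightarrow> integrable M (\<lambda>\<omega>. F h k \<omega> ^ j)"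
  unfolding E_def F_def by (auto intro!: integrable_Lc_power)

lemma E_F_expectation [simp]: "expectation (E h k) = 0" "expectation (F h k) = 0"
  unfolding E_def F_def by auto

lemma E_F_second_moment: "expectation (\<lambda>\<omega>. (E h k \<omega>)\<^sup>2) = area h" "expectation (\<lambda>\<omega>. (F h k \<omega>)\<^sup>2) = area h"
  unfolding E_def F_def by (auto simp: variance_Lc measure_En measure_Lv)

lemma E_F_fourth_moment:
  "expectation (\<lambda>\<omega>. E h k \<omega> ^ 4) = c4 \<nu> * area h + 3 * (area h)\<^sup>2"
  "expectation (\<lambda>\<omega>. F h k \<omega> ^ 4) = c4 \<nu> * area h + 3 * (area h)\<^sup>2"
  unfolding E_def F_def by (auto simp: fourth_moment_Lc[OF c4_integrable] measure_En measure_Lv)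

lemma square_products:
  "integrable M (\<lambda>\<omega>. (E h k \<omega>)\<^sup>2 * (E h l \<omega>)\<^sup>2)" "integrable M (\<lambda>\<omega>. (F h k \<omega>)\<^sup>2 * (F h l \<omega>)\<^sup>2)"
  "integrable M (\<lambda>\<omega>. (E h k \<omega>)\<^sup>2 * (F h l \<omega>)\<^sup>2)"
  "expectation (\<lambda>\<omega>. (E h k \<omega>)\<^sup>2 * (E h l \<omega>)\<^sup>2) = (area h)\<^sup>2 + (if k = l then c4 \<nu> * area h + 2 * (area h)\<^sup>2 else 0)"
  "expectation (\<lambda>\<omega>. (F h k \<omega>)\<^sup>2 * (F h l \<omega>)\<^sup>2) = (area h)\<^sup>2 + (if k = l then c4 \<nu> * area h + 2 * (area h)\<^sup>2 else 0)"
  "expectation (\<lambda>\<omega>. (E h k \<omega>)\<^sup>2 * (F h l \<omega>)\<^sup>2) = (area h)\<^sup>2 + c4 \<nu> * C h k l + 2 * (C h k l)\<^sup>2"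
proof -
  note S = Lc_square_product[OF c4_integrable]
  show "integrable M (\<lambda>\<omega>. (E h k \<omega>)\<^sup>2 * (E h l \<omega>)\<^sup>2)" "integrable M (\<lambda>\<omega>. (F h k \<omega>)\<^sup>2 * (F h l \<omega>)\<^sup>2)"
    "integrable M (\<lambda>\<omega>. (E h k \<omega>)\<^sup>2 * (F h l \<omega>)\<^sup>2)"
    unfolding E_def F_def by (auto intro!: S(1))
  show "expectation (\<lambda>\<omega>. (E h k \<omega>)\<^sup>2 * (E h l \<omega>)\<^sup>2) = (area h)\<^sup>2 + (if k = l then c4 \<nu> * area h + 2 * (area h)\<^sup>2 else 0)"
    using S(2)[of "En h k" "En h l"] En_disjoint[of k l] by (auto simp: E_def measure_En power2_eq_square)
  show "expectation (\<lambda>\<omega>. (F h k \<omega>)\<^sup>2 * (F h l \<omega>)\<^sup>2) = (area h)\<^sup>2 + (if k = l then c4 \<nu> * area h + 2 * (area h)\<^sup>2 else 0)"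
    using S(2)[of "Lv h k" "Lv h l"] Lv_disjoint[of k l] by (auto simp: F_def measure_Lv power2_eq_square)
  show "expectation (\<lambda>\<omega>. (E h k \<omega>)\<^sup>2 * (F h l \<omega>)\<^sup>2) = (area h)\<^sup>2 + c4 \<nu> * C h k l + 2 * (C h k l)\<^sup>2"
    using S(2)[of "En h k" "Lv h l"] by (auto simp: E_def F_def C_def measure_En measure_Lv power2_eq_square)
qed

text \<open>
  Every point which enters during the observation period also leaves during it, except for those
  surviving in the last trawl set; so the squares of the entering and of the leaving parts nearly
  cancel, although they are correlated.
\<close>

lemma square_difference_bound:
  "integrable M (\<lambda>\<omega>. (\<Sum>k<N. (E h k \<omega>)\<^sup>2 - (F h k \<omega>)\<^sup>2)\<^sup>2)"
  "0 \<le> c4 \<nu> \<Longrightarrow> expectation (\<lambda>\<omega>. (\<Sum>k<N. (E h k \<omega>)\<^sup>2 - (F h k \<omega>)\<^sup>2)\<^sup>2)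
    \<le> 2 * c4 \<nu> * measure lborel (T 0) + 4 * real N * (area h)\<^sup>2"
proof -
  let ?U = "\<lambda>k \<omega>. (E h k \<omega>)\<^sup>2 - (F h k \<omega>)\<^sup>2"
  define cc where "cc k l = c4 \<nu> * C h k l + 2 * (C h k l)\<^sup>2" for k l
  have expand: "(\<lambda>\<omega>. ?U k \<omega> * ?U l \<omega>) = (\<lambda>\<omega>. (E h k \<omega>)\<^sup>2 * (E h l \<omega>)\<^sup>2 - (E h k \<omega>)\<^sup>2 * (F h l \<omega>)\<^sup>2
      - (E h l \<omega>)\<^sup>2 * (F h k \<omega>)\<^sup>2 + (F h k \<omega>)\<^sup>2 * (F h l \<omega>)\<^sup>2)" for k l
    by (simp add: algebra_simps)
  have i: "integrable M (\<lambda>\<omega>. ?U k \<omega> * ?U l \<omega>)" for k l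
    unfolding expand by (intro Bochner_Integration.integrable_add Bochner_Integration.integrable_diff square_products)
  have e: "expectation (\<lambda>\<omega>. ?U k \<omega> * ?U l \<omega>) = (if k = l then 2 * (c4 \<nu> * area h + 2 * (area h)\<^sup>2) else 0) - cc k l - cc l k" for k l
    unfolding expand using square_products[of k l] square_products[of l k] by (simp add: cc_def)
  show "integrable M (\<lambda>\<omega>. (\<Sum>k<N. ?U k \<omega>)\<^sup>2)" by (rule expectation_square_sum(1)) (rule i)
  assume c4: "0 \<le> c4 \<nu>"
  have "expectation (\<lambda>\<omega>. (\<Sum>k<N. ?U k \<omega>)\<^sup>2) = (\<Sum>k<N. \<Sum>l<N. expectation (\<lambda>\<omega>. ?U k \<omega> * ?U l \<omega>))"
    by (rule expectation_square_sum(2)) (rule i)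
  also have "\<dots> = (\<Sum>k<N. \<Sum>l<N. (if k = l then 2 * (c4 \<nu> * area h + 2 * (area h)\<^sup>2) else 0)) - (\<Sum>k<N. \<Sum>l<N. cc k l) - (\<Sum>k<N. \<Sum>l<N. cc l k)"
    by (simp add: e sum_subtractf)
  also have "(\<Sum>k<N. \<Sum>l<N. (if k = l then 2 * (c4 \<nu> * area h + 2 * (area h)\<^sup>2) else 0)) = real N * (2 * (c4 \<nu> * area h + 2 * (area h)\<^sup>2))"
    by simp
  also have "(\<Sum>k<N. \<Sum>l<N. cc l k) = (\<Sum>k<N. \<Sum>l<N. cc k l)" by (rule sum.swap)
  also have "real N * (2 * (c4 \<nu> * area h + 2 * (area h)\<^sup>2)) - (\<Sum>k<N. \<Sum>l<N. cc k l) - (\<Sum>k<N. \<Sum>l<N. cc k l)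
     \<le> 2 * c4 \<nu> * measure lborel (T 0) + 4 * real N * (area h)\<^sup>2"
  proof -
    \<comment> \<open>Here the terms of order \<open>c4 \<nu> * N * area h\<close> cancel: the
      covariances between the two families recover all of the diagonal except for the share of one
      trawl set.\<close>
    have "c4 \<nu> * (real N * area h - measure lborel (T 0)) \<le> c4 \<nu> * (\<Sum>k<N. \<Sum>l<N. C h k l)"
      using total_C c4 by (intro mult_left_mono) auto
    also have "\<dots> \<le> (\<Sum>k<N. \<Sum>l<N. cc k l)"
      unfolding sum_distrib_left cc_def by (intro sum_mono) auto
    finally show ?thesis by (simp add: algebra_simps)
  qed
  finally show "expectation (\<lambda>\<omega>. (\<Sum>k<N. ?U k \<omega>)\<^sup>2) \<le> 2 * c4 \<nu> * measure lborel (T 0) + 4 * real N * (area h)\<^sup>2" .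
qed

lemma enter_leave_factorization:
  fixes f :: "real \<times> real \<Rightarrow> real"
  assumes kl: "k < l"
    and [measurable]: "f \<in> borel_measurable (borel \<Otimes>\<^sub>M borel)" "q \<in> borel_measurable borel" "r \<in> borel_measurable borel"
    and int: "integrable M (\<lambda>\<omega>. f (E h k \<omega>, F h l \<omega>))" "integrable M (\<lambda>\<omega>. q (F h k \<omega>))" "integrable M (\<lambda>\<omega>. r (E h l \<omega>))"
  shows "integrable M (\<lambda>\<omega>. f (E h k \<omega>, F h l \<omega>) * q (F h k \<omega>) * r (E h l \<omega>))"
    and "expectation (\<lambda>\<omega>. f (E h k \<omega>, F h l \<omega>) * q (F h k \<omega>) * r (E h l \<omega>)) =
      expectation (\<lambda>\<omega>. f (E h k \<omega>, F h l \<omega>)) * expectation (\<lambda>\<omega>. q (F h k \<omega>)) * expectation (\<lambda>\<omega>. r (E h l \<omega>))"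
  using Lc_factorization[of "En h k" "Lv h l" "Lv h k" "En h l" f q r] int kl
    En_Lv_disjoint[of k k] Lv_disjoint[of k l] En_disjoint[of l k] En_Lv_disjoint[of l l] En_Lv_disjoint[of k l]
  by (auto simp: E_def F_def Int_commute)

text \<open>For \<open>k < l\<close> the product of two summands contains
  \<open>v (F h k \<omega>)\<close> and \<open>u (E h l \<omega>)\<close> as factors independent of
  the rest, so one vanishing mean annihilates it. General \<open>u\<close> and \<open>v\<close> also
  cover the products of a cube and a first power in the Gaussian case.\<close>

lemma cross_term_orthogonal:
  assumes [measurable]: "u \<in> borel_measurable borel" "v \<in> borel_measurable borel"
    and int: "\<And>k. integrable M (\<lambda>\<omega>. (u (E h k \<omega>))\<^sup>2)" "\<And>k. integrable M (\<lambda>\<omega>. (v (F h k \<omega>))\<^sup>2)"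
    and mean: "(\<forall>k. expectation (\<lambda>\<omega>. u (E h k \<omega>)) = 0) \<or> (\<forall>k. expectation (\<lambda>\<omega>. v (F h k \<omega>)) = (0::real))"
  shows "integrable M (\<lambda>\<omega>. (\<Sum>k<N. u (E h k \<omega>) * v (F h k \<omega>))\<^sup>2)"
    and "expectation (\<lambda>\<omega>. (\<Sum>k<N. u (E h k \<omega>) * v (F h k \<omega>))\<^sup>2) =
      (\<Sum>k<N. expectation (\<lambda>\<omega>. (u (E h k \<omega>))\<^sup>2) * expectation (\<lambda>\<omega>. (v (F h k \<omega>))\<^sup>2))"
proof -
  have iu: "integrable M (\<lambda>\<omega>. u (E h k \<omega>))" "integrable M (\<lambda>\<omega>. v (F h k \<omega>))" for k
    by (auto intro!: square_integrable_imp_integrable int)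
  have iuv: "integrable M (\<lambda>\<omega>. u (E h k \<omega>) * v (F h l \<omega>))" for k l
  proof (rule Bochner_Integration.integrable_bound)
    show "integrable M (\<lambda>\<omega>. (u (E h k \<omega>))\<^sup>2 + (v (F h l \<omega>))\<^sup>2)" using int by auto
    show "AE \<omega> in M. norm (u (E h k \<omega>) * v (F h l \<omega>)) \<le> norm ((u (E h k \<omega>))\<^sup>2 + (v (F h l \<omega>))\<^sup>2)"
    proof (rule AE_I2)
      fix \<omega>
      have "2 * (\<bar>u (E h k \<omega>)\<bar> * \<bar>v (F h l \<omega>)\<bar>) \<le> (u (E h k \<omega>))\<^sup>2 + (v (F h l \<omega>))\<^sup>2"
        using sum_squares_bound[of "\<bar>u (E h k \<omega>)\<bar>" "\<bar>v (F h l \<omega>)\<bar>"] by simp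
      then show "norm (u (E h k \<omega>) * v (F h l \<omega>)) \<le> norm ((u (E h k \<omega>))\<^sup>2 + (v (F h l \<omega>))\<^sup>2)"
        by (simp add: abs_mult) (smt (verit) abs_ge_zero mult_nonneg_nonneg)
    qed
  qed measurable
  let ?U = "\<lambda>k \<omega>. u (E h k \<omega>) * v (F h k \<omega>)"
  have lt: "integrable M (\<lambda>\<omega>. ?U k \<omega> * ?U l \<omega>) \<and> expectation (\<lambda>\<omega>. ?U k \<omega> * ?U l \<omega>) = 0" if "k < l" for k l
  proof -
    have eq: "(\<lambda>\<omega>. ?U k \<omega> * ?U l \<omega>) = (\<lambda>\<omega>. (\<lambda>(x, y). u x * v y) (E h k \<omega>, F h l \<omega>) * v (F h k \<omega>) * u (E h l \<omega>))"
      by (simp add: mult_ac)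
    show ?thesis
      unfolding eq using enter_leave_factorization[OF that, of "\<lambda>(x, y). u x * v y" v u] iuv iu mean by auto
  qed
  have ind: "indep_var borel (\<lambda>\<omega>. (u (E h k \<omega>))\<^sup>2) borel (\<lambda>\<omega>. (v (F h k \<omega>))\<^sup>2)" for k
    using indep_var_compose[OF E_F_indep_var[of k], of "\<lambda>x. (u x)\<^sup>2" borel "\<lambda>x. (v x)\<^sup>2" borel] by (simp add: comp_def)
  have i: "integrable M (\<lambda>\<omega>. ?U k \<omega> * ?U l \<omega>)" for k l
  proof -
    consider "k < l" | "l < k" | "k = l" by linarith
    then show ?thesis
    proof cases
      case 3
      then show ?thesis using indep_var_integrable[OF ind int(1) int(2), of k] by (simp add: power2_eq_square mult_ac)
    qed (use lt[of k l] lt[of l k] in \<open>auto simp: mult.commute\<close>)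
  qed
  show "integrable M (\<lambda>\<omega>. (\<Sum>k<N. ?U k \<omega>)\<^sup>2)" by (rule expectation_square_sum(1)) (rule i)
  have "expectation (\<lambda>\<omega>. (\<Sum>k<N. ?U k \<omega>)\<^sup>2) = (\<Sum>k<N. expectation (\<lambda>\<omega>. (?U k \<omega>)\<^sup>2))"
  proof (rule expectation_square_sum_orthogonal)
    show "expectation (\<lambda>\<omega>. ?U k \<omega> * ?U l \<omega>) = 0" if "k \<noteq> l" for k l
      using that lt[of k l] lt[of l k] by (cases k l rule: linorder_cases) (auto simp: mult.commute)
  qed (use i in auto)
  also have "\<dots> = (\<Sum>k<N. expectation (\<lambda>\<omega>. (u (E h k \<omega>))\<^sup>2) * expectation (\<lambda>\<omega>. (v (F h k \<omega>))\<^sup>2))"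
    using indep_var_lebesgue_integral[OF ind int(1) int(2)] by (simp add: power_mult_distrib)
  finally show "expectation (\<lambda>\<omega>. (\<Sum>k<N. ?U k \<omega>)\<^sup>2) =
      (\<Sum>k<N. expectation (\<lambda>\<omega>. (u (E h k \<omega>))\<^sup>2) * expectation (\<lambda>\<omega>. (v (F h k \<omega>))\<^sup>2))" .
qed

end

end

section \<open>Normal limits and studentization\<close>

lemma real_distribution_normal_plus_const:
  assumes "0 < v" shows "real_distribution (normal_plus_const v c)"
proof -
  interpret prob_space "density lborel (\<lambda>x. ennreal (normal_density 0 (sqrt v) x))"
    using prob_space_normal_density[of "sqrt v" 0] assms by simp
  show ?thesis unfolding normal_plus_const_def by simp
qed

lemma char_normal_plus_const:
  assumes v: "0 < v"
  shows "char (normal_plus_const v c) t = iexp (t * c) * complex_of_real (exp (- (v * t\<^sup>2 / 2)))"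
proof -
  interpret S: prob_space std_normal_distribution
    by (rule prob_space_normal_density) simp
  have "distributed std_normal_distribution lborel (\<lambda>x. x) std_normal_density"
    by (auto simp: distributed_def distr_id2)
  from S.normal_density_affine[OF this, of "sqrt v" 0] v
  have "distr std_normal_distribution lborel (\<lambda>x. sqrt v * x) = density lborel (\<lambda>x. ennreal (normal_density 0 (sqrt v) x))"
    by (simp add: distributed_def)
  moreover have "distr std_normal_distribution lborel (\<lambda>x. sqrt v * x) = distr std_normal_distribution borel (\<lambda>x. sqrt v * x)"
    by (rule distr_cong) auto
  ultimately have "normal_plus_const v c = distr std_normal_distribution borel (\<lambda>x. sqrt v * x + c)"
    unfolding normal_plus_const_def by (simp add: distr_distr comp_def flip: \<open>distr std_normal_distribution lborel (\<lambda>x. sqrt v * x) = density lborel (\<lambda>x. ennreal (normal_density 0 (sqrt v) x))\<close>)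
  then have "char (normal_plus_const v c) t = iexp (t * c) * char std_normal_distribution (t * sqrt v)"
    by (simp add: char_def integral_distr ring_distribs exp_add mult_ac)
  then show ?thesis using v by (simp add: char_std_normal_distribution power_mult_distrib mult.commute)
qed

lemma distr_normal_plus_const:
  assumes v: "0 < v" and r: "0 < r"
  shows "distr (normal_plus_const v 0) borel (\<lambda>x. r * x + c) = normal_plus_const (r\<^sup>2 * v) c"
proof (rule Levy_uniqueness)
  interpret V: real_distribution "normal_plus_const v 0" by (rule real_distribution_normal_plus_const[OF v])
  show "real_distribution (distr (normal_plus_const v 0) borel (\<lambda>x. r * x + c))" by simp
  show "real_distribution (normal_plus_const (r\<^sup>2 * v) c)" by (rule real_distribution_normal_plus_const) (use v r in auto)
  have "char (distr (normal_plus_const v 0) borel (\<lambda>x. r * x + c)) t = iexp (t * c) * char (normal_plus_const v 0) (t * r)" for t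
    by (simp add: char_def integral_distr ring_distribs exp_add mult_ac)
  then show "char (distr (normal_plus_const v 0) borel (\<lambda>x. r * x + c)) = char (normal_plus_const (r\<^sup>2 * v) c)"
    using v r by (auto simp: char_normal_plus_const power_mult_distrib mult_ac fun_eq_iff)
qed

context prob_space
begin

lemma converges_in_char_AE_cong:
  fixes X Y :: "nat \<Rightarrow> 'a \<Rightarrow> real"
  assumes [measurable]: "\<And>n. random_variable borel (X n)" "\<And>n. random_variable borel (Y n)"
    and Y: "converges_in_char Y \<mu>" and eq: "\<forall>\<^sub>F n in sequentially. AE \<omega> in M. X n \<omega> = Y n \<omega>"
  shows "converges_in_char X \<mu>"
  unfolding converges_in_char_def
proof
  fix t
  have "\<forall>\<^sub>F n in sequentially. char (distr M borel (Y n)) t = char (distr M borel (X n)) t"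
    using eq by eventually_elim (auto intro!: arg_cong[where f="\<lambda>\<mu>. char \<mu> t"] distr_cong_AE elim: eventually_mono)
  then show "(\<lambda>n. char (distr M borel (X n)) t) \<longlonglongrightarrow> char \<mu> t"
    using Y unfolding converges_in_char_def by (blast intro: Lim_transform_eventually)
qed

lemma converges_in_distribution_if_char:
  fixes X :: "nat \<Rightarrow> 'a \<Rightarrow> real"
  assumes [measurable]: "\<And>n. random_variable borel (X n)"
    and "real_distribution \<mu>" "converges_in_char X \<mu>"
  shows "converges_in_distribution M X \<mu>"
  unfolding converges_in_distribution_def
  using assms by (intro levy_continuity) (auto simp: converges_in_char_def)

text \<open>Slutsky's theorem for a quotient. With \<open>r = 1 / sqrt q\<close> the random factor
  is \<open>r + S n\<close>, where \<open>S n\<close> tends to 0 in probability; the product splits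
  into an affine image of a convergent sequence and terms in which \<open>S n\<close> is multiplied
  by a tight or a constant factor.\<close>

lemma converges_in_distribution_studentized:
  fixes X R Q Y :: "nat \<Rightarrow> 'a \<Rightarrow> real"
  assumes [measurable]: "\<And>n. random_variable borel (X n)" "\<And>n. random_variable borel (R n)"
      "\<And>n. random_variable borel (Q n)" "\<And>n. random_variable borel (Y n)"
    and v: "0 < v" and q: "0 < q"
    and X: "converges_in_char X (normal_plus_const v 0)"
    and R: "converges_in_probability M R (\<lambda>_. \<beta>)"
    and Q: "converges_in_probability M Q (\<lambda>_. q)"
    and eq: "\<forall>\<^sub>F n in sequentially. AE \<omega> in M. Y n \<omega> = (X n \<omega> + R n \<omega>) * (1 / sqrt (Q n \<omega>))"
  shows "converges_in_distribution M Y (normal_plus_const (v / q) (\<beta> / sqrt q))"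
proof -
  let ?V = "normal_plus_const v 0"
  define r where "r = 1 / sqrt q"
  have r: "0 < r" "r\<^sup>2 * v = v / q" "\<beta> * r = \<beta> / sqrt q" using q by (auto simp: r_def power_divide)
  have rd: "real_distribution ?V" by (rule real_distribution_normal_plus_const[OF v])
  define S where "S n \<omega> = 1 / sqrt (Q n \<omega>) + - r" for n \<omega>
  define W where "W n \<omega> = X n \<omega> + (R n \<omega> + - \<beta>)" for n \<omega>
  have [measurable]: "random_variable borel (S n)" "random_variable borel (W n)" for n
    unfolding S_def W_def by measurable
  have cont: "isCont (\<lambda>x. 1 / sqrt x) q" using q by (intro continuous_intros) auto
  have "converges_in_probability M (\<lambda>n \<omega>. 1 / sqrt (Q n \<omega>)) (\<lambda>_. r)"
    unfolding r_def by (rule converges_in_probability_compose[OF _ _ Q cont]) auto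
  from converges_in_probability_add[OF _ _ this converges_in_probability_const[OF tendsto_const[of "- r"]]]
  have S: "converges_in_probability M S (\<lambda>_. 0)" by (simp add: S_def[abs_def])
  from converges_in_probability_add[OF _ _ R converges_in_probability_const[OF tendsto_const[of "- \<beta>"]]]
  have "converges_in_probability M (\<lambda>n \<omega>. R n \<omega> + - \<beta>) (\<lambda>_. 0)" by simp
  from converges_in_char_add[OF _ _ X this]
  have W: "converges_in_char W ?V" by (simp add: W_def[abs_def])
  have "converges_in_char (\<lambda>n \<omega>. r * W n \<omega> + \<beta> * r) (normal_plus_const (v / q) (\<beta> / sqrt q))"
    using converges_in_char_cmult[OF _ rd W, of r "\<beta> * r"] distr_normal_plus_const[OF v r(1), of "\<beta> * r"] r by simp
  from converges_in_char_add[OF _ _ this converges_in_probability_tight_mult[OF _ _ rd W S]]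
  have "converges_in_char (\<lambda>n \<omega>. r * W n \<omega> + \<beta> * r + W n \<omega> * S n \<omega>) (normal_plus_const (v / q) (\<beta> / sqrt q))"
    by simp
  from converges_in_char_add[OF _ _ this] converges_in_probability_cmult[OF _ S, of \<beta>]
  have fin: "converges_in_char (\<lambda>n \<omega>. (r * W n \<omega> + \<beta> * r + W n \<omega> * S n \<omega>) + \<beta> * S n \<omega>) (normal_plus_const (v / q) (\<beta> / sqrt q))"
    by simp
  have "converges_in_char Y (normal_plus_const (v / q) (\<beta> / sqrt q))"
  proof (rule converges_in_char_AE_cong[OF _ _ fin])
    have alg: "(x + y) * z = r * (x + (y + - \<beta>)) + \<beta> * r + (x + (y + - \<beta>)) * (z + - r) + \<beta> * (z + - r)" for x y z
      by (simp add: algebra_simps)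
    show "\<forall>\<^sub>F n in sequentially. AE \<omega> in M. Y n \<omega> = (r * W n \<omega> + \<beta> * r + W n \<omega> * S n \<omega>) + \<beta> * S n \<omega>"
      using eq
    proof eventually_elim
      case (elim n)
      then show ?case by eventually_elim (simp only: W_def S_def, rule alg)
    qed
  qed measurable
  then show ?thesis
    using v q by (intro converges_in_distribution_if_char real_distribution_normal_plus_const) auto
qed

end

section \<open>High-frequency asymptotics\<close>

locale trawl_sampling = trawl_array M \<gamma> b \<nu> L p a \<phi> \<alpha>
  for M :: "'w measure" and \<gamma> b \<nu> L p a \<phi> \<alpha> +
  fixes \<Delta> :: "nat \<Rightarrow> real"
  assumes mesh_pos: "\<And>n. 0 < \<Delta> n"
    and mesh_null: "\<Delta> \<longlonglongrightarrow> 0"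
    and horizon: "filterlim (\<lambda>n. real n * \<Delta> n) at_top sequentially"
begin

definition A :: "nat \<Rightarrow> real" where "A n = area (\<Delta> n)"

definition X :: "real \<Rightarrow> 'w \<Rightarrow> real" where "X = trawl_process L a"

lemma X_measurable [measurable]: "X t \<in> borel_measurable M"
  unfolding X_def trawl_process_def by auto

lemma increment_measurable [measurable]: "increment X h k \<in> borel_measurable M"
  unfolding increment_def by measurable

lemma a_hat_measurable [measurable]: "a_hat_0 X n h \<in> borel_measurable M"
  and Q_stat_measurable [measurable]: "Q_stat X n h \<in> borel_measurable M"
  unfolding a_hat_0_def Q_stat_def normalized_power_variation_def by measurable

lemma mesh_at_right: "filterlim \<Delta> (at_right 0) sequentially"
  using mesh_null mesh_pos by (auto simp: filterlim_at intro!: always_eventually less_imp_neq[symmetric])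

lemma A_limit: "(\<lambda>n. A n / \<Delta> n) \<longlonglongrightarrow> a 0"
  and A_second_limit: "(\<lambda>n. (A n / \<Delta> n - a 0) / \<Delta> n) \<longlonglongrightarrow> - \<phi> 0 / 2"
  unfolding A_def using filterlim_compose[OF area_limit mesh_at_right] filterlim_compose[OF area_second_limit mesh_at_right]
  by auto

lemma A_null: "A \<longlonglongrightarrow> 0"
proof -
  have "(\<lambda>n. A n / \<Delta> n * \<Delta> n) \<longlonglongrightarrow> a 0 * 0" by (intro tendsto_mult A_limit mesh_null)
  moreover have "A n / \<Delta> n * \<Delta> n = A n" for n using mesh_pos[of n] by simp
  ultimately show ?thesis by simp
qed

lemma A_nonneg: "0 \<le> A n"
  unfolding A_def using measure_enter(2) mesh_pos[of n] by simp

lemma horizon_pos: "0 < n \<Longrightarrow> 0 < real n * \<Delta> n"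
  using mesh_pos[of n] by simp

lemma eventually_regular: "\<forall>\<^sub>F n in sequentially. 0 < n \<and> area (\<Delta> n) \<le> 1"
proof -
  have "\<forall>\<^sub>F n in sequentially. A n < 1" using A_null by (rule order_tendstoD) simp
  then show ?thesis using eventually_gt_at_top[of "0::nat"] by eventually_elim (simp add: A_def)
qed

lemma pred_over_limit: "(\<lambda>n. real (n - 1) / real n) \<longlonglongrightarrow> 1"
proof -
  have "(\<lambda>n. 1 - 1 / real n) \<longlonglongrightarrow> 1" by real_asymp
  then show ?thesis
    by (rule Lim_transform_eventually) (use eventually_gt_at_top[of "0::nat"] in \<open>eventually_elim, simp add: of_nat_diff diff_divide_distrib\<close>)
qed

lemma NA_limit: "(\<lambda>n. real (n - 1) * A n / (real n * \<Delta> n)) \<longlonglongrightarrow> a 0"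
  using tendsto_mult[OF pred_over_limit A_limit] by simp

lemma inverse_horizon: "(\<lambda>n. 1 / (real n * \<Delta> n)) \<longlonglongrightarrow> 0"
  using tendsto_inverse_0_at_top[OF horizon] by (simp add: inverse_eq_divide)

lemma horizon_powr: "0 < e \<Longrightarrow> (\<lambda>n. (real n * \<Delta> n) powr (- e)) \<longlonglongrightarrow> 0"
  by (rule tendsto_neg_powr[OF _ horizon]) simp

lemma increments_eq:
  assumes "area (\<Delta> n) \<le> 1"
  shows "AE \<omega> in M. \<forall>k. increment X (\<Delta> n) k \<omega> = E (\<Delta> n) k \<omega> - F (\<Delta> n) k \<omega>"
  unfolding X_def AE_all_countable using increment_eq[OF mesh_pos assms] by auto

text \<open>The part of the error that has a normal limit. It takes the entering squares with full
  weight instead of both families with half weight, because independence is available only within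
  one family.\<close>

definition V :: "nat \<Rightarrow> 'w \<Rightarrow> real" where
  "V n \<omega> = (\<Sum>k<n - 1. ((E (\<Delta> n) k \<omega>)\<^sup>2 - A n) / sqrt (real n * \<Delta> n))"

lemma V_measurable [measurable]: "V n \<in> borel_measurable M"
  unfolding V_def by measurable

text \<open>The moment of order \<open>p / 2\<close> of a centred square is essentially a
  \<open>p\<close>-th moment of the basis, hence \<open>O(A n)\<close>. With the normalization it
  sums to the order \<open>(real n * \<Delta> n) powr (1 - p / 4)\<close> over all steps, and this
  vanishes because \<open>p > 4\<close>.\<close>

lemma V_summand_moments:
  assumes n: "0 < n" "area (\<Delta> n) \<le> 1"
  defines "Y \<equiv> \<lambda>k \<omega>. ((E (\<Delta> n) k \<omega>)\<^sup>2 - A n) / sqrt (real n * \<Delta> n)"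
  shows "expectation (Y k) = 0"
    and "expectation (\<lambda>\<omega>. (Y k \<omega>)\<^sup>2) = (c4 \<nu> * A n + 2 * (A n)\<^sup>2) / (real n * \<Delta> n)"
    and "integrable M (\<lambda>\<omega>. \<bar>Y k \<omega>\<bar> powr (p / 2))"
    and "expectation (\<lambda>\<omega>. \<bar>Y k \<omega>\<bar> powr (p / 2)) \<le> 2 powr (p / 2) * (2 * Zp 1 + 1) * A n * (real n * \<Delta> n) powr (- (p / 4))"
proof -
  note hp = horizon_pos[OF n(1)]
  have sm: "small (En (\<Delta> n) k)" using small_En_Lv(1)[OF mesh_pos n(2)] .
  have mE: "measure lborel (En (\<Delta> n) k) = A n" using measure_En[OF mesh_pos n(2)] by (simp add: A_def)
  have i: "j \<le> 4 \<Longrightarrow> integrable M (\<lambda>\<omega>. E (\<Delta> n) k \<omega> ^ j)" for j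
    using E_F_power_integrable(1)[OF mesh_pos n(2)] .
  have e2: "expectation (\<lambda>\<omega>. (E (\<Delta> n) k \<omega>)\<^sup>2) = A n"
    using E_F_second_moment(1)[OF mesh_pos n(2)] by (simp add: A_def)
  have e4: "expectation (\<lambda>\<omega>. E (\<Delta> n) k \<omega> ^ 4) = c4 \<nu> * A n + 3 * (A n)\<^sup>2"
    using E_F_fourth_moment(1)[OF mesh_pos n(2)] by (simp add: A_def)
  show "expectation (Y k) = 0"
    unfolding Y_def using i[of 2] e2 by (simp add: prob_space)
  have "(Y k \<omega>)\<^sup>2 = (E (\<Delta> n) k \<omega> ^ 4 - 2 * A n * (E (\<Delta> n) k \<omega>)\<^sup>2 + (A n)\<^sup>2) / (real n * \<Delta> n)" for \<omega>
    unfolding Y_def power_divide real_sqrt_pow2[OF less_imp_le[OF hp]]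
    by (simp add: power2_eq_square power4_eq_xxxx algebra_simps)
  then show "expectation (\<lambda>\<omega>. (Y k \<omega>)\<^sup>2) = (c4 \<nu> * A n + 2 * (A n)\<^sup>2) / (real n * \<Delta> n)"
    using i[of 4] i[of 2] e2 e4 by (simp add: prob_space power2_eq_square)
  have bd: "\<bar>Y k \<omega>\<bar> powr (p / 2) \<le> 2 powr (p / 2) * (\<bar>E (\<Delta> n) k \<omega>\<bar> powr p + A n) * (real n * \<Delta> n) powr (- (p / 4))" for \<omega>
  proof -
    let ?x = "E (\<Delta> n) k \<omega>"
    have "sqrt (real n * \<Delta> n) powr (p / 2) = (real n * \<Delta> n) powr (p / 4)"
      using hp by (simp add: powr_half_sqrt[symmetric] powr_powr)
    then have "\<bar>Y k \<omega>\<bar> powr (p / 2) = \<bar>?x\<^sup>2 - A n\<bar> powr (p / 2) * (real n * \<Delta> n) powr (- (p / 4))"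
      using hp by (simp add: Y_def abs_divide powr_divide powr_minus_divide)
    also have "\<bar>?x\<^sup>2 - A n\<bar> powr (p / 2) \<le> 2 powr (p / 2) * (\<bar>?x\<^sup>2\<bar> powr (p / 2) + \<bar>- A n\<bar> powr (p / 2))"
      using abs_add_powr_le[of "p / 2" "?x\<^sup>2" "- A n"] p by simp
    also have "\<bar>?x\<^sup>2\<bar> powr (p / 2) = \<bar>?x\<bar> powr p"
    proof (cases "?x = 0")
      case False
      then have e: "?x\<^sup>2 = \<bar>?x\<bar> powr 2" by (simp add: powr_numeral)
      have "\<bar>?x\<^sup>2\<bar> powr (p / 2) = (\<bar>?x\<bar> powr 2) powr (p / 2)" using e by simp
      also have "\<dots> = \<bar>?x\<bar> powr (2 * (p / 2))" by (rule powr_powr)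
      finally show ?thesis by simp
    qed simp
    also have "\<bar>- A n\<bar> powr (p / 2) \<le> A n"
      using powr_mono'[of 1 "p / 2" "A n"] A_nonneg[of n] n(2) p by (simp add: A_def)
    finally show ?thesis by (simp add: mult_left_mono mult_right_mono)
  qed
  have ip: "integrable M (\<lambda>\<omega>. \<bar>E (\<Delta> n) k \<omega>\<bar> powr p)" unfolding E_def by (rule integrable_Lc_powr[OF sm])
  have ib: "integrable M (\<lambda>\<omega>. 2 powr (p / 2) * (\<bar>E (\<Delta> n) k \<omega>\<bar> powr p + A n) * (real n * \<Delta> n) powr (- (p / 4)))"
    using ip by simp
  have m: "(\<lambda>\<omega>. \<bar>Y k \<omega>\<bar> powr (p / 2)) \<in> borel_measurable M" unfolding Y_def by measurable
  show iY: "integrable M (\<lambda>\<omega>. \<bar>Y k \<omega>\<bar> powr (p / 2))"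
    by (rule Bochner_Integration.integrable_bound[OF ib m]) (use bd in \<open>auto intro!: AE_I2 order_trans[OF _ abs_ge_self]\<close>)
  have "expectation (\<lambda>\<omega>. \<bar>Y k \<omega>\<bar> powr (p / 2)) \<le> expectation (\<lambda>\<omega>. 2 powr (p / 2) * (\<bar>E (\<Delta> n) k \<omega>\<bar> powr p + A n) * (real n * \<Delta> n) powr (- (p / 4)))"
    by (rule integral_mono[OF iY ib bd])
  also have "\<dots> = 2 powr (p / 2) * (expectation (\<lambda>\<omega>. \<bar>E (\<Delta> n) k \<omega>\<bar> powr p) + A n) * (real n * \<Delta> n) powr (- (p / 4))"
    using ip by (simp add: prob_space)
  also have "\<dots> \<le> 2 powr (p / 2) * (2 * Zp 1 * A n + A n) * (real n * \<Delta> n) powr (- (p / 4))"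
    using expectation_Lc_powr_le[OF sm] by (intro mult_right_mono mult_left_mono add_right_mono) (auto simp: E_def mE)
  finally show "expectation (\<lambda>\<omega>. \<bar>Y k \<omega>\<bar> powr (p / 2)) \<le> 2 powr (p / 2) * (2 * Zp 1 + 1) * A n * (real n * \<Delta> n) powr (- (p / 4))"
    by (simp add: algebra_simps)
qed

lemma V_char_limit:
  assumes c4: "0 < c4 \<nu>"
  shows "converges_in_char V (normal_plus_const (c4 \<nu> * a 0) 0)"
  unfolding converges_in_char_def
proof
  fix t
  define s where "s n = (c4 \<nu> * A n + 2 * (A n)\<^sup>2) / (real n * \<Delta> n)" for n
  define r where "r n = 2 powr (p / 2) * (2 * Zp 1 + 1) * A n * (real n * \<Delta> n) powr (- (p / 4))" for n
  define N where "N n = real (n - 1)" for n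
  \<comment> \<open>Of the variance \<open>c4 \<nu> * A n + 2 * (A n)\<^sup>2\<close> of a centred
    square only the part linear in the area survives; it is the jumps that provide it.\<close>
  have Ns: "(\<lambda>n. N n * s n) \<longlonglongrightarrow> c4 \<nu> * a 0"
  proof -
    have "(\<lambda>n. (N n * A n / (real n * \<Delta> n)) * (c4 \<nu> + 2 * A n)) \<longlonglongrightarrow> a 0 * (c4 \<nu> + 2 * 0)"
      unfolding N_def by (intro tendsto_intros NA_limit A_null)
    then show ?thesis by (simp add: s_def power2_eq_square field_simps)
  qed
  have s0: "s \<longlonglongrightarrow> 0"
  proof -
    have "(\<lambda>n. A n * (1 / (real n * \<Delta> n)) * (c4 \<nu> + 2 * A n)) \<longlonglongrightarrow> 0 * 0 * (c4 \<nu> + 2 * 0)"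
      by (intro tendsto_intros inverse_horizon A_null)
    moreover have "s = (\<lambda>n. A n * (1 / (real n * \<Delta> n)) * (c4 \<nu> + 2 * A n))"
      by (simp add: s_def fun_eq_iff power2_eq_square algebra_simps add_divide_distrib)
    ultimately show ?thesis by simp
  qed
  have Nr: "(\<lambda>n. N n * r n) \<longlonglongrightarrow> 0"
  proof -
    have "(\<lambda>n. 2 powr (p / 2) * (2 * Zp 1 + 1) * (N n * A n / (real n * \<Delta> n)) * (real n * \<Delta> n) powr (- (p / 4 - 1))) \<longlonglongrightarrow>
        2 powr (p / 2) * (2 * Zp 1 + 1) * a 0 * 0"
      unfolding N_def using p by (intro tendsto_mult tendsto_const NA_limit horizon_powr) auto
    moreover have "\<forall>\<^sub>F n in sequentially. 2 powr (p / 2) * (2 * Zp 1 + 1) * (N n * A n / (real n * \<Delta> n)) * (real n * \<Delta> n) powr (- (p / 4 - 1)) = N n * r n"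
      using eventually_gt_at_top[of "0::nat"]
    proof eventually_elim
      case (elim n)
      have "(real n * \<Delta> n) powr (- (p / 4 - 1)) = (real n * \<Delta> n) powr (- (p / 4)) * (real n * \<Delta> n)"
        using horizon_pos[OF elim] powr_add[of "real n * \<Delta> n" "- (p / 4)" 1] by simp
      then show ?case using horizon_pos[OF elim] mesh_pos[of n] elim by (simp add: r_def)
    qed
    ultimately show ?thesis by (simp add: Lim_transform_eventually)
  qed
  have bound: "\<forall>\<^sub>F n in sequentially. norm (char (distr M borel (V n)) t - complex_of_real (exp (- (N n * s n * t\<^sup>2 / 2))))
     \<le> t\<^sup>2 * (1 + \<bar>t\<bar>) * (N n * r n) + t ^ 4 * (N n * (s n)\<^sup>2)"
    using eventually_regular
  proof eventually_elim
    case (elim n)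
    note m = V_summand_moments[OF conjunct1[OF elim] conjunct2[OF elim]]
    have "indep_vars (\<lambda>_. borel) (\<lambda>k \<omega>. ((E (\<Delta> n) k \<omega>)\<^sup>2 - A n) / sqrt (real n * \<Delta> n)) {..<n - 1}"
      by (rule indep_vars_compose2[OF E_indep_vars[OF mesh_pos]]) (use elim in auto)
    from char_sum_normal_approx[OF this m(3) _ _ m(1) m(2) m(4)]
    show ?case using p unfolding V_def N_def s_def r_def by simp
  qed
  have "(\<lambda>n. t\<^sup>2 * (1 + \<bar>t\<bar>) * (N n * r n) + t ^ 4 * ((N n * s n) * s n)) \<longlonglongrightarrow> t\<^sup>2 * (1 + \<bar>t\<bar>) * 0 + t ^ 4 * ((c4 \<nu> * a 0) * 0)"
    by (intro tendsto_intros Nr Ns s0)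
  then have "(\<lambda>n. t\<^sup>2 * (1 + \<bar>t\<bar>) * (N n * r n) + t ^ 4 * (N n * (s n)\<^sup>2)) \<longlonglongrightarrow> 0"
    by (simp add: power2_eq_square mult.assoc)
  from Lim_null_comparison[OF bound this]
  have D: "(\<lambda>n. char (distr M borel (V n)) t - complex_of_real (exp (- (N n * s n * t\<^sup>2 / 2)))) \<longlonglongrightarrow> 0" .
  have "(\<lambda>n. complex_of_real (exp (- (N n * s n * t\<^sup>2 / 2)))) \<longlonglongrightarrow> complex_of_real (exp (- ((c4 \<nu> * a 0) * t\<^sup>2 / 2)))"
    by (intro tendsto_of_real tendsto_exp tendsto_minus tendsto_divide tendsto_mult tendsto_const Ns) auto
  from tendsto_add[OF D this]
  show "(\<lambda>n. char (distr M borel (V n)) t) \<longlonglongrightarrow> char (normal_plus_const (c4 \<nu> * a 0) 0) t"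
    using c4 a0_pos by (simp add: char_normal_plus_const)
qed

end

section \<open>The jump case: limit of the random normalization, negligible terms,
  conclusion\<close>

lemma (in prob_space) converges_in_probability_L1_bound:
  fixes R U :: "nat \<Rightarrow> 'a \<Rightarrow> real"
  assumes m: "\<And>n. random_variable borel (R n)"
    and ev: "\<forall>\<^sub>F n in sequentially. integrable M (U n) \<and> (AE \<omega> in M. \<bar>R n \<omega> - c\<bar> \<le> U n \<omega>) \<and> expectation (U n) \<le> v n"
    and lim: "v \<longlonglongrightarrow> 0"
  shows "converges_in_probability M R (\<lambda>_. c)"
proof (rule converges_in_probability_L1[OF m])
  show "\<forall>\<^sub>F n in sequentially. integrable M (U n) \<and> (AE \<omega> in M. \<bar>R n \<omega> - c\<bar> \<le> U n \<omega>)"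
    using ev by eventually_elim simp
  have "\<forall>\<^sub>F n in sequentially. norm (expectation (U n)) \<le> v n"
    using ev
  proof eventually_elim
    case (elim n)
    then have *: "AE \<omega> in M. \<bar>R n \<omega> - c\<bar> \<le> U n \<omega>" by simp
    have "AE \<omega> in M. 0 \<le> U n \<omega>" using * by eventually_elim linarith
    then have "0 \<le> expectation (U n)" by (rule integral_nonneg_AE)
    then show ?case using elim by simp
  qed
  then show "(\<lambda>n. expectation (U n)) \<longlonglongrightarrow> 0" by (rule Lim_null_comparison[OF _ lim])
qed

text \<open>The mixed terms \<open>x ^ 3 * y\<close> are split by the weighted arithmetic-geometric
  inequality into a small multiple of \<open>x ^ 4\<close> and a large multiple of
  \<open>x^2 * y^2\<close>. For the two parts of one step the latter has mean only
  \<open>A^2\<close>, and no sixth moments are called for.\<close>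

lemma fourth_power_diff_bound:
  fixes x y \<eta> :: real assumes "0 < \<eta>"
  shows "\<bar>(x - y) ^ 4 - (x ^ 4 + y ^ 4)\<bar> \<le> 2 * \<eta> * (x ^ 4 + y ^ 4) + (4 / \<eta> + 6) * (x\<^sup>2 * y\<^sup>2)"
proof -
  have *: "4 * \<bar>u * w\<bar> \<le> 2 * \<eta> * u\<^sup>2 + 2 / \<eta> * w\<^sup>2" for u w :: real
  proof -
    have "0 \<le> (\<eta> * \<bar>u\<bar> - \<bar>w\<bar>)\<^sup>2" by simp
    then have "2 * (\<eta> * \<bar>u * w\<bar>) \<le> \<eta>\<^sup>2 * u\<^sup>2 + w\<^sup>2"
      by (simp add: power2_diff power_mult_distrib abs_mult algebra_simps)
    then show ?thesis using assms by (simp add: field_simps power2_eq_square)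
  qed
  have "(x - y) ^ 4 - (x ^ 4 + y ^ 4) = - (4 * (x\<^sup>2 * (x * y))) + 6 * (x\<^sup>2 * y\<^sup>2) - 4 * (y\<^sup>2 * (x * y))"
    by (simp add: power2_eq_square power4_eq_xxxx algebra_simps)
  then have "\<bar>(x - y) ^ 4 - (x ^ 4 + y ^ 4)\<bar> \<le> 4 * \<bar>x\<^sup>2 * (x * y)\<bar> + 6 * (x\<^sup>2 * y\<^sup>2) + 4 * \<bar>y\<^sup>2 * (x * y)\<bar>"
  proof -
    have "\<bar>- (4 * u) + 6 * v - 4 * w\<bar> \<le> 4 * \<bar>u\<bar> + 6 * v + 4 * \<bar>w\<bar>" if "0 \<le> v" for u v w :: real
      using that by linarith
    then show ?thesis
      using \<open>(x - y) ^ 4 - (x ^ 4 + y ^ 4) = _\<close> mult_nonneg_nonneg[OF zero_le_power2[of x] zero_le_power2[of y]]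
      by presburger
  qed
  also have "\<dots> \<le> (2 * \<eta> * (x\<^sup>2)\<^sup>2 + 2 / \<eta> * (x * y)\<^sup>2) + 6 * (x\<^sup>2 * y\<^sup>2) + (2 * \<eta> * (y\<^sup>2)\<^sup>2 + 2 / \<eta> * (x * y)\<^sup>2)"
    by (intro add_mono * order_refl)
  also have "\<dots> = 2 * \<eta> * (x ^ 4 + y ^ 4) + (4 / \<eta> + 6) * (x\<^sup>2 * y\<^sup>2)"
    using assms by (simp add: power_mult_distrib field_simps flip: power_mult)
  finally show ?thesis .
qed

context trawl_sampling
begin

lemma eventually_A_pos: "\<forall>\<^sub>F n in sequentially. 0 < A n"
proof -
  have "\<forall>\<^sub>F n in sequentially. 0 < A n / \<Delta> n" using A_limit a0_pos by (rule order_tendstoD)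
  then show ?thesis by eventually_elim (metis mesh_pos zero_less_divide_iff less_asym)
qed

text \<open>The weak law with exponent \<open>p / 4 > 1\<close>: the moment of this order of a
  fourth power is a \<open>p\<close>-th moment of the basis, hence linear in the area.\<close>

lemma fourth_power_sum_L1:
  assumes n: "0 < n" "area (\<Delta> n) \<le> 1"
    and Y: "Y = E (\<Delta> n) \<or> Y = F (\<Delta> n)"
  defines "r \<equiv> 2 * Zp 1 * A n * (real n * \<Delta> n) powr (- (p / 4))"
  shows "expectation (\<lambda>\<omega>. \<bar>(\<Sum>k<n - 1. Y k \<omega> ^ 4 / (real n * \<Delta> n)) - real (n - 1) * (c4 \<nu> * A n + 3 * (A n)\<^sup>2) / (real n * \<Delta> n)\<bar>)
    \<le> 2 * (real (n - 1) * r) + sqrt (real (n - 1) * r)"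
proof -
  note hp = horizon_pos[OF n(1)]
  obtain B where B: "\<And>k. Y k = Lc (B k)" "\<And>k. small (B k)" "\<And>k. measure lborel (B k) = A n"
    using Y small_En_Lv[OF mesh_pos n(2)] measure_En[OF mesh_pos n(2)] measure_Lv[OF mesh_pos n(2)]
    unfolding E_def F_def A_def by (metis)
  have [measurable]: "random_variable borel (Y k)" for k using B by auto
  have ind: "indep_vars (\<lambda>_. borel) Y {..<n - 1}"
    using Y E_indep_vars[OF mesh_pos n(2)] F_indep_vars[OF mesh_pos n(2)] by auto
  define W where "W k \<omega> = Y k \<omega> ^ 4 / (real n * \<Delta> n)" for k \<omega>
  have indW: "indep_vars (\<lambda>_. borel) W {..<n - 1}"
    unfolding W_def by (rule indep_vars_compose2[OF ind]) auto
  have W0: "0 \<le> W k \<omega>" for k \<omega> using hp by (simp add: W_def)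
  have Wp: "W k \<omega> powr (p / 4) = \<bar>Y k \<omega>\<bar> powr p * (real n * \<Delta> n) powr (- (p / 4))" for k \<omega>
  proof (cases "Y k \<omega> = 0")
    case False
    have "Y k \<omega> ^ 4 = \<bar>Y k \<omega>\<bar> powr 4" using False by (simp add: powr_numeral power_even_abs)
    then have "W k \<omega> powr (p / 4) = (\<bar>Y k \<omega>\<bar> powr 4) powr (p / 4) / (real n * \<Delta> n) powr (p / 4)"
      using hp unfolding W_def by (simp only: powr_divide powr_ge_zero less_imp_le)
    then show ?thesis by (simp only: powr_powr powr_minus divide_inverse) simp
  qed (use p hp in \<open>simp add: W_def\<close>)
  have iW: "integrable M (\<lambda>\<omega>. W k \<omega> powr (p / 4))" for k
    unfolding Wp using integrable_Lc_powr[OF B(2)] by (simp add: B)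
  have rW: "expectation (\<lambda>\<omega>. W k \<omega> powr (p / 4)) \<le> r" for k
    unfolding Wp r_def using expectation_Lc_powr_le[OF B(2), of k] by (simp add: B mult_right_mono)
  have eW: "expectation (W k) = (c4 \<nu> * A n + 3 * (A n)\<^sup>2) / (real n * \<Delta> n)" for k
    unfolding W_def by (simp add: B fourth_moment_Lc[OF c4_integrable])
  show ?thesis
    using L1_weak_law(2)[OF indW W0 iW _ _ rW] p by (simp add: eW) (simp add: W_def)
qed

text \<open>The families of entering and leaving fourth powers depend on each other, but each obeys
  a weak law by itself, with the same limit, and \<open>Q_stat\<close> averages the two up to mixed
  terms.\<close>

lemma Q_limit:
  assumes c4: "0 < c4 \<nu>"
  shows "converges_in_probability M (\<lambda>n. Q_stat X n (\<Delta> n)) (\<lambda>_. c4 \<nu> * a 0)"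
proof -
  define N where "N n = real (n - 1)" for n
  define hz where "hz n = real n * \<Delta> n" for n
  define m where "m n = N n * (c4 \<nu> * A n + 3 * (A n)\<^sup>2) / hz n" for n
  define r where "r n = 2 * Zp 1 * A n * hz n powr (- (p / 4))" for n
  \<comment> \<open>This choice makes both \<open>\<eta> * A\<close> and \<open>A^2 / \<eta>\<close>
    negligible against \<open>A\<close>, which is what the two halves of the mixed-term bound
    require.\<close>
  define \<eta> where "\<eta> n = sqrt (A n)" for n
  define SE where "SE n \<omega> = (\<Sum>k<n - 1. E (\<Delta> n) k \<omega> ^ 4 / hz n)" for n \<omega>
  define SF where "SF n \<omega> = (\<Sum>k<n - 1. F (\<Delta> n) k \<omega> ^ 4 / hz n)" for n \<omega>
  define G where "G n k \<omega> = 2 * \<eta> n * (E (\<Delta> n) k \<omega> ^ 4 + F (\<Delta> n) k \<omega> ^ 4) +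
     (4 / \<eta> n + 6) * ((E (\<Delta> n) k \<omega>)\<^sup>2 * (F (\<Delta> n) k \<omega>)\<^sup>2)" for n k \<omega>
  define g where "g n = 4 * \<eta> n * (c4 \<nu> * A n + 3 * (A n)\<^sup>2) + (4 / \<eta> n + 6) * (A n)\<^sup>2" for n
  define U where "U n \<omega> = 1/2 * \<bar>SE n \<omega> - m n\<bar> + 1/2 * \<bar>SF n \<omega> - m n\<bar> + (\<Sum>k<n - 1. G n k \<omega>) / (2 * hz n) + \<bar>m n - c4 \<nu> * a 0\<bar>" for n \<omega>
  define v where "v n = 2 * (N n * r n) + sqrt (N n * r n) + N n * g n / (2 * hz n) + \<bar>m n - c4 \<nu> * a 0\<bar>" for n
  show ?thesis
  proof (rule converges_in_probability_L1_bound)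
    show "\<forall>\<^sub>F n in sequentially. integrable M (U n) \<and> (AE \<omega> in M. \<bar>Q_stat X n (\<Delta> n) \<omega> - c4 \<nu> * a 0\<bar> \<le> U n \<omega>) \<and> expectation (U n) \<le> v n"
      using eventually_regular eventually_A_pos
    proof eventually_elim
      case (elim n)
      then have n: "0 < n" "area (\<Delta> n) \<le> 1" "0 < A n" by auto
      have hz: "0 < hz n" using horizon_pos[OF n(1)] by (simp add: hz_def)
      have \<eta>: "0 < \<eta> n" using n by (simp add: \<eta>_def)
      note i4 = E_F_power_integrable[OF mesh_pos n(2), of 4]
      have iEF: "integrable M (\<lambda>\<omega>. (E (\<Delta> n) k \<omega>)\<^sup>2 * (F (\<Delta> n) k \<omega>)\<^sup>2)"
        "expectation (\<lambda>\<omega>. (E (\<Delta> n) k \<omega>)\<^sup>2 * (F (\<Delta> n) k \<omega>)\<^sup>2) = (A n)\<^sup>2" for k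
        using square_products(3,6)[OF mesh_pos n(2), of k k] C_zero[OF mesh_pos n(2), of k k] by (auto simp: A_def)
      have iG: "integrable M (G n k)" "expectation (G n k) = g n" for k
        unfolding G_def g_def using i4 iEF E_F_fourth_moment[OF mesh_pos n(2)] by (auto simp: A_def)
      have iS: "integrable M (SE n)" "integrable M (SF n)" unfolding SE_def SF_def using i4 by auto
      have iA: "integrable M (\<lambda>\<omega>. \<bar>SE n \<omega> - m n\<bar>)" "integrable M (\<lambda>\<omega>. \<bar>SF n \<omega> - m n\<bar>)"
        using iS by (auto intro!: integrable_abs Bochner_Integration.integrable_diff)
      have iU: "integrable M (U n)"
        unfolding U_def using iA iG by (intro Bochner_Integration.integrable_add integrable_mult_right integrable_divide Bochner_Integration.integrable_sum) auto
      have eU: "expectation (U n) = 1/2 * expectation (\<lambda>\<omega>. \<bar>SE n \<omega> - m n\<bar>) + 1/2 * expectation (\<lambda>\<omega>. \<bar>SF n \<omega> - m n\<bar>)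
          + N n * g n / (2 * hz n) + \<bar>m n - c4 \<nu> * a 0\<bar>"
      proof -
        have iSG: "integrable M (\<lambda>\<omega>. (\<Sum>k<n - 1. G n k \<omega>) / (2 * hz n))" using iG by auto
        have "expectation (\<lambda>\<omega>. (\<Sum>k<n - 1. G n k \<omega>) / (2 * hz n)) = N n * g n / (2 * hz n)"
          using iG by (simp add: Bochner_Integration.integral_sum N_def)
        then show ?thesis
          unfolding U_def using iA iSG
          by (subst Bochner_Integration.integral_add, (auto)[2],
              subst Bochner_Integration.integral_add, (auto)[2],
              subst Bochner_Integration.integral_add) (auto simp: prob_space)
      qed
      have b: "expectation (\<lambda>\<omega>. \<bar>SE n \<omega> - m n\<bar>) \<le> 2 * (N n * r n) + sqrt (N n * r n)"
        "expectation (\<lambda>\<omega>. \<bar>SF n \<omega> - m n\<bar>) \<le> 2 * (N n * r n) + sqrt (N n * r n)"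
        unfolding SE_def SF_def m_def N_def r_def hz_def using fourth_power_sum_L1[OF n(1,2)] by auto
      have ptw: "\<bar>1 / (2 * hz n) * (\<Sum>k<n - 1. (E (\<Delta> n) k \<omega> - F (\<Delta> n) k \<omega>) ^ 4) - c4 \<nu> * a 0\<bar> \<le> U n \<omega>" for \<omega>
      proof -
        let ?D = "\<Sum>k<n - 1. (E (\<Delta> n) k \<omega> - F (\<Delta> n) k \<omega>) ^ 4 - (E (\<Delta> n) k \<omega> ^ 4 + F (\<Delta> n) k \<omega> ^ 4)"
        have "\<bar>?D\<bar> \<le> (\<Sum>k<n - 1. G n k \<omega>)"
          unfolding G_def by (rule order_trans[OF sum_abs sum_mono]) (rule fourth_power_diff_bound[OF \<eta>])
        then have D: "\<bar>?D / (2 * hz n)\<bar> \<le> (\<Sum>k<n - 1. G n k \<omega>) / (2 * hz n)"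
          using hz by (simp add: abs_divide divide_right_mono)
        have "1 / (2 * hz n) * (\<Sum>k<n - 1. (E (\<Delta> n) k \<omega> - F (\<Delta> n) k \<omega>) ^ 4) =
           ?D / (2 * hz n) + 1/2 * SE n \<omega> + 1/2 * SF n \<omega>"
          using hz by (simp add: SE_def SF_def sum_subtractf sum.distrib sum_divide_distrib[symmetric] field_simps)
        then have "1 / (2 * hz n) * (\<Sum>k<n - 1. (E (\<Delta> n) k \<omega> - F (\<Delta> n) k \<omega>) ^ 4) - c4 \<nu> * a 0 =
           ?D / (2 * hz n) + 1/2 * (SE n \<omega> - m n) + 1/2 * (SF n \<omega> - m n) + (m n - c4 \<nu> * a 0)"
          by (simp add: diff_divide_distrib)
        moreover have "\<bar>d + 1/2 * u + 1/2 * w + z\<bar> \<le> 1/2 * \<bar>u\<bar> + 1/2 * \<bar>w\<bar> + g + \<bar>z\<bar>" if "\<bar>d\<bar> \<le> g" for d u w z g :: real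
          using that by linarith
        ultimately show ?thesis using D unfolding U_def by (simp only:)
      qed
      have "AE \<omega> in M. \<bar>Q_stat X n (\<Delta> n) \<omega> - c4 \<nu> * a 0\<bar> \<le> U n \<omega>"
        using increments_eq[OF n(2)]
      proof eventually_elim
        case (elim \<omega>)
        then show ?case using ptw[of \<omega>]
          by (simp add: Q_stat_def normalized_power_variation_def hz_def mult_ac)
      qed
      then show ?case using iU eU b unfolding v_def by auto
    qed
    have lim1: "(\<lambda>n. N n * A n / hz n) \<longlonglongrightarrow> a 0" unfolding N_def hz_def by (rule NA_limit)
    have mlim: "m \<longlonglongrightarrow> c4 \<nu> * a 0"
    proof -
      have "(\<lambda>n. (N n * A n / hz n) * (c4 \<nu> + 3 * A n)) \<longlonglongrightarrow> a 0 * (c4 \<nu> + 3 * 0)"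
        by (intro tendsto_intros lim1 A_null)
      then show ?thesis by (simp add: m_def[abs_def] power2_eq_square field_simps)
    qed
    have Nr: "(\<lambda>n. N n * r n) \<longlonglongrightarrow> 0"
    proof -
      have "(\<lambda>n. 2 * Zp 1 * (N n * A n / hz n) * hz n powr (- (p / 4 - 1))) \<longlonglongrightarrow> 2 * Zp 1 * a 0 * 0"
        using p unfolding hz_def by (intro tendsto_mult tendsto_const lim1[unfolded hz_def] horizon_powr) auto
      moreover have "\<forall>\<^sub>F n in sequentially. 2 * Zp 1 * (N n * A n / hz n) * hz n powr (- (p / 4 - 1)) = N n * r n"
        using eventually_gt_at_top[of "0::nat"]
      proof eventually_elim
        case (elim n)
        have hz: "0 < hz n" using horizon_pos[OF elim] by (simp add: hz_def)
        then have "hz n powr (- (p / 4 - 1)) = hz n powr (- (p / 4)) * hz n"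
          using powr_add[of "hz n" "- (p / 4)" 1] by simp
        then show ?case using hz by (simp add: r_def)
      qed
      ultimately show ?thesis by (simp add: Lim_transform_eventually)
    qed
    have \<eta>lim: "\<eta> \<longlonglongrightarrow> 0" unfolding \<eta>_def[abs_def] using tendsto_real_sqrt[OF A_null] by simp
    have Ng: "(\<lambda>n. N n * g n / (2 * hz n)) \<longlonglongrightarrow> 0"
    proof -
      have "(\<lambda>n. (N n * A n / hz n) * (2 * \<eta> n * (c4 \<nu> + 3 * A n) + 2 * \<eta> n + 3 * A n)) \<longlonglongrightarrow> a 0 * (2 * 0 * (c4 \<nu> + 3 * 0) + 2 * 0 + 3 * 0)"
        by (intro tendsto_intros lim1 A_null \<eta>lim)
      moreover have "\<forall>\<^sub>F n in sequentially. (N n * A n / hz n) * (2 * \<eta> n * (c4 \<nu> + 3 * A n) + 2 * \<eta> n + 3 * A n) = N n * g n / (2 * hz n)"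
        using eventually_A_pos
      proof eventually_elim
        case (elim n)
        then have "A n / \<eta> n = \<eta> n" by (simp add: \<eta>_def real_div_sqrt)
        moreover have "4 / \<eta> n * (A n)\<^sup>2 = 4 * A n * (A n / \<eta> n)" by (simp add: power2_eq_square)
        ultimately have "4 / \<eta> n * (A n)\<^sup>2 = 4 * A n * \<eta> n" by simp
        then have g: "g n = 2 * (A n * (2 * \<eta> n * (c4 \<nu> + 3 * A n) + 2 * \<eta> n + 3 * A n))"
          by (simp add: g_def power2_eq_square algebra_simps)
        show ?case unfolding g by simp
      qed
      ultimately show ?thesis by (simp add: Lim_transform_eventually)
    qed
    have "v \<longlonglongrightarrow> 2 * 0 + sqrt 0 + 0 + \<bar>c4 \<nu> * a 0 - c4 \<nu> * a 0\<bar>"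
      unfolding v_def[abs_def] by (intro tendsto_add tendsto_mult tendsto_const tendsto_real_sqrt tendsto_rabs tendsto_diff Nr Ng mlim)
    then show "v \<longlonglongrightarrow> 0" by simp
  qed measurable
qed

text \<open>The second moment of the sum is bounded up to a term of order \<open>N * A^2\<close>, so
  it vanishes after division by the horizon.\<close>

lemma square_difference_limit:
  assumes c4: "0 < c4 \<nu>"
  shows "converges_in_probability M
    (\<lambda>n \<omega>. (\<Sum>k<n - 1. (E (\<Delta> n) k \<omega>)\<^sup>2 - (F (\<Delta> n) k \<omega>)\<^sup>2) / sqrt (real n * \<Delta> n)) (\<lambda>_. 0)"
proof (rule converges_in_probability_L2)
  let ?v = "\<lambda>n. 2 * c4 \<nu> * measure lborel (T 0) * (1 / (real n * \<Delta> n)) + 4 * (real (n - 1) * A n / (real n * \<Delta> n)) * A n"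
  show "\<forall>\<^sub>F n in sequentially. integrable M (\<lambda>\<omega>. ((\<Sum>k<n - 1. (E (\<Delta> n) k \<omega>)\<^sup>2 - (F (\<Delta> n) k \<omega>)\<^sup>2) / sqrt (real n * \<Delta> n))\<^sup>2) \<and>
     expectation (\<lambda>\<omega>. ((\<Sum>k<n - 1. (E (\<Delta> n) k \<omega>)\<^sup>2 - (F (\<Delta> n) k \<omega>)\<^sup>2) / sqrt (real n * \<Delta> n))\<^sup>2) \<le> ?v n"
    using eventually_regular
  proof eventually_elim
    case (elim n)
    then have n: "0 < n" "area (\<Delta> n) \<le> 1" by auto
    have s: "(sqrt (real n * \<Delta> n))\<^sup>2 = real n * \<Delta> n" using horizon_pos[OF n(1)] by simp
    let ?D = "\<lambda>\<omega>. (\<Sum>k<n - 1. (E (\<Delta> n) k \<omega>)\<^sup>2 - (F (\<Delta> n) k \<omega>)\<^sup>2)\<^sup>2"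
    have "expectation ?D / (real n * \<Delta> n) \<le> (2 * c4 \<nu> * measure lborel (T 0) + 4 * real (n - 1) * (A n)\<^sup>2) / (real n * \<Delta> n)"
      using square_difference_bound(2)[OF mesh_pos n(2) less_imp_le[OF c4], of "n - 1"] horizon_pos[OF n(1)]
      by (intro divide_right_mono) (auto simp: A_def)
    also have "\<dots> = ?v n" by (simp add: add_divide_distrib power2_eq_square)
    finally show ?case
      using square_difference_bound(1)[OF mesh_pos n(2), of "n - 1"] by (simp add: power_divide s)
  qed
  have "?v \<longlonglongrightarrow> 2 * c4 \<nu> * measure lborel (T 0) * 0 + 4 * a 0 * 0"
    by (intro tendsto_intros inverse_horizon NA_limit A_null)
  then show "?v \<longlonglongrightarrow> 0" by simp
qed measurable

text \<open>A product \<open>E k * F k\<close> has variance \<open>A^2\<close>, one power of the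
  area less than what a square contributes when there are jumps.\<close>

lemma cross_term_limit:
  "converges_in_probability M
    (\<lambda>n \<omega>. (\<Sum>k<n - 1. E (\<Delta> n) k \<omega> * F (\<Delta> n) k \<omega>) / sqrt (real n * \<Delta> n)) (\<lambda>_. 0)"
proof (rule converges_in_probability_L2)
  let ?v = "\<lambda>n. (real (n - 1) * A n / (real n * \<Delta> n)) * A n"
  show "\<forall>\<^sub>F n in sequentially. integrable M (\<lambda>\<omega>. ((\<Sum>k<n - 1. E (\<Delta> n) k \<omega> * F (\<Delta> n) k \<omega>) / sqrt (real n * \<Delta> n))\<^sup>2) \<and>
     expectation (\<lambda>\<omega>. ((\<Sum>k<n - 1. E (\<Delta> n) k \<omega> * F (\<Delta> n) k \<omega>) / sqrt (real n * \<Delta> n))\<^sup>2) \<le> ?v n"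
    using eventually_regular
  proof eventually_elim
    case (elim n)
    then have n: "0 < n" "area (\<Delta> n) \<le> 1" by auto
    have s: "(sqrt (real n * \<Delta> n))\<^sup>2 = real n * \<Delta> n" using horizon_pos[OF n(1)] by simp
    note c = cross_term_orthogonal[OF mesh_pos n(2), of "\<lambda>x. x" "\<lambda>x. x" "n - 1"]
    show ?case
      using c E_F_power_integrable[OF mesh_pos n(2), of 2] E_F_expectation[OF mesh_pos n(2)] E_F_second_moment[OF mesh_pos n(2)]
      by (simp add: power_divide s A_def)
  qed
  have "?v \<longlonglongrightarrow> a 0 * 0"
    by (intro tendsto_intros NA_limit A_null)
  then show "?v \<longlonglongrightarrow> 0" by simp
qed measurable

theorem jump_case:
  assumes c4: "0 < c4 \<nu>" and rate: "(\<lambda>n. real n * \<Delta> n ^ 3) \<longlonglongrightarrow> \<mu>" and \<mu>: "0 \<le> \<mu>"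
  shows "converges_in_distribution M
    (\<lambda>n \<omega>. sqrt (real n * \<Delta> n / Q_stat X n (\<Delta> n) \<omega>) * (a_hat_0 X n (\<Delta> n) \<omega> - a 0))
    (normal_plus_const 1 (- \<phi> 0 / 2 * sqrt (\<mu> / (c4 \<nu> * a 0))))"
proof -
  define D where "D n \<omega> = (\<Sum>k<n - 1. (E (\<Delta> n) k \<omega>)\<^sup>2 - (F (\<Delta> n) k \<omega>)\<^sup>2) / sqrt (real n * \<Delta> n)" for n \<omega>
  define W where "W n \<omega> = (\<Sum>k<n - 1. E (\<Delta> n) k \<omega> * F (\<Delta> n) k \<omega>) / sqrt (real n * \<Delta> n)" for n \<omega>
  define \<beta> where "\<beta> n = real (n - 1) * A n / sqrt (real n * \<Delta> n) - sqrt (real n * \<Delta> n) * a 0" for n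
  \<comment> \<open>The coefficient of \<open>D\<close> undoes the replacement of half of the
    leaving squares by entering ones in \<open>V\<close>; that of \<open>W\<close> is half of the -2
    from squaring a difference.\<close>
  define R where "R n \<omega> = ((- 1 / 2) * D n \<omega> + (- 1) * W n \<omega>) + \<beta> n" for n \<omega>
  have [measurable]: "D n \<in> borel_measurable M" "W n \<in> borel_measurable M" for n unfolding D_def W_def by measurable
  have [measurable]: "R n \<in> borel_measurable M" for n unfolding R_def by measurable
  have \<beta>lim: "\<beta> \<longlonglongrightarrow> sqrt \<mu> * (- \<phi> 0 / 2)"
  proof -
    \<comment> \<open>The scaled bias in two parts: the first comes from the second-order expansion
      of the area, the second from dividing a sum of \<open>n - 1\<close> increments by
      \<open>n\<close>.\<close>
    have "(\<lambda>n. sqrt (real n * \<Delta> n ^ 3) * ((A n / \<Delta> n - a 0) / \<Delta> n) - A n * sqrt (1 / (real n * \<Delta> n))) \<longlonglongrightarrow>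
      sqrt \<mu> * (- \<phi> 0 / 2) - 0 * sqrt 0"
      by (intro tendsto_intros A_second_limit A_null tendsto_real_sqrt rate inverse_horizon)
    moreover have "\<forall>\<^sub>F n in sequentially. sqrt (real n * \<Delta> n ^ 3) * ((A n / \<Delta> n - a 0) / \<Delta> n) - A n * sqrt (1 / (real n * \<Delta> n)) = \<beta> n"
      using eventually_gt_at_top[of "0::nat"]
    proof eventually_elim
      case (elim n)
      have d: "0 < \<Delta> n" by (rule mesh_pos)
      define s where "s = sqrt (real n * \<Delta> n)"
      have s: "0 < s" "s * s = real n * \<Delta> n" using horizon_pos[OF elim] by (auto simp: s_def)
      have "sqrt (real n * \<Delta> n ^ 3) = sqrt ((real n * \<Delta> n) * (\<Delta> n)\<^sup>2)" by (simp add: power3_eq_cube power2_eq_square mult_ac)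
      then have s3: "sqrt (real n * \<Delta> n ^ 3) = s * \<Delta> n" using d unfolding s_def by (simp only: real_sqrt_mult real_sqrt_abs)
      have "s * (A n / \<Delta> n) = (s * s) * A n / (\<Delta> n * s)" using s(1) by simp
      also have "\<dots> = real n * A n / s" unfolding s(2) using d by simp
      finally have e: "s * (A n / \<Delta> n) = real n * A n / s" .
      have n1: "real (n - 1) = real n - 1" using elim by simp
      have "s * \<Delta> n * ((A n / \<Delta> n - a 0) / \<Delta> n) = s * (A n / \<Delta> n) - s * a 0" using d by (simp add: field_simps)
      then show ?case
        unfolding s3 \<beta>_def real_sqrt_divide s_def[symmetric] e n1 by (simp add: diff_divide_distrib algebra_simps)
    qed
    ultimately show ?thesis by (simp add: Lim_transform_eventually)
  qed
  have R: "converges_in_probability M R (\<lambda>_. ((- 1 / 2) * 0 + (- 1) * 0) + sqrt \<mu> * (- \<phi> 0 / 2))"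
    unfolding R_def
    by (intro converges_in_probability_add converges_in_probability_cmult converges_in_probability_const \<beta>lim)
      (use square_difference_limit[OF c4] cross_term_limit in \<open>simp_all add: D_def[abs_def] W_def[abs_def]\<close>)
  have "converges_in_distribution M
    (\<lambda>n \<omega>. sqrt (real n * \<Delta> n / Q_stat X n (\<Delta> n) \<omega>) * (a_hat_0 X n (\<Delta> n) \<omega> - a 0))
    (normal_plus_const ((c4 \<nu> * a 0) / (c4 \<nu> * a 0)) ((((- 1 / 2) * 0 + (- 1) * 0) + sqrt \<mu> * (- \<phi> 0 / 2)) / sqrt (c4 \<nu> * a 0)))"
  proof (rule converges_in_distribution_studentized[OF _ _ _ _ _ _ V_char_limit[OF c4] R Q_limit[OF c4]])
    show "\<forall>\<^sub>F n in sequentially. AE \<omega> in M. sqrt (real n * \<Delta> n / Q_stat X n (\<Delta> n) \<omega>) * (a_hat_0 X n (\<Delta> n) \<omega> - a 0) =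
       (V n \<omega> + R n \<omega>) * (1 / sqrt (Q_stat X n (\<Delta> n) \<omega>))"
      using eventually_regular
    proof eventually_elim
      case (elim n)
      then have n: "0 < n" "area (\<Delta> n) \<le> 1" by auto
      show ?case using increments_eq[OF n(2)]
      proof eventually_elim
        case (elim \<omega>)
        define s where "s = sqrt (real n * \<Delta> n)"
        have s: "0 < s" "s * s = real n * \<Delta> n" using horizon_pos[OF n(1)] by (auto simp: s_def)
        define SE SF SW where "SE = (\<Sum>k<n - 1. (E (\<Delta> n) k \<omega>)\<^sup>2)" and "SF = (\<Sum>k<n - 1. (F (\<Delta> n) k \<omega>)\<^sup>2)"
          and "SW = (\<Sum>k<n - 1. E (\<Delta> n) k \<omega> * F (\<Delta> n) k \<omega>)"
        have "a_hat_0 X n (\<Delta> n) \<omega> = 1 / (2 * (s * s)) * (\<Sum>k<n - 1. (E (\<Delta> n) k \<omega> - F (\<Delta> n) k \<omega>)\<^sup>2)"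
          unfolding a_hat_0_def normalized_power_variation_def s(2) using elim by (simp add: mult_ac)
        also have "(\<Sum>k<n - 1. (E (\<Delta> n) k \<omega> - F (\<Delta> n) k \<omega>)\<^sup>2) = SE + SF - 2 * SW"
          by (simp add: SE_def SF_def SW_def power2_diff sum.distrib sum_subtractf sum_distrib_left mult.assoc)
        finally have ah: "a_hat_0 X n (\<Delta> n) \<omega> = 1 / (2 * (s * s)) * (SE + SF - 2 * SW)" .
        have VR: "V n \<omega> = (SE - real (n - 1) * A n) / s" "D n \<omega> = (SE - SF) / s" "W n \<omega> = SW / s"
          unfolding V_def D_def W_def s_def[symmetric]
          by (simp_all add: SE_def SF_def SW_def sum_subtractf sum_divide_distrib[symmetric])
        have "s * (a_hat_0 X n (\<Delta> n) \<omega> - a 0) = V n \<omega> + R n \<omega>"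
          unfolding ah R_def VR \<beta>_def s_def[symmetric] using s(1) by (simp add: field_simps)
        \<comment> \<open>The identity persists where \<open>Q_stat\<close> is 0, since both sides
          are then 0 by the convention for division.\<close>
        then show ?case by (simp add: real_sqrt_divide s_def[symmetric])
      qed
    qed
  qed (use c4 a0_pos in auto)
  moreover have "(((- 1 / 2) * 0 + (- 1) * 0) + sqrt \<mu> * (- \<phi> 0 / 2)) / sqrt (c4 \<nu> * a 0) = - \<phi> 0 / 2 * sqrt (\<mu> / (c4 \<nu> * a 0))"
    by (simp add: real_sqrt_divide)
  moreover have "(c4 \<nu> * a 0) / (c4 \<nu> * a 0) = 1" using c4 a0_pos by simp
  ultimately show ?thesis by (simp only:)
qed

end

section \<open>Gaussian variables\<close>

context prob_space
begin

text \<open>Scaling a standard normal variable, rather than naming a density, includes the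
  degenerate case \<open>v = 0\<close>, which occurs for sets of area 0.\<close>

lemma gaussian_distr:
  assumes [measurable]: "random_variable borel Y" and v: "0 \<le> v"
    and char: "\<And>t. char (distr M borel Y) t = complex_of_real (exp (- (v * t\<^sup>2 / 2)))"
  shows "distr M borel Y = distr std_normal_distribution borel (\<lambda>x. sqrt v * x)"
proof (rule Levy_uniqueness)
  interpret S: real_distribution std_normal_distribution by (rule real_dist_normal_dist)
  show "real_distribution (distr std_normal_distribution borel (\<lambda>x. sqrt v * x))" by simp
  have "char (distr std_normal_distribution borel (\<lambda>x. sqrt v * x)) t = char std_normal_distribution (t * sqrt v)" for t
    by (simp add: char_def integral_distr mult_ac)
  then show "char (distr M borel Y) = char (distr std_normal_distribution borel (\<lambda>x. sqrt v * x))"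
    using v by (simp add: fun_eq_iff char char_std_normal_distribution power_mult_distrib mult_ac)
qed simp

lemma gaussian_moments:
  assumes [measurable]: "random_variable borel Y" and v: "0 \<le> v"
    and char: "\<And>t. char (distr M borel Y) t = complex_of_real (exp (- (v * t\<^sup>2 / 2)))"
  shows "integrable M (\<lambda>\<omega>. Y \<omega> ^ k)"
    and "expectation (\<lambda>\<omega>. Y \<omega> ^ k) = sqrt v ^ k * (LINT x|std_normal_distribution. x ^ k)"
proof -
  note d = gaussian_distr[OF assms]
  have "integrable (distr M borel Y) (\<lambda>x. x ^ k)"
    unfolding d by (subst integrable_distr_eq) (auto simp: power_mult_distrib integrable_std_normal_distribution_moment)
  then show "integrable M (\<lambda>\<omega>. Y \<omega> ^ k)" by (subst (asm) integrable_distr_eq) auto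
  have "(LINT x|distr M borel Y. x ^ k) = sqrt v ^ k * (LINT x|std_normal_distribution. x ^ k)"
    unfolding d by (subst integral_distr) (auto simp: power_mult_distrib)
  then show "expectation (\<lambda>\<omega>. Y \<omega> ^ k) = sqrt v ^ k * (LINT x|std_normal_distribution. x ^ k)"
    by (subst (asm) integral_distr) auto
qed

end

lemma std_normal_moments:
  "(LINT x|std_normal_distribution. x ^ 1) = 0"
  "(LINT x|std_normal_distribution. x ^ 2) = 1"
  "(LINT x|std_normal_distribution. x ^ 4) = 3"
  "(LINT x|std_normal_distribution. x ^ 6) = 15"
  "(LINT x|std_normal_distribution. x ^ 8) = 105"
  using integral_std_normal_distribution_moment_odd[of 1] std_normal_distribution_even_moments(1)[of 1]
    std_normal_distribution_even_moments(1)[of 2] std_normal_distribution_even_moments(1)[of 3]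
    std_normal_distribution_even_moments(1)[of 4]
  by (simp_all add: fact_numeral)

text \<open>One infinite product serves all sample sizes, so that limits in \<open>n\<close> concern
  sequences on a single space.\<close>

definition gauss_space :: "(nat \<Rightarrow> real) measure" where
  "gauss_space = PiM UNIV (\<lambda>_. std_normal_distribution)"

interpretation gauss: prob_space gauss_space
  unfolding gauss_space_def by (intro prob_space_PiM prob_space_normal_density) simp

lemma gauss_measurable [measurable]: "(\<lambda>g. g k) \<in> borel_measurable gauss_space"
proof -
  have "(\<lambda>g. g k) \<in> measurable gauss_space std_normal_distribution"
    unfolding gauss_space_def by (rule measurable_component_singleton) simp
  then show ?thesis by simp
qed

lemma gauss_distr: "distr gauss_space borel (\<lambda>g. g k) = std_normal_distribution"
proof -
  have "distr gauss_space borel (\<lambda>g. g k) = distr gauss_space std_normal_distribution (\<lambda>g. g k)"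
    by (rule distr_cong) auto
  also have "\<dots> = std_normal_distribution"
    unfolding gauss_space_def by (rule distr_PiM_component) (auto intro: prob_space_normal_density)
  finally show ?thesis .
qed

lemma gauss_indep_vars: "gauss.indep_vars (\<lambda>_. borel) (\<lambda>k g. g k) I"
proof (rule gauss.indep_vars_subset)
  show "gauss.indep_vars (\<lambda>_. borel) (\<lambda>k g. g k) UNIV"
  proof (subst gauss.indep_vars_iff_distr_eq_PiM')
    have "distr gauss_space (\<Pi>\<^sub>M i\<in>UNIV. borel) (\<lambda>x. \<lambda>i\<in>UNIV. x i) = distr gauss_space gauss_space (\<lambda>x. x)"
      by (rule distr_cong) (auto simp: gauss_space_def intro!: sets_PiM_cong)
    then show "distr gauss_space (\<Pi>\<^sub>M i\<in>UNIV. borel) (\<lambda>x. \<lambda>i\<in>UNIV. x i) = (\<Pi>\<^sub>M i\<in>UNIV. distr gauss_space borel (\<lambda>x. x i))"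
      by (simp add: gauss_distr distr_id2 gauss_space_def[symmetric])
  qed auto
qed simp

lemma gauss_power:
  "integrable gauss_space (\<lambda>g. g k ^ j)"
  "(LINT g|gauss_space. g k ^ j) = (LINT x|std_normal_distribution. x ^ j)"
proof -
  have "integrable (distr gauss_space borel (\<lambda>g. g k)) (\<lambda>x. x ^ j)"
    unfolding gauss_distr by (rule integrable_std_normal_distribution_moment)
  then show "integrable gauss_space (\<lambda>g. g k ^ j)" by (subst (asm) integrable_distr_eq) auto
  have "(LINT x|distr gauss_space borel (\<lambda>g. g k). x ^ j) = (LINT x|std_normal_distribution. x ^ j)"
    unfolding gauss_distr ..
  then show "(LINT g|gauss_space. g k ^ j) = (LINT x|std_normal_distribution. x ^ j)"
    by (subst (asm) integral_distr) auto
qed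

lemma gauss_char:
  "(CLINT g|gauss_space. iexp (\<Sum>k<N. d k * g k)) = complex_of_real (exp (- ((\<Sum>k<N. (d k)\<^sup>2) / 2)))"
proof -
  have ind: "gauss.indep_vars (\<lambda>_. borel) (\<lambda>k g. d k * g k) {..<N}"
    by (rule gauss.indep_vars_compose2[OF gauss_indep_vars]) auto
  have c: "char (distr gauss_space borel (\<lambda>g. d k * g k)) 1 = complex_of_real (exp (- ((d k)\<^sup>2 / 2)))" for k
  proof -
    have "char (distr gauss_space borel (\<lambda>g. d k * g k)) 1 = char (distr gauss_space borel (\<lambda>g. g k)) (d k)"
      by (simp add: char_def integral_distr)
    then show ?thesis by (simp add: gauss_distr char_std_normal_distribution)
  qed
  have "(CLINT g|gauss_space. iexp (\<Sum>k<N. d k * g k)) = char (distr gauss_space borel (\<lambda>g. \<Sum>k<N. d k * g k)) 1"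
    by (simp add: char_def integral_distr)
  also have "\<dots> = (\<Prod>k<N. complex_of_real (exp (- ((d k)\<^sup>2 / 2))))"
    by (simp only: gauss.char_distr_sum[OF ind] c)
  also have "\<dots> = complex_of_real (\<Prod>k<N. exp (- ((d k)\<^sup>2 / 2)))" by (simp only: of_real_prod)
  also have "(\<Prod>k<N. exp (- ((d k)\<^sup>2 / 2))) = exp (- ((\<Sum>k<N. (d k)\<^sup>2) / 2))"
    by (simp add: exp_sum[symmetric] sum_negf sum_divide_distrib)
  finally show ?thesis .
qed

text \<open>\<open>c i\<close> counts the occurrences of the index \<open>i\<close> in the product.
  For two different increasing pairs some index occurs exactly once, and by independence its
  vanishing first moment is a factor of the mean.\<close>

lemma gauss_products_orthogonal:
  assumes "k < l" "k' < l'" "(k, l) \<noteq> (k', l')"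
  shows "(LINT g|gauss_space. (g k * g l) * (g k' * g l')) = 0"
proof -
  define c where "c i = (if i = k then 1 else 0) + (if i = l then 1 else 0) + (if i = k' then 1 else 0) + (if i = l' then 1 else (0::nat))" for i
  define I where "I = {k, l, k', l'}"
  have fin: "finite I" by (simp add: I_def)
  have ind: "gauss.indep_vars (\<lambda>_. borel) (\<lambda>i g. g i ^ c i) I"
    by (rule gauss.indep_vars_compose2[OF gauss_indep_vars]) auto
  have "(\<Prod>i\<in>I. g i ^ c i) = (g k * g l) * (g k' * g l')" for g :: "nat \<Rightarrow> real"
  proof -
    have "(\<Prod>i\<in>I. g i ^ c i) = (\<Prod>i\<in>I. (if i = k then g i else 1) * (if i = l then g i else 1) * (if i = k' then g i else 1) * (if i = l' then g i else 1))"
      by (intro prod.cong) (auto simp: c_def power_add)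
    also have "\<dots> = g k * g l * g k' * g l'"
      using fin by (simp add: prod.distrib) (simp add: I_def)
    finally show ?thesis by (simp add: mult.assoc)
  qed
  then have "(LINT g|gauss_space. (g k * g l) * (g k' * g l')) = (LINT g|gauss_space. (\<Prod>i\<in>I. g i ^ c i))" by simp
  also have "\<dots> = (\<Prod>i\<in>I. LINT g|gauss_space. g i ^ c i)"
    by (rule gauss.indep_vars_lebesgue_integral[OF fin ind]) (rule gauss_power)
  also have "\<dots> = 0"
  proof -
    have "\<exists>i\<in>I. c i = 1" using assms by (auto simp: c_def I_def)
    then obtain i where "i \<in> I" "c i = 1" by blast
    then have "(LINT g|gauss_space. g i ^ c i) = 0" using std_normal_moments(1) by (simp only: gauss_power)
    with \<open>i \<in> I\<close> fin show ?thesis by (intro prod_zero) auto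
  qed
  finally show ?thesis .
qed

text \<open>A strictly triangular form contains no squares, and the products
  \<open>g k * g l\<close> with \<open>k < l\<close> are orthonormal.\<close>

lemma gauss_quadratic_form:
  fixes c :: "nat \<Rightarrow> nat \<Rightarrow> real"
  assumes c0: "\<And>k l. l \<le> k \<Longrightarrow> c k l = 0"
  shows "integrable gauss_space (\<lambda>g. (\<Sum>k<N. \<Sum>l<N. c k l * (g k * g l))\<^sup>2)"
    and "(LINT g|gauss_space. (\<Sum>k<N. \<Sum>l<N. c k l * (g k * g l))\<^sup>2) = (\<Sum>k<N. \<Sum>l<N. (c k l)\<^sup>2)"
proof -
  define I where "I = {..<N} \<times> {..<N}"
  define Y where "Y = (\<lambda>(k, l) (g :: nat \<Rightarrow> real). c k l * (g k * g l))"
  have Y: "(\<Sum>k<N. \<Sum>l<N. c k l * (g k * g l)) = (\<Sum>q\<in>I. Y q g)" for g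
    unfolding I_def Y_def by (simp add: sum.cartesian_product split_def)
  have i4: "integrable gauss_space (\<lambda>g. (g k * g l) * (g k' * g l'))" for k l k' l'
  proof (rule Bochner_Integration.integrable_bound)
    show "integrable gauss_space (\<lambda>g. g k ^ 4 + g l ^ 4 + g k' ^ 4 + g l' ^ 4)"
      by (intro Bochner_Integration.integrable_add gauss_power)
    show "AE g in gauss_space. norm ((g k * g l) * (g k' * g l')) \<le> norm (g k ^ 4 + g l ^ 4 + g k' ^ 4 + g l' ^ 4)"
    proof (rule AE_I2)
      fix g :: "nat \<Rightarrow> real"
      have *: "2 * \<bar>u * w\<bar> \<le> u\<^sup>2 + w\<^sup>2" for u w :: real
        using sum_squares_bound[of "\<bar>u\<bar>" "\<bar>w\<bar>"] by (simp add: abs_mult mult.assoc)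
      have "4 * \<bar>(g k * g l) * (g k' * g l')\<bar> \<le> 2 * ((g k * g l)\<^sup>2 + (g k' * g l')\<^sup>2)"
        using *[of "g k * g l" "g k' * g l'"] by simp
      also have "\<dots> = 2 * \<bar>(g k)\<^sup>2 * (g l)\<^sup>2\<bar> + 2 * \<bar>(g k')\<^sup>2 * (g l')\<^sup>2\<bar>"
        by (simp add: power_mult_distrib)
      also have "\<dots> \<le> ((g k)\<^sup>2)\<^sup>2 + ((g l)\<^sup>2)\<^sup>2 + (((g k')\<^sup>2)\<^sup>2 + ((g l')\<^sup>2)\<^sup>2)"
        by (intro add_mono *)
      finally have "4 * \<bar>(g k * g l) * (g k' * g l')\<bar> \<le> g k ^ 4 + g l ^ 4 + g k' ^ 4 + g l' ^ 4"
        by (simp flip: power_mult)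
      then show "norm ((g k * g l) * (g k' * g l')) \<le> norm (g k ^ 4 + g l ^ 4 + g k' ^ 4 + g l' ^ 4)"
        unfolding real_norm_def by linarith
    qed
  qed measurable
  have iY: "integrable gauss_space (\<lambda>g. Y q g * Y q' g)" for q q' :: "nat \<times> nat"
  proof -
    obtain k l k' l' where q: "q = (k, l)" "q' = (k', l')" by (metis surj_pair)
    have "(\<lambda>g. Y q g * Y q' g) = (\<lambda>g. (c k l * c k' l') * ((g k * g l) * (g k' * g l')))" by (simp add: Y_def q mult_ac)
    then show ?thesis using i4 by simp
  qed
  show "integrable gauss_space (\<lambda>g. (\<Sum>k<N. \<Sum>l<N. c k l * (g k * g l))\<^sup>2)"
    unfolding Y by (rule expectation_square_sum(1)) (rule iY)
  have "(LINT g|gauss_space. (\<Sum>q\<in>I. Y q g)\<^sup>2) = (\<Sum>q\<in>I. LINT g|gauss_space. (Y q g)\<^sup>2)"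
  proof (rule expectation_square_sum_orthogonal)
    fix q q' :: "nat \<times> nat" assume "q \<noteq> q'"
    obtain k l k' l' where q: "q = (k, l)" "q' = (k', l')" by (metis surj_pair)
    have "(LINT g|gauss_space. Y q g * Y q' g) = (LINT g|gauss_space. (c k l * c k' l') * ((g k * g l) * (g k' * g l')))"
      by (simp add: Y_def q mult_ac)
    also have "\<dots> = (c k l * c k' l') * (LINT g|gauss_space. (g k * g l) * (g k' * g l'))" by simp
    also have "\<dots> = 0"
    proof (cases "k < l \<and> k' < l'")
      case True
      then show ?thesis using gauss_products_orthogonal[of k l k' l'] \<open>q \<noteq> q'\<close> q by auto
    qed (use c0 in \<open>auto simp: not_less\<close>)
    finally show "(LINT g|gauss_space. Y q g * Y q' g) = 0" .
  qed (auto simp: I_def intro: iY)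
  also have "\<dots> = (\<Sum>q\<in>I. (case q of (k, l) \<Rightarrow> (c k l)\<^sup>2))"
  proof (intro sum.cong refl)
    fix q :: "nat \<times> nat" assume "q \<in> I"
    obtain k l where q: "q = (k, l)" by (metis surj_pair)
    show "(LINT g|gauss_space. (Y q g)\<^sup>2) = (case q of (k, l) \<Rightarrow> (c k l)\<^sup>2)"
    proof (cases "k < l")
      case True
      have "gauss.indep_vars (\<lambda>_. borel) (\<lambda>i g. (g i)\<^sup>2) UNIV"
        by (rule gauss.indep_vars_compose2[OF gauss_indep_vars]) auto
      from gauss.indep_vars_expectation_mult(2)[OF this, of k l]
      have "(LINT g|gauss_space. (g k)\<^sup>2 * (g l)\<^sup>2) = 1" using True gauss_power std_normal_moments(2) by simp
      then show ?thesis by (simp add: Y_def q power_mult_distrib)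
    qed (use c0 in \<open>simp add: Y_def q\<close>)
  qed
  also have "\<dots> = (\<Sum>k<N. \<Sum>l<N. (c k l)\<^sup>2)" unfolding I_def by (simp add: sum.cartesian_product)
  finally show "(LINT g|gauss_space. (\<Sum>k<N. \<Sum>l<N. c k l * (g k * g l))\<^sup>2) = (\<Sum>k<N. \<Sum>l<N. (c k l)\<^sup>2)"
    unfolding Y .
qed

text \<open>
  Randomizing the argument of the characteristic function by an independent Gaussian vector turns
  it into the Laplace transform of the squared norm; by Fubini, the same transform belongs to the
  quadratic form of the covariance matrix, which is thereby equal in law to the squared norm.
\<close>

lemma square_norm_distr_eq:
  fixes \<delta> :: "nat \<Rightarrow> 'a \<Rightarrow> real" and q :: "(nat \<Rightarrow> real) \<Rightarrow> real"
  assumes "prob_space M" and [measurable]: "\<And>k. \<delta> k \<in> borel_measurable M" "q \<in> borel_measurable gauss_space"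
    and q0: "\<And>g. 0 \<le> q g" and q_scale: "\<And>r g. q (\<lambda>k. r * g k) = r\<^sup>2 * q g"
    and char: "\<And>g. (CLINT \<omega>|M. iexp (\<Sum>k<N. g k * \<delta> k \<omega>)) = complex_of_real (exp (- (q g / 2)))"
  shows "distr M borel (\<lambda>\<omega>. \<Sum>k<N. (\<delta> k \<omega>)\<^sup>2) = distr gauss_space borel q"
proof (rule distr_eq_if_Laplace_eq)
  interpret prob_space M by fact
  interpret P: pair_prob_space M gauss_space ..
  fix m :: nat
  \<comment> \<open>Chosen so that averaging over the Gaussian vector yields the Laplace transform
    at \<open>m\<close>: \<open>r\<^sup>2 / 2 = real m\<close>.\<close>
  define r where "r = sqrt (2 * real m)"
  have r2: "r\<^sup>2 = 2 * real m" by (simp add: r_def)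
  have i: "integrable (M \<Otimes>\<^sub>M gauss_space) (case_prod (\<lambda>\<omega> g. iexp (\<Sum>k<N. r * g k * \<delta> k \<omega>)))"
    by (rule P.integrable_const_bound[where B=1]) (auto simp: split_def)
  have inner: "(CLINT g|gauss_space. iexp (\<Sum>k<N. r * g k * \<delta> k \<omega>)) = complex_of_real (exp (- (real m * (\<Sum>k<N. (\<delta> k \<omega>)\<^sup>2))))" for \<omega>
  proof -
    have "(CLINT g|gauss_space. iexp (\<Sum>k<N. (r * \<delta> k \<omega>) * g k)) = complex_of_real (exp (- ((\<Sum>k<N. (r * \<delta> k \<omega>)\<^sup>2) / 2)))"
      by (rule gauss_char)
    also have "(\<Sum>k<N. (r * \<delta> k \<omega>)\<^sup>2) / 2 = real m * (\<Sum>k<N. (\<delta> k \<omega>)\<^sup>2)"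
      by (simp add: power_mult_distrib r2 flip: sum_distrib_left)
    finally show ?thesis by (simp add: mult_ac)
  qed
  have outer: "(CLINT \<omega>|M. iexp (\<Sum>k<N. r * g k * \<delta> k \<omega>)) = complex_of_real (exp (- (real m * q g)))" for g
    using char[of "\<lambda>k. r * g k"] by (simp add: q_scale r2)
  have "complex_of_real (LINT \<omega>|M. exp (- (real m * (\<Sum>k<N. (\<delta> k \<omega>)\<^sup>2)))) =
      (CLINT \<omega>|M. (CLINT g|gauss_space. iexp (\<Sum>k<N. r * g k * \<delta> k \<omega>)))"
    unfolding inner by (simp only: integral_complex_of_real)
  also have "\<dots> = (CLINT g|gauss_space. (CLINT \<omega>|M. iexp (\<Sum>k<N. r * g k * \<delta> k \<omega>)))"
    by (rule P.Fubini_integral[OF i, symmetric])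
  also have "\<dots> = complex_of_real (LINT g|gauss_space. exp (- (real m * q g)))"
    unfolding outer by (simp only: integral_complex_of_real)
  finally show "(LINT \<omega>|M. exp (- (real m * (\<Sum>k<N. (\<delta> k \<omega>)\<^sup>2)))) = (LINT g|gauss_space. exp (- (real m * q g)))"
    by (simp only: of_real_eq_iff)
qed (use assms in \<open>auto intro: sum_nonneg gauss.prob_space_axioms\<close>)

text \<open>Codes pairs of indices by single numbers, because independence of the basis is
  formulated for sequences of disjoint sets.\<close>

lemma sum_div_mod:
  fixes f :: "nat \<Rightarrow> nat \<Rightarrow> 'a::comm_monoid_add"
  assumes "0 < n"
  shows "(\<Sum>i<m * n. f (i div n) (i mod n)) = (\<Sum>k<m. \<Sum>l<n. f k l)"
proof -
  have "(\<Sum>i<m * n. f (i div n) (i mod n)) = (\<Sum>k<m. \<Sum>i\<in>{k * n..<k * n + n}. f (i div n) (i mod n))"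
    by (rule sum.nat_group[symmetric])
  also have "\<dots> = (\<Sum>k<m. \<Sum>l<n. f k l)"
  proof (rule sum.cong[OF refl])
    fix k
    have "(\<Sum>i\<in>{k * n..<k * n + n}. f (i div n) (i mod n)) = (\<Sum>l\<in>{0..<n}. f ((l + k * n) div n) ((l + k * n) mod n))"
      using sum.shift_bounds_nat_ivl[of "\<lambda>i. f (i div n) (i mod n)" 0 "k * n" n] by (simp add: add.commute)
    also have "\<dots> = (\<Sum>l<n. f k l)"
      by (rule sum.cong) (auto simp: atLeast0LessThan)
    finally show "(\<Sum>i\<in>{k * n..<k * n + n}. f (i div n) (i mod n)) = (\<Sum>l<n. f k l)" .
  qed
  finally show ?thesis .
qed

section \<open>The Gaussian basis\<close>

context levy_basis_moments
begin

lemma Lc_UN: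
  assumes "finite I" "\<And>i. i \<in> I \<Longrightarrow> small (A i)" "disjoint_family_on A I" "small (\<Union>i\<in>I. A i)"
  shows "AE \<omega> in M. Lc (\<Union>i\<in>I. A i) \<omega> = (\<Sum>i\<in>I. Lc (A i) \<omega>)"
proof -
  have L: "AE \<omega> in M. L (\<Union>i\<in>I. A i) \<omega> = (\<Sum>i\<in>I. L (A i) \<omega>)"
    by (rule L_UN) (use assms in auto)
  have "expectation (L (\<Union>i\<in>I. A i)) = expectation (\<lambda>\<omega>. \<Sum>i\<in>I. L (A i) \<omega>)"
    by (rule integral_cong_AE) (use assms L in auto)
  also have "\<dots> = (\<Sum>i\<in>I. expectation (L (A i)))"
    using assms(2) by (intro Bochner_Integration.integral_sum) auto
  finally show ?thesis using L by (simp add: Lc_def sum_subtractf)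
qed

context
  assumes gaussian: "\<nu> = null_measure borel"
begin

lemma c4_gaussian: "c4 \<nu> = 0"
  by (simp add: c4_def gaussian)

lemma levy_exponent_gaussian:
  "levy_exponent \<gamma> b \<nu> z = \<i> * complex_of_real (\<gamma> * z) - complex_of_real (b\<^sup>2 * z\<^sup>2 / 2)"
  unfolding levy_exponent_def set_lebesgue_integral_def by (simp add: gaussian)

lemma char_Lc_gaussian:
  assumes B: "small B"
  shows "char (distr M borel (Lc B)) t = complex_of_real (exp (- (measure lborel B * t\<^sup>2 / 2)))"
proof -
  have ch: "char (distr M borel (\<lambda>\<omega>. L B \<omega> - measure lborel B * \<gamma>)) t = complex_of_real (exp (- ((measure lborel B * b\<^sup>2) * t\<^sup>2 / 2)))"
    if "small B" for B t
  proof -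
    have "char (distr M borel (\<lambda>\<omega>. L B \<omega> - measure lborel B * \<gamma>)) t = iexp (- (t * (measure lborel B * \<gamma>))) * char (distr M borel (L B)) t"
      using that by (simp add: char_def integral_distr right_diff_distrib exp_diff exp_minus divide_inverse mult.commute)
    also have "\<dots> = exp (- complex_of_real ((measure lborel B * b\<^sup>2) * t\<^sup>2 / 2))"
      using that by (simp add: char_eq levy_exponent_gaussian exp_add[symmetric] algebra_simps)
    finally show ?thesis by (simp add: exp_of_real[symmetric])
  qed
  have Lc: "Lc B = (\<lambda>\<omega>. L B \<omega> - measure lborel B * \<gamma>)" if "small B" for B
  proof -
    have "expectation (\<lambda>\<omega>. L B \<omega> - measure lborel B * \<gamma>) = 0"
      using gaussian_moments(2)[OF _ _ ch[OF that], of 1] that std_normal_moments(1) by simp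
    then have "expectation (L B) = measure lborel B * \<gamma>" using that by (simp add: prob_space)
    then show ?thesis by (simp add: Lc_def[abs_def])
  qed
  \<comment> \<open>The variance of a unit set, once from the exponent and once from the
    normalization, determines the Gaussian coefficient.\<close>
  have "b\<^sup>2 = 1"
  proof -
    have s: "small (rect 0 0 1)" by (rule small_rect) auto
    have "expectation (\<lambda>\<omega>. (Lc (rect 0 0 1) \<omega>)\<^sup>2) = b\<^sup>2"
      unfolding Lc[OF s] using gaussian_moments(2)[OF _ _ ch[OF s], of 2] std_normal_moments(2) by (simp add: measure_rect)
    then show ?thesis using variance_Lc[OF s] by (simp add: measure_rect)
  qed
  then show ?thesis using ch[OF B, of t] Lc[OF B] by simp
qed

lemma Lc_gaussian_moments:
  assumes "small B"
  shows "integrable M (\<lambda>\<omega>. Lc B \<omega> ^ k)"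
    and "expectation (\<lambda>\<omega>. Lc B \<omega> ^ k) = sqrt (measure lborel B) ^ k * (LINT x|std_normal_distribution. x ^ k)"
  using gaussian_moments[OF _ _ char_Lc_gaussian[OF assms]] assms by auto

end

end

section \<open>Increments of a Gaussian trawl process as a Gaussian vector\<close>

context trawl_array
begin

context
  fixes h :: real and N :: nat assumes h: "0 < h" and area_le: "area h \<le> 1"
begin

text \<open>
  The cells partition the union of all entering and leaving sets; index \<open>N\<close> collects the points
  which were present from the start, respectively have not left at the end.
\<close>

definition cell :: "nat \<Rightarrow> nat \<Rightarrow> (real \<times> real) set" where
  "cell k l = (if k < N then En h k else - (\<Union>k<N. En h k)) \<inter> (if l < N then Lv h l else - (\<Union>l<N. Lv h l))
    \<inter> (\<Union>k<N. En h k \<union> Lv h k)"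

lemma small_cell: assumes "k \<le> N" "l \<le> N" shows "small (cell k l)"
proof -
  have "En h k \<in> sets borel" "Lv h k \<in> sets borel" for k
    using En_Lv_finite_borel[of h k] by (auto simp: finite_borel_sets_def)
  then have m: "cell k l \<in> sets borel" unfolding cell_def by auto
  consider "k < N" | "l < N" | "k = N" "l = N" using assms by linarith
  then show ?thesis
  proof cases
    case 1
    then show ?thesis by (intro small_mono[OF small_En_Lv(1)[OF h area_le, of k] _ m]) (auto simp: cell_def)
  next
    case 2
    then show ?thesis by (intro small_mono[OF small_En_Lv(2)[OF h area_le, of l] _ m]) (auto simp: cell_def)
  next
    case 3
    then have "cell k l = {}" by (auto simp: cell_def)
    then show ?thesis by (simp add: small_def)
  qed
qed

lemma cell_disjoint:
  assumes "k \<le> N" "l \<le> N" "k' \<le> N" "l' \<le> N" "(k, l) \<noteq> (k', l')"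
  shows "cell k l \<inter> cell k' l' = {}"
proof -
  have "x \<in> cell k l \<Longrightarrow> x \<in> cell k' l' \<Longrightarrow> k = k'" for x
    using En_disjoint[OF h area_le, of k k'] assms by (auto simp: cell_def split: if_splits)
  moreover have "x \<in> cell k l \<Longrightarrow> x \<in> cell k' l' \<Longrightarrow> l = l'" for x
    using Lv_disjoint[OF h area_le, of l l'] assms by (auto simp: cell_def split: if_splits)
  ultimately show ?thesis using assms(5) by blast
qed

lemma En_cells: "k < N \<Longrightarrow> En h k = (\<Union>l<Suc N. cell k l)"
  and Lv_cells: "l < N \<Longrightarrow> Lv h l = (\<Union>k<Suc N. cell k l)"
proof -
  assume k: "k < N"
  show "En h k = (\<Union>l<Suc N. cell k l)"
  proof
    show "(\<Union>l<Suc N. cell k l) \<subseteq> En h k" using k by (auto simp: cell_def)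
    show "En h k \<subseteq> (\<Union>l<Suc N. cell k l)"
    proof
      fix x assume x: "x \<in> En h k"
      show "x \<in> (\<Union>l<Suc N. cell k l)"
      proof (cases "\<exists>l<N. x \<in> Lv h l")
        case True
        then obtain l where "l < N" "x \<in> Lv h l" by blast
        then show ?thesis using x k by (intro UN_I[of l]) (auto simp: cell_def)
      next
        case False
        then show ?thesis using x k by (intro UN_I[of N]) (auto simp: cell_def)
      qed
    qed
  qed
next
  assume l: "l < N"
  show "Lv h l = (\<Union>k<Suc N. cell k l)"
  proof
    show "(\<Union>k<Suc N. cell k l) \<subseteq> Lv h l" using l by (auto simp: cell_def)
    show "Lv h l \<subseteq> (\<Union>k<Suc N. cell k l)"
    proof
      fix x assume x: "x \<in> Lv h l"
      show "x \<in> (\<Union>k<Suc N. cell k l)"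
      proof (cases "\<exists>k<N. x \<in> En h k")
        case True
        then obtain k where "k < N" "x \<in> En h k" by blast
        then show ?thesis using x l by (intro UN_I[of k]) (auto simp: cell_def)
      next
        case False
        then show ?thesis using x l by (intro UN_I[of N]) (auto simp: cell_def)
      qed
    qed
  qed
qed

lemma E_cells: "k < N \<Longrightarrow> AE \<omega> in M. E h k \<omega> = (\<Sum>l<Suc N. Lc (cell k l) \<omega>)"
  and F_cells: "l < N \<Longrightarrow> AE \<omega> in M. F h l \<omega> = (\<Sum>k<Suc N. Lc (cell k l) \<omega>)"
  and measure_cells: "k < N \<Longrightarrow> (\<Sum>l<Suc N. measure lborel (cell k l)) = area h"
    "l < N \<Longrightarrow> (\<Sum>k<Suc N. measure lborel (cell k l)) = area h"
proof -
  assume k: "k < N"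
  have s: "\<And>l. l \<in> {..<Suc N} \<Longrightarrow> small (cell k l)" using small_cell k by simp
  have d: "disjoint_family_on (cell k) {..<Suc N}"
    unfolding disjoint_family_on_def by (intro ballI impI cell_disjoint) (use k in auto)
  have u: "small (\<Union>l<Suc N. cell k l)" using small_En_Lv(1)[OF h area_le, of k] by (simp only: En_cells[OF k])
  show "AE \<omega> in M. E h k \<omega> = (\<Sum>l<Suc N. Lc (cell k l) \<omega>)"
    using Lc_UN[OF _ s d u] by (simp only: E_def En_cells[OF k] finite_lessThan)
  show "(\<Sum>l<Suc N. measure lborel (cell k l)) = area h"
    using measure_UN_finite_borel[OF _ _ d] s measure_En[OF h area_le, of k]
    by (simp only: En_cells[OF k] finite_lessThan small_finite_borel)
next
  assume l: "l < N"
  have s: "\<And>k. k \<in> {..<Suc N} \<Longrightarrow> small (cell k l)" using small_cell l by simp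
  have d: "disjoint_family_on (\<lambda>k. cell k l) {..<Suc N}"
    unfolding disjoint_family_on_def by (intro ballI impI cell_disjoint) (use l in auto)
  have u: "small (\<Union>k<Suc N. cell k l)" using small_En_Lv(2)[OF h area_le, of l] by (simp only: Lv_cells[OF l])
  show "AE \<omega> in M. F h l \<omega> = (\<Sum>k<Suc N. Lc (cell k l) \<omega>)"
    using Lc_UN[OF _ s d u] by (simp only: F_def Lv_cells[OF l] finite_lessThan)
  show "(\<Sum>k<Suc N. measure lborel (cell k l)) = area h"
    using measure_UN_finite_borel[OF _ _ d] s measure_Lv[OF h area_le, of l]
    by (simp only: Lv_cells[OF l] finite_lessThan small_finite_borel)
qed

text \<open>The variance of the sum of the \<open>g k * (E h k - F h k)\<close>: each family is
  uncorrelated within itself, and the covariances between the two families enter with a minus sign,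
  twice.\<close>

definition quad :: "(nat \<Rightarrow> real) \<Rightarrow> real" where
  "quad g = 2 * area h * (\<Sum>k<N. (g k)\<^sup>2) - 2 * (\<Sum>k<N. \<Sum>l<N. C h k l * (g k * g l))"

text \<open>Each cell carries the weight of its entering step minus that of its leaving step, the
  index \<open>N\<close> standing for no such step and weight 0. In this form the quadratic form is
  visibly nonnegative.\<close>

lemma quad_cells:
  defines "ext \<equiv> \<lambda>g k. if k < N then g k else (0::real)"
  shows "quad g = (\<Sum>k<Suc N. \<Sum>l<Suc N. measure lborel (cell k l) * (ext g k - ext g l)\<^sup>2)"
proof -
  let ?m = "\<lambda>k l. measure lborel (cell k l)"
  have C: "C h k l = ?m k l" if "k < N" "l < N" for k l
    unfolding C_def cell_def using that by (intro arg_cong[where f="measure lborel"]) auto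
  have "(\<Sum>k<Suc N. \<Sum>l<Suc N. ?m k l * (ext g k - ext g l)\<^sup>2) =
     (\<Sum>k<Suc N. (ext g k)\<^sup>2 * (\<Sum>l<Suc N. ?m k l)) + (\<Sum>k<Suc N. \<Sum>l<Suc N. (ext g l)\<^sup>2 * ?m k l)
     - 2 * (\<Sum>k<Suc N. \<Sum>l<Suc N. ?m k l * (ext g k * ext g l))"
    unfolding sum_distrib_left sum.distrib[symmetric] sum_subtractf[symmetric]
    by (intro sum.cong refl) (simp add: power2_eq_square algebra_simps)
  also have "(\<Sum>k<Suc N. \<Sum>l<Suc N. (ext g l)\<^sup>2 * ?m k l) = (\<Sum>l<Suc N. (ext g l)\<^sup>2 * (\<Sum>k<Suc N. ?m k l))"
    unfolding sum_distrib_left by (rule sum.swap)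
  also have "(\<Sum>k<Suc N. (ext g k)\<^sup>2 * (\<Sum>l<Suc N. ?m k l)) = area h * (\<Sum>k<N. (g k)\<^sup>2)"
  proof -
    have "(\<Sum>k<Suc N. (ext g k)\<^sup>2 * (\<Sum>l<Suc N. ?m k l)) = (\<Sum>k<N. (ext g k)\<^sup>2 * (\<Sum>l<Suc N. ?m k l))"
      by (simp add: ext_def)
    also have "\<dots> = (\<Sum>k<N. area h * (g k)\<^sup>2)"
      by (intro sum.cong refl) (use measure_cells(1) in \<open>simp only: lessThan_iff ext_def if_True mult.commute\<close>)
    finally show ?thesis by (simp only: sum_distrib_left)
  qed
  also have "(\<Sum>l<Suc N. (ext g l)\<^sup>2 * (\<Sum>k<Suc N. ?m k l)) = area h * (\<Sum>k<N. (g k)\<^sup>2)"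
  proof -
    have "(\<Sum>l<Suc N. (ext g l)\<^sup>2 * (\<Sum>k<Suc N. ?m k l)) = (\<Sum>l<N. (ext g l)\<^sup>2 * (\<Sum>k<Suc N. ?m k l))"
      by (simp add: ext_def)
    also have "\<dots> = (\<Sum>l<N. area h * (g l)\<^sup>2)"
      by (intro sum.cong refl) (use measure_cells(2) in \<open>simp only: lessThan_iff ext_def if_True mult.commute\<close>)
    finally show ?thesis by (simp only: sum_distrib_left)
  qed
  also have "(\<Sum>k<Suc N. \<Sum>l<Suc N. ?m k l * (ext g k * ext g l)) = (\<Sum>k<N. \<Sum>l<N. C h k l * (g k * g l))"
  proof -
    have "(\<Sum>k<Suc N. \<Sum>l<Suc N. ?m k l * (ext g k * ext g l)) = (\<Sum>k<N. \<Sum>l<N. ?m k l * (ext g k * ext g l))"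
      by (simp add: ext_def)
    also have "\<dots> = (\<Sum>k<N. \<Sum>l<N. C h k l * (g k * g l))"
      by (intro sum.cong refl) (simp add: C ext_def)
    finally show ?thesis .
  qed
  finally show ?thesis unfolding quad_def by simp
qed

text \<open>Regrouping by cells turns a combination of dependent increments into a weighted sum of
  independent normal variables, whose characteristic function is a product.\<close>

lemma increments_char_gaussian:
  assumes gaussian: "\<nu> = null_measure borel"
  shows "(CLINT \<omega>|M. iexp (\<Sum>k<N. g k * (E h k \<omega> - F h k \<omega>))) = complex_of_real (exp (- (quad g / 2)))"
proof -
  define ext where "ext k = (if k < N then g k else 0)" for k
  define n where "n = Suc N"
  have n0: "0 < n" by (simp add: n_def)
  define D where "D i = cell (i div n) (i mod n)" for i
  define w where "w i = ext (i div n) - ext (i mod n)" for i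
  have idx: "i div n \<le> N" "i mod n \<le> N" if "i < n * n" for i
    using that less_mult_imp_div_less[of i n n] mod_less_divisor[OF n0, of i] by (auto simp: n_def)
  have sD: "small (D i)" if "i < n * n" for i
    unfolding D_def using idx[OF that] by (rule small_cell)
  have dD: "disjoint_family_on D {..<n * n}"
    unfolding disjoint_family_on_def
  proof (intro ballI impI)
    fix i j assume ij: "i \<in> {..<n * n}" "j \<in> {..<n * n}" "i \<noteq> j"
    have "(i div n, i mod n) \<noteq> (j div n, j mod n)"
      using ij(3) by (metis div_mult_mod_eq prod.inject)
    then show "D i \<inter> D j = {}" unfolding D_def using idx ij by (intro cell_disjoint) auto
  qed
  have ind: "indep_vars (\<lambda>_. borel) (\<lambda>i \<omega>. w i * Lc (D i) \<omega>) {..<n * n}"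
    by (rule indep_vars_compose2[OF Lc_indep_vars[OF _ dD]]) (use sD in auto)
  have [measurable]: "(\<lambda>\<omega>. \<Sum>i<n * n. w i * Lc (D i) \<omega>) \<in> borel_measurable M"
    using sD by (intro borel_measurable_sum borel_measurable_times borel_measurable_const Lc_measurable) auto
  have "AE \<omega> in M. \<forall>k\<in>{..<N}. E h k \<omega> = (\<Sum>l<Suc N. Lc (cell k l) \<omega>)"
    by (intro AE_finite_allI E_cells) auto
  moreover have "AE \<omega> in M. \<forall>l\<in>{..<N}. F h l \<omega> = (\<Sum>k<Suc N. Lc (cell k l) \<omega>)"
    by (intro AE_finite_allI F_cells) auto
  ultimately have AE: "AE \<omega> in M. (\<Sum>k<N. g k * (E h k \<omega> - F h k \<omega>)) = (\<Sum>i<n * n. w i * Lc (D i) \<omega>)"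
  proof eventually_elim
    case (elim \<omega>)
    have "(\<Sum>i<n * n. w i * Lc (D i) \<omega>) = (\<Sum>k<n. \<Sum>l<n. (ext k - ext l) * Lc (cell k l) \<omega>)"
      unfolding w_def D_def by (rule sum_div_mod[OF n0])
    also have "\<dots> = (\<Sum>k<n. ext k * (\<Sum>l<n. Lc (cell k l) \<omega>)) - (\<Sum>k<n. \<Sum>l<n. ext l * Lc (cell k l) \<omega>)"
      by (simp only: sum_distrib_left left_diff_distrib sum_subtractf)
    also have "(\<Sum>k<n. \<Sum>l<n. ext l * Lc (cell k l) \<omega>) = (\<Sum>l<n. ext l * (\<Sum>k<n. Lc (cell k l) \<omega>))"
      unfolding sum_distrib_left by (rule sum.swap)
    also have "(\<Sum>k<n. ext k * (\<Sum>l<n. Lc (cell k l) \<omega>)) = (\<Sum>k<N. g k * E h k \<omega>)"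
    proof -
      have "(\<Sum>k<n. ext k * (\<Sum>l<n. Lc (cell k l) \<omega>)) = (\<Sum>k<N. ext k * (\<Sum>l<n. Lc (cell k l) \<omega>))"
        unfolding n_def by (simp add: ext_def)
      also have "\<dots> = (\<Sum>k<N. g k * E h k \<omega>)"
        by (intro sum.cong refl) (use elim(1) in \<open>simp only: n_def ext_def lessThan_iff if_True Ball_def\<close>)
      finally show ?thesis .
    qed
    also have "(\<Sum>l<n. ext l * (\<Sum>k<n. Lc (cell k l) \<omega>)) = (\<Sum>k<N. g k * F h k \<omega>)"
    proof -
      have "(\<Sum>l<n. ext l * (\<Sum>k<n. Lc (cell k l) \<omega>)) = (\<Sum>l<N. ext l * (\<Sum>k<n. Lc (cell k l) \<omega>))"
        unfolding n_def by (simp add: ext_def)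
      also have "\<dots> = (\<Sum>k<N. g k * F h k \<omega>)"
        by (intro sum.cong refl) (use elim(2) in \<open>simp only: n_def ext_def lessThan_iff if_True Ball_def\<close>)
      finally show ?thesis .
    qed
    finally show ?case by (simp add: right_diff_distrib sum_subtractf)
  qed
  have c: "char (distr M borel (\<lambda>\<omega>. w i * Lc (D i) \<omega>)) 1 = complex_of_real (exp (- (measure lborel (D i) * (w i)\<^sup>2 / 2)))" if "i < n * n" for i
  proof -
    have "char (distr M borel (\<lambda>\<omega>. w i * Lc (D i) \<omega>)) 1 = char (distr M borel (Lc (D i))) (w i)"
      using sD[OF that] by (simp add: char_def integral_distr)
    then show ?thesis by (simp add: char_Lc_gaussian[OF gaussian sD[OF that]])
  qed
  have "(CLINT \<omega>|M. iexp (\<Sum>k<N. g k * (E h k \<omega> - F h k \<omega>))) = (CLINT \<omega>|M. iexp (\<Sum>i<n * n. w i * Lc (D i) \<omega>))"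
  proof -
    have cong: "(CLINT \<omega>|M. iexp (S \<omega>)) = (CLINT \<omega>|M. iexp (S' \<omega>))"
      if [measurable]: "S \<in> borel_measurable M" "S' \<in> borel_measurable M" and "AE \<omega> in M. S \<omega> = S' \<omega>" for S S' :: "'w \<Rightarrow> real"
      by (intro integral_cong_AE) (use that(3) in \<open>auto elim!: eventually_mono\<close>)
    show ?thesis by (rule cong[OF _ _ AE]) measurable
  qed
  also have "\<dots> = char (distr M borel (\<lambda>\<omega>. \<Sum>i<n * n. w i * Lc (D i) \<omega>)) 1"
    by (simp add: char_def integral_distr)
  also have "\<dots> = (\<Prod>i<n * n. char (distr M borel (\<lambda>\<omega>. w i * Lc (D i) \<omega>)) 1)"
    by (rule char_distr_sum[OF ind])
  also have "\<dots> = complex_of_real (\<Prod>i<n * n. exp (- (measure lborel (D i) * (w i)\<^sup>2 / 2)))"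
    by (simp add: c)
  also have "(\<Prod>i<n * n. exp (- (measure lborel (D i) * (w i)\<^sup>2 / 2))) = exp (- ((\<Sum>i<n * n. measure lborel (D i) * (w i)\<^sup>2) / 2))"
    by (simp add: exp_sum[symmetric] sum_negf sum_divide_distrib)
  also have "(\<Sum>i<n * n. measure lborel (D i) * (w i)\<^sup>2) = (\<Sum>k<n. \<Sum>l<n. measure lborel (cell k l) * (ext k - ext l)\<^sup>2)"
    unfolding w_def D_def by (rule sum_div_mod[OF n0])
  also have "\<dots> = quad g" unfolding quad_cells n_def ext_def ..
  finally show ?thesis .
qed

lemma increments_square_norm_distr:
  assumes gaussian: "\<nu> = null_measure borel"
  shows "distr M borel (\<lambda>\<omega>. \<Sum>k<N. (E h k \<omega> - F h k \<omega>)\<^sup>2) = distr gauss_space borel quad"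
proof (rule square_norm_distr_eq[OF prob_space_axioms])
  show "quad \<in> borel_measurable gauss_space" unfolding quad_def by measurable
  show "0 \<le> quad g" for g unfolding quad_cells by (intro sum_nonneg) auto
  show "quad (\<lambda>k. r * g k) = r\<^sup>2 * quad g" for r g
    unfolding quad_def by (simp add: power_mult_distrib sum_distrib_left power2_eq_square algebra_simps)
qed (use increments_char_gaussian[OF gaussian] in auto)

end

end

section \<open>Gaussian case: limit law of the sum of squared increments\<close>

lemma abs_square_minus_one_cubed:
  defines "c3 \<equiv> LINT x|std_normal_distribution. \<bar>x\<^sup>2 - 1\<bar> powr 3"
  shows "integrable gauss_space (\<lambda>g. \<bar>(g k)\<^sup>2 - 1\<bar> powr 3)"
    and "(LINT g|gauss_space. \<bar>(g k)\<^sup>2 - 1\<bar> powr 3) = c3" and "0 \<le> c3"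
proof -
  have "integrable std_normal_distribution (\<lambda>x. x ^ 6 + 3 * x ^ 4 + 3 * x ^ 2 + 1)"
  proof -
    interpret real_distribution std_normal_distribution by (rule real_dist_normal_dist)
    show ?thesis
      by (intro Bochner_Integration.integrable_add integrable_mult_right integrable_std_normal_distribution_moment) simp
  qed
  then have i: "integrable std_normal_distribution (\<lambda>x. \<bar>x\<^sup>2 - 1\<bar> powr 3)"
  proof (rule Bochner_Integration.integrable_bound)
    show "AE x in std_normal_distribution. norm (\<bar>x\<^sup>2 - 1\<bar> powr 3) \<le> norm (x ^ 6 + 3 * x ^ 4 + 3 * x ^ 2 + 1)"
    proof (rule AE_I2)
      fix x :: real
      have "\<bar>x\<^sup>2 - 1\<bar> \<le> x\<^sup>2 + 1" using zero_le_power2[of x] by linarith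
      then have "\<bar>x\<^sup>2 - 1\<bar> ^ 3 \<le> (x\<^sup>2 + 1) ^ 3" by (intro power_mono) auto
      also have "(x\<^sup>2 + 1) ^ 3 = x ^ 6 + 3 * x ^ 4 + 3 * x ^ 2 + 1"
        by (simp add: power3_eq_cube algebra_simps flip: power_add)
      finally have "\<bar>x\<^sup>2 - 1\<bar> powr 3 \<le> x ^ 6 + 3 * x ^ 4 + 3 * x ^ 2 + 1"
        by (cases "\<bar>x\<^sup>2 - 1\<bar> = 0") (auto simp: powr_numeral zero_le_even_power)
      then show "norm (\<bar>x\<^sup>2 - 1\<bar> powr 3) \<le> norm (x ^ 6 + 3 * x ^ 4 + 3 * x ^ 2 + 1)"
        using powr_ge_zero[of "\<bar>x\<^sup>2 - 1\<bar>" 3] unfolding real_norm_def by linarith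
    qed
  qed simp
  then have "integrable (distr gauss_space borel (\<lambda>g. g k)) (\<lambda>x. \<bar>x\<^sup>2 - 1\<bar> powr 3)" unfolding gauss_distr .
  then show "integrable gauss_space (\<lambda>g. \<bar>(g k)\<^sup>2 - 1\<bar> powr 3)" by (subst (asm) integrable_distr_eq) auto
  have "(LINT x|distr gauss_space borel (\<lambda>g. g k). \<bar>x\<^sup>2 - 1\<bar> powr 3) = c3" unfolding gauss_distr c3_def ..
  then show "(LINT g|gauss_space. \<bar>(g k)\<^sup>2 - 1\<bar> powr 3) = c3" by (subst (asm) integral_distr) auto
  show "0 \<le> c3" unfolding c3_def by simp
qed

context trawl_sampling
begin

lemma A_ratio_square: "(\<lambda>n. (A n / \<Delta> n)\<^sup>2 * (real (n - 1) / real n)) \<longlonglongrightarrow> (a 0)\<^sup>2"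
  using tendsto_mult[OF tendsto_power[OF A_limit, of 2] pred_over_limit] by simp

lemma inverse_n: "(\<lambda>n. 1 / real n) \<longlonglongrightarrow> 0"
  by real_asymp

text \<open>The diagonal of the quadratic form. The square of a standard normal variable has
  variance 2, whence \<open>2 * (a 0)\<^sup>2\<close>; its third absolute central moment need only
  be finite, as the weights are of order \<open>1 / sqrt n\<close>.\<close>

lemma gauss_sum_char_limit:
  "gauss.converges_in_char (\<lambda>n g. \<Sum>k<n - 1. (A n / \<Delta> n) / sqrt (real n) * ((g k)\<^sup>2 - 1)) (normal_plus_const (2 * (a 0)\<^sup>2) 0)"
  unfolding gauss.converges_in_char_def
proof
  fix t
  define c3 where "c3 = (LINT x|std_normal_distribution. \<bar>x\<^sup>2 - 1\<bar> powr 3)"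
  define u where "u n = (A n / \<Delta> n) / sqrt (real n)" for n
  define s where "s n = 2 * (u n)\<^sup>2" for n
  define r where "r n = u n ^ 3 * c3" for n
  define N where "N n = real (n - 1)" for n
  let ?S = "\<lambda>n g. \<Sum>k<n - 1. u n * ((g k)\<^sup>2 - 1)"
  have u0: "0 \<le> u n" for n using A_nonneg[of n] mesh_pos[of n] by (simp add: u_def)
  have u2: "(u n)\<^sup>2 = (A n / \<Delta> n)\<^sup>2 / real n" for n by (simp add: u_def power_divide power_mult_distrib)
  have Ns: "(\<lambda>n. N n * s n) \<longlonglongrightarrow> 2 * (a 0)\<^sup>2"
    using tendsto_mult_left[OF A_ratio_square, of 2] by (simp add: N_def s_def u2 mult_ac)
  have ulim: "u \<longlonglongrightarrow> 0"
  proof -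
    have "(\<lambda>n. (A n / \<Delta> n) * sqrt (1 / real n)) \<longlonglongrightarrow> a 0 * sqrt 0"
      by (intro tendsto_mult A_limit tendsto_real_sqrt inverse_n)
    then show ?thesis by (simp add: u_def[abs_def] real_sqrt_divide)
  qed
  have s0: "s \<longlonglongrightarrow> 0" unfolding s_def[abs_def] by (auto intro!: tendsto_eq_intros ulim)
  have Nr: "(\<lambda>n. N n * r n) \<longlonglongrightarrow> 0"
  proof -
    have "(\<lambda>n. (N n * s n) * u n * (c3 / 2)) \<longlonglongrightarrow> (2 * (a 0)\<^sup>2) * 0 * (c3 / 2)"
      by (intro tendsto_mult Ns ulim tendsto_const)
    then show ?thesis by (simp add: s_def r_def power3_eq_cube power2_eq_square mult_ac)
  qed
  have bound: "norm (char (distr gauss_space borel (?S n)) t - complex_of_real (exp (- (N n * s n * t\<^sup>2 / 2))))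
     \<le> t\<^sup>2 * (1 + \<bar>t\<bar>) * (N n * r n) + t ^ 4 * (N n * (s n)\<^sup>2)" for n
    unfolding N_def
  proof (rule gauss.char_sum_normal_approx[where q=3])
    show "gauss.indep_vars (\<lambda>_. borel) (\<lambda>k g. u n * ((g k)\<^sup>2 - 1)) {..<n - 1}"
      by (rule gauss.indep_vars_compose2[OF gauss_indep_vars]) auto
    have p3: "\<bar>u n * ((g k)\<^sup>2 - 1)\<bar> powr 3 = u n ^ 3 * \<bar>(g k)\<^sup>2 - 1\<bar> powr 3" for g :: "nat \<Rightarrow> real" and k
      using u0[of n] by (cases "u n = 0") (auto simp: abs_mult powr_mult powr_numeral)
    show "integrable gauss_space (\<lambda>g. \<bar>u n * ((g k)\<^sup>2 - 1)\<bar> powr 3)" for k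
      unfolding p3 using abs_square_minus_one_cubed(1) by simp
    show "gauss.expectation (\<lambda>g. \<bar>u n * ((g k)\<^sup>2 - 1)\<bar> powr 3) \<le> r n" for k
      unfolding p3 r_def c3_def using abs_square_minus_one_cubed(2) by simp
    show "gauss.expectation (\<lambda>g. u n * ((g k)\<^sup>2 - 1)) = 0" for k
      using gauss_power[of k 2] std_normal_moments(2) by (simp add: gauss.prob_space)
    have "(u n * ((g k)\<^sup>2 - 1))\<^sup>2 = (u n)\<^sup>2 * (g k ^ 4 - 2 * (g k)\<^sup>2 + 1)" for g :: "nat \<Rightarrow> real" and k
      by (simp add: power2_eq_square power4_eq_xxxx algebra_simps)
    then show "gauss.expectation (\<lambda>g. (u n * ((g k)\<^sup>2 - 1))\<^sup>2) = s n" for k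
      using gauss_power[of k 4] gauss_power[of k 2] std_normal_moments(2,3)
      by (simp add: s_def gauss.prob_space)
  qed auto
  have "(\<lambda>n. t\<^sup>2 * (1 + \<bar>t\<bar>) * (N n * r n) + t ^ 4 * ((N n * s n) * s n)) \<longlonglongrightarrow> t\<^sup>2 * (1 + \<bar>t\<bar>) * 0 + t ^ 4 * ((2 * (a 0)\<^sup>2) * 0)"
    by (intro tendsto_intros Nr Ns s0)
  then have "(\<lambda>n. t\<^sup>2 * (1 + \<bar>t\<bar>) * (N n * r n) + t ^ 4 * (N n * (s n)\<^sup>2)) \<longlonglongrightarrow> 0"
    by (simp add: power2_eq_square mult.assoc)
  from Lim_null_comparison[OF eventuallyI[OF bound] this]
  have D: "(\<lambda>n. char (distr gauss_space borel (?S n)) t - complex_of_real (exp (- (N n * s n * t\<^sup>2 / 2)))) \<longlonglongrightarrow> 0" .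
  have "(\<lambda>n. complex_of_real (exp (- (N n * s n * t\<^sup>2 / 2)))) \<longlonglongrightarrow> complex_of_real (exp (- ((2 * (a 0)\<^sup>2) * t\<^sup>2 / 2)))"
    by (intro tendsto_of_real tendsto_exp tendsto_minus tendsto_divide tendsto_mult[OF Ns] tendsto_const) auto
  from tendsto_add[OF D this]
  show "(\<lambda>n. char (distr gauss_space borel (\<lambda>g. \<Sum>k<n - 1. (A n / \<Delta> n) / sqrt (real n) * ((g k)\<^sup>2 - 1))) t)
     \<longlonglongrightarrow> char (normal_plus_const (2 * (a 0)\<^sup>2) 0) t"
    using a0_pos by (simp add: char_normal_plus_const u_def)
qed

lemma C_le_mesh_square:
  obtains K where "0 \<le> K" "\<And>n k l. area (\<Delta> n) \<le> 1 \<Longrightarrow> C (\<Delta> n) k l \<le> K * (\<Delta> n)\<^sup>2"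
proof -
  obtain K where K: "0 < K" "\<And>s. 0 \<le> s \<Longrightarrow> \<phi> s \<le> K" using phi_bounded by metis
  have "C (\<Delta> n) k l \<le> K * (\<Delta> n)\<^sup>2" if "area (\<Delta> n) \<le> 1" for n k l
  proof (cases "k < l")
    case True
    then have "real k + 1 \<le> real l" by simp
    then have "(real k + 1) * \<Delta> n \<le> real l * \<Delta> n" using mesh_pos[of n] by (intro mult_right_mono) auto
    then have "real k * \<Delta> n + \<Delta> n \<le> real l * \<Delta> n" by (simp add: algebra_simps)
    from measure_enter_leave_le[OF K(2) mesh_pos this]
    show ?thesis by (simp add: C_def En_def Lv_def algebra_simps)
  next
    case False
    then show ?thesis using C_zero[OF mesh_pos that, of l k] K by simp
  qed
  then show ?thesis using K by (intro that[of K]) auto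
qed

text \<open>One factor of each square is bounded by \<open>D\<close>, the other is summed over a
  row, where the total is at most \<open>A n\<close>.\<close>

lemma sum_C_square_le:
  assumes "area (\<Delta> n) \<le> 1" and "\<And>k l. C (\<Delta> n) k l \<le> D"
  shows "(\<Sum>k<N. \<Sum>l<N. (C (\<Delta> n) k l)\<^sup>2) \<le> real N * (D * A n)"
proof -
  have "(\<Sum>l<N. (C (\<Delta> n) k l)\<^sup>2) \<le> D * A n" for k
  proof -
    have D: "0 \<le> D" using assms(2)[of k k] C_nonneg[OF mesh_pos assms(1), of k k] by simp
    have "(\<Sum>l<N. (C (\<Delta> n) k l)\<^sup>2) \<le> (\<Sum>l<N. D * C (\<Delta> n) k l)"
      unfolding power2_eq_square using assms(2) C_nonneg[OF mesh_pos assms(1)] by (intro sum_mono mult_right_mono) auto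
    also have "\<dots> \<le> D * A n"
      unfolding sum_distrib_left[symmetric] A_def using sum_C_le[OF mesh_pos assms(1)] D by (intro mult_left_mono) auto
    finally show ?thesis .
  qed
  then show ?thesis using sum_mono[of "{..<N}" "\<lambda>k. \<Sum>l<N. (C (\<Delta> n) k l)\<^sup>2" "\<lambda>_. D * A n"] by simp
qed

text \<open>The second moment is the sum of the squared coefficients divided by
  \<open>n * \<Delta>^2\<close>. Coefficients of order \<open>\<Delta>^2\<close> with row sums at
  most \<open>A n\<close> make it \<open>O(A n)\<close>; the trivial bound
  \<open>C \<le> A n\<close> would leave a bound that does not vanish.\<close>

lemma gauss_quadratic_remainder:
  "converges_in_probability gauss_space
    (\<lambda>n g. - (\<Sum>k<n - 1. \<Sum>l<n - 1. C (\<Delta> n) k l * (g k * g l)) / (sqrt (real n) * \<Delta> n)) (\<lambda>_. 0)"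
proof -
  obtain K where K: "0 \<le> K" "\<And>n k l. area (\<Delta> n) \<le> 1 \<Longrightarrow> C (\<Delta> n) k l \<le> K * (\<Delta> n)\<^sup>2" using C_le_mesh_square by metis
  show ?thesis
  proof (rule gauss.converges_in_probability_L2)
    show "\<forall>\<^sub>F n in sequentially.
       integrable gauss_space (\<lambda>g. (- (\<Sum>k<n - 1. \<Sum>l<n - 1. C (\<Delta> n) k l * (g k * g l)) / (sqrt (real n) * \<Delta> n))\<^sup>2) \<and>
       gauss.expectation (\<lambda>g. (- (\<Sum>k<n - 1. \<Sum>l<n - 1. C (\<Delta> n) k l * (g k * g l)) / (sqrt (real n) * \<Delta> n))\<^sup>2)
         \<le> (real (n - 1) / real n) * (K * A n)"
      using eventually_regular
    proof eventually_elim
      case (elim n)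
      then have n: "0 < n" "area (\<Delta> n) \<le> 1" by auto
      note gq = gauss_quadratic_form[OF C_zero[OF mesh_pos n(2)], where N="n - 1"]
      have "(\<Sum>k<n - 1. \<Sum>l<n - 1. (C (\<Delta> n) k l)\<^sup>2) / (real n * (\<Delta> n)\<^sup>2) \<le> real (n - 1) * ((K * (\<Delta> n)\<^sup>2) * A n) / (real n * (\<Delta> n)\<^sup>2)"
        using K(2)[OF n(2)] by (intro divide_right_mono sum_C_square_le n(2)) auto
      also have "\<dots> = (real (n - 1) / real n) * (K * A n)" using mesh_pos[of n] by simp
      finally show ?case using gq by (simp add: power_divide power_mult_distrib)
    qed
    have "(\<lambda>n. (real (n - 1) / real n) * (K * A n)) \<longlonglongrightarrow> 1 * (K * 0)"
      by (intro tendsto_mult pred_over_limit tendsto_const A_null)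
    then show "(\<lambda>n. (real (n - 1) / real n) * (K * A n)) \<longlonglongrightarrow> 0" by simp
  qed measurable
qed

context
  assumes gaussian: "\<nu> = null_measure borel"
begin

text \<open>The estimator, centred at its mean and multiplied by \<open>sqrt (real n)\<close>. The
  rate is that of \<open>sqrt (real n * \<Delta> n / Q_stat)\<close>, because \<open>Q_stat\<close>
  is of order \<open>\<Delta> n\<close> without jumps.\<close>

definition U :: "nat \<Rightarrow> 'w \<Rightarrow> real" where
  "U n \<omega> = sqrt (real n) / (2 * real n * \<Delta> n) *
    ((\<Sum>k<n - 1. (E (\<Delta> n) k \<omega> - F (\<Delta> n) k \<omega>)\<^sup>2) - 2 * real (n - 1) * A n)"

lemma U_measurable [measurable]: "U n \<in> borel_measurable M"
  unfolding U_def by measurable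

text \<open>For every large \<open>n\<close> the laws of \<open>U n\<close> and \<open>G n\<close>
  coincide, although the two sequences live on different spaces; the limit is computed for
  \<open>G\<close>, as diagonal plus negligible remainder.\<close>

lemma U_char_limit: "converges_in_char U (normal_plus_const (2 * (a 0)\<^sup>2) 0)"
  unfolding converges_in_char_def
proof
  fix t
  define G where "G n g = (\<Sum>k<n - 1. (A n / \<Delta> n) / sqrt (real n) * ((g k)\<^sup>2 - 1)) +
     - (\<Sum>k<n - 1. \<Sum>l<n - 1. C (\<Delta> n) k l * (g k * g l)) / (sqrt (real n) * \<Delta> n)" for n and g :: "nat \<Rightarrow> real"
  have "gauss.converges_in_char G (normal_plus_const (2 * (a 0)\<^sup>2) 0)"
    unfolding G_def[abs_def]
    by (rule gauss.converges_in_char_add[OF _ _ gauss_sum_char_limit gauss_quadratic_remainder]) measurable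
  then have lim: "(\<lambda>n. char (distr gauss_space borel (G n)) t) \<longlonglongrightarrow> char (normal_plus_const (2 * (a 0)\<^sup>2) 0) t"
    unfolding gauss.converges_in_char_def by blast
  have "\<forall>\<^sub>F n in sequentially. char (distr gauss_space borel (G n)) t = char (distr M borel (U n)) t"
    using eventually_regular
  proof eventually_elim
    case (elim n)
    then have n: "0 < n" "area (\<Delta> n) \<le> 1" by auto
    define c where "c = sqrt (real n) / (2 * real n * \<Delta> n)"
    have c: "c = 1 / (2 * sqrt (real n) * \<Delta> n)"
    proof -
      have "sqrt (real n) / real n = 1 / sqrt (real n)" using n(1) by (simp add: real_div_sqrt field_simps)
      then have "sqrt (real n) / real n / (2 * \<Delta> n) = 1 / sqrt (real n) / (2 * \<Delta> n)" by simp
      then show ?thesis unfolding c_def by (simp add: mult_ac)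
    qed
    let ?f = "\<lambda>x. c * (x - 2 * real (n - 1) * A n)"
    have q: "quad (\<Delta> n) (n - 1) \<in> borel_measurable gauss_space"
      unfolding quad_def[OF mesh_pos n(2)] by measurable
    have "distr M borel (U n) = distr (distr M borel (\<lambda>\<omega>. \<Sum>k<n - 1. (E (\<Delta> n) k \<omega> - F (\<Delta> n) k \<omega>)\<^sup>2)) borel ?f"
      by (subst distr_distr) (auto simp: comp_def U_def[abs_def] c_def)
    also have "\<dots> = distr (distr gauss_space borel (quad (\<Delta> n) (n - 1))) borel ?f"
      by (simp only: increments_square_norm_distr[OF mesh_pos n(2) gaussian])
    also have "\<dots> = distr gauss_space borel (G n)"
    proof -
      have "?f (quad (\<Delta> n) (n - 1) g) = G n g" for g
      proof -
        have "1 / (2 * r * d) * (2 * y * S - 2 * Q - 2 * N * y) = (y / d) / r * (S - N) + - Q / (r * d)"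
          if "0 < r" "0 < d" for r d y S Q N :: real
          using that by (simp add: field_simps)
        from this[of "sqrt (real n)" "\<Delta> n"] n(1) mesh_pos[of n]
        have "c * (2 * A n * S - 2 * Q - 2 * N * A n) = (A n / \<Delta> n) / sqrt (real n) * (S - N) + - Q / (sqrt (real n) * \<Delta> n)" for S Q N
          unfolding c by simp
        then show ?thesis
          unfolding G_def quad_def[OF mesh_pos n(2)] A_def[symmetric] sum_distrib_left[symmetric] sum_subtractf by simp
      qed
      then show ?thesis using q by (subst distr_distr) (auto simp: comp_def)
    qed
    finally show ?case by simp
  qed
  from Lim_transform_eventually[OF lim this]
  show "(\<lambda>n. char (distr M borel (U n)) t) \<longlonglongrightarrow> char (normal_plus_const (2 * (a 0)\<^sup>2) 0) t" .
qed

lemma a_hat_eq_U: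
  assumes n: "0 < n" "area (\<Delta> n) \<le> 1"
  shows "AE \<omega> in M. a_hat_0 X n (\<Delta> n) \<omega> = U n \<omega> / sqrt (real n) + (real (n - 1) / real n) * (A n / \<Delta> n)"
  using increments_eq[OF n(2)]
proof eventually_elim
  case (elim \<omega>)
  have gen: "S / (2 * d * m) = (r / (2 * m * d) * (S - 2 * N * y)) / r + (N / m) * (y / d)" if "0 < m" "0 < d" "0 < r" for S r m d N y :: real
    using that by (simp add: field_simps)
  have ah: "a_hat_0 X n (\<Delta> n) \<omega> = (\<Sum>k<n - 1. (E (\<Delta> n) k \<omega> - F (\<Delta> n) k \<omega>)\<^sup>2) / (2 * \<Delta> n * real n)"
    using elim by (simp add: a_hat_0_def normalized_power_variation_def)
  show ?case unfolding ah U_def by (rule gen) (use n(1) mesh_pos[of n] in auto)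
qed

text \<open>Separates the bias of a single squared increment from the effect of dividing a sum of
  \<open>n - 1\<close> terms by \<open>n\<close>.\<close>

lemma bias_identity:
  assumes "0 < n"
  shows "real (n - 1) / real n * (A n / \<Delta> n) - a 0 = \<Delta> n * ((A n / \<Delta> n - a 0) / \<Delta> n) - (A n / \<Delta> n) * (1 / real n)"
proof -
  have e: "real (n - 1) / real n = 1 - 1 / real n" using assms by (simp add: of_nat_diff diff_divide_distrib)
  have d: "\<Delta> n * (x / \<Delta> n) = x" for x using mesh_pos[of n] by simp
  show ?thesis unfolding e d by (simp only: left_diff_distrib mult_1_left mult.commute diff_right_commute)
qed

lemma EF_gaussian_moments:
  assumes n: "area (\<Delta> n) \<le> 1"
  shows "integrable M (\<lambda>\<omega>. E (\<Delta> n) k \<omega> ^ j)" "integrable M (\<lambda>\<omega>. F (\<Delta> n) k \<omega> ^ j)"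
    and "expectation (\<lambda>\<omega>. E (\<Delta> n) k \<omega> ^ j) = sqrt (A n) ^ j * (LINT x|std_normal_distribution. x ^ j)"
    and "expectation (\<lambda>\<omega>. F (\<Delta> n) k \<omega> ^ j) = sqrt (A n) ^ j * (LINT x|std_normal_distribution. x ^ j)"
  unfolding E_def F_def A_def
  using Lc_gaussian_moments[OF gaussian small_En_Lv(1)[OF mesh_pos n]] Lc_gaussian_moments[OF gaussian small_En_Lv(2)[OF mesh_pos n]]
  by (auto simp: measure_En[OF mesh_pos n] measure_Lv[OF mesh_pos n])

lemma sqrt_A_powers: "sqrt (A n) ^ 2 = A n" "sqrt (A n) ^ 4 = (A n)\<^sup>2" "sqrt (A n) ^ 6 = (A n) ^ 3" "sqrt (A n) ^ 8 = (A n) ^ 4"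
  using A_nonneg[of n] power_mult[of "sqrt (A n)" 2 2] power_mult[of "sqrt (A n)" 2 3] power_mult[of "sqrt (A n)" 2 4] by auto

section \<open>Gaussian case: sums of fourth order and the limit of the normalization\<close>

definition nh2 :: "nat \<Rightarrow> real" where "nh2 n = real n * (\<Delta> n)\<^sup>2"

lemma fourth_order_scale: "(\<lambda>n. real (n - 1) * (A n) ^ 4 / (nh2 n)\<^sup>2) \<longlonglongrightarrow> 0"
proof -
  have "(\<lambda>n. ((A n / \<Delta> n)\<^sup>2 * (real (n - 1) / real n)) * (A n / \<Delta> n)\<^sup>2 * (1 / real n)) \<longlonglongrightarrow> (a 0)\<^sup>2 * (a 0)\<^sup>2 * 0"
    by (intro tendsto_mult A_ratio_square tendsto_power A_limit inverse_n)
  moreover have "((A n / \<Delta> n)\<^sup>2 * (real (n - 1) / real n)) * (A n / \<Delta> n)\<^sup>2 * (1 / real n) = real (n - 1) * (A n) ^ 4 / (nh2 n)\<^sup>2" for n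
    by (simp add: nh2_def power2_eq_square power4_eq_xxxx mult_ac)
  ultimately show ?thesis by simp
qed

text \<open>The common criterion for the remainders in the expansion of fourth powers: a second
  moment \<open>O(N * A^4)\<close> is of order \<open>1 / n\<close> relative to the squared scale,
  since \<open>A\<close> is of order \<open>\<Delta>\<close>.\<close>

lemma converges_in_probability_fourth_order:
  assumes [measurable]: "\<And>n. S n \<in> borel_measurable M"
    and bd: "\<And>n. 0 < n \<Longrightarrow> area (\<Delta> n) \<le> 1 \<Longrightarrow>
      integrable M (\<lambda>\<omega>. (S n \<omega>)\<^sup>2) \<and> expectation (\<lambda>\<omega>. (S n \<omega>)\<^sup>2) \<le> K * (real (n - 1) * (A n) ^ 4)"
  shows "converges_in_probability M (\<lambda>n \<omega>. S n \<omega> / nh2 n) (\<lambda>_. 0)"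
proof (rule converges_in_probability_L2)
  show "\<forall>\<^sub>F n in sequentially. integrable M (\<lambda>\<omega>. (S n \<omega> / nh2 n)\<^sup>2) \<and>
     expectation (\<lambda>\<omega>. (S n \<omega> / nh2 n)\<^sup>2) \<le> K * (real (n - 1) * (A n) ^ 4 / (nh2 n)\<^sup>2)"
    using eventually_regular
  proof eventually_elim
    case (elim n)
    then have b: "integrable M (\<lambda>\<omega>. (S n \<omega>)\<^sup>2)" "expectation (\<lambda>\<omega>. (S n \<omega>)\<^sup>2) \<le> K * (real (n - 1) * (A n) ^ 4)"
      using bd[of n] by auto
    have "expectation (\<lambda>\<omega>. (S n \<omega>)\<^sup>2) / (nh2 n)\<^sup>2 \<le> K * (real (n - 1) * (A n) ^ 4) / (nh2 n)\<^sup>2"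
      by (intro divide_right_mono b) simp
    then show ?case using b(1) by (simp add: power_divide)
  qed
  show "(\<lambda>n. K * (real (n - 1) * (A n) ^ 4 / (nh2 n)\<^sup>2)) \<longlonglongrightarrow> 0"
    using tendsto_mult_left[OF fourth_order_scale, of K] by simp
qed measurable

text \<open>The constant 96 is the variance of the fourth power of a standard normal variable,
  \<open>105 - 9\<close>.\<close>

lemma centred_fourth_powers:
  assumes n: "area (\<Delta> n) \<le> 1" and Y: "Y = E (\<Delta> n) \<or> Y = F (\<Delta> n)"
  shows "integrable M (\<lambda>\<omega>. (\<Sum>k<N. Y k \<omega> ^ 4 - 3 * (A n)\<^sup>2)\<^sup>2)"
    and "expectation (\<lambda>\<omega>. (\<Sum>k<N. Y k \<omega> ^ 4 - 3 * (A n)\<^sup>2)\<^sup>2) = 96 * (real N * (A n) ^ 4)"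
proof -
  let ?U = "\<lambda>k \<omega>. Y k \<omega> ^ 4 - 3 * (A n)\<^sup>2"
  have ind: "indep_vars (\<lambda>_. borel) Y {..<N}" for N
    using Y E_indep_vars[OF mesh_pos n] F_indep_vars[OF mesh_pos n] by auto
  have indU: "indep_vars (\<lambda>_. borel) ?U {..<N}" for N
    by (rule indep_vars_compose2[OF ind]) auto
  have i: "integrable M (\<lambda>\<omega>. Y k \<omega> ^ j)"
    and e: "expectation (\<lambda>\<omega>. Y k \<omega> ^ j) = sqrt (A n) ^ j * (LINT x|std_normal_distribution. x ^ j)" for k j
    using Y EF_gaussian_moments[OF n] by auto
  have iU: "integrable M (?U k)" "expectation (?U k) = 0" for k
    using i[of k 4] e[of k 4] by (auto simp: sqrt_A_powers std_normal_moments prob_space)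
  have eqU: "?U k \<omega> * ?U k \<omega> = Y k \<omega> ^ 8 - 6 * (A n)\<^sup>2 * Y k \<omega> ^ 4 + 9 * (A n) ^ 4" for k \<omega>
    by (simp add: algebra_simps power2_eq_square power4_eq_xxxx numeral_eq_Suc)
  have iUU: "integrable M (\<lambda>\<omega>. ?U k \<omega> * ?U k \<omega>)" "expectation (\<lambda>\<omega>. ?U k \<omega> * ?U k \<omega>) = 96 * (A n) ^ 4" for k
  proof -
    have e8: "expectation (\<lambda>\<omega>. Y k \<omega> ^ 8) = 105 * (A n) ^ 4" and e4: "expectation (\<lambda>\<omega>. Y k \<omega> ^ 4) = 3 * (A n)\<^sup>2"
      using e[of k 8] e[of k 4] by (simp_all add: sqrt_A_powers std_normal_moments)
    show "integrable M (\<lambda>\<omega>. ?U k \<omega> * ?U k \<omega>)" unfolding eqU using i[of k 8] i[of k 4] by auto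
    have "expectation (\<lambda>\<omega>. ?U k \<omega> * ?U k \<omega>) = 105 * (A n) ^ 4 - 6 * (A n)\<^sup>2 * (3 * (A n)\<^sup>2) + 9 * (A n) ^ 4"
      unfolding eqU using i[of k 8] i[of k 4] by (simp add: e8 e4 prob_space)
    also have "\<dots> = 96 * (A n) ^ 4" by (simp flip: power_add)
    finally show "expectation (\<lambda>\<omega>. ?U k \<omega> * ?U k \<omega>) = 96 * (A n) ^ 4" .
  qed
  have iUl: "integrable M (\<lambda>\<omega>. ?U k \<omega> * ?U l \<omega>)" for k l
  proof (cases "k = l")
    case False
    then show ?thesis
      using indep_vars_expectation_mult(1)[OF indU[of "Suc (max k l)"], of k l] iU by (auto simp: less_Suc_eq_le)
  qed (use iUU in auto)
  show "integrable M (\<lambda>\<omega>. (\<Sum>k<N. ?U k \<omega>)\<^sup>2)" by (rule expectation_square_sum(1)) (rule iUl)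
  have "expectation (\<lambda>\<omega>. (\<Sum>k<N. ?U k \<omega>)\<^sup>2) = (\<Sum>k<N. expectation (\<lambda>\<omega>. (?U k \<omega>)\<^sup>2))"
  proof (rule expectation_square_sum_orthogonal)
    fix k l assume "k \<in> {..<N}" "l \<in> {..<N}" "k \<noteq> l"
    then show "expectation (\<lambda>\<omega>. ?U k \<omega> * ?U l \<omega>) = 0"
      using indep_vars_expectation_mult(2)[OF indU[of N], of k l] iU by auto
  qed (use iUl in auto)
  also have "\<dots> = 96 * (real N * (A n) ^ 4)" using iUU(2) by (simp add: power2_eq_square)
  finally show "expectation (\<lambda>\<omega>. (\<Sum>k<N. ?U k \<omega>)\<^sup>2) = 96 * (real N * (A n) ^ 4)" .
qed

text \<open>For \<open>k < l\<close> the product of two terms factors into \<open>(F k)^2\<close>,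
  \<open>(E l)^2\<close> and the squares of the overlapping pair \<open>E k\<close>,
  \<open>F l\<close>, which leaves the covariance \<open>2 * A^2 * C^2\<close>. The diagonal
  contributes \<open>8 * A^4\<close> per step, the covariances at most \<open>4 * A^4\<close>; hence
  12.\<close>

lemma centred_square_products:
  assumes n: "area (\<Delta> n) \<le> 1"
  shows "integrable M (\<lambda>\<omega>. (\<Sum>k<N. (E (\<Delta> n) k \<omega>)\<^sup>2 * (F (\<Delta> n) k \<omega>)\<^sup>2 - (A n)\<^sup>2)\<^sup>2)"
    and "expectation (\<lambda>\<omega>. (\<Sum>k<N. (E (\<Delta> n) k \<omega>)\<^sup>2 * (F (\<Delta> n) k \<omega>)\<^sup>2 - (A n)\<^sup>2)\<^sup>2) \<le> 12 * (real N * (A n) ^ 4)"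
proof -
  let ?e = "E (\<Delta> n)" and ?f = "F (\<Delta> n)" and ?c = "C (\<Delta> n)"
  define P where "P k \<omega> = (?e k \<omega>)\<^sup>2 * (?f k \<omega>)\<^sup>2" for k \<omega>
  have [measurable]: "P k \<in> borel_measurable M" for k unfolding P_def by measurable
  note m = EF_gaussian_moments[OF n]
  note sp = square_products[OF mesh_pos n, unfolded A_def[symmetric] c4_gaussian[OF gaussian]]
  have iP: "integrable M (P k)" "expectation (P k) = (A n)\<^sup>2" for k
    unfolding P_def using sp(3,6)[of k k] C_zero[OF mesh_pos n, of k k] by auto
  have PP: "integrable M (\<lambda>\<omega>. P k \<omega> * P k \<omega>) \<and> expectation (\<lambda>\<omega>. P k \<omega> * P k \<omega>) = 9 * (A n) ^ 4" for k
  proof -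
    have ind: "indep_var borel (\<lambda>\<omega>. ?e k \<omega> ^ 4) borel (\<lambda>\<omega>. ?f k \<omega> ^ 4)"
      using indep_var_compose[OF E_F_indep_var[OF mesh_pos n, of k], of "\<lambda>x. x ^ 4" borel "\<lambda>x. x ^ 4" borel] by (simp add: comp_def)
    have eq: "P k \<omega> * P k \<omega> = ?e k \<omega> ^ 4 * ?f k \<omega> ^ 4" for \<omega>
      by (simp add: P_def power2_eq_square power4_eq_xxxx mult_ac)
    show ?thesis unfolding eq
      using indep_var_integrable[OF ind m(1) m(2)] indep_var_lebesgue_integral[OF ind m(1) m(2)] m(3)[of k 4] m(4)[of k 4]
      by (simp add: sqrt_A_powers std_normal_moments flip: power_add)
  qed
  have Pl: "integrable M (\<lambda>\<omega>. P k \<omega> * P l \<omega>) \<and> expectation (\<lambda>\<omega>. P k \<omega> * P l \<omega>) = (A n) ^ 4 + 2 * (A n)\<^sup>2 * (?c k l)\<^sup>2" if "k < l" for k l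
  proof -
    have eq: "P k \<omega> * P l \<omega> = (\<lambda>(x, y). x\<^sup>2 * y\<^sup>2) (?e k \<omega>, ?f l \<omega>) * (?f k \<omega>)\<^sup>2 * (?e l \<omega>)\<^sup>2" for \<omega>
      by (simp add: P_def mult_ac)
    have i: "integrable M (\<lambda>\<omega>. (\<lambda>(x, y). x\<^sup>2 * y\<^sup>2) (?e k \<omega>, ?f l \<omega>))" using sp(3)[of k l] by simp
    note fac = enter_leave_factorization[OF mesh_pos n that _ _ _ i m(2)[of k 2] m(1)[of l 2]]
    have "expectation (\<lambda>\<omega>. (?f k \<omega>)\<^sup>2) = A n" "expectation (\<lambda>\<omega>. (?e l \<omega>)\<^sup>2) = A n"
      using m(3)[of l 2] m(4)[of k 2] by (simp_all add: sqrt_A_powers std_normal_moments)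
    moreover have "expectation (\<lambda>\<omega>. (\<lambda>(x, y). x\<^sup>2 * y\<^sup>2) (?e k \<omega>, ?f l \<omega>)) = (A n)\<^sup>2 + 2 * (?c k l)\<^sup>2"
      using sp(6)[of k l] by simp
    moreover have "((A n)\<^sup>2 + 2 * (?c k l)\<^sup>2) * A n * A n = (A n) ^ 4 + 2 * (A n)\<^sup>2 * (?c k l)\<^sup>2"
      by (simp add: power2_eq_square power4_eq_xxxx algebra_simps)
    ultimately show ?thesis unfolding eq using fac by simp
  qed
  let ?U = "\<lambda>k \<omega>. P k \<omega> - (A n)\<^sup>2"
  define cc where "cc k l = (?c k l)\<^sup>2 + (?c l k)\<^sup>2" for k l
  have iPl: "integrable M (\<lambda>\<omega>. P k \<omega> * P l \<omega>)" for k l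
  proof (cases k l rule: linorder_cases)
    case greater
    then show ?thesis using Pl[of l k] by (simp add: mult.commute)
  qed (use PP Pl in auto)
  have ePl: "expectation (\<lambda>\<omega>. P k \<omega> * P l \<omega>) = (A n) ^ 4 + 2 * (A n)\<^sup>2 * cc k l + (if k = l then 8 * (A n) ^ 4 else 0)" for k l
  proof (cases k l rule: linorder_cases)
    case less
    then show ?thesis using Pl[of k l] C_zero[OF mesh_pos n, of k l] by (simp add: cc_def)
  next
    case greater
    then show ?thesis using Pl[of l k] C_zero[OF mesh_pos n, of l k] by (simp add: cc_def mult.commute)
  next
    case equal
    then show ?thesis using PP[of k] C_zero[OF mesh_pos n, of k k] by (simp add: cc_def)
  qed
  have eqU: "?U k \<omega> * ?U l \<omega> = P k \<omega> * P l \<omega> - (A n)\<^sup>2 * P k \<omega> - (A n)\<^sup>2 * P l \<omega> + (A n) ^ 4" for k l \<omega>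
    by (simp add: algebra_simps power2_eq_square power4_eq_xxxx)
  have iU: "integrable M (\<lambda>\<omega>. ?U k \<omega> * ?U l \<omega>)" for k l
    unfolding eqU using iPl iP by auto
  have eU: "expectation (\<lambda>\<omega>. ?U k \<omega> * ?U l \<omega>) = 2 * (A n)\<^sup>2 * cc k l + (if k = l then 8 * (A n) ^ 4 else 0)" for k l
  proof -
    have "expectation (\<lambda>\<omega>. ?U k \<omega> * ?U l \<omega>) = expectation (\<lambda>\<omega>. P k \<omega> * P l \<omega>) - (A n)\<^sup>2 * (A n)\<^sup>2 - (A n)\<^sup>2 * (A n)\<^sup>2 + (A n) ^ 4"
      unfolding eqU using iPl iP by (simp add: prob_space)
    then show ?thesis unfolding ePl by (simp add: power2_eq_square power4_eq_xxxx)
  qed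
  show "integrable M (\<lambda>\<omega>. (\<Sum>k<N. (?e k \<omega>)\<^sup>2 * (?f k \<omega>)\<^sup>2 - (A n)\<^sup>2)\<^sup>2)"
    unfolding P_def[symmetric] by (rule expectation_square_sum(1)) (rule iU)
  have "expectation (\<lambda>\<omega>. (\<Sum>k<N. ?U k \<omega>)\<^sup>2) = (\<Sum>k<N. \<Sum>l<N. 2 * (A n)\<^sup>2 * cc k l + (if k = l then 8 * (A n) ^ 4 else 0))"
    by (subst expectation_square_sum(2)) (auto simp only: iU eU)
  also have "\<dots> = 2 * (A n)\<^sup>2 * (\<Sum>k<N. \<Sum>l<N. cc k l) + real N * (8 * (A n) ^ 4)"
    by (simp add: sum.distrib sum_distrib_left)
  also have "(\<Sum>k<N. \<Sum>l<N. cc k l) = (\<Sum>k<N. \<Sum>l<N. (?c k l)\<^sup>2) + (\<Sum>k<N. \<Sum>l<N. (?c k l)\<^sup>2)"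
    unfolding cc_def sum.distrib by (subst (2) sum.swap) simp
  also have "2 * (A n)\<^sup>2 * ((\<Sum>k<N. \<Sum>l<N. (?c k l)\<^sup>2) + (\<Sum>k<N. \<Sum>l<N. (?c k l)\<^sup>2)) + real N * (8 * (A n) ^ 4)
     \<le> 2 * (A n)\<^sup>2 * (real N * (A n * A n) + real N * (A n * A n)) + real N * (8 * (A n) ^ 4)"
    using sum_C_square_le[OF n, of "A n" N] C_le[OF mesh_pos n] by (intro add_mono mult_left_mono) (auto simp: A_def)
  also have "\<dots> = 12 * (real N * (A n) ^ 4)" by (simp add: power2_eq_square power4_eq_xxxx)
  finally show "expectation (\<lambda>\<omega>. (\<Sum>k<N. (?e k \<omega>)\<^sup>2 * (?f k \<omega>)\<^sup>2 - (A n)\<^sup>2)\<^sup>2) \<le> 12 * (real N * (A n) ^ 4)"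
    unfolding P_def .
qed

text \<open>The first power has mean 0, which makes different steps orthogonal; 15 is the sixth
  moment of a standard normal variable.\<close>

lemma cubic_cross_terms:
  assumes n: "area (\<Delta> n) \<le> 1"
  shows "integrable M (\<lambda>\<omega>. (\<Sum>k<N. E (\<Delta> n) k \<omega> ^ 3 * F (\<Delta> n) k \<omega>)\<^sup>2)"
    and "expectation (\<lambda>\<omega>. (\<Sum>k<N. E (\<Delta> n) k \<omega> ^ 3 * F (\<Delta> n) k \<omega>)\<^sup>2) = 15 * (real N * (A n) ^ 4)"
    and "integrable M (\<lambda>\<omega>. (\<Sum>k<N. E (\<Delta> n) k \<omega> * F (\<Delta> n) k \<omega> ^ 3)\<^sup>2)"
    and "expectation (\<lambda>\<omega>. (\<Sum>k<N. E (\<Delta> n) k \<omega> * F (\<Delta> n) k \<omega> ^ 3)\<^sup>2) = 15 * (real N * (A n) ^ 4)"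
proof -
  note m = EF_gaussian_moments[OF n]
  let ?e = "E (\<Delta> n)" and ?f = "F (\<Delta> n)"
  have cube: "(x ^ 3)\<^sup>2 = x ^ 6" for x :: real by (simp flip: power_mult)
  have i6: "integrable M (\<lambda>\<omega>. (?e k \<omega> ^ 3)\<^sup>2)" "integrable M (\<lambda>\<omega>. (?f k \<omega> ^ 3)\<^sup>2)"
    and e6: "expectation (\<lambda>\<omega>. (?e k \<omega> ^ 3)\<^sup>2) = 15 * A n ^ 3" "expectation (\<lambda>\<omega>. (?f k \<omega> ^ 3)\<^sup>2) = 15 * A n ^ 3"
    and e2: "expectation (\<lambda>\<omega>. (?e k \<omega>)\<^sup>2) = A n" "expectation (\<lambda>\<omega>. (?f k \<omega>)\<^sup>2) = A n" for k
    unfolding cube m(3,4) sqrt_A_powers std_normal_moments by (simp_all add: m(1,2))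
  have m0: "\<forall>k. expectation (?e k) = 0" "\<forall>k. expectation (?f k) = 0"
    using E_F_expectation[OF mesh_pos n] by auto
  note c1 = cross_term_orthogonal[where u="\<lambda>x. x ^ 3" and v="\<lambda>x. x" and N=N, OF mesh_pos n _ _ i6(1) m(2) disjI2[OF m0(2)]]
  note c2 = cross_term_orthogonal[where u="\<lambda>x. x" and v="\<lambda>x. x ^ 3" and N=N, OF mesh_pos n _ _ m(1) i6(2) disjI1[OF m0(1)]]
  have A4: "15 * A n ^ 3 * A n = 15 * A n ^ 4" "A n * (15 * A n ^ 3) = 15 * A n ^ 4" by (simp_all add: power3_eq_cube power4_eq_xxxx)
  show "integrable M (\<lambda>\<omega>. (\<Sum>k<N. ?e k \<omega> ^ 3 * ?f k \<omega>)\<^sup>2)" by (rule c1(1)) measurable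
  have "expectation (\<lambda>\<omega>. (\<Sum>k<N. ?e k \<omega> ^ 3 * ?f k \<omega>)\<^sup>2) = (\<Sum>k<N. 15 * A n ^ 3 * A n)"
    by (subst c1(2)) (measurable, simp only: e6 e2)
  then show "expectation (\<lambda>\<omega>. (\<Sum>k<N. ?e k \<omega> ^ 3 * ?f k \<omega>)\<^sup>2) = 15 * (real N * (A n) ^ 4)"
    unfolding A4 by simp
  show "integrable M (\<lambda>\<omega>. (\<Sum>k<N. ?e k \<omega> * ?f k \<omega> ^ 3)\<^sup>2)" by (rule c2(1)) measurable
  have "expectation (\<lambda>\<omega>. (\<Sum>k<N. ?e k \<omega> * ?f k \<omega> ^ 3)\<^sup>2) = (\<Sum>k<N. A n * (15 * A n ^ 3))"
    by (subst c2(2)) (measurable, simp only: e6 e2)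
  then show "expectation (\<lambda>\<omega>. (\<Sum>k<N. ?e k \<omega> * ?f k \<omega> ^ 3)\<^sup>2) = 15 * (real N * (A n) ^ 4)"
    unfolding A4 by simp
qed

text \<open>An increment has variance \<open>2 * A\<close>, hence fourth moment
  \<open>3 * (2 * A)^2 = 12 * A^2\<close>, and division by \<open>2 * n * \<Delta>^2\<close> leads
  to \<open>6 * (a 0)^2\<close>. The five centred sums of the expansion are negligible one by one,
  so their joint behaviour is irrelevant.\<close>

lemma Q_limit_gaussian:
  "converges_in_probability M (\<lambda>n \<omega>. Q_stat X n (\<Delta> n) \<omega> / \<Delta> n) (\<lambda>_. 6 * (a 0)\<^sup>2)"
proof -
  define S1 where "S1 n \<omega> = (\<Sum>k<n - 1. E (\<Delta> n) k \<omega> ^ 4 - 3 * (A n)\<^sup>2)" for n \<omega>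
  define S2 where "S2 n \<omega> = (\<Sum>k<n - 1. F (\<Delta> n) k \<omega> ^ 4 - 3 * (A n)\<^sup>2)" for n \<omega>
  define S3 where "S3 n \<omega> = (\<Sum>k<n - 1. (E (\<Delta> n) k \<omega>)\<^sup>2 * (F (\<Delta> n) k \<omega>)\<^sup>2 - (A n)\<^sup>2)" for n \<omega>
  define S4 where "S4 n \<omega> = (\<Sum>k<n - 1. E (\<Delta> n) k \<omega> ^ 3 * F (\<Delta> n) k \<omega>)" for n \<omega>
  define S5 where "S5 n \<omega> = (\<Sum>k<n - 1. E (\<Delta> n) k \<omega> * F (\<Delta> n) k \<omega> ^ 3)" for n \<omega>
  have [measurable]: "S1 n \<in> borel_measurable M" "S2 n \<in> borel_measurable M" "S3 n \<in> borel_measurable M"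
    "S4 n \<in> borel_measurable M" "S5 n \<in> borel_measurable M" for n
    unfolding S1_def S2_def S3_def S4_def S5_def by measurable
  have c1: "converges_in_probability M (\<lambda>n \<omega>. S1 n \<omega> / nh2 n) (\<lambda>_. 0)"
    by (rule converges_in_probability_fourth_order[where K=96]) (use centred_fourth_powers in \<open>auto simp: S1_def\<close>)
  have c2: "converges_in_probability M (\<lambda>n \<omega>. S2 n \<omega> / nh2 n) (\<lambda>_. 0)"
    by (rule converges_in_probability_fourth_order[where K=96]) (use centred_fourth_powers in \<open>auto simp: S2_def\<close>)
  have c3: "converges_in_probability M (\<lambda>n \<omega>. S3 n \<omega> / nh2 n) (\<lambda>_. 0)"
  proof (rule converges_in_probability_fourth_order[where K=12])
    fix n assume "area (\<Delta> n) \<le> 1"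
    then show "integrable M (\<lambda>\<omega>. (S3 n \<omega>)\<^sup>2) \<and> expectation (\<lambda>\<omega>. (S3 n \<omega>)\<^sup>2) \<le> 12 * (real (n - 1) * (A n) ^ 4)"
      unfolding S3_def using centred_square_products[of n "n - 1"] by blast
  qed measurable
  have c4: "converges_in_probability M (\<lambda>n \<omega>. S4 n \<omega> / nh2 n) (\<lambda>_. 0)"
    by (rule converges_in_probability_fourth_order[where K=15]) (use cubic_cross_terms in \<open>auto simp: S4_def\<close>)
  have c5: "converges_in_probability M (\<lambda>n \<omega>. S5 n \<omega> / nh2 n) (\<lambda>_. 0)"
    by (rule converges_in_probability_fourth_order[where K=15]) (use cubic_cross_terms in \<open>auto simp: S5_def\<close>)
  define R where "R n \<omega> = ((((1/2 * (S1 n \<omega> / nh2 n) + 1/2 * (S2 n \<omega> / nh2 n)) + 3 * (S3 n \<omega> / nh2 n))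
      + (-2) * (S4 n \<omega> / nh2 n)) + (-2) * (S5 n \<omega> / nh2 n)) + 6 * ((A n / \<Delta> n)\<^sup>2 * (real (n - 1) / real n))" for n \<omega>
  have "converges_in_probability M R (\<lambda>_. ((((1/2 * 0 + 1/2 * 0) + 3 * 0) + (-2) * 0) + (-2) * 0) + 6 * (a 0)\<^sup>2)"
    unfolding R_def
    by (intro converges_in_probability_add converges_in_probability_cmult converges_in_probability_const
        tendsto_mult_left A_ratio_square c1 c2 c3 c4 c5) measurable
  then have R: "converges_in_probability M R (\<lambda>_. 6 * (a 0)\<^sup>2)" by simp
  show ?thesis
  proof (rule converges_in_probability_AE_cong[OF _ _ R])
    show "\<forall>\<^sub>F n in sequentially. AE \<omega> in M. Q_stat X n (\<Delta> n) \<omega> / \<Delta> n = R n \<omega>"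
      using eventually_regular
    proof eventually_elim
      case (elim n)
      then have n: "0 < n" "area (\<Delta> n) \<le> 1" by auto
      have d: "0 < \<Delta> n" "0 < nh2 n" using mesh_pos[of n] n by (auto simp: nh2_def)
      show ?case using increments_eq[OF n(2)]
      proof eventually_elim
        case (elim \<omega>)
        let ?e = "\<lambda>k. E (\<Delta> n) k \<omega>" and ?f = "\<lambda>k. F (\<Delta> n) k \<omega>"
        have "(\<Sum>k<n - 1. (?e k - ?f k) ^ 4) = (\<Sum>k<n - 1. (?e k ^ 4 - 3 * (A n)\<^sup>2) + (?f k ^ 4 - 3 * (A n)\<^sup>2)
            + 6 * ((?e k)\<^sup>2 * (?f k)\<^sup>2 - (A n)\<^sup>2) - 4 * (?e k ^ 3 * ?f k) - 4 * (?e k * ?f k ^ 3) + 12 * (A n)\<^sup>2)"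
          by (intro sum.cong refl) (simp add: power2_eq_square power3_eq_cube power4_eq_xxxx algebra_simps)
        also have "\<dots> = S1 n \<omega> + S2 n \<omega> + 6 * S3 n \<omega> - 4 * S4 n \<omega> - 4 * S5 n \<omega> + 12 * real (n - 1) * (A n)\<^sup>2"
          by (simp add: S1_def S2_def S3_def S4_def S5_def sum.distrib sum_subtractf sum_distrib_left sum_negf)
        finally have s: "(\<Sum>k<n - 1. (?e k - ?f k) ^ 4) = S1 n \<omega> + S2 n \<omega> + 6 * S3 n \<omega> - 4 * S4 n \<omega> - 4 * S5 n \<omega> + 12 * real (n - 1) * (A n)\<^sup>2" .
        have "Q_stat X n (\<Delta> n) \<omega> / \<Delta> n = (\<Sum>k<n - 1. (?e k - ?f k) ^ 4) / (2 * nh2 n)"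
          using elim by (simp add: Q_stat_def normalized_power_variation_def nh2_def power2_eq_square mult_ac)
        also have "\<dots> = 1/2 * (S1 n \<omega> / nh2 n) + 1/2 * (S2 n \<omega> / nh2 n) + 3 * (S3 n \<omega> / nh2 n)
            + (-2) * (S4 n \<omega> / nh2 n) + (-2) * (S5 n \<omega> / nh2 n) + 6 * (real (n - 1) * (A n)\<^sup>2 / nh2 n)"
          unfolding s using d(2) by (simp add: field_simps)
        also have "real (n - 1) * (A n)\<^sup>2 / nh2 n = (A n / \<Delta> n)\<^sup>2 * (real (n - 1) / real n)"
          by (simp add: nh2_def power_divide mult_ac)
        finally show ?case by (simp add: R_def)
      qed
    qed
    show "R n \<in> borel_measurable M" for n unfolding R_def by measurable
  qed measurable
qed

text \<open>The variance 1/3 is \<open>2 * (a 0)^2\<close>, from the limit of \<open>U\<close>, over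
  \<open>6 * (a 0)^2\<close>, from that of \<open>Q_stat / \<Delta>\<close>. The bias of order
  \<open>\<Delta>\<close>, scaled by \<open>sqrt n\<close>, tends to a multiple of
  \<open>sqrt m\<close>.\<close>

theorem gaussian_case_finite:
  assumes rate: "(\<lambda>n. real n * (\<Delta> n)\<^sup>2) \<longlonglongrightarrow> m"
  shows "converges_in_distribution M
    (\<lambda>n \<omega>. sqrt (real n * \<Delta> n / Q_stat X n (\<Delta> n) \<omega>) * (a_hat_0 X n (\<Delta> n) \<omega> - a 0))
    (normal_plus_const (1 / 3) (- \<phi> 0 / 2 * sqrt (m / (6 * (a 0)\<^sup>2))))"
proof -
  define \<beta> where "\<beta> n = sqrt (real n) * (real (n - 1) / real n * (A n / \<Delta> n) - a 0)" for n
  have \<beta>lim: "\<beta> \<longlonglongrightarrow> sqrt m * (- \<phi> 0 / 2) - a 0 * sqrt 0"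
  proof -
    have "(\<lambda>n. sqrt (real n * (\<Delta> n)\<^sup>2) * ((A n / \<Delta> n - a 0) / \<Delta> n) - (A n / \<Delta> n) * sqrt (1 / real n)) \<longlonglongrightarrow>
        sqrt m * (- \<phi> 0 / 2) - a 0 * sqrt 0"
      by (intro tendsto_diff tendsto_mult tendsto_real_sqrt rate A_second_limit A_limit inverse_n)
    moreover have "\<forall>\<^sub>F n in sequentially. sqrt (real n * (\<Delta> n)\<^sup>2) * ((A n / \<Delta> n - a 0) / \<Delta> n) - (A n / \<Delta> n) * sqrt (1 / real n) = \<beta> n"
      using eventually_gt_at_top[of "0::nat"]
    proof eventually_elim
      case (elim n)
      have "sqrt (real n) * (1 / real n) = sqrt (1 / real n)"
        using elim by (simp add: real_sqrt_divide real_div_sqrt field_simps)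
      then have "(A n / \<Delta> n) * (sqrt (real n) * (1 / real n)) = (A n / \<Delta> n) * sqrt (1 / real n)" by simp
      moreover have "sqrt (real n * (\<Delta> n)\<^sup>2) = sqrt (real n) * \<Delta> n"
        using mesh_pos[of n] by (simp add: real_sqrt_mult)
      ultimately show ?case
        unfolding \<beta>_def bias_identity[OF elim] by (simp only: right_diff_distrib mult_ac)
    qed
    ultimately show ?thesis by (rule Lim_transform_eventually)
  qed
  have "converges_in_distribution M
    (\<lambda>n \<omega>. sqrt (real n * \<Delta> n / Q_stat X n (\<Delta> n) \<omega>) * (a_hat_0 X n (\<Delta> n) \<omega> - a 0))
    (normal_plus_const (2 * (a 0)\<^sup>2 / (6 * (a 0)\<^sup>2)) ((sqrt m * (- \<phi> 0 / 2) - a 0 * sqrt 0) / sqrt (6 * (a 0)\<^sup>2)))"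
  proof (rule converges_in_distribution_studentized[OF _ _ _ _ _ _ U_char_limit converges_in_probability_const[OF \<beta>lim] Q_limit_gaussian])
    show "\<forall>\<^sub>F n in sequentially. AE \<omega> in M. sqrt (real n * \<Delta> n / Q_stat X n (\<Delta> n) \<omega>) * (a_hat_0 X n (\<Delta> n) \<omega> - a 0) =
       (U n \<omega> + \<beta> n) * (1 / sqrt (Q_stat X n (\<Delta> n) \<omega> / \<Delta> n))"
      using eventually_regular
    proof eventually_elim
      case (elim n)
      then have n: "0 < n" "area (\<Delta> n) \<le> 1" by auto
      show ?case using a_hat_eq_U[OF n]
      proof eventually_elim
        case (elim \<omega>)
        have "sqrt (real n) * (a_hat_0 X n (\<Delta> n) \<omega> - a 0) = U n \<omega> + \<beta> n"
          unfolding elim \<beta>_def using n(1) by (simp add: algebra_simps)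
        moreover have "sqrt (real n * \<Delta> n / Q_stat X n (\<Delta> n) \<omega>) = sqrt (real n) * (1 / sqrt (Q_stat X n (\<Delta> n) \<omega> / \<Delta> n))"
          by (simp add: real_sqrt_divide real_sqrt_mult)
        ultimately show ?case by (simp add: mult_ac)
      qed
    qed
  qed (use a0_pos in auto)
  moreover have "2 * (a 0)\<^sup>2 / (6 * (a 0)\<^sup>2) = 1 / 3" using a0_pos by simp
  moreover have "(sqrt m * (- \<phi> 0 / 2) - a 0 * sqrt 0) / sqrt (6 * (a 0)\<^sup>2) = - \<phi> 0 / 2 * sqrt (m / (6 * (a 0)\<^sup>2))"
    by (simp only: real_sqrt_divide real_sqrt_zero) simp
  ultimately show ?thesis by (simp only:)
qed

text \<open>The fluctuations of the estimator are of order \<open>1 / sqrt n\<close>, negligible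
  against \<open>\<Delta> n\<close> in this regime, so that after division by the mesh only the bias
  remains.\<close>

theorem gaussian_case_infinite:
  assumes rate: "filterlim (\<lambda>n. real n * (\<Delta> n)\<^sup>2) at_top sequentially"
  shows "converges_in_probability M (\<lambda>n \<omega>. 1 / \<Delta> n * (a_hat_0 X n (\<Delta> n) \<omega> - a 0)) (\<lambda>_. - \<phi> 0 / 2)"
proof -
  have rd: "real_distribution (normal_plus_const (2 * (a 0)\<^sup>2) 0)"
    using a0_pos by (intro real_distribution_normal_plus_const) auto
  define \<beta> where "\<beta> n = (real (n - 1) / real n * (A n / \<Delta> n) - a 0) / \<Delta> n" for n
  have "(\<lambda>n. sqrt (1 / (real n * (\<Delta> n)\<^sup>2))) \<longlonglongrightarrow> sqrt 0"
    using tendsto_inverse_0_at_top[OF rate] by (intro tendsto_real_sqrt) (simp add: inverse_eq_divide)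
  then have "converges_in_probability M (\<lambda>n _. sqrt (1 / (real n * (\<Delta> n)\<^sup>2))) (\<lambda>_. 0)"
    using converges_in_probability_const by simp
  then have UR: "converges_in_probability M (\<lambda>n \<omega>. U n \<omega> * sqrt (1 / (real n * (\<Delta> n)\<^sup>2))) (\<lambda>_. 0)"
    by (intro converges_in_probability_tight_mult[OF _ _ rd U_char_limit]) auto
  have \<beta>lim: "\<beta> \<longlonglongrightarrow> - \<phi> 0 / 2"
  proof -
    have "(\<lambda>n. (A n / \<Delta> n - a 0) / \<Delta> n - (A n / \<Delta> n) * (1 / (real n * \<Delta> n))) \<longlonglongrightarrow> - \<phi> 0 / 2 - a 0 * 0"
      by (intro tendsto_diff tendsto_mult A_second_limit A_limit inverse_horizon)
    moreover have "\<forall>\<^sub>F n in sequentially. (A n / \<Delta> n - a 0) / \<Delta> n - (A n / \<Delta> n) * (1 / (real n * \<Delta> n)) = \<beta> n"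
      using eventually_gt_at_top[of "0::nat"]
    proof eventually_elim
      case (elim n)
      show ?case
        unfolding \<beta>_def bias_identity[OF elim] using mesh_pos[of n] by (simp add: diff_divide_distrib)
    qed
    ultimately show ?thesis by (simp add: Lim_transform_eventually)
  qed
  have "converges_in_probability M (\<lambda>n \<omega>. U n \<omega> * sqrt (1 / (real n * (\<Delta> n)\<^sup>2)) + \<beta> n) (\<lambda>_. 0 + - \<phi> 0 / 2)"
    by (intro converges_in_probability_add UR converges_in_probability_const \<beta>lim) auto
  then have lim: "converges_in_probability M (\<lambda>n \<omega>. U n \<omega> * sqrt (1 / (real n * (\<Delta> n)\<^sup>2)) + \<beta> n) (\<lambda>_. - \<phi> 0 / 2)"
    by simp
  show ?thesis
  proof (rule converges_in_probability_AE_cong[OF _ _ lim])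
    show "\<forall>\<^sub>F n in sequentially. AE \<omega> in M. 1 / \<Delta> n * (a_hat_0 X n (\<Delta> n) \<omega> - a 0) = U n \<omega> * sqrt (1 / (real n * (\<Delta> n)\<^sup>2)) + \<beta> n"
      using eventually_regular
    proof eventually_elim
      case (elim n)
      then have n: "0 < n" "area (\<Delta> n) \<le> 1" by auto
      have s: "sqrt (1 / (real n * (\<Delta> n)\<^sup>2)) = 1 / (sqrt (real n) * \<Delta> n)"
        using mesh_pos[of n] by (simp add: real_sqrt_divide real_sqrt_mult)
      show ?case using a_hat_eq_U[OF n]
      proof eventually_elim
        case (elim \<omega>)
        show ?case unfolding elim s \<beta>_def using n(1) mesh_pos[of n] by (simp add: field_simps)
      qed
    qed
  qed measurable
qed

end

end

section \<open>From the seed to the basis, and the conclusion\<close>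

lemma unit_law_eq_seed:
  assumes "homogeneous_levy_basis M \<gamma> b \<nu> L" "levy_seed S \<gamma> b \<nu> L'"
    and B: "B \<in> finite_borel_sets" "measure lborel B = 1"
  shows "distr M borel (L B) = distr S borel L'"
proof -
  interpret M: homogeneous_levy_basis M \<gamma> b \<nu> L by fact
  interpret S: levy_seed S \<gamma> b \<nu> L' by fact
  show ?thesis
    using B M.random_variable[OF B(1)] S.random_variable
    by (intro Levy_uniqueness) (auto simp: M.char_eq S.char_eq fun_eq_iff)
qed

text \<open>A set of unit area has the law of the seed and inherits its moments and its variance;
  \<open>1 + \<bar>L' x\<bar> powr p\<close> dominates the lowered power.\<close>

lemma levy_basis_moments_if_seed:
  assumes basis: "homogeneous_levy_basis M \<gamma> b \<nu> L" and seed: "levy_seed S \<gamma> b \<nu> L'"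
    and var: "prob_space.variance S L' = 1"
    and p: "4 < p" and moment: "integrable S (\<lambda>x. \<bar>L' x\<bar> powr p)"
  shows "levy_basis_moments M \<gamma> b \<nu> L (min p 6)"
proof -
  interpret M: homogeneous_levy_basis M \<gamma> b \<nu> L by fact
  interpret S: levy_seed S \<gamma> b \<nu> L' by fact
  have [measurable]: "L' \<in> borel_measurable S" by (rule S.random_variable)
  show ?thesis
  proof
    show "4 < min p 6" "min p 6 \<le> 6" using p by auto
    fix B :: "(real \<times> real) set" assume B: "B \<in> finite_borel_sets" "measure lborel B = 1"
    have [measurable]: "L B \<in> borel_measurable M" by (rule M.random_variable[OF B(1)])
    note eq = unit_law_eq_seed[OF basis seed B]
    have "integrable S (\<lambda>x. \<bar>L' x\<bar> powr (min p 6))"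
    proof (rule Bochner_Integration.integrable_bound[where f="\<lambda>x. 1 + \<bar>L' x\<bar> powr p"])
      show "AE x in S. norm (\<bar>L' x\<bar> powr (min p 6)) \<le> norm (1 + \<bar>L' x\<bar> powr p)"
      proof (rule AE_I2)
        fix x
        show "norm (\<bar>L' x\<bar> powr (min p 6)) \<le> norm (1 + \<bar>L' x\<bar> powr p)"
        proof (cases "\<bar>L' x\<bar> \<le> 1")
          case True
          then have "\<bar>L' x\<bar> powr (min p 6) \<le> 1" using p by (intro powr_le1) auto
          then show ?thesis using powr_ge_zero[of "\<bar>L' x\<bar>" p] by (simp add: add_increasing2)
        next
          case False
          then have "\<bar>L' x\<bar> powr (min p 6) \<le> \<bar>L' x\<bar> powr p" by (intro powr_mono) auto
          then show ?thesis by simp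
        qed
      qed
    qed (use moment in auto)
    then have "integrable (distr M borel (L B)) (\<lambda>x. \<bar>x\<bar> powr (min p 6))"
      unfolding eq by (subst integrable_distr_eq) auto
    then show "integrable M (\<lambda>\<omega>. \<bar>L B \<omega>\<bar> powr (min p 6))"
      by (subst (asm) integrable_distr_eq) auto
    have E: "M.expectation (\<lambda>\<omega>. f (L B \<omega>)) = S.expectation (\<lambda>\<omega>. f (L' \<omega>))"
      if [measurable]: "f \<in> borel_measurable borel" for f :: "real \<Rightarrow> real"
      using arg_cong[OF eq, of "\<lambda>\<mu>. integral\<^sup>L \<mu> f"] by (simp add: integral_distr)
    show "M.variance (L B) = 1"
      using E[of "\<lambda>x. x"] E[of "\<lambda>x. (x - S.expectation L')\<^sup>2"] var by simp
  qed
qed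

theorem theorem3:
  fixes M :: "'w measure" and S :: "'s measure"
    and \<gamma> b :: real and \<nu> :: "real measure"
    and L :: "(real \<times> real) set \<Rightarrow> 'w \<Rightarrow> real" and L' :: "'s \<Rightarrow> real"
    and a \<phi> :: "real \<Rightarrow> real" and X :: "real \<Rightarrow> 'w \<Rightarrow> real"
    and \<Delta> :: "nat \<Rightarrow> real" and \<mu> \<alpha> p\<^sub>0 :: real
  assumes basis: "homogeneous_levy_basis M \<gamma> b \<nu> L"
    and seed: "levy_seed S \<gamma> b \<nu> L'"
    and trawl: "trawl_function a"
    and X_def: "X = trawl_process L a"
    and mesh_pos: "\<And>n. 0 < \<Delta> n"
    and mesh_null: "\<Delta> \<longlonglongrightarrow> 0"
    and horizon: "filterlim (\<lambda>n. real n * \<Delta> n) at_top sequentially"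
    and mesh_rate: "(\<lambda>n. real n * \<Delta> n ^ 3) \<longlonglongrightarrow> \<mu>"
    and mu_nonneg: "0 \<le> \<mu>"
    and a_eq: "\<And>s. 0 \<le> s \<Longrightarrow> a s = (LBINT y:{s..}. \<phi> y)"
    and phi_pos: "\<And>s. 0 \<le> s \<Longrightarrow> 0 < \<phi> s"
    and phi_cont: "continuous_on {0..} \<phi>"
    and alpha: "1 < \<alpha>"
    and phi_decay: "\<phi> \<in> O[at_top](\<lambda>s. s powr (- \<alpha> - 1))"
    and seed_var: "prob_space.variance S L' = 1"
    and p0: "4 < p\<^sub>0"
    and seed_moment: "integrable S (\<lambda>x. \<bar>L' x\<bar> powr p\<^sub>0)"
  shows
    "(0 < c4 \<nu> \<longrightarrow>
        converges_in_distribution M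
          (\<lambda>n \<omega>. sqrt (real n * \<Delta> n / Q_stat X n (\<Delta> n) \<omega>) * (a_hat_0 X n (\<Delta> n) \<omega> - a 0))
          (normal_plus_const 1
            (vector_derivative a (at_right 0) / 2 * sqrt (\<mu> / (c4 \<nu> * a 0)))))
     \<and>
     (\<nu> = null_measure borel \<longrightarrow>
       (\<forall>\<mu>\<^sub>0::ennreal. (\<lambda>n. ennreal (real n * (\<Delta> n)\<^sup>2)) \<longlonglongrightarrow> \<mu>\<^sub>0 \<longrightarrow>
          (\<mu>\<^sub>0 < \<infinity> \<longrightarrow>
            converges_in_distribution M
              (\<lambda>n \<omega>. sqrt (real n * \<Delta> n / Q_stat X n (\<Delta> n) \<omega>) * (a_hat_0 X n (\<Delta> n) \<omega> - a 0))
              (normal_plus_const (1 / 3)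
                (vector_derivative a (at_right 0) / 2 * sqrt (enn2real \<mu>\<^sub>0 / (6 * (a 0)\<^sup>2)))))
          \<and>
          (\<mu>\<^sub>0 = \<infinity> \<longrightarrow>
            converges_in_probability M
              (\<lambda>n \<omega>. 1 / \<Delta> n * (a_hat_0 X n (\<Delta> n) \<omega> - a 0))
              (\<lambda>_. 1 / 2 * vector_derivative a (at_right 0)))))"
proof -
  note process_eq = X_def
  define p where "p = min p\<^sub>0 6"
  interpret levy_basis_moments M \<gamma> b \<nu> L p
    unfolding p_def by (rule levy_basis_moments_if_seed[OF basis seed seed_var p0 seed_moment])
  interpret trawl_shape a \<phi> \<alpha>
    by unfold_locales (use trawl a_eq phi_pos phi_cont alpha phi_decay in auto)
  have sampling: "trawl_sampling M \<gamma> b \<nu> L p a \<phi> \<alpha> \<Delta>" if "integrable \<nu> (\<lambda>x. x ^ 4)"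
    by unfold_locales (use that mesh_pos mesh_null horizon in auto)
  have drift: "vector_derivative a (at_right 0) / 2 = - \<phi> 0 / 2" "1 / 2 * vector_derivative a (at_right 0) = - \<phi> 0 / 2"
    by (simp_all add: vector_derivative_a)
  show ?thesis
  proof (intro conjI impI allI)
    assume c4: "0 < c4 \<nu>"
    \<comment> \<open>Positivity of \<open>c4 \<nu>\<close> contains integrability, since the
      integral of a non-integrable function is 0 by convention.\<close>
    have "integrable \<nu> (\<lambda>x. x ^ 4)"
      using c4 not_integrable_integral_eq[of \<nu> "\<lambda>x. x ^ 4"] by (auto simp: c4_def)
    then interpret trawl_sampling M \<gamma> b \<nu> L p a \<phi> \<alpha> \<Delta> by (rule sampling)
    show "converges_in_distribution M
          (\<lambda>n \<omega>. sqrt (real n * \<Delta> n / Q_stat X n (\<Delta> n) \<omega>) * (a_hat_0 X n (\<Delta> n) \<omega> - a 0))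
          (normal_plus_const 1
            (vector_derivative a (at_right 0) / 2 * sqrt (\<mu> / (c4 \<nu> * a 0))))"
      using jump_case[OF c4 mesh_rate mu_nonneg] unfolding drift process_eq X_def .
  next
    fix \<mu>\<^sub>0 :: ennreal
    assume gaussian: "\<nu> = null_measure borel" and rate: "(\<lambda>n. ennreal (real n * (\<Delta> n)\<^sup>2)) \<longlonglongrightarrow> \<mu>\<^sub>0"
    have "integrable \<nu> (\<lambda>x. x ^ 4)" by (simp add: gaussian)
    then interpret trawl_sampling M \<gamma> b \<nu> L p a \<phi> \<alpha> \<Delta> by (rule sampling)
    {
      assume "\<mu>\<^sub>0 < \<infinity>"
      then have "\<mu>\<^sub>0 = ennreal (enn2real \<mu>\<^sub>0)" by simp
      with rate have "(\<lambda>n. ennreal (real n * (\<Delta> n)\<^sup>2)) \<longlonglongrightarrow> ennreal (enn2real \<mu>\<^sub>0)" by simp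
      from tendsto_enn2real[OF this]
      have "(\<lambda>n. real n * (\<Delta> n)\<^sup>2) \<longlonglongrightarrow> enn2real \<mu>\<^sub>0" by simp
      from gaussian_case_finite[OF gaussian this]
      show "converges_in_distribution M
              (\<lambda>n \<omega>. sqrt (real n * \<Delta> n / Q_stat X n (\<Delta> n) \<omega>) * (a_hat_0 X n (\<Delta> n) \<omega> - a 0))
              (normal_plus_const (1 / 3)
                (vector_derivative a (at_right 0) / 2 * sqrt (enn2real \<mu>\<^sub>0 / (6 * (a 0)\<^sup>2))))"
        unfolding drift process_eq X_def .
    }
    {
      assume "\<mu>\<^sub>0 = \<infinity>"
      have "filterlim (\<lambda>n. real n * (\<Delta> n)\<^sup>2) at_top sequentially"
        unfolding filterlim_at_top_dense
      proof
        fix Z :: real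
        \<comment> \<open>For negative \<open>Z\<close> the left side is 0; the return to real
          numbers uses only that \<open>ennreal\<close> is monotone.\<close>
        have "ennreal Z < \<mu>\<^sub>0" using \<open>\<mu>\<^sub>0 = \<infinity>\<close> by simp
        then have "\<forall>\<^sub>F n in sequentially. ennreal Z < ennreal (real n * (\<Delta> n)\<^sup>2)"
          by (rule order_tendstoD(1)[OF rate])
        then show "\<forall>\<^sub>F n in sequentially. Z < real n * (\<Delta> n)\<^sup>2"
          by eventually_elim (metis ennreal_leI not_le)
      qed
      from gaussian_case_infinite[OF gaussian this]
      show "converges_in_probability M (\<lambda>n \<omega>. 1 / \<Delta> n * (a_hat_0 X n (\<Delta> n) \<omega> - a 0))
              (\<lambda>_. 1 / 2 * vector_derivative a (at_right 0))"
        unfolding drift process_eq X_def .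
    }
  qed
qed

end
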